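(* Let $R$ be a commutative unital ring and let $(P,\le,+,0)$ be a preordered set with a compatible abelian group structure. The category $\mathbf{Mod}_R^{\mathbf{P}}$ is enriched over the monoidal category $\big(\mathbf{Mod}_R^{\mathbf{P}},\otimes_{\mathbf{gr}}, R[U_0]\big)$. The category $\underline{\mathbf{Mod}}_R^{\mathbf{P}}$ is enriched over the monoidal category $\big(\underline{\mathbf{Mod}}_R^{\mathbf{P}},\otimes_{\mathbf{gr}}, R[U_0]\big)$.
   Context: Compatible means: $a\le b$ implies $a+c\le b+c$ for all $a,b,c\in P$. Let $\mathbf{P}$ be the category associated to $(P,\le)$ and $\mathbf{Mod}_R^{\mathbf{P}}$ the category of functors $\mathbf{P}\to\mathbf{Mod}_R$ (persistence modules) with natural transformations; $\mathrm{Hom}(M,N)$ is the $R$-module of natural transformations. Let $U_0=\{x\in P:0\le x\}$; $R[U_0]$ is the persistence module equal to $R$ on $U_0$ and $0$ elsewhere, with identity maps within $U_0$. Tensor product: $(M\otimes_{\mathbf{gr}}N)_r=\operatorname{colim}_{s+t\le r}M_s\otimes_R N_t$, with colimit over pairs $(s,t)\in P\times P$ with $s+t\le r$ under the product preorder; the symmetric monoidal structure maps are induced by those of $\otimes_R$. For $s\in P$, $N(s)_x=N_{x+s}$. The hom objects are the persistence modules $\underline{\mathrm{Hom}}(M,N)$ with $\underline{\mathrm{Hom}}(M,N)_s=\mathrm{Hom}(M,N(s))$ and map for $s\le t$ obtained by composing components $M_x\to N_{x+s}$ with $N_{x+s\le x+t}$. $\underline{\mathbf{Mod}}_R^{\mathbf{P}}$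 is the category whose objects are persistence modules and whose morphisms from $M$ to $N$ are the elements of $\bigoplus_{s\in P}\mathrm{Hom}(M,N(s))$; for $\alpha:M\to N(s)$ and $\beta:N\to N'(t)$, the composite $\beta\circ\alpha$ of degree $s+t$ has $x$-component $\beta_{s+x}\circ\alpha_x$, extended bilinearly. *)

theory Defs
  imports "HOL-Algebra.Module" "HOL-Algebra.AbelCoset" "HOL-Library.Equipollence" "HOL-Library.FuncSet"
begin

section \<open>Categories, monoidal categories and enriched categories\<close>

text \<open>
  Hom-sets are not required to be disjoint, so composition and the tensor product of
  morphisms take the objects involved as arguments:
  \<open>Cmp C a b c g f\<close> is the composite of \<open>f : a \<rightarrow> b\<close> and \<open>g : b \<rightarrow> c\<close>, and
  \<open>TenM V a a' b b' f g\<close> is the tensor product of \<open>f : a \<rightarrow> a'\<close> and \<open>g : b \<rightarrow> b'\<close>.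
\<close>

record ('o, 'm) cat =
  Ob :: "'o set"
  Hom :: "'o \<Rightarrow> 'o \<Rightarrow> 'm set"
  Idm :: "'o \<Rightarrow> 'm"
  Cmp :: "'o \<Rightarrow> 'o \<Rightarrow> 'o \<Rightarrow> 'm \<Rightarrow> 'm \<Rightarrow> 'm"

locale category =
  fixes C :: "('o, 'm, 'z) cat_scheme"
  assumes Idm_in_Hom: "a \<in> Ob C \<Longrightarrow> Idm C a \<in> Hom C a a"
    and Cmp_in_Hom: "\<lbrakk>a \<in> Ob C; b \<in> Ob C; c \<in> Ob C; f \<in> Hom C a b; g \<in> Hom C b c\<rbrakk>
      \<Longrightarrow> Cmp C a b c g f \<in> Hom C a c"
    and Cmp_Idm_left: "\<lbrakk>a \<in> Ob C; b \<in> Ob C; f \<in> Hom C a b\<rbrakk>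
      \<Longrightarrow> Cmp C a b b (Idm C b) f = f"
    and Cmp_Idm_right: "\<lbrakk>a \<in> Ob C; b \<in> Ob C; f \<in> Hom C a b\<rbrakk>
      \<Longrightarrow> Cmp C a a b f (Idm C a) = f"
    and Cmp_assoc: "\<lbrakk>a \<in> Ob C; b \<in> Ob C; c \<in> Ob C; d \<in> Ob C;
        f \<in> Hom C a b; g \<in> Hom C b c; h \<in> Hom C c d\<rbrakk>
      \<Longrightarrow> Cmp C a c d h (Cmp C a b c g f) = Cmp C a b d (Cmp C b c d h g) f"

definition inverse_mors :: "('o, 'm, 'z) cat_scheme \<Rightarrow> 'o \<Rightarrow> 'o \<Rightarrow> 'm \<Rightarrow> 'm \<Rightarrow> bool" where
  "inverse_mors C a b f g \<longleftrightarrow> f \<in> Hom C a b \<and> g \<in> Hom C b a \<and>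
     Cmp C a b a g f = Idm C a \<and> Cmp C b a b f g = Idm C b"

definition iso_mor :: "('o, 'm, 'z) cat_scheme \<Rightarrow> 'o \<Rightarrow> 'o \<Rightarrow> 'm \<Rightarrow> bool" where
  "iso_mor C a b f \<longleftrightarrow> (\<exists>g. inverse_mors C a b f g)"

definition inv_mor :: "('o, 'm, 'z) cat_scheme \<Rightarrow> 'o \<Rightarrow> 'o \<Rightarrow> 'm \<Rightarrow> 'm" where
  "inv_mor C a b f = (THE g. inverse_mors C a b f g)"

text \<open>
  \<open>AssocM V a b c : (a \<otimes> b) \<otimes> c \<rightarrow> a \<otimes> (b \<otimes> c)\<close>, \<open>LUnitM V a : I \<otimes> a \<rightarrow> a\<close> and
  \<open>RUnitM V a : a \<otimes> I \<rightarrow> a\<close>.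
\<close>

record ('o, 'm) moncat = "('o, 'm) cat" +
  TenO :: "'o \<Rightarrow> 'o \<Rightarrow> 'o"
  TenM :: "'o \<Rightarrow> 'o \<Rightarrow> 'o \<Rightarrow> 'o \<Rightarrow> 'm \<Rightarrow> 'm \<Rightarrow> 'm"
  UnitO :: "'o"
  AssocM :: "'o \<Rightarrow> 'o \<Rightarrow> 'o \<Rightarrow> 'm"
  LUnitM :: "'o \<Rightarrow> 'm"
  RUnitM :: "'o \<Rightarrow> 'm"

locale monoidal_category = category V for V :: "('o, 'm, 'z) moncat_scheme" +
  assumes TenO_in_Ob: "\<lbrakk>a \<in> Ob V; b \<in> Ob V\<rbrakk> \<Longrightarrow> TenO V a b \<in> Ob V"
    and UnitO_in_Ob: "UnitO V \<in> Ob V"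
    and TenM_in_Hom: "\<lbrakk>a \<in> Ob V; a' \<in> Ob V; b \<in> Ob V; b' \<in> Ob V;
        f \<in> Hom V a a'; g \<in> Hom V b b'\<rbrakk>
      \<Longrightarrow> TenM V a a' b b' f g \<in> Hom V (TenO V a b) (TenO V a' b')"
    and TenM_Idm: "\<lbrakk>a \<in> Ob V; b \<in> Ob V\<rbrakk>
      \<Longrightarrow> TenM V a a b b (Idm V a) (Idm V b) = Idm V (TenO V a b)"
    and TenM_Cmp: "\<lbrakk>a \<in> Ob V; a' \<in> Ob V; a'' \<in> Ob V; b \<in> Ob V; b' \<in> Ob V; b'' \<in> Ob V;
        f \<in> Hom V a a'; f' \<in> Hom V a' a''; g \<in> Hom V b b'; g' \<in> Hom V b' b''\<rbrakk>
      \<Longrightarrow> TenM V a a'' b b'' (Cmp V a a' a'' f' f) (Cmp V b b' b'' g' g) =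
          Cmp V (TenO V a b) (TenO V a' b') (TenO V a'' b'')
            (TenM V a' a'' b' b'' f' g') (TenM V a a' b b' f g)"
    and AssocM_iso: "\<lbrakk>a \<in> Ob V; b \<in> Ob V; c \<in> Ob V\<rbrakk>
      \<Longrightarrow> iso_mor V (TenO V (TenO V a b) c) (TenO V a (TenO V b c)) (AssocM V a b c)"
    and LUnitM_iso: "a \<in> Ob V \<Longrightarrow> iso_mor V (TenO V (UnitO V) a) a (LUnitM V a)"
    and RUnitM_iso: "a \<in> Ob V \<Longrightarrow> iso_mor V (TenO V a (UnitO V)) a (RUnitM V a)"
    and AssocM_natural: "\<lbrakk>a \<in> Ob V; a' \<in> Ob V; b \<in> Ob V; b' \<in> Ob V; c \<in> Ob V; c' \<in> Ob V;
        f \<in> Hom V a a'; g \<in> Hom V b b'; h \<in> Hom V c c'\<rbrakk>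
      \<Longrightarrow> Cmp V (TenO V (TenO V a b) c) (TenO V (TenO V a' b') c') (TenO V a' (TenO V b' c'))
            (AssocM V a' b' c')
            (TenM V (TenO V a b) (TenO V a' b') c c' (TenM V a a' b b' f g) h) =
          Cmp V (TenO V (TenO V a b) c) (TenO V a (TenO V b c)) (TenO V a' (TenO V b' c'))
            (TenM V a a' (TenO V b c) (TenO V b' c') f (TenM V b b' c c' g h))
            (AssocM V a b c)"
    and LUnitM_natural: "\<lbrakk>a \<in> Ob V; a' \<in> Ob V; f \<in> Hom V a a'\<rbrakk>
      \<Longrightarrow> Cmp V (TenO V (UnitO V) a) (TenO V (UnitO V) a') a' (LUnitM V a')
            (TenM V (UnitO V) (UnitO V) a a' (Idm V (UnitO V)) f) =
          Cmp V (TenO V (UnitO V) a) a a' f (LUnitM V a)"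
    and RUnitM_natural: "\<lbrakk>a \<in> Ob V; a' \<in> Ob V; f \<in> Hom V a a'\<rbrakk>
      \<Longrightarrow> Cmp V (TenO V a (UnitO V)) (TenO V a' (UnitO V)) a' (RUnitM V a')
            (TenM V a a' (UnitO V) (UnitO V) f (Idm V (UnitO V))) =
          Cmp V (TenO V a (UnitO V)) a a' f (RUnitM V a)"
    and pentagon: "\<lbrakk>a \<in> Ob V; b \<in> Ob V; c \<in> Ob V; d \<in> Ob V\<rbrakk>
      \<Longrightarrow> Cmp V (TenO V (TenO V (TenO V a b) c) d) (TenO V (TenO V a b) (TenO V c d))
            (TenO V a (TenO V b (TenO V c d)))
            (AssocM V a b (TenO V c d)) (AssocM V (TenO V a b) c d) =
          Cmp V (TenO V (TenO V (TenO V a b) c) d) (TenO V (TenO V a (TenO V b c)) d)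
            (TenO V a (TenO V b (TenO V c d)))
            (Cmp V (TenO V (TenO V a (TenO V b c)) d) (TenO V a (TenO V (TenO V b c) d))
               (TenO V a (TenO V b (TenO V c d)))
               (TenM V a a (TenO V (TenO V b c) d) (TenO V b (TenO V c d))
                  (Idm V a) (AssocM V b c d))
               (AssocM V a (TenO V b c) d))
            (TenM V (TenO V (TenO V a b) c) (TenO V a (TenO V b c)) d d
               (AssocM V a b c) (Idm V d))"
    and triangle: "\<lbrakk>a \<in> Ob V; b \<in> Ob V\<rbrakk>
      \<Longrightarrow> Cmp V (TenO V (TenO V a (UnitO V)) b) (TenO V a (TenO V (UnitO V) b)) (TenO V a b)
            (TenM V a a (TenO V (UnitO V) b) b (Idm V a) (LUnitM V b))
            (AssocM V a (UnitO V) b) =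
          TenM V (TenO V a (UnitO V)) a b b (RUnitM V a) (Idm V b)"

text \<open>
  \<open>ECmp E a b c : E(b,c) \<otimes> E(a,b) \<rightarrow> E(a,c)\<close> and \<open>EId E a : I \<rightarrow> E(a,a)\<close>.
\<close>

record ('a, 'o, 'm) ecat =
  EOb :: "'a set"
  EHom :: "'a \<Rightarrow> 'a \<Rightarrow> 'o"
  ECmp :: "'a \<Rightarrow> 'a \<Rightarrow> 'a \<Rightarrow> 'm"
  EId :: "'a \<Rightarrow> 'm"

locale enriched_category = monoidal_category V
  for V :: "('o, 'm, 'z) moncat_scheme" and E :: "('a, 'o, 'm) ecat" +
  assumes EHom_in_Ob: "\<lbrakk>a \<in> EOb E; b \<in> EOb E\<rbrakk> \<Longrightarrow> EHom E a b \<in> Ob V"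
    and ECmp_in_Hom: "\<lbrakk>a \<in> EOb E; b \<in> EOb E; c \<in> EOb E\<rbrakk>
      \<Longrightarrow> ECmp E a b c \<in> Hom V (TenO V (EHom E b c) (EHom E a b)) (EHom E a c)"
    and EId_in_Hom: "a \<in> EOb E \<Longrightarrow> EId E a \<in> Hom V (UnitO V) (EHom E a a)"
    and ECmp_assoc: "\<lbrakk>a \<in> EOb E; b \<in> EOb E; c \<in> EOb E; d \<in> EOb E\<rbrakk>
      \<Longrightarrow> Cmp V (TenO V (TenO V (EHom E c d) (EHom E b c)) (EHom E a b))
            (TenO V (EHom E b d) (EHom E a b)) (EHom E a d)
            (ECmp E a b d)
            (TenM V (TenO V (EHom E c d) (EHom E b c)) (EHom E b d) (EHom E a b) (EHom E a b)
               (ECmp E b c d) (Idm V (EHom E a b))) =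
          Cmp V (TenO V (TenO V (EHom E c d) (EHom E b c)) (EHom E a b))
            (TenO V (EHom E c d) (TenO V (EHom E b c) (EHom E a b))) (EHom E a d)
            (Cmp V (TenO V (EHom E c d) (TenO V (EHom E b c) (EHom E a b)))
               (TenO V (EHom E c d) (EHom E a c)) (EHom E a d)
               (ECmp E a c d)
               (TenM V (EHom E c d) (EHom E c d) (TenO V (EHom E b c) (EHom E a b)) (EHom E a c)
                  (Idm V (EHom E c d)) (ECmp E a b c)))
            (AssocM V (EHom E c d) (EHom E b c) (EHom E a b))"
    and ECmp_EId_left: "\<lbrakk>a \<in> EOb E; b \<in> EOb E\<rbrakk>
      \<Longrightarrow> Cmp V (TenO V (UnitO V) (EHom E a b)) (TenO V (EHom E b b) (EHom E a b)) (EHom E a b)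
            (ECmp E a b b)
            (TenM V (UnitO V) (EHom E b b) (EHom E a b) (EHom E a b)
               (EId E b) (Idm V (EHom E a b))) =
          LUnitM V (EHom E a b)"
    and ECmp_EId_right: "\<lbrakk>a \<in> EOb E; b \<in> EOb E\<rbrakk>
      \<Longrightarrow> Cmp V (TenO V (EHom E a b) (UnitO V)) (TenO V (EHom E a b) (EHom E a a)) (EHom E a b)
            (ECmp E a a b)
            (TenM V (EHom E a b) (EHom E a b) (UnitO V) (EHom E a a)
               (Idm V (EHom E a b)) (EId E a)) =
          RUnitM V (EHom E a b)"

text \<open>
  The underlying ordinary category of an enriched category: its morphisms \<open>a \<rightarrow> b\<close> are the
  morphisms \<open>I \<rightarrow> E(a,b)\<close>, and the composite of \<open>f\<close> and \<open>g\<close> is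
  \<open>I \<cong> I \<otimes> I \<rightarrow> E(b,c) \<otimes> E(a,b) \<rightarrow> E(a,c)\<close>, the middle map being \<open>g \<otimes> f\<close>.
\<close>

definition underlying_cat ::
    "('o, 'm, 'z) moncat_scheme \<Rightarrow> ('a, 'o, 'm) ecat \<Rightarrow> ('a, 'm) cat" where
  "underlying_cat V E = \<lparr>
     Ob = EOb E,
     Hom = (\<lambda>a b. Hom V (UnitO V) (EHom E a b)),
     Idm = EId E,
     Cmp = (\<lambda>a b c g f.
       Cmp V (UnitO V) (TenO V (EHom E b c) (EHom E a b)) (EHom E a c)
         (ECmp E a b c)
         (Cmp V (UnitO V) (TenO V (UnitO V) (UnitO V)) (TenO V (EHom E b c) (EHom E a b))
            (TenM V (UnitO V) (EHom E b c) (UnitO V) (EHom E a b) g f)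
            (inv_mor V (TenO V (UnitO V) (UnitO V)) (UnitO V) (LUnitM V (UnitO V))))) \<rparr>"

definition iso_over_objects :: "('a, 'm, 'z) cat_scheme \<Rightarrow> ('a, 'n, 'y) cat_scheme \<Rightarrow> bool" where
  "iso_over_objects C D \<longleftrightarrow> Ob C = Ob D \<and>
     (\<exists>\<Phi>. (\<forall>a\<in>Ob C. \<forall>b\<in>Ob C. bij_betw (\<Phi> a b) (Hom C a b) (Hom D a b)) \<and>
          (\<forall>a\<in>Ob C. \<Phi> a a (Idm C a) = Idm D a) \<and>
          (\<forall>a\<in>Ob C. \<forall>b\<in>Ob C. \<forall>c\<in>Ob C. \<forall>f\<in>Hom C a b. \<forall>g\<in>Hom C b c.
             \<Phi> a c (Cmp C a b c g f) = Cmp D a b c (\<Phi> b c g) (\<Phi> a b f)))"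

text \<open>
  An ordinary category \<open>C\<close> is enriched over \<open>V\<close> by \<open>E\<close>: \<open>E\<close> is a \<open>V\<close>-category with the objects
  of \<open>C\<close> whose underlying ordinary category is \<open>C\<close>.
\<close>

definition enriched_over ::
    "('a, 'n, 'y) cat_scheme \<Rightarrow> ('o, 'm, 'z) moncat_scheme \<Rightarrow> ('a, 'o, 'm) ecat \<Rightarrow> bool" where
  "enriched_over C V E \<longleftrightarrow>
     category C \<and> enriched_category V E \<and> iso_over_objects C (underlying_cat V E)"


section \<open>Modules\<close>

text \<open>
  A library module is a ring record whose fields \<open>mult\<close> and \<open>one\<close> play no role; the
  modules constructed below leave them unspecified.
\<close>

definition mk_module ::
    "'a set \<Rightarrow> 'a \<Rightarrow> ('a \<Rightarrow> 'a \<Rightarrow> 'a) \<Rightarrow> ('r \<Rightarrow> 'a \<Rightarrow> 'a) \<Rightarrow> ('r, 'a) module" where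
  "mk_module A z ad sm =
     \<lparr>carrier = A, monoid.mult = undefined, one = undefined, ring.zero = z, ring.add = ad, smult = sm\<rparr>"

definition lin_maps ::
    "('r, 'x) ring_scheme \<Rightarrow> ('r, 'a) module \<Rightarrow> ('r, 'b) module \<Rightarrow> ('a \<Rightarrow> 'b) set" where
  "lin_maps R A B = {h \<in> carrier A \<rightarrow>\<^sub>E carrier B.
     (\<forall>x\<in>carrier A. \<forall>y\<in>carrier A. h (x \<oplus>\<^bsub>A\<^esub> y) = h x \<oplus>\<^bsub>B\<^esub> h y) \<and>
     (\<forall>a\<in>carrier R. \<forall>x\<in>carrier A. h (a \<odot>\<^bsub>A\<^esub> x) = a \<odot>\<^bsub>B\<^esub> h x)}"

definition ring_module :: "('r, 'x) ring_scheme \<Rightarrow> ('r, 'r) module" where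
  "ring_module R = mk_module (carrier R) \<zero>\<^bsub>R\<^esub> (ring.add R) (monoid.mult R)"

definition dsum_module :: "'i set \<Rightarrow> ('i \<Rightarrow> ('r, 'a) module) \<Rightarrow> ('r, 'i \<Rightarrow> 'a) module" where
  "dsum_module I D = mk_module
     {f \<in> (\<Pi>\<^sub>E i\<in>I. carrier (D i)). finite {i \<in> I. f i \<noteq> \<zero>\<^bsub>D i\<^esub>}}
     (\<lambda>i\<in>I. \<zero>\<^bsub>D i\<^esub>)
     (\<lambda>f g. \<lambda>i\<in>I. f i \<oplus>\<^bsub>D i\<^esub> g i)
     (\<lambda>a f. \<lambda>i\<in>I. a \<odot>\<^bsub>D i\<^esub> f i)"

definition dsum_single :: "'i set \<Rightarrow> ('i \<Rightarrow> ('r, 'a) module) \<Rightarrow> 'i \<Rightarrow> 'a \<Rightarrow> 'i \<Rightarrow> 'a" where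
  "dsum_single I D i x = (\<lambda>j\<in>I. if j = i then x else \<zero>\<^bsub>D j\<^esub>)"

definition span_module :: "('r, 'x) ring_scheme \<Rightarrow> ('r, 'a) module \<Rightarrow> 'a set \<Rightarrow> 'a set" where
  "span_module R A S = \<Inter> {H. submodule H R A \<and> S \<subseteq> H}"

definition quot_module :: "('r, 'a) module \<Rightarrow> 'a set \<Rightarrow> ('r, 'a set) module" where
  "quot_module A H = mk_module (a_rcosets\<^bsub>A\<^esub> H) H (set_add A)
     (\<lambda>a X. \<Union>x\<in>X. H +>\<^bsub>A\<^esub> (a \<odot>\<^bsub>A\<^esub> x))"


subsection \<open>The tensor product of two modules\<close>

abbreviation free_module :: "('r, 'x) ring_scheme \<Rightarrow> 'i set \<Rightarrow> ('r, 'i \<Rightarrow> 'r) module" where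
  "free_module R I \<equiv> dsum_module I (\<lambda>_. ring_module R)"

definition free_gen :: "('r, 'x) ring_scheme \<Rightarrow> 'i set \<Rightarrow> 'i \<Rightarrow> 'i \<Rightarrow> 'r" where
  "free_gen R I i = dsum_single I (\<lambda>_. ring_module R) i \<one>\<^bsub>R\<^esub>"

definition tensor_rels ::
    "('r, 'x) ring_scheme \<Rightarrow> ('r, 'a) module \<Rightarrow> ('r, 'b) module \<Rightarrow> ('a \<times> 'b \<Rightarrow> 'r) set" where
  "tensor_rels R A B =
     (let X = carrier A \<times> carrier B; F = free_module R X; e = (\<lambda>m n. free_gen R X (m, n)) in
      {e (m \<oplus>\<^bsub>A\<^esub> m') n \<ominus>\<^bsub>F\<^esub> (e m n \<oplus>\<^bsub>F\<^esub> e m' n) | m m' n.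
         m \<in> carrier A \<and> m' \<in> carrier A \<and> n \<in> carrier B} \<union>
      {e m (n \<oplus>\<^bsub>B\<^esub> n') \<ominus>\<^bsub>F\<^esub> (e m n \<oplus>\<^bsub>F\<^esub> e m n') | m n n'.
         m \<in> carrier A \<and> n \<in> carrier B \<and> n' \<in> carrier B} \<union>
      {e (a \<odot>\<^bsub>A\<^esub> m) n \<ominus>\<^bsub>F\<^esub> a \<odot>\<^bsub>F\<^esub> e m n | a m n.
         a \<in> carrier R \<and> m \<in> carrier A \<and> n \<in> carrier B} \<union>
      {e m (a \<odot>\<^bsub>B\<^esub> n) \<ominus>\<^bsub>F\<^esub> a \<odot>\<^bsub>F\<^esub> e m n | a m n.
         a \<in> carrier R \<and> m \<in> carrier A \<and> n \<in> carrier B})"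

definition tensor_module ::
    "('r, 'x) ring_scheme \<Rightarrow> ('r, 'a) module \<Rightarrow> ('r, 'b) module \<Rightarrow>
     ('r, ('a \<times> 'b \<Rightarrow> 'r) set) module" where
  "tensor_module R A B =
     (let F = free_module R (carrier A \<times> carrier B)
      in quot_module F (span_module R F (tensor_rels R A B)))"

definition tensor_pure ::
    "('r, 'x) ring_scheme \<Rightarrow> ('r, 'a) module \<Rightarrow> ('r, 'b) module \<Rightarrow> 'a \<Rightarrow> 'b \<Rightarrow>
     ('a \<times> 'b \<Rightarrow> 'r) set" where
  "tensor_pure R A B m n =
     (let X = carrier A \<times> carrier B; F = free_module R X
      in span_module R F (tensor_rels R A B) +>\<^bsub>F\<^esub> free_gen R X (m, n))"

definition tensor_map ::
    "('r, 'x) ring_scheme \<Rightarrow> ('r, 'a) module \<Rightarrow> ('r, 'c) module \<Rightarrow> ('r, 'b) module \<Rightarrow>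
     ('r, 'd) module \<Rightarrow> ('a \<Rightarrow> 'c) \<Rightarrow> ('b \<Rightarrow> 'd) \<Rightarrow>
     ('a \<times> 'b \<Rightarrow> 'r) set \<Rightarrow> ('c \<times> 'd \<Rightarrow> 'r) set" where
  "tensor_map R A A' B B' f g =
     (THE h. h \<in> lin_maps R (tensor_module R A B) (tensor_module R A' B') \<and>
        (\<forall>m\<in>carrier A. \<forall>n\<in>carrier B.
           h (tensor_pure R A B m n) = tensor_pure R A' B' (f m) (g n)))"


subsection \<open>The colimit of a diagram of modules over a preordered set\<close>

text \<open>
  The diagram \<open>D\<close> is indexed by \<open>I\<close>, preordered by \<open>leq\<close>, with transition maps
  \<open>d i j : D i \<rightarrow> D j\<close> for \<open>leq i j\<close>.
\<close>

definition colim_rels ::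
    "'i set \<Rightarrow> ('i \<Rightarrow> 'i \<Rightarrow> bool) \<Rightarrow> ('i \<Rightarrow> ('r, 'a) module) \<Rightarrow>
     ('i \<Rightarrow> 'i \<Rightarrow> 'a \<Rightarrow> 'a) \<Rightarrow> ('i \<Rightarrow> 'a) set" where
  "colim_rels I leq D d =
     {dsum_single I D j (d i j x) \<ominus>\<^bsub>dsum_module I D\<^esub> dsum_single I D i x | i j x.
        i \<in> I \<and> j \<in> I \<and> leq i j \<and> x \<in> carrier (D i)}"

definition colim_module ::
    "('r, 'x) ring_scheme \<Rightarrow> 'i set \<Rightarrow> ('i \<Rightarrow> 'i \<Rightarrow> bool) \<Rightarrow> ('i \<Rightarrow> ('r, 'a) module) \<Rightarrow>
     ('i \<Rightarrow> 'i \<Rightarrow> 'a \<Rightarrow> 'a) \<Rightarrow> ('r, ('i \<Rightarrow> 'a) set) module" where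
  "colim_module R I leq D d =
     quot_module (dsum_module I D) (span_module R (dsum_module I D) (colim_rels I leq D d))"

definition colim_in ::
    "('r, 'x) ring_scheme \<Rightarrow> 'i set \<Rightarrow> ('i \<Rightarrow> 'i \<Rightarrow> bool) \<Rightarrow> ('i \<Rightarrow> ('r, 'a) module) \<Rightarrow>
     ('i \<Rightarrow> 'i \<Rightarrow> 'a \<Rightarrow> 'a) \<Rightarrow> 'i \<Rightarrow> 'a \<Rightarrow> ('i \<Rightarrow> 'a) set" where
  "colim_in R I leq D d i x =
     span_module R (dsum_module I D) (colim_rels I leq D d) +>\<^bsub>dsum_module I D\<^esub> dsum_single I D i x"


section \<open>Size\<close>

text \<open>
  The category of all \<open>R\<close>-modules is taken, as usual, relative to a universe: a family
  \<open>\<U>\<close> of subsets of an ambient type, the small sets, and the objects are the modules whose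
  carrier is in \<open>\<U>\<close>. The ambient type has to be fixed in HOL, whereas tensor products,
  colimits and modules of natural transformations naturally live in other types; they are moved
  into \<open>\<U>\<close> along an arbitrarily chosen injection.

  Tensor products and colimits stay in a universe in the sense of \<open>universe\<close>. Modules of
  natural transformations need power sets as well, and HOL does not prove that such a universe
  closed under power sets exists. The objects of the category that is enriched are therefore
  taken in a universe \<open>\<U>\<close>, and those of the category over which it is enriched in a
  universe \<open>\<V>\<close> that contains the power sets of \<open>\<U>\<close> up to bijection. If \<open>\<U>\<close> is closed under
  power sets, \<open>\<V> = \<U>\<close> is allowed, and the two categories are the same.
\<close>

definition universe :: "'p set \<Rightarrow> 'r set \<Rightarrow> 'u set set \<Rightarrow> bool" where
  "universe P K \<U> \<longleftrightarrow>
     (\<forall>A\<in>\<U>. \<forall>B. B \<lesssim> A \<longrightarrow> B \<in> \<U>) \<and>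
     (\<exists>A\<in>\<U>. infinite A \<and> P \<lesssim> A \<and> K \<lesssim> A) \<and>
     (\<forall>A\<in>\<U>. \<forall>B\<in>\<U>. A \<union> B \<in> \<U>) \<and>
     (\<forall>A. (\<forall>x\<in>P. A x \<in> \<U>) \<longrightarrow> (\<Union>x\<in>P. A x) \<in> \<U>)"

definition contains_powers :: "'u set set \<Rightarrow> 'u set set \<Rightarrow> bool" where
  "contains_powers \<V> \<U> \<longleftrightarrow> (\<forall>A\<in>\<U>. \<exists>B\<in>\<V>. Pow A \<lesssim> B)"

definition code :: "'u set set \<Rightarrow> 'a set \<Rightarrow> 'a \<Rightarrow> 'u" where
  "code \<V> X = (SOME f. inj_on f X \<and> f ` X \<in> \<V>)"

definition decode :: "'u set set \<Rightarrow> 'a set \<Rightarrow> 'u \<Rightarrow> 'a" where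
  "decode \<V> X = inv_into X (code \<V> X)"

definition copy_module :: "'u set set \<Rightarrow> ('r, 'a) module \<Rightarrow> ('r, 'u) module" where
  "copy_module \<V> A =
     (let c = code \<V> (carrier A); d = decode \<V> (carrier A) in
      mk_module (c ` carrier A) (c \<zero>\<^bsub>A\<^esub>)
        (\<lambda>x y. c (d x \<oplus>\<^bsub>A\<^esub> d y)) (\<lambda>a x. c (a \<odot>\<^bsub>A\<^esub> d x)))"


section \<open>Persistence modules\<close>

class preordered_ab_group_add = ab_group_add + preorder +
  assumes add_right_mono_preorder: "a \<le> b \<Longrightarrow> a + c \<le> b + c"

text \<open>\<open>tmap M x y\<close> is relevant only for \<open>x \<le> y\<close>.\<close>

record ('p, 'r, 'u) pmod =
  stalk :: "'p \<Rightarrow> ('r, 'u) module"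
  tmap :: "'p \<Rightarrow> 'p \<Rightarrow> 'u \<Rightarrow> 'u"

definition persistence_module ::
    "('r, 'x) ring_scheme \<Rightarrow> ('p::preorder, 'r, 'u) pmod \<Rightarrow> bool" where
  "persistence_module R M \<longleftrightarrow>
     (\<forall>x. module R (stalk M x)) \<and>
     (\<forall>x y. x \<le> y \<longrightarrow> tmap M x y \<in> lin_maps R (stalk M x) (stalk M y)) \<and>
     (\<forall>x. \<forall>m\<in>carrier (stalk M x). tmap M x x m = m) \<and>
     (\<forall>x y z. x \<le> y \<longrightarrow> y \<le> z \<longrightarrow>
        (\<forall>m\<in>carrier (stalk M x). tmap M y z (tmap M x y m) = tmap M x z m))"

definition pmods ::
    "('r, 'x) ring_scheme \<Rightarrow> 'u set set \<Rightarrow> ('p::preorder, 'r, 'u) pmod set" where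
  "pmods R \<U> = {M. persistence_module R M \<and> (\<forall>x. carrier (stalk M x) \<in> \<U>)}"

definition nat_trans ::
    "('r, 'x) ring_scheme \<Rightarrow> ('p::preorder, 'r, 'u) pmod \<Rightarrow> ('p, 'r, 'u) pmod \<Rightarrow>
     ('p \<Rightarrow> 'u \<Rightarrow> 'u) set" where
  "nat_trans R M N = {\<eta>.
     (\<forall>x. \<eta> x \<in> lin_maps R (stalk M x) (stalk N x)) \<and>
     (\<forall>x y. x \<le> y \<longrightarrow> (\<forall>m\<in>carrier (stalk M x). \<eta> y (tmap M x y m) = tmap N x y (\<eta> x m)))}"

definition id_trans :: "('p, 'r, 'u) pmod \<Rightarrow> 'p \<Rightarrow> 'u \<Rightarrow> 'u" where
  "id_trans M = (\<lambda>x. \<lambda>m\<in>carrier (stalk M x). m)"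

definition hom_module ::
    "('r, 'x) ring_scheme \<Rightarrow> ('p::preorder, 'r, 'u) pmod \<Rightarrow> ('p, 'r, 'u) pmod \<Rightarrow>
     ('r, 'p \<Rightarrow> 'u \<Rightarrow> 'u) module" where
  "hom_module R M N = mk_module (nat_trans R M N)
     (\<lambda>x. \<lambda>m\<in>carrier (stalk M x). \<zero>\<^bsub>stalk N x\<^esub>)
     (\<lambda>\<eta> \<theta> x. \<lambda>m\<in>carrier (stalk M x). \<eta> x m \<oplus>\<^bsub>stalk N x\<^esub> \<theta> x m)
     (\<lambda>a \<eta> x. \<lambda>m\<in>carrier (stalk M x). a \<odot>\<^bsub>stalk N x\<^esub> \<eta> x m)"

definition shift :: "'p::ab_group_add \<Rightarrow> ('p, 'r, 'u) pmod \<Rightarrow> ('p, 'r, 'u) pmod" where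
  "shift s N = \<lparr>stalk = (\<lambda>x. stalk N (x + s)), tmap = (\<lambda>x y. tmap N (x + s) (y + s))\<rparr>"

text \<open>
  The composite of \<open>\<alpha> : M \<rightarrow> N(s)\<close> and \<open>\<beta> : N \<rightarrow> L(t)\<close>, of degree \<open>s + t\<close>.
\<close>

definition hom_comp ::
    "('p::ab_group_add, 'r, 'u) pmod \<Rightarrow> 'p \<Rightarrow> ('p \<Rightarrow> 'u \<Rightarrow> 'u) \<Rightarrow> ('p \<Rightarrow> 'u \<Rightarrow> 'u) \<Rightarrow>
     'p \<Rightarrow> 'u \<Rightarrow> 'u" where
  "hom_comp M s \<beta> \<alpha> = (\<lambda>x. compose (carrier (stalk M x)) (\<beta> (s + x)) (\<alpha> x))"

definition PMod ::
    "('r, 'x) ring_scheme \<Rightarrow> 'u set set \<Rightarrow>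
     (('p::preordered_ab_group_add, 'r, 'u) pmod, 'p \<Rightarrow> 'u \<Rightarrow> 'u) cat" where
  "PMod R \<U> = \<lparr>
     Ob = pmods R \<U>,
     Hom = nat_trans R,
     Idm = id_trans,
     Cmp = (\<lambda>M N L \<beta> \<alpha> x. compose (carrier (stalk M x)) (\<beta> x) (\<alpha> x)) \<rparr>"


subsection \<open>The unit and the tensor product\<close>

definition unit_pmod ::
    "('r, 'x) ring_scheme \<Rightarrow> 'u set set \<Rightarrow> ('p::preordered_ab_group_add, 'r, 'u) pmod" where
  "unit_pmod R \<V> =
     (let K = copy_module \<V> (ring_module R) in
      \<lparr>stalk = (\<lambda>x. if 0 \<le> x then K else K\<lparr>carrier := {\<zero>\<^bsub>K\<^esub>}\<rparr>),
       tmap = (\<lambda>x y. if 0 \<le> x then (\<lambda>a\<in>carrier K. a) else (\<lambda>a\<in>{\<zero>\<^bsub>K\<^esub>}. \<zero>\<^bsub>K\<^esub>))\<rparr>)"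

definition unit_elem :: "('r, 'x) ring_scheme \<Rightarrow> 'u set set \<Rightarrow> 'r \<Rightarrow> 'u" where
  "unit_elem R \<V> = code \<V> (carrier R)"

definition gr_index :: "'p::preordered_ab_group_add \<Rightarrow> ('p \<times> 'p) set" where
  "gr_index r = {(s, t). s + t \<le> r}"

definition prod_le :: "'p::preorder \<times> 'p \<Rightarrow> 'p \<times> 'p \<Rightarrow> bool" where
  "prod_le i j \<longleftrightarrow> fst i \<le> fst j \<and> snd i \<le> snd j"

definition gr_diag ::
    "('r, 'x) ring_scheme \<Rightarrow> ('p, 'r, 'u) pmod \<Rightarrow> ('p, 'r, 'u) pmod \<Rightarrow>
     'p \<times> 'p \<Rightarrow> ('r, ('u \<times> 'u \<Rightarrow> 'r) set) module" where
  "gr_diag R M N = (\<lambda>(s, t). tensor_module R (stalk M s) (stalk N t))"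

definition gr_diag_map ::
    "('r, 'x) ring_scheme \<Rightarrow> ('p, 'r, 'u) pmod \<Rightarrow> ('p, 'r, 'u) pmod \<Rightarrow>
     'p \<times> 'p \<Rightarrow> 'p \<times> 'p \<Rightarrow> ('u \<times> 'u \<Rightarrow> 'r) set \<Rightarrow> ('u \<times> 'u \<Rightarrow> 'r) set" where
  "gr_diag_map R M N = (\<lambda>(s, t) (s', t').
     tensor_map R (stalk M s) (stalk M s') (stalk N t) (stalk N t') (tmap M s s') (tmap N t t'))"

definition gr_stalk ::
    "('r, 'x) ring_scheme \<Rightarrow> ('p::preordered_ab_group_add, 'r, 'u) pmod \<Rightarrow>
     ('p, 'r, 'u) pmod \<Rightarrow> 'p \<Rightarrow> ('r, ('p \<times> 'p \<Rightarrow> ('u \<times> 'u \<Rightarrow> 'r) set) set) module" where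
  "gr_stalk R M N r =
     colim_module R (gr_index r) prod_le (gr_diag R M N) (gr_diag_map R M N)"

definition gr_in ::
    "('r, 'x) ring_scheme \<Rightarrow> 'u set set \<Rightarrow> ('p::preordered_ab_group_add, 'r, 'u) pmod \<Rightarrow>
     ('p, 'r, 'u) pmod \<Rightarrow> 'p \<Rightarrow> 'p \<times> 'p \<Rightarrow> ('u \<times> 'u \<Rightarrow> 'r) set \<Rightarrow> 'u" where
  "gr_in R \<V> M N r i z = code \<V> (carrier (gr_stalk R M N r))
     (colim_in R (gr_index r) prod_le (gr_diag R M N) (gr_diag_map R M N) i z)"

definition gr_tensor ::
    "('r, 'x) ring_scheme \<Rightarrow> 'u set set \<Rightarrow> ('p::preordered_ab_group_add, 'r, 'u) pmod \<Rightarrow>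
     ('p, 'r, 'u) pmod \<Rightarrow> ('p, 'r, 'u) pmod" where
  "gr_tensor R \<V> M N = \<lparr>
     stalk = (\<lambda>r. copy_module \<V> (gr_stalk R M N r)),
     tmap = (\<lambda>r r'. THE h.
       h \<in> lin_maps R (copy_module \<V> (gr_stalk R M N r)) (copy_module \<V> (gr_stalk R M N r')) \<and>
       (\<forall>i\<in>gr_index r. \<forall>z\<in>carrier (gr_diag R M N i).
          h (gr_in R \<V> M N r i z) = gr_in R \<V> M N r' i z)) \<rparr>"

text \<open>
  The image in degree \<open>r\<close> of the pure tensor of \<open>m\<close> and \<open>n\<close>, where \<open>m\<close> has degree \<open>s\<close>, \<open>n\<close> has
  degree \<open>t\<close> and \<open>s + t \<le> r\<close>. These elements generate the tensor product in degree \<open>r\<close>, so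
  that a natural transformation is determined by its values on them.
\<close>

definition gr_pure ::
    "('r, 'x) ring_scheme \<Rightarrow> 'u set set \<Rightarrow> ('p::preordered_ab_group_add, 'r, 'u) pmod \<Rightarrow>
     ('p, 'r, 'u) pmod \<Rightarrow> 'p \<Rightarrow> 'p \<Rightarrow> 'p \<Rightarrow> 'u \<Rightarrow> 'u \<Rightarrow> 'u" where
  "gr_pure R \<V> M N s t r m n =
     gr_in R \<V> M N r (s, t) (tensor_pure R (stalk M s) (stalk N t) m n)"

text \<open>The tensor product of \<open>f : M \<rightarrow> M'(u)\<close> and \<open>g : N \<rightarrow> N'(v)\<close>, of degree \<open>u + v\<close>.\<close>

definition gr_tensor_hom ::
    "('r, 'x) ring_scheme \<Rightarrow> 'u set set \<Rightarrow> ('p::preordered_ab_group_add, 'r, 'u) pmod \<Rightarrow>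
     ('p, 'r, 'u) pmod \<Rightarrow> ('p, 'r, 'u) pmod \<Rightarrow> ('p, 'r, 'u) pmod \<Rightarrow> 'p \<Rightarrow> 'p \<Rightarrow>
     ('p \<Rightarrow> 'u \<Rightarrow> 'u) \<Rightarrow> ('p \<Rightarrow> 'u \<Rightarrow> 'u) \<Rightarrow> 'p \<Rightarrow> 'u \<Rightarrow> 'u" where
  "gr_tensor_hom R \<V> M M' N N' u v f g =
     (THE h. h \<in> nat_trans R (gr_tensor R \<V> M N) (shift (u + v) (gr_tensor R \<V> M' N')) \<and>
        (\<forall>s t r. s + t \<le> r \<longrightarrow> (\<forall>m\<in>carrier (stalk M s). \<forall>n\<in>carrier (stalk N t).
           h r (gr_pure R \<V> M N s t r m n) =
           gr_pure R \<V> M' N' (s + u) (t + v) (r + (u + v)) (f s m) (g t n))))"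

definition gr_assoc ::
    "('r, 'x) ring_scheme \<Rightarrow> 'u set set \<Rightarrow> ('p::preordered_ab_group_add, 'r, 'u) pmod \<Rightarrow>
     ('p, 'r, 'u) pmod \<Rightarrow> ('p, 'r, 'u) pmod \<Rightarrow> 'p \<Rightarrow> 'u \<Rightarrow> 'u" where
  "gr_assoc R \<V> M N L =
     (THE h. h \<in> nat_trans R (gr_tensor R \<V> (gr_tensor R \<V> M N) L)
                             (gr_tensor R \<V> M (gr_tensor R \<V> N L)) \<and>
        (\<forall>a b c r. a + b + c \<le> r \<longrightarrow>
          (\<forall>m\<in>carrier (stalk M a). \<forall>n\<in>carrier (stalk N b). \<forall>l\<in>carrier (stalk L c).
             h r (gr_pure R \<V> (gr_tensor R \<V> M N) L (a + b) c r
                    (gr_pure R \<V> M N a b (a + b) m n) l) =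
             gr_pure R \<V> M (gr_tensor R \<V> N L) a (b + c) r
               m (gr_pure R \<V> N L b c (b + c) n l))))"

definition gr_lunit ::
    "('r, 'x) ring_scheme \<Rightarrow> 'u set set \<Rightarrow> ('p::preordered_ab_group_add, 'r, 'u) pmod \<Rightarrow>
     'p \<Rightarrow> 'u \<Rightarrow> 'u" where
  "gr_lunit R \<V> M =
     (THE h. h \<in> nat_trans R (gr_tensor R \<V> (unit_pmod R \<V>) M) M \<and>
        (\<forall>s t r. 0 \<le> s \<longrightarrow> s + t \<le> r \<longrightarrow>
          (\<forall>a\<in>carrier R. \<forall>m\<in>carrier (stalk M t).
             h r (gr_pure R \<V> (unit_pmod R \<V>) M s t r (unit_elem R \<V> a) m) =
             a \<odot>\<^bsub>stalk M r\<^esub> tmap M t r m)))"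

definition gr_runit ::
    "('r, 'x) ring_scheme \<Rightarrow> 'u set set \<Rightarrow> ('p::preordered_ab_group_add, 'r, 'u) pmod \<Rightarrow>
     'p \<Rightarrow> 'u \<Rightarrow> 'u" where
  "gr_runit R \<V> M =
     (THE h. h \<in> nat_trans R (gr_tensor R \<V> M (unit_pmod R \<V>)) M \<and>
        (\<forall>s t r. 0 \<le> t \<longrightarrow> s + t \<le> r \<longrightarrow>
          (\<forall>a\<in>carrier R. \<forall>m\<in>carrier (stalk M s).
             h r (gr_pure R \<V> M (unit_pmod R \<V>) s t r m (unit_elem R \<V> a)) =
             a \<odot>\<^bsub>stalk M r\<^esub> tmap M s r m)))"

definition PMod_gr ::
    "('r, 'x) ring_scheme \<Rightarrow> 'u set set \<Rightarrow>
     (('p::preordered_ab_group_add, 'r, 'u) pmod, 'p \<Rightarrow> 'u \<Rightarrow> 'u) moncat" where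
  "PMod_gr R \<V> = cat.extend (PMod R \<V>) \<lparr>
     TenO = gr_tensor R \<V>,
     TenM = (\<lambda>M M' N N'. gr_tensor_hom R \<V> M M' N N' 0 0),
     UnitO = unit_pmod R \<V>,
     AssocM = gr_assoc R \<V>,
     LUnitM = gr_lunit R \<V>,
     RUnitM = gr_runit R \<V> \<rparr>"


subsection \<open>The hom objects\<close>

definition ihom ::
    "('r, 'x) ring_scheme \<Rightarrow> 'u set set \<Rightarrow> ('p::preordered_ab_group_add, 'r, 'u) pmod \<Rightarrow>
     ('p, 'r, 'u) pmod \<Rightarrow> ('p, 'r, 'u) pmod" where
  "ihom R \<V> M N = \<lparr>
     stalk = (\<lambda>s. copy_module \<V> (hom_module R M (shift s N))),
     tmap = (\<lambda>s t. \<lambda>z\<in>carrier (copy_module \<V> (hom_module R M (shift s N))).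
       code \<V> (nat_trans R M (shift t N))
         (\<lambda>x. compose (carrier (stalk M x)) (tmap N (x + s) (x + t))
            (decode \<V> (nat_trans R M (shift s N)) z x))) \<rparr>"

definition ihom_elem ::
    "('r, 'x) ring_scheme \<Rightarrow> 'u set set \<Rightarrow> ('p::preordered_ab_group_add, 'r, 'u) pmod \<Rightarrow>
     ('p, 'r, 'u) pmod \<Rightarrow> 'p \<Rightarrow> ('p \<Rightarrow> 'u \<Rightarrow> 'u) \<Rightarrow> 'u" where
  "ihom_elem R \<V> M N s = code \<V> (nat_trans R M (shift s N))"

definition ihom_comp ::
    "('r, 'x) ring_scheme \<Rightarrow> 'u set set \<Rightarrow> ('p::preordered_ab_group_add, 'r, 'u) pmod \<Rightarrow>
     ('p, 'r, 'u) pmod \<Rightarrow> ('p, 'r, 'u) pmod \<Rightarrow> 'p \<Rightarrow> 'u \<Rightarrow> 'u" where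
  "ihom_comp R \<V> M N L =
     (THE h. h \<in> nat_trans R (gr_tensor R \<V> (ihom R \<V> N L) (ihom R \<V> M N)) (ihom R \<V> M L) \<and>
        (\<forall>s t r. t + s \<le> r \<longrightarrow>
          (\<forall>\<beta>\<in>nat_trans R N (shift t L). \<forall>\<alpha>\<in>nat_trans R M (shift s N).
             h r (gr_pure R \<V> (ihom R \<V> N L) (ihom R \<V> M N) t s r
                    (ihom_elem R \<V> N L t \<beta>) (ihom_elem R \<V> M N s \<alpha>)) =
             tmap (ihom R \<V> M L) (s + t) r
               (ihom_elem R \<V> M L (s + t) (hom_comp M s \<beta> \<alpha>)))))"

definition ihom_id ::
    "('r, 'x) ring_scheme \<Rightarrow> 'u set set \<Rightarrow> ('p::preordered_ab_group_add, 'r, 'u) pmod \<Rightarrow>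
     'p \<Rightarrow> 'u \<Rightarrow> 'u" where
  "ihom_id R \<V> M =
     (THE h. h \<in> nat_trans R (unit_pmod R \<V>) (ihom R \<V> M M) \<and>
        h 0 (unit_elem R \<V> \<one>\<^bsub>R\<^esub>) = ihom_elem R \<V> M M 0 (id_trans M))"

definition PMod_enr ::
    "('r, 'x) ring_scheme \<Rightarrow> 'u set set \<Rightarrow> 'u set set \<Rightarrow>
     (('p::preordered_ab_group_add, 'r, 'u) pmod, ('p, 'r, 'u) pmod, 'p \<Rightarrow> 'u \<Rightarrow> 'u) ecat" where
  "PMod_enr R \<U> \<V> = \<lparr>
     EOb = pmods R \<U>,
     EHom = ihom R \<V>,
     ECmp = ihom_comp R \<V>,
     EId = ihom_id R \<V> \<rparr>"


section \<open>The category with graded morphisms\<close>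

definition ghom_module ::
    "('r, 'x) ring_scheme \<Rightarrow> ('p::preordered_ab_group_add, 'r, 'u) pmod \<Rightarrow>
     ('p, 'r, 'u) pmod \<Rightarrow> ('r, 'p \<Rightarrow> 'p \<Rightarrow> 'u \<Rightarrow> 'u) module" where
  "ghom_module R M N = dsum_module UNIV (\<lambda>s. hom_module R M (shift s N))"

definition homog ::
    "('r, 'x) ring_scheme \<Rightarrow> ('p::preordered_ab_group_add, 'r, 'u) pmod \<Rightarrow>
     ('p, 'r, 'u) pmod \<Rightarrow> 'p \<Rightarrow> ('p \<Rightarrow> 'u \<Rightarrow> 'u) \<Rightarrow> 'p \<Rightarrow> 'p \<Rightarrow> 'u \<Rightarrow> 'u" where
  "homog R M N = dsum_single UNIV (\<lambda>s. hom_module R M (shift s N))"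

definition gsupp ::
    "('r, 'x) ring_scheme \<Rightarrow> ('p::preordered_ab_group_add, 'r, 'u) pmod \<Rightarrow>
     ('p, 'r, 'u) pmod \<Rightarrow> ('p \<Rightarrow> 'p \<Rightarrow> 'u \<Rightarrow> 'u) \<Rightarrow> 'p set" where
  "gsupp R M N \<phi> = {s. \<phi> s \<noteq> \<zero>\<^bsub>hom_module R M (shift s N)\<^esub>}"

definition gcomp ::
    "('r, 'x) ring_scheme \<Rightarrow> ('p::preordered_ab_group_add, 'r, 'u) pmod \<Rightarrow>
     ('p, 'r, 'u) pmod \<Rightarrow> ('p, 'r, 'u) pmod \<Rightarrow> ('p \<Rightarrow> 'p \<Rightarrow> 'u \<Rightarrow> 'u) \<Rightarrow>
     ('p \<Rightarrow> 'p \<Rightarrow> 'u \<Rightarrow> 'u) \<Rightarrow> 'p \<Rightarrow> 'p \<Rightarrow> 'u \<Rightarrow> 'u" where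
  "gcomp R M N L \<psi> \<phi> =
     finsum (ghom_module R M L)
       (\<lambda>(t, s). homog R M L (s + t) (hom_comp M s (\<psi> t) (\<phi> s)))
       (gsupp R N L \<psi> \<times> gsupp R M N \<phi>)"

definition gtensor_hom ::
    "('r, 'x) ring_scheme \<Rightarrow> 'u set set \<Rightarrow> ('p::preordered_ab_group_add, 'r, 'u) pmod \<Rightarrow>
     ('p, 'r, 'u) pmod \<Rightarrow> ('p, 'r, 'u) pmod \<Rightarrow> ('p, 'r, 'u) pmod \<Rightarrow>
     ('p \<Rightarrow> 'p \<Rightarrow> 'u \<Rightarrow> 'u) \<Rightarrow> ('p \<Rightarrow> 'p \<Rightarrow> 'u \<Rightarrow> 'u) \<Rightarrow> 'p \<Rightarrow> 'p \<Rightarrow> 'u \<Rightarrow> 'u" where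
  "gtensor_hom R \<V> M M' N N' \<phi> \<psi> =
     finsum (ghom_module R (gr_tensor R \<V> M N) (gr_tensor R \<V> M' N'))
       (\<lambda>(u, v). homog R (gr_tensor R \<V> M N) (gr_tensor R \<V> M' N') (u + v)
          (gr_tensor_hom R \<V> M M' N N' u v (\<phi> u) (\<psi> v)))
       (gsupp R M M' \<phi> \<times> gsupp R N N' \<psi>)"

definition GMod ::
    "('r, 'x) ring_scheme \<Rightarrow> 'u set set \<Rightarrow>
     (('p::preordered_ab_group_add, 'r, 'u) pmod, 'p \<Rightarrow> 'p \<Rightarrow> 'u \<Rightarrow> 'u) cat" where
  "GMod R \<U> = \<lparr>
     Ob = pmods R \<U>,
     Hom = (\<lambda>M N. carrier (ghom_module R M N)),
     Idm = (\<lambda>M. homog R M M 0 (id_trans M)),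
     Cmp = gcomp R \<rparr>"

text \<open>The structure maps are those of \<open>PMod_gr\<close>, in degree \<open>0\<close>.\<close>

definition GMod_gr ::
    "('r, 'x) ring_scheme \<Rightarrow> 'u set set \<Rightarrow>
     (('p::preordered_ab_group_add, 'r, 'u) pmod, 'p \<Rightarrow> 'p \<Rightarrow> 'u \<Rightarrow> 'u) moncat" where
  "GMod_gr R \<V> = cat.extend (GMod R \<V>) \<lparr>
     TenO = gr_tensor R \<V>,
     TenM = gtensor_hom R \<V>,
     UnitO = unit_pmod R \<V>,
     AssocM = (\<lambda>M N L. homog R (gr_tensor R \<V> (gr_tensor R \<V> M N) L)
                         (gr_tensor R \<V> M (gr_tensor R \<V> N L)) 0 (gr_assoc R \<V> M N L)),
     LUnitM = (\<lambda>M. homog R (gr_tensor R \<V> (unit_pmod R \<V>) M) M 0 (gr_lunit R \<V> M)),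
     RUnitM = (\<lambda>M. homog R (gr_tensor R \<V> M (unit_pmod R \<V>)) M 0 (gr_runit R \<V> M)) \<rparr>"

definition GMod_enr ::
    "('r, 'x) ring_scheme \<Rightarrow> 'u set set \<Rightarrow> 'u set set \<Rightarrow>
     (('p::preordered_ab_group_add, 'r, 'u) pmod, ('p, 'r, 'u) pmod, 'p \<Rightarrow> 'p \<Rightarrow> 'u \<Rightarrow> 'u) ecat"
  where
  "GMod_enr R \<U> \<V> = \<lparr>
     EOb = pmods R \<U>,
     EHom = ihom R \<V>,
     ECmp = (\<lambda>M N L. homog R (gr_tensor R \<V> (ihom R \<V> N L) (ihom R \<V> M N)) (ihom R \<V> M L) 0
                       (ihom_comp R \<V> M N L)),
     EId = (\<lambda>M. homog R (unit_pmod R \<V>) (ihom R \<V> M M) 0 (ihom_id R \<V> M)) \<rparr>"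


section \<open>Universes exist\<close>

text \<open>
  Over every \<open>P\<close> and \<open>K\<close> there are universes \<open>\<U>\<close> and \<open>\<V>\<close> as required, so hypotheses
  asking for them are not vacuous.
\<close>

lemma lepoll_iff_ordLeq:
  includes cardinal_syntax
  shows "A \<lesssim> B \<longleftrightarrow> |A| \<le>o |B|"
  unfolding lepoll_def by (rule card_of_ordLeq)

lemma universes_exist:
  fixes P :: "'p set" and K :: "'r set"
  defines "\<U> \<equiv> {A :: ('p \<times> 'r \<times> nat) set set. A \<lesssim> (UNIV :: ('p \<times> 'r \<times> nat) set)}"
  shows "universe P K \<U>"
    and "universe P K (UNIV :: ('p \<times> 'r \<times> nat) set set set)"
    and "contains_powers (UNIV :: ('p \<times> 'r \<times> nat) set set set) \<U>"
proof -
  let ?T = "UNIV :: ('p \<times> 'r \<times> nat) set"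
  define X where "X = (\<lambda>t. {t}) ` ?T"
  have injX: "inj (\<lambda>t :: 'p \<times> 'r \<times> nat. {t})"
    by (simp add: inj_def)
  have infT: "infinite ?T"
    by (simp add: finite_prod)
  have infX: "infinite X"
    unfolding X_def using finite_imageD[OF _ injX] infT by blast
  have PT: "P \<lesssim> ?T"
    unfolding lepoll_def by (rule exI[of _ "\<lambda>p. (p, undefined, 0)"]) (auto simp: inj_on_def)
  have KT: "K \<lesssim> ?T"
    unfolding lepoll_def by (rule exI[of _ "\<lambda>k. (undefined, k, 0)"]) (auto simp: inj_on_def)
  have TX: "?T \<lesssim> X"
    unfolding lepoll_def X_def using injX by blast
  have XT: "X \<lesssim> ?T"
    unfolding X_def by (rule image_lepoll)
  have PX: "P \<lesssim> X" and KX: "K \<lesssim> X"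
    using PT KT TX lepoll_trans by blast+
  have BT: "(UNIV :: bool set) \<lesssim> ?T"
    unfolding lepoll_def
    by (rule exI[of _ "\<lambda>b. (undefined, undefined, if b then 0 else 1)"])
       (auto simp: inj_on_def split: if_splits)
  have un: "A \<union> B \<lesssim> ?T" if "A \<lesssim> ?T" "B \<lesssim> ?T" for A B :: "('p \<times> 'r \<times> nat) set set"
  proof -
    have "(\<Union>b\<in>(UNIV :: bool set). if b then A else B) \<lesssim> ?T"
      using that card_of_UNION_ordLeq_infinite[of ?T "UNIV :: bool set" "\<lambda>b. if b then A else B"]
        infT BT unfolding lepoll_iff_ordLeq by auto
    then show ?thesis
      by (simp add: UNIV_bool Un_commute)
  qed
  have UNP: "(\<Union>x\<in>P. A x) \<lesssim> ?T" if "\<forall>x\<in>P. A x \<lesssim> ?T" for A :: "'p \<Rightarrow> ('p \<times> 'r \<times> nat) set set"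
    using that infT PT unfolding lepoll_iff_ordLeq by (intro card_of_UNION_ordLeq_infinite) auto
  show "universe P K \<U>"
    unfolding universe_def \<U>_def using infX PX KX XT un UNP
    by (auto intro: lepoll_trans)
  show "universe P K (UNIV :: ('p \<times> 'r \<times> nat) set set set)"
    unfolding universe_def using infX PX KX by auto
  show "contains_powers (UNIV :: ('p \<times> 'r \<times> nat) set set set) \<U>"
    unfolding contains_powers_def
  proof
    fix A assume "A \<in> \<U>"
    then have "A \<lesssim> ?T" by (simp add: \<U>_def)
    then obtain f :: "('p \<times> 'r \<times> nat) set \<Rightarrow> 'p \<times> 'r \<times> nat" where f: "inj_on f A"
      by (auto simp: lepoll_def)
    then have "inj_on (image f) (Pow A)"
      by (rule inj_on_image_Pow)
    then have "Pow A \<lesssim> (UNIV :: ('p \<times> 'r \<times> nat) set set)"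
      unfolding lepoll_def by auto
    then show "\<exists>B\<in>(UNIV :: ('p \<times> 'r \<times> nat) set set set). Pow A \<lesssim> B" by blast
  qed
qed

end

theory Submission
  imports Defs
begin

text \<open>
  By the universal properties of the tensor product of modules and of the colimit, morphisms out of
  \<open>M \<otimes> N\<close> correspond to families of bilinear maps \<open>M\<^sub>s \<times> N\<^sub>t \<rightarrow> K\<^sub>s\<^sub>+\<^sub>t\<close> natural in \<open>s\<close> and \<open>t\<close>. So the
  structure maps and the inverse of the associator are obtained by lifting such families, and every identity
  between them is tested on pure tensors; since \<open>R[U\<^sub>0]\<close> represents evaluation at \<open>0\<close>, unit factors need
  only be tested on the generator in degree \<open>0\<close>. All naturality statements are proved for morphisms of
  arbitrary degrees. Degree \<open>0\<close> gives the first enrichment. Composition and tensor product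
  of graded morphisms are biadditive, so the second one reduces to homogeneous morphisms.

  The \<open>R\<close>-linear bijection \<open>Hom(M, N(s)) \<cong> Hom(R[U\<^sub>0], Hom(M, N)(s))\<close> identifies the underlying categories.
  A stalk of \<open>M \<otimes> N\<close> stays in the universe because its elements are finite sums of pure tensors.
\<close>

section \<open>Linear maps\<close>

text \<open>The structure maps are definite descriptions, so each of them requires existence and
  uniqueness together: a lift gives the one, testing on generators the other. Two obstacles shape
  the argument. First, a bilinear family is given only in the exact degrees \<open>s + t\<close>,
  while the stalk at \<open>r\<close> is a colimit over all \<open>s + t \<le> r\<close>. The
  transition map of the target from \<open>s + t\<close> to \<open>r\<close> fills this gap for
  lifts, and naturality brings every test back to \<open>r = s + t\<close>. The order need be
  neither antisymmetric nor total, so the colimits are never computed; only their universal property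
  is used. Second, in a nested tensor product the elements of the inner product are sums of pure
  tensors, so a test on pure tensors of the outer product is not yet a test on triples. Freezing one
  argument of degree \<open>w\<close> leaves a natural transformation into the target shifted by
  \<open>w\<close>, to which the test for the inner product applies. Shifted targets thus occur even
  where all maps in question have degree 0.\<close>

lemma mk_module_simps [simp]:
  "carrier (mk_module A z ad sm) = A"
  "zero (mk_module A z ad sm) = z"
  "add (mk_module A z ad sm) = ad"
  "smult (mk_module A z ad sm) = sm"
  by (simp_all add: mk_module_def)

lemma lin_mapsI:
  assumes "h \<in> extensional (carrier A)"
    and "\<And>x. x \<in> carrier A \<Longrightarrow> h x \<in> carrier B"
    and "\<And>x y. x \<in> carrier A \<Longrightarrow> y \<in> carrier A \<Longrightarrow> h (x \<oplus>\<^bsub>A\<^esub> y) = h x \<oplus>\<^bsub>B\<^esub> h y"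
    and "\<And>a x. a \<in> carrier R \<Longrightarrow> x \<in> carrier A \<Longrightarrow> h (a \<odot>\<^bsub>A\<^esub> x) = a \<odot>\<^bsub>B\<^esub> h x"
  shows "h \<in> lin_maps R A B"
  using assms by (auto simp: lin_maps_def PiE_def)

lemma lin_closed: "h \<in> lin_maps R A B \<Longrightarrow> x \<in> carrier A \<Longrightarrow> h x \<in> carrier B"
  and lin_add: "h \<in> lin_maps R A B \<Longrightarrow> x \<in> carrier A \<Longrightarrow> y \<in> carrier A \<Longrightarrow>
    h (x \<oplus>\<^bsub>A\<^esub> y) = h x \<oplus>\<^bsub>B\<^esub> h y"
  and lin_smult: "h \<in> lin_maps R A B \<Longrightarrow> a \<in> carrier R \<Longrightarrow> x \<in> carrier A \<Longrightarrow>
    h (a \<odot>\<^bsub>A\<^esub> x) = a \<odot>\<^bsub>B\<^esub> h x"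
  and lin_extensional: "h \<in> lin_maps R A B \<Longrightarrow> h \<in> extensional (carrier A)"
  by (auto simp: lin_maps_def PiE_def)

lemma lin_maps_eqI:
  assumes "h \<in> lin_maps R A B" "h' \<in> lin_maps R A B'"
    and "\<And>x. x \<in> carrier A \<Longrightarrow> h x = h' x"
  shows "h = h'"
  using assms by (meson lin_extensional extensionalityI)

text \<open>Quotient projections and the coding into a universe both have this shape. Unlike in
  \<open>lin_maps\<close> there is no extensionality, since such maps are given by terms on a whole
  type. The condition on zero is explicit because \<open>B\<close> is not yet known to be a
  group.\<close>

definition lin_onto ::
    "('r, 'x) ring_scheme \<Rightarrow> ('a \<Rightarrow> 'b) \<Rightarrow> ('r, 'a) module \<Rightarrow> ('r, 'b) module \<Rightarrow> bool" where
  "lin_onto R \<pi> A B \<longleftrightarrow> \<pi> ` carrier A = carrier B \<and> \<pi> \<zero>\<^bsub>A\<^esub> = \<zero>\<^bsub>B\<^esub> \<and>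
     (\<forall>x\<in>carrier A. \<forall>y\<in>carrier A. \<pi> (x \<oplus>\<^bsub>A\<^esub> y) = \<pi> x \<oplus>\<^bsub>B\<^esub> \<pi> y) \<and>
     (\<forall>a\<in>carrier R. \<forall>x\<in>carrier A. \<pi> (a \<odot>\<^bsub>A\<^esub> x) = a \<odot>\<^bsub>B\<^esub> \<pi> x)"

lemma lin_ontoI:
  assumes "\<pi> ` carrier A = carrier B" "\<pi> \<zero>\<^bsub>A\<^esub> = \<zero>\<^bsub>B\<^esub>"
    and "\<And>x y. x \<in> carrier A \<Longrightarrow> y \<in> carrier A \<Longrightarrow> \<pi> (x \<oplus>\<^bsub>A\<^esub> y) = \<pi> x \<oplus>\<^bsub>B\<^esub> \<pi> y"
    and "\<And>a x. a \<in> carrier R \<Longrightarrow> x \<in> carrier A \<Longrightarrow> \<pi> (a \<odot>\<^bsub>A\<^esub> x) = a \<odot>\<^bsub>B\<^esub> \<pi> x"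
  shows "lin_onto R \<pi> A B"
  using assms by (auto simp: lin_onto_def)

lemma lin_onto_image: "lin_onto R \<pi> A B \<Longrightarrow> carrier B = \<pi> ` carrier A"
  and lin_onto_zero: "lin_onto R \<pi> A B \<Longrightarrow> \<zero>\<^bsub>B\<^esub> = \<pi> \<zero>\<^bsub>A\<^esub>"
  and lin_onto_closed: "lin_onto R \<pi> A B \<Longrightarrow> x \<in> carrier A \<Longrightarrow> \<pi> x \<in> carrier B"
  and lin_onto_add: "lin_onto R \<pi> A B \<Longrightarrow> x \<in> carrier A \<Longrightarrow> y \<in> carrier A \<Longrightarrow>
    \<pi> (x \<oplus>\<^bsub>A\<^esub> y) = \<pi> x \<oplus>\<^bsub>B\<^esub> \<pi> y"
  and lin_onto_smult: "lin_onto R \<pi> A B \<Longrightarrow> a \<in> carrier R \<Longrightarrow> x \<in> carrier A \<Longrightarrow>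
    \<pi> (a \<odot>\<^bsub>A\<^esub> x) = a \<odot>\<^bsub>B\<^esub> \<pi> x"
  by (auto simp: lin_onto_def)

section \<open>Arithmetic in modules, linear maps and transport of module structure\<close>

context cring
begin

text \<open>The laws of a module with the module as an explicit premise: modules vary with the
  degree, and one set of rewrite rules has to serve all stalks at once without interpreting a locale
  for each.\<close>

lemma mod_zero [simp, intro]: "module R A \<Longrightarrow> \<zero>\<^bsub>A\<^esub> \<in> carrier A"
  and mod_add [simp, intro]:
    "module R A \<Longrightarrow> x \<in> carrier A \<Longrightarrow> y \<in> carrier A \<Longrightarrow> x \<oplus>\<^bsub>A\<^esub> y \<in> carrier A"
  and mod_uminus [simp, intro]: "module R A \<Longrightarrow> x \<in> carrier A \<Longrightarrow> \<ominus>\<^bsub>A\<^esub> x \<in> carrier A"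
  and mod_minus [simp, intro]:
    "module R A \<Longrightarrow> x \<in> carrier A \<Longrightarrow> y \<in> carrier A \<Longrightarrow> x \<ominus>\<^bsub>A\<^esub> y \<in> carrier A"
  and mod_l_zero [simp]: "module R A \<Longrightarrow> x \<in> carrier A \<Longrightarrow> \<zero>\<^bsub>A\<^esub> \<oplus>\<^bsub>A\<^esub> x = x"
  and mod_r_zero [simp]: "module R A \<Longrightarrow> x \<in> carrier A \<Longrightarrow> x \<oplus>\<^bsub>A\<^esub> \<zero>\<^bsub>A\<^esub> = x"
  and mod_a_assoc: "module R A \<Longrightarrow> x \<in> carrier A \<Longrightarrow> y \<in> carrier A \<Longrightarrow> z \<in> carrier A \<Longrightarrow>
    (x \<oplus>\<^bsub>A\<^esub> y) \<oplus>\<^bsub>A\<^esub> z = x \<oplus>\<^bsub>A\<^esub> (y \<oplus>\<^bsub>A\<^esub> z)"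
  and mod_a_comm: "module R A \<Longrightarrow> x \<in> carrier A \<Longrightarrow> y \<in> carrier A \<Longrightarrow> x \<oplus>\<^bsub>A\<^esub> y = y \<oplus>\<^bsub>A\<^esub> x"
  and mod_a_lcomm: "module R A \<Longrightarrow> x \<in> carrier A \<Longrightarrow> y \<in> carrier A \<Longrightarrow> z \<in> carrier A \<Longrightarrow>
    x \<oplus>\<^bsub>A\<^esub> (y \<oplus>\<^bsub>A\<^esub> z) = y \<oplus>\<^bsub>A\<^esub> (x \<oplus>\<^bsub>A\<^esub> z)"
  by (simp_all add: module_def abelian_groupE abelian_group.axioms abelian_monoid.a_closed
      abelian_group.a_inv_closed abelian_group.minus_closed abelian_monoid.l_zero
      abelian_monoid.r_zero abelian_monoid.a_assoc abelian_monoid.a_comm abelian_monoid.a_lcomm)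

lemma mod_smult [simp, intro]:
    "module R A \<Longrightarrow> a \<in> carrier R \<Longrightarrow> x \<in> carrier A \<Longrightarrow> a \<odot>\<^bsub>A\<^esub> x \<in> carrier A"
  and mod_smult_zero [simp]: "module R A \<Longrightarrow> a \<in> carrier R \<Longrightarrow> a \<odot>\<^bsub>A\<^esub> \<zero>\<^bsub>A\<^esub> = \<zero>\<^bsub>A\<^esub>"
  and mod_zero_smult [simp]: "module R A \<Longrightarrow> x \<in> carrier A \<Longrightarrow> \<zero> \<odot>\<^bsub>A\<^esub> x = \<zero>\<^bsub>A\<^esub>"
  and mod_one_smult [simp]: "module R A \<Longrightarrow> x \<in> carrier A \<Longrightarrow> \<one> \<odot>\<^bsub>A\<^esub> x = x"
  and mod_smult_add: "module R A \<Longrightarrow> a \<in> carrier R \<Longrightarrow> x \<in> carrier A \<Longrightarrow> y \<in> carrier A \<Longrightarrow>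
    a \<odot>\<^bsub>A\<^esub> (x \<oplus>\<^bsub>A\<^esub> y) = a \<odot>\<^bsub>A\<^esub> x \<oplus>\<^bsub>A\<^esub> a \<odot>\<^bsub>A\<^esub> y"
  and mod_add_smult: "module R A \<Longrightarrow> a \<in> carrier R \<Longrightarrow> b \<in> carrier R \<Longrightarrow> x \<in> carrier A \<Longrightarrow>
    (a \<oplus> b) \<odot>\<^bsub>A\<^esub> x = a \<odot>\<^bsub>A\<^esub> x \<oplus>\<^bsub>A\<^esub> b \<odot>\<^bsub>A\<^esub> x"
  and mod_smult_smult: "module R A \<Longrightarrow> a \<in> carrier R \<Longrightarrow> b \<in> carrier R \<Longrightarrow> x \<in> carrier A \<Longrightarrow>
    a \<odot>\<^bsub>A\<^esub> (b \<odot>\<^bsub>A\<^esub> x) = (a \<otimes> b) \<odot>\<^bsub>A\<^esub> x"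
  and mod_smult_uminus: "module R A \<Longrightarrow> x \<in> carrier A \<Longrightarrow> (\<ominus> \<one>) \<odot>\<^bsub>A\<^esub> x = \<ominus>\<^bsub>A\<^esub> x"
  by (simp_all add: module.smult_closed module.smult_l_null module.smult_l_minus
      module.smult_r_null module.smult_one module.smult_r_distr module.smult_l_distr
      module.smult_assoc1)

lemma lin_zero:
  assumes "module R A" "module R B" "h \<in> lin_maps R A B"
  shows "h \<zero>\<^bsub>A\<^esub> = \<zero>\<^bsub>B\<^esub>"
proof -
  have "h (\<zero> \<odot>\<^bsub>A\<^esub> \<zero>\<^bsub>A\<^esub>) = \<zero> \<odot>\<^bsub>B\<^esub> h \<zero>\<^bsub>A\<^esub>"
    using assms by (intro lin_smult) auto
  then show ?thesis
    using assms lin_closed[OF assms(3) mod_zero] by simp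
qed

lemma lin_minus:
  assumes "module R A" "module R B" "h \<in> lin_maps R A B" "x \<in> carrier A" "y \<in> carrier A"
  shows "h (x \<ominus>\<^bsub>A\<^esub> y) = h x \<ominus>\<^bsub>B\<^esub> h y"
  using assms lin_closed[OF assms(3)]
  by (simp add: a_minus_def lin_add lin_smult flip: mod_smult_uminus)

lemma mod_minus_eq_zero:
  assumes "module R A" "x \<in> carrier A" "y \<in> carrier A"
  shows "x \<ominus>\<^bsub>A\<^esub> y = \<zero>\<^bsub>A\<^esub> \<longleftrightarrow> x = y"
proof -
  interpret A: module R A by fact
  show ?thesis
    using assms by (metis A.add.inv_closed A.add.inv_inv A.minus_eq A.minus_equality A.r_neg)
qed

lemma lin_comp:
  assumes "f \<in> lin_maps R A B" "g \<in> lin_maps R B C" "module R A"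
  shows "compose (carrier A) g f \<in> lin_maps R A C"
  using assms by (intro lin_mapsI) (auto simp: compose_def lin_closed lin_add lin_smult)

text \<open>The module axioms are equations together with the existence of negatives, and these pass
  along a surjection that respects the operations. Quotients and coded copies get their module
  structure this way.\<close>

lemma lin_onto_module:
  assumes A: "module R A" and \<pi>: "lin_onto R \<pi> A B"
  shows "module R B"
proof -
  have ex: "\<exists>x\<in>carrier A. z = \<pi> x" if "z \<in> carrier B" for z
    using that lin_onto_image[OF \<pi>] by auto
  have ad: "\<pi> x \<oplus>\<^bsub>B\<^esub> \<pi> y = \<pi> (x \<oplus>\<^bsub>A\<^esub> y)" if "x \<in> carrier A" "y \<in> carrier A" for x y
    using lin_onto_add[OF \<pi>] that by simp
  have sm: "a \<odot>\<^bsub>B\<^esub> \<pi> x = \<pi> (a \<odot>\<^bsub>A\<^esub> x)" if "a \<in> carrier R" "x \<in> carrier A" for a x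
    using lin_onto_smult[OF \<pi>] that by simp
  note [simp] = ad sm lin_onto_closed[OF \<pi>] lin_onto_zero[OF \<pi>]
  interpret A: module R A by fact
  have "abelian_group B"
  proof (rule abelian_groupI)
    fix x assume "x \<in> carrier B"
    then obtain x' where x': "x' \<in> carrier A" "x = \<pi> x'" using ex by metis
    then show "\<zero>\<^bsub>B\<^esub> \<oplus>\<^bsub>B\<^esub> x = x" using A by simp
    have "\<pi> (\<ominus>\<^bsub>A\<^esub> x') \<in> carrier B" "\<pi> (\<ominus>\<^bsub>A\<^esub> x') \<oplus>\<^bsub>B\<^esub> x = \<zero>\<^bsub>B\<^esub>"
      using x' by (simp_all add: A.l_neg)
    then show "\<exists>y\<in>carrier B. y \<oplus>\<^bsub>B\<^esub> x = \<zero>\<^bsub>B\<^esub>" by blast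
    fix y assume "y \<in> carrier B"
    then obtain y' where y': "y' \<in> carrier A" "y = \<pi> y'" using ex by metis
    show "x \<oplus>\<^bsub>B\<^esub> y = y \<oplus>\<^bsub>B\<^esub> x" "x \<oplus>\<^bsub>B\<^esub> y \<in> carrier B"
      using x' y' A by (simp_all add: A.a_comm)
    fix z assume "z \<in> carrier B"
    then obtain z' where "z' \<in> carrier A" "z = \<pi> z'" using ex by metis
    then show "x \<oplus>\<^bsub>B\<^esub> y \<oplus>\<^bsub>B\<^esub> z = x \<oplus>\<^bsub>B\<^esub> (y \<oplus>\<^bsub>B\<^esub> z)"
      using x' y' A by (simp add: A.a_assoc)
  qed (use A in simp)
  then show ?thesis
  proof (rule moduleI[OF is_cring])
    fix x assume "x \<in> carrier B"
    then obtain x' where x': "x' \<in> carrier A" "x = \<pi> x'" using ex by metis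
    then show "\<one> \<odot>\<^bsub>B\<^esub> x = x" using A by simp
    fix a assume a: "a \<in> carrier R"
    then show "a \<odot>\<^bsub>B\<^esub> x \<in> carrier B" using A x' by simp
    show "(a \<oplus> b) \<odot>\<^bsub>B\<^esub> x = a \<odot>\<^bsub>B\<^esub> x \<oplus>\<^bsub>B\<^esub> b \<odot>\<^bsub>B\<^esub> x" "a \<otimes> b \<odot>\<^bsub>B\<^esub> x = a \<odot>\<^bsub>B\<^esub> (b \<odot>\<^bsub>B\<^esub> x)"
      if "b \<in> carrier R" for b
      using A x' a that by (simp_all add: A.smult_l_distr A.smult_assoc1)
    fix y assume "y \<in> carrier B"
    then obtain y' where "y' \<in> carrier A" "y = \<pi> y'" using ex by metis
    then show "a \<odot>\<^bsub>B\<^esub> (x \<oplus>\<^bsub>B\<^esub> y) = a \<odot>\<^bsub>B\<^esub> x \<oplus>\<^bsub>B\<^esub> a \<odot>\<^bsub>B\<^esub> y"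
      using A x' a by (simp add: A.smult_r_distr)
  qed
qed

lemma lin_onto_lift:
  assumes A: "module R A" and \<pi>: "lin_onto R \<pi> A B" and f: "f \<in> lin_maps R A C"
    and eq: "\<And>x y. x \<in> carrier A \<Longrightarrow> y \<in> carrier A \<Longrightarrow> \<pi> x = \<pi> y \<Longrightarrow> f x = f y"
  shows "\<exists>h\<in>lin_maps R B C. \<forall>x\<in>carrier A. h (\<pi> x) = f x"
proof -
  \<comment> \<open>The value is read off at a chosen preimage; \<open>eq\<close> makes the choice
    irrelevant, and linearity is then inherited from \<open>f\<close>.\<close>
  define h where "h = (\<lambda>z\<in>carrier B. f (inv_into (carrier A) \<pi> z))"
  have h: "h (\<pi> x) = f x" if x: "x \<in> carrier A" for x
    using x lin_onto_closed[OF \<pi> x] by (auto simp: h_def f_inv_into_f inv_into_into intro: eq)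
  have ex: "\<exists>x\<in>carrier A. z = \<pi> x" if "z \<in> carrier B" for z
    using that lin_onto_image[OF \<pi>] by auto
  have "h \<in> lin_maps R B C"
  proof (rule lin_mapsI)
    show "h \<in> extensional (carrier B)" by (simp add: h_def)
    fix x y assume "x \<in> carrier B" "y \<in> carrier B"
    then obtain x' y' where xy: "x' \<in> carrier A" "y' \<in> carrier A" "x = \<pi> x'" "y = \<pi> y'"
      using ex by metis
    then show "h x \<in> carrier C" by (simp add: h lin_closed[OF f])
    show "h (x \<oplus>\<^bsub>B\<^esub> y) = h x \<oplus>\<^bsub>C\<^esub> h y"
      using A xy by (simp add: h lin_add[OF f] flip: lin_onto_add[OF \<pi>])
    show "h (a \<odot>\<^bsub>B\<^esub> x) = a \<odot>\<^bsub>C\<^esub> h x" if "a \<in> carrier R" for a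
      using A xy that by (simp add: h lin_smult[OF f] flip: lin_onto_smult[OF \<pi>])
  qed
  with h show ?thesis by blast
qed


section \<open>Quotients, direct sums, tensor products and colimits\<close>

lemma quot_onto:
  assumes A: "module R A" and H: "submodule H R A"
  shows "lin_onto R (\<lambda>x. H +>\<^bsub>A\<^esub> x) A (quot_module A H)"
    and "\<And>x y. x \<in> carrier A \<Longrightarrow> y \<in> carrier A \<Longrightarrow> H +>\<^bsub>A\<^esub> x = H +>\<^bsub>A\<^esub> y \<longleftrightarrow> x \<ominus>\<^bsub>A\<^esub> y \<in> H"
proof -
  interpret A: module R A by fact
  interpret H: submodule H R A by fact
  have sg: "subgroup H (add_monoid A)" by (rule H.subgroup_axioms)
  interpret S: abelian_subgroup H A
    by (intro abelian_subgroupI3 additive_subgroupI sg) (rule module.axioms(2)[OF A])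
  show eq: "H +>\<^bsub>A\<^esub> x = H +>\<^bsub>A\<^esub> y \<longleftrightarrow> x \<ominus>\<^bsub>A\<^esub> y \<in> H" if "x \<in> carrier A" "y \<in> carrier A" for x y
  proof -
    have e1: "x \<in> H +>\<^bsub>A\<^esub> y \<longleftrightarrow> x \<ominus>\<^bsub>A\<^esub> y \<in> H"
      using S.a_rcos_module[OF that(2,1)] unfolding a_minus_def .
    have e2: "x \<in> H +>\<^bsub>A\<^esub> y \<longleftrightarrow> H +>\<^bsub>A\<^esub> x = H +>\<^bsub>A\<^esub> y"
    proof
      assume "x \<in> H +>\<^bsub>A\<^esub> y"
      from A.a_repr_independence[OF this that(2) sg] show "H +>\<^bsub>A\<^esub> x = H +>\<^bsub>A\<^esub> y" by (rule sym)
    next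
      assume "H +>\<^bsub>A\<^esub> x = H +>\<^bsub>A\<^esub> y"
      with S.a_rcos_self[OF that(1)] show "x \<in> H +>\<^bsub>A\<^esub> y" by (rule back_subst)
    qed
    show ?thesis by (rule trans[OF sym[OF e2] e1])
  qed
  show "lin_onto R (\<lambda>x. H +>\<^bsub>A\<^esub> x) A (quot_module A H)"
  proof (rule lin_ontoI)
    show "(\<lambda>x. H +>\<^bsub>A\<^esub> x) ` carrier A = carrier (quot_module A H)"
      by (auto simp: quot_module_def A_RCOSETS_def')
    show "H +>\<^bsub>A\<^esub> \<zero>\<^bsub>A\<^esub> = \<zero>\<^bsub>quot_module A H\<^esub>"
      by (simp add: quot_module_def S.a_subset)
  next
    fix x y assume "x \<in> carrier A" "y \<in> carrier A"
    then show "H +>\<^bsub>A\<^esub> (x \<oplus>\<^bsub>A\<^esub> y) = (H +>\<^bsub>A\<^esub> x) \<oplus>\<^bsub>quot_module A H\<^esub> (H +>\<^bsub>A\<^esub> y)"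
      by (simp add: quot_module_def S.a_rcos_sum)
  next
    fix a x assume ax: "a \<in> carrier R" "x \<in> carrier A"
    \<comment> \<open>\<open>quot_module\<close> multiplies a coset by taking a union over all its
      representatives. Every representative contributes the same coset, so the union
      collapses.\<close>
    have c: "H +>\<^bsub>A\<^esub> (a \<odot>\<^bsub>A\<^esub> y) = H +>\<^bsub>A\<^esub> (a \<odot>\<^bsub>A\<^esub> x)" if y: "y \<in> H +>\<^bsub>A\<^esub> x" for y
    proof -
      obtain h where h: "h \<in> H" "y = h \<oplus>\<^bsub>A\<^esub> x" using y by (auto simp: a_r_coset_def r_coset_def)
      then have hc: "h \<in> carrier A" using S.a_subset by blast
      have "a \<odot>\<^bsub>A\<^esub> y = a \<odot>\<^bsub>A\<^esub> h \<oplus>\<^bsub>A\<^esub> a \<odot>\<^bsub>A\<^esub> x"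
        using h hc ax by (simp add: A.smult_r_distr)
      then have "a \<odot>\<^bsub>A\<^esub> y \<in> H +>\<^bsub>A\<^esub> (a \<odot>\<^bsub>A\<^esub> x)"
        using h ax A.a_rcosI[OF H.smult_closed S.a_subset] by simp
      from A.a_repr_independence[OF this A.smult_closed[OF ax] sg] show ?thesis by (rule sym)
    qed
    have "H +>\<^bsub>A\<^esub> x \<noteq> {}" using S.a_rcos_self[OF ax(2)] by blast
    then have "(\<Union>y\<in>H +>\<^bsub>A\<^esub> x. H +>\<^bsub>A\<^esub> (a \<odot>\<^bsub>A\<^esub> y)) = H +>\<^bsub>A\<^esub> (a \<odot>\<^bsub>A\<^esub> x)"
      by (rule SUP_eq_const) (rule c)
    then show "H +>\<^bsub>A\<^esub> (a \<odot>\<^bsub>A\<^esub> x) = a \<odot>\<^bsub>quot_module A H\<^esub> (H +>\<^bsub>A\<^esub> x)"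
      by (simp add: quot_module_def)
  qed
qed

lemma submodule_span:
  assumes A: "module R A" and S: "S \<subseteq> carrier A"
  shows "submodule (span_module R A S) R A" and "S \<subseteq> span_module R A S"
proof -
  interpret A: module R A by fact
  show "S \<subseteq> span_module R A S" by (auto simp: span_module_def)
  \<comment> \<open>The whole module is among the submodules intersected, which keeps the span
    inside the carrier.\<close>
  have c: "submodule (carrier A) R A" by (rule A.carrier_is_submodule)
  have z: "\<zero>\<^bsub>A\<^esub> \<in> H" if "submodule H R A" for H
    using subgroup.one_closed[OF submodule.axioms(1)[OF that]] by simp
  show "submodule (span_module R A S) R A"
  proof (rule A.submoduleI)
    show "span_module R A S \<subseteq> carrier A"
      using c S by (auto simp: span_module_def)
    show "\<zero>\<^bsub>A\<^esub> \<in> span_module R A S"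
      using z by (simp add: span_module_def)
  next
    fix x assume "x \<in> span_module R A S"
    then show "\<ominus>\<^bsub>A\<^esub> x \<in> span_module R A S"
      by (simp add: span_module_def A.submoduleE(3))
    show "a \<odot>\<^bsub>A\<^esub> x \<in> span_module R A S" if "a \<in> carrier R" for a
      using \<open>x \<in> _\<close> that by (simp add: span_module_def A.submoduleE(4))
    show "x \<oplus>\<^bsub>A\<^esub> y \<in> span_module R A S" if "y \<in> span_module R A S" for y
      using \<open>x \<in> _\<close> that by (simp add: span_module_def A.submoduleE(5))
  qed
qed

text \<open>The kernel of \<open>f\<close> is a submodule containing \<open>S\<close>, hence
  contains the span.\<close>

lemma lin_zero_on_span:
  assumes A: "module R A" and B: "module R B" and f: "f \<in> lin_maps R A B"
    and S: "S \<subseteq> carrier A" and z: "\<And>x. x \<in> S \<Longrightarrow> f x = \<zero>\<^bsub>B\<^esub>" and x: "x \<in> span_module R A S"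
  shows "f x = \<zero>\<^bsub>B\<^esub>"
proof -
  interpret A: module R A by fact
  interpret B: module R B by fact
  have "submodule {x \<in> carrier A. f x = \<zero>\<^bsub>B\<^esub>} R A"
  proof (rule A.submoduleI)
    fix x assume "x \<in> {x \<in> carrier A. f x = \<zero>\<^bsub>B\<^esub>}"
    then show "\<ominus>\<^bsub>A\<^esub> x \<in> {x \<in> carrier A. f x = \<zero>\<^bsub>B\<^esub>}"
      using A B lin_smult[OF f, of "\<ominus> \<one>" x] by (simp add: mod_smult_uminus)
  qed (auto simp: lin_zero[OF A B f] lin_add[OF f] lin_smult[OF f] A B)
  then show ?thesis using x S z by (auto simp: span_module_def)
qed

text \<open>Generators and relations in one package: projection, module structure, validity of the
  relations and universal property. Tensor products and colimits are both instances.\<close>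

lemma quot_span:
  fixes A :: "('a, 'c) module"
  assumes A: "module R A" and S: "S \<subseteq> carrier A"
  defines "\<pi> \<equiv> \<lambda>x. span_module R A S +>\<^bsub>A\<^esub> x" and "Q \<equiv> quot_module A (span_module R A S)"
  shows "lin_onto R \<pi> A Q" and "module R Q"
    and "\<And>x y. x \<in> carrier A \<Longrightarrow> y \<in> carrier A \<Longrightarrow> x \<ominus>\<^bsub>A\<^esub> y \<in> S \<Longrightarrow> \<pi> x = \<pi> y"
    and "\<And>B f. module R B \<Longrightarrow> f \<in> lin_maps R A B \<Longrightarrow> (\<And>x. x \<in> S \<Longrightarrow> f x = \<zero>\<^bsub>B\<^esub>) \<Longrightarrow>
      \<exists>h\<in>lin_maps R Q B. \<forall>x\<in>carrier A. h (\<pi> x) = f x"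
proof -
  note sp = submodule_span[OF A S]
  show onto: "lin_onto R \<pi> A Q" unfolding \<pi>_def Q_def by (rule quot_onto(1)[OF A sp(1)])
  show "module R Q" by (rule lin_onto_module[OF A onto])
  show "\<pi> x = \<pi> y" if "x \<in> carrier A" "y \<in> carrier A" "x \<ominus>\<^bsub>A\<^esub> y \<in> S" for x y
    unfolding \<pi>_def by (rule iffD2[OF quot_onto(2)[OF A sp(1) that(1,2)]]) (use that(3) sp(2) in blast)
  show "\<exists>h\<in>lin_maps R Q B. \<forall>x\<in>carrier A. h (\<pi> x) = f x"
    if B: "module R B" and f: "f \<in> lin_maps R A B" and z: "\<And>x. x \<in> S \<Longrightarrow> f x = \<zero>\<^bsub>B\<^esub>" for B :: "('a, 'd) module"
        and f
  proof (rule lin_onto_lift[OF A onto f])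
    fix x y assume xy: "x \<in> carrier A" "y \<in> carrier A" "\<pi> x = \<pi> y"
    have "x \<ominus>\<^bsub>A\<^esub> y \<in> span_module R A S"
      by (rule iffD1[OF quot_onto(2)[OF A sp(1) xy(1,2)] xy(3)[unfolded \<pi>_def]])
    from lin_zero_on_span[OF A B f S z this] have "f (x \<ominus>\<^bsub>A\<^esub> y) = \<zero>\<^bsub>B\<^esub>" .
    then show "f x = f y"
      using lin_minus[OF A B f xy(1,2)]
        mod_minus_eq_zero[OF B lin_closed[OF f xy(1)] lin_closed[OF f xy(2)]] by simp
  qed
qed

end

definition bilin ::
    "('r, 'x) ring_scheme \<Rightarrow> ('r, 'a) module \<Rightarrow> ('r, 'b) module \<Rightarrow> ('r, 'c) module \<Rightarrow>
     ('a \<Rightarrow> 'b \<Rightarrow> 'c) \<Rightarrow> bool" where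
  "bilin R A B C \<beta> \<longleftrightarrow>
     (\<forall>x\<in>carrier A. \<forall>y\<in>carrier B. \<beta> x y \<in> carrier C) \<and>
     (\<forall>x\<in>carrier A. \<forall>x'\<in>carrier A. \<forall>y\<in>carrier B. \<beta> (x \<oplus>\<^bsub>A\<^esub> x') y = \<beta> x y \<oplus>\<^bsub>C\<^esub> \<beta> x' y) \<and>
     (\<forall>x\<in>carrier A. \<forall>y\<in>carrier B. \<forall>y'\<in>carrier B. \<beta> x (y \<oplus>\<^bsub>B\<^esub> y') = \<beta> x y \<oplus>\<^bsub>C\<^esub> \<beta> x y') \<and>
     (\<forall>a\<in>carrier R. \<forall>x\<in>carrier A. \<forall>y\<in>carrier B. \<beta> (a \<odot>\<^bsub>A\<^esub> x) y = a \<odot>\<^bsub>C\<^esub> \<beta> x y) \<and>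
     (\<forall>a\<in>carrier R. \<forall>x\<in>carrier A. \<forall>y\<in>carrier B. \<beta> x (a \<odot>\<^bsub>B\<^esub> y) = a \<odot>\<^bsub>C\<^esub> \<beta> x y)"

lemma bilinI:
  assumes "\<And>x y. x \<in> carrier A \<Longrightarrow> y \<in> carrier B \<Longrightarrow> \<beta> x y \<in> carrier C"
    and "\<And>x x' y. x \<in> carrier A \<Longrightarrow> x' \<in> carrier A \<Longrightarrow> y \<in> carrier B \<Longrightarrow>
      \<beta> (x \<oplus>\<^bsub>A\<^esub> x') y = \<beta> x y \<oplus>\<^bsub>C\<^esub> \<beta> x' y"
    and "\<And>x y y'. x \<in> carrier A \<Longrightarrow> y \<in> carrier B \<Longrightarrow> y' \<in> carrier B \<Longrightarrow>
      \<beta> x (y \<oplus>\<^bsub>B\<^esub> y') = \<beta> x y \<oplus>\<^bsub>C\<^esub> \<beta> x y'"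
    and "\<And>a x y. a \<in> carrier R \<Longrightarrow> x \<in> carrier A \<Longrightarrow> y \<in> carrier B \<Longrightarrow>
      \<beta> (a \<odot>\<^bsub>A\<^esub> x) y = a \<odot>\<^bsub>C\<^esub> \<beta> x y"
    and "\<And>a x y. a \<in> carrier R \<Longrightarrow> x \<in> carrier A \<Longrightarrow> y \<in> carrier B \<Longrightarrow>
      \<beta> x (a \<odot>\<^bsub>B\<^esub> y) = a \<odot>\<^bsub>C\<^esub> \<beta> x y"
  shows "bilin R A B C \<beta>"
  using assms by (simp add: bilin_def)

lemma bilin_closed: "bilin R A B C \<beta> \<Longrightarrow> x \<in> carrier A \<Longrightarrow> y \<in> carrier B \<Longrightarrow> \<beta> x y \<in> carrier C"
  and bilin_add_left: "bilin R A B C \<beta> \<Longrightarrow> x \<in> carrier A \<Longrightarrow> x' \<in> carrier A \<Longrightarrow> y \<in> carrier B \<Longrightarrow>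
      \<beta> (x \<oplus>\<^bsub>A\<^esub> x') y = \<beta> x y \<oplus>\<^bsub>C\<^esub> \<beta> x' y"
  and bilin_add_right: "bilin R A B C \<beta> \<Longrightarrow> x \<in> carrier A \<Longrightarrow> y \<in> carrier B \<Longrightarrow> y' \<in> carrier B \<Longrightarrow>
      \<beta> x (y \<oplus>\<^bsub>B\<^esub> y') = \<beta> x y \<oplus>\<^bsub>C\<^esub> \<beta> x y'"
  and bilin_smult_left: "bilin R A B C \<beta> \<Longrightarrow> a \<in> carrier R \<Longrightarrow> x \<in> carrier A \<Longrightarrow> y \<in> carrier B \<Longrightarrow>
      \<beta> (a \<odot>\<^bsub>A\<^esub> x) y = a \<odot>\<^bsub>C\<^esub> \<beta> x y"
  and bilin_smult_right: "bilin R A B C \<beta> \<Longrightarrow> a \<in> carrier R \<Longrightarrow> x \<in> carrier A \<Longrightarrow> y \<in> carrier B \<Longrightarrow>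
      \<beta> x (a \<odot>\<^bsub>B\<^esub> y) = a \<odot>\<^bsub>C\<^esub> \<beta> x y"
  by (simp_all add: bilin_def)

context cring
begin

lemma bilin_zero_left:
  assumes "bilin R A B C \<beta>" "module R A" "module R C" "y \<in> carrier B"
  shows "\<beta> \<zero>\<^bsub>A\<^esub> y = \<zero>\<^bsub>C\<^esub>"
  using bilin_smult_left[OF assms(1) zero_closed mod_zero[OF assms(2)] assms(4)] assms
    bilin_closed[OF assms(1) mod_zero[OF assms(2)] assms(4)] by simp

subsection \<open>Direct sums\<close>

lemma dsum_simps [simp]:
  "\<zero>\<^bsub>dsum_module I D\<^esub> = (\<lambda>i\<in>I. \<zero>\<^bsub>D i\<^esub>)"
  "\<phi> \<oplus>\<^bsub>dsum_module I D\<^esub> \<psi> = (\<lambda>i\<in>I. \<phi> i \<oplus>\<^bsub>D i\<^esub> \<psi> i)"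
  "a \<odot>\<^bsub>dsum_module I D\<^esub> \<phi> = (\<lambda>i\<in>I. a \<odot>\<^bsub>D i\<^esub> \<phi> i)"
  by (simp_all add: dsum_module_def)

lemma dsum_carrierI:
  assumes "\<phi> \<in> extensional I" "\<And>i. i \<in> I \<Longrightarrow> \<phi> i \<in> carrier (D i)"
    and "finite S" "\<And>i. i \<in> I \<Longrightarrow> i \<notin> S \<Longrightarrow> \<phi> i = \<zero>\<^bsub>D i\<^esub>"
  shows "\<phi> \<in> carrier (dsum_module I D)"
  using assms by (auto simp: dsum_module_def PiE_def intro: finite_subset[of _ S])

lemma dsum_carrierD:
  assumes "\<phi> \<in> carrier (dsum_module I D)"
  shows "\<phi> \<in> extensional I" "\<And>i. i \<in> I \<Longrightarrow> \<phi> i \<in> carrier (D i)" "finite {i \<in> I. \<phi> i \<noteq> \<zero>\<^bsub>D i\<^esub>}"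
  using assms by (auto simp: dsum_module_def PiE_def)

lemma dsum_eqI:
  assumes "\<phi> \<in> carrier (dsum_module I D)" "\<psi> \<in> carrier (dsum_module I D)"
    and "\<And>i. i \<in> I \<Longrightarrow> \<phi> i = \<psi> i"
  shows "\<phi> = \<psi>"
  using assms dsum_carrierD(1) extensionalityI by metis

lemma dsum_module_is_module:
  assumes D: "\<And>i. i \<in> I \<Longrightarrow> module R (D i)"
  shows "module R (dsum_module I D)"
proof -
  let ?A = "dsum_module I D"
  have add: "\<phi> \<oplus>\<^bsub>?A\<^esub> \<psi> \<in> carrier ?A" if "\<phi> \<in> carrier ?A" "\<psi> \<in> carrier ?A" for \<phi> \<psi>
    by (rule dsum_carrierI[where S="{i \<in> I. \<phi> i \<noteq> \<zero>\<^bsub>D i\<^esub>} \<union> {i \<in> I. \<psi> i \<noteq> \<zero>\<^bsub>D i\<^esub>}"])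
      (use that in \<open>auto simp: dsum_carrierD D\<close>)
  have zero: "\<zero>\<^bsub>?A\<^esub> \<in> carrier ?A"
    by (rule dsum_carrierI[where S="{}"]) (auto simp: D)
  have smult: "a \<odot>\<^bsub>?A\<^esub> \<phi> \<in> carrier ?A" if "a \<in> carrier R" "\<phi> \<in> carrier ?A" for a \<phi>
    by (rule dsum_carrierI[where S="{i \<in> I. \<phi> i \<noteq> \<zero>\<^bsub>D i\<^esub>}"])
      (use that in \<open>auto simp: dsum_carrierD D\<close>)
  have "abelian_group ?A"
  proof (rule abelian_groupI)
    fix \<phi> assume \<phi>: "\<phi> \<in> carrier ?A"
    have neg: "(\<lambda>i\<in>I. \<ominus>\<^bsub>D i\<^esub> \<phi> i) \<oplus>\<^bsub>?A\<^esub> \<phi> = \<zero>\<^bsub>?A\<^esub>"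
      using \<phi> D[THEN module.axioms(2)] by (auto simp: dsum_carrierD abelian_group.l_neg)
    have "(\<ominus> \<one>) \<odot>\<^bsub>?A\<^esub> \<phi> \<in> carrier ?A" by (rule smult) (auto simp: \<phi>)
    also have "(\<ominus> \<one>) \<odot>\<^bsub>?A\<^esub> \<phi> = (\<lambda>i\<in>I. \<ominus>\<^bsub>D i\<^esub> \<phi> i)"
      using \<phi> by (auto simp: dsum_carrierD D mod_smult_uminus)
    finally show "\<exists>\<psi>\<in>carrier ?A. \<psi> \<oplus>\<^bsub>?A\<^esub> \<phi> = \<zero>\<^bsub>?A\<^esub>"
      using neg by blast
    show "\<zero>\<^bsub>?A\<^esub> \<oplus>\<^bsub>?A\<^esub> \<phi> = \<phi>"
      by (rule dsum_eqI[OF add[OF zero \<phi>] \<phi>]) (simp add: \<phi> D dsum_carrierD(2)[OF \<phi>])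
  qed (simp_all add: add[simplified] zero[simplified] dsum_carrierD D mod_a_assoc mod_a_comm mod_a_lcomm cong:
      restrict_cong)
  then show ?thesis
  proof (rule moduleI[OF is_cring])
    fix \<phi> assume \<phi>: "\<phi> \<in> carrier ?A"
    have "\<one> \<odot>\<^bsub>?A\<^esub> \<phi> \<in> carrier ?A" by (rule smult[OF one_closed \<phi>])
    then show "\<one> \<odot>\<^bsub>?A\<^esub> \<phi> = \<phi>"
      by (rule dsum_eqI[OF _ \<phi>]) (simp add: \<phi> D dsum_carrierD(2)[OF \<phi>])
  qed (simp_all add: smult[simplified] dsum_carrierD D mod_smult_add mod_add_smult mod_smult_smult cong:
      restrict_cong)
qed

lemma dsum_single_closed:
  assumes "\<And>i. i \<in> I \<Longrightarrow> module R (D i)" "i \<in> I" "x \<in> carrier (D i)"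
  shows "dsum_single I D i x \<in> carrier (dsum_module I D)"
  by (rule dsum_carrierI[where S="{i}"]) (use assms in \<open>auto simp: dsum_single_def\<close>)

lemma dsum_single_add:
  assumes "\<And>i. i \<in> I \<Longrightarrow> module R (D i)"
  shows "dsum_single I D i (x \<oplus>\<^bsub>D i\<^esub> y) = dsum_single I D i x \<oplus>\<^bsub>dsum_module I D\<^esub> dsum_single I D i y"
  using assms by (auto simp: dsum_single_def fun_eq_iff restrict_def)

lemma dsum_single_smult:
  assumes "\<And>i. i \<in> I \<Longrightarrow> module R (D i)" "a \<in> carrier R"
  shows "dsum_single I D i (a \<odot>\<^bsub>D i\<^esub> x) = a \<odot>\<^bsub>dsum_module I D\<^esub> dsum_single I D i x"
  using assms by (auto simp: dsum_single_def fun_eq_iff restrict_def)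

lemma dsum_single_zero: "dsum_single I D i \<zero>\<^bsub>D i\<^esub> = \<zero>\<^bsub>dsum_module I D\<^esub>"
  by (auto simp: dsum_single_def fun_eq_iff restrict_def)

text \<open>Supports are finite, so the components can be split off one after the other.\<close>

lemma dsum_induct [consumes 1, case_names module zero single add]:
  assumes \<phi>: "\<phi> \<in> carrier (dsum_module I D)" and D: "\<And>i. i \<in> I \<Longrightarrow> module R (D i)"
    and zero: "P \<zero>\<^bsub>dsum_module I D\<^esub>"
    and single: "\<And>i x. i \<in> I \<Longrightarrow> x \<in> carrier (D i) \<Longrightarrow> P (dsum_single I D i x)"
    and add: "\<And>\<phi> \<psi>. \<phi> \<in> carrier (dsum_module I D) \<Longrightarrow> \<psi> \<in> carrier (dsum_module I D) \<Longrightarrow>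
      P \<phi> \<Longrightarrow> P \<psi> \<Longrightarrow> P (\<phi> \<oplus>\<^bsub>dsum_module I D\<^esub> \<psi>)"
  shows "P \<phi>"
proof -
  let ?A = "dsum_module I D"
  \<comment> \<open>The induction runs over a finite set that merely contains the support; erasing
    the component at \<open>j\<close> then falls under the hypothesis without computing the new
    support exactly.\<close>
  have "\<forall>\<phi>\<in>carrier ?A. {i \<in> I. \<phi> i \<noteq> \<zero>\<^bsub>D i\<^esub>} \<subseteq> S \<longrightarrow> P \<phi>" if "finite S" for S
    using that
  proof (induction S)
    case empty
    have "\<phi> = \<zero>\<^bsub>?A\<^esub>" if "\<phi> \<in> carrier ?A" "{i \<in> I. \<phi> i \<noteq> \<zero>\<^bsub>D i\<^esub>} \<subseteq> {}" for \<phi>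
      by (rule dsum_eqI[OF that(1) mod_zero]) (use that in \<open>auto intro: dsum_module_is_module D\<close>)
    then show ?case using zero by blast
  next
    case (insert j S)
    show ?case
    proof (intro ballI impI)
      fix \<phi> assume \<phi>: "\<phi> \<in> carrier ?A" and S: "{i \<in> I. \<phi> i \<noteq> \<zero>\<^bsub>D i\<^esub>} \<subseteq> insert j S"
      show "P \<phi>"
      proof (cases "j \<in> I")
        case False
        then show ?thesis using insert.IH \<phi> S by blast
      next
        case j: True
        define \<psi> where "\<psi> = (\<lambda>i\<in>I. if i = j then \<zero>\<^bsub>D i\<^esub> else \<phi> i)"
        have \<psi>: "\<psi> \<in> carrier ?A"
          by (rule dsum_carrierI[where S="{i \<in> I. \<phi> i \<noteq> \<zero>\<^bsub>D i\<^esub>}"])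
            (use \<phi> in \<open>auto simp: \<psi>_def dsum_carrierD D\<close>)
        have s: "dsum_single I D j (\<phi> j) \<in> carrier ?A"
          using D j \<phi> by (intro dsum_single_closed) (auto simp: dsum_carrierD)
        have "\<phi> = dsum_single I D j (\<phi> j) \<oplus>\<^bsub>?A\<^esub> \<psi>"
          by (rule dsum_eqI[OF \<phi> mod_add[OF dsum_module_is_module[OF D] s \<psi>]])
            (use \<phi> in \<open>auto simp: \<psi>_def dsum_single_def dsum_carrierD D\<close>)
        moreover have "{i \<in> I. \<psi> i \<noteq> \<zero>\<^bsub>D i\<^esub>} \<subseteq> S"
          using S by (auto simp: \<psi>_def)
        then have "P \<psi>"
          using insert.IH \<psi> by blast
        moreover have "P (dsum_single I D j (\<phi> j))"
          using single j \<phi> by (simp add: dsum_carrierD)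
        ultimately show ?thesis using add[OF s \<psi>] by simp
      qed
    qed
  qed
  then show ?thesis using \<phi> dsum_carrierD(3)[OF \<phi>] by blast
qed

lemma dsum_lift:
  assumes D: "\<And>i. i \<in> I \<Longrightarrow> module R (D i)" and B: "module R B"
    and f: "\<And>i. i \<in> I \<Longrightarrow> f i \<in> lin_maps R (D i) B"
  shows "\<exists>h\<in>lin_maps R (dsum_module I D) B. \<forall>i\<in>I. \<forall>x\<in>carrier (D i). h (dsum_single I D i x) = f i x"
proof -
  interpret B: module R B by fact
  let ?A = "dsum_module I D"
  define h where "h = (\<lambda>\<phi>\<in>carrier ?A. finsum B (\<lambda>i. f i (\<phi> i)) {i \<in> I. \<phi> i \<noteq> \<zero>\<^bsub>D i\<^esub>})"
  have A: "module R ?A" by (rule dsum_module_is_module[OF D])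
  have fin: "(\<lambda>i. f i (\<phi> i)) \<in> S \<rightarrow> carrier B" if "\<phi> \<in> carrier ?A" "S \<subseteq> I" for \<phi> S
    using that dsum_carrierD(2)[OF that(1)] lin_closed[OF f] by (auto simp: subset_iff)
  \<comment> \<open>Summation over any finite set above the support gives the same value, the extra
    terms being zero. Two elements with different supports can then be summed over the union of the
    supports.\<close>
  have h: "h \<phi> = finsum B (\<lambda>i. f i (\<phi> i)) S"
    if "\<phi> \<in> carrier ?A" "finite S" "{i \<in> I. \<phi> i \<noteq> \<zero>\<^bsub>D i\<^esub>} \<subseteq> S" "S \<subseteq> I" for \<phi> S
    unfolding h_def restrict_apply'[OF that(1)]
  proof (rule B.add.finprod_mono_neutral_cong_left[OF that(2,3)])
    show "f i (\<phi> i) = \<zero>\<^bsub>B\<^esub>" if "i \<in> S - {i \<in> I. \<phi> i \<noteq> \<zero>\<^bsub>D i\<^esub>}" for i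
    proof -
      have "i \<in> I" "\<phi> i = \<zero>\<^bsub>D i\<^esub>" using that \<open>S \<subseteq> I\<close> by auto
      then show ?thesis by (simp add: lin_zero[OF D B f])
    qed
  qed (use fin[OF that(1,4)] in auto)
  have "h \<in> lin_maps R ?A B"
  proof (rule lin_mapsI)
    show "h \<in> extensional (carrier ?A)" by (simp add: h_def)
    fix \<phi> assume \<phi>: "\<phi> \<in> carrier ?A"
    let ?S = "{i \<in> I. \<phi> i \<noteq> \<zero>\<^bsub>D i\<^esub>}"
    have S: "finite ?S" "?S \<subseteq> I" using dsum_carrierD(3)[OF \<phi>] by auto
    show "h \<phi> \<in> carrier B"
      using h[OF \<phi> S(1)] S fin[OF \<phi> S(2)] by simp
    show "h (a \<odot>\<^bsub>?A\<^esub> \<phi>) = a \<odot>\<^bsub>B\<^esub> h \<phi>" if a: "a \<in> carrier R" for a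
    proof -
      have "h (a \<odot>\<^bsub>?A\<^esub> \<phi>) = finsum B (\<lambda>i. f i ((a \<odot>\<^bsub>?A\<^esub> \<phi>) i)) ?S"
        by (rule h[OF mod_smult[OF A a \<phi>]]) (use S a D in auto)
      also have "\<dots> = finsum B (\<lambda>i. a \<odot>\<^bsub>B\<^esub> f i (\<phi> i)) ?S"
        by (rule B.finsum_cong') (use a dsum_carrierD(2)[OF \<phi>] lin_closed[OF f] lin_smult[OF f] in auto)
      also have "\<dots> = a \<odot>\<^bsub>B\<^esub> h \<phi>"
        using h[OF \<phi> S(1)] S fin[OF \<phi> S(2)] a by (simp add: B.finsum_smult_ldistr)
      finally show ?thesis .
    qed
    fix \<psi> assume \<psi>: "\<psi> \<in> carrier ?A"
    let ?T = "?S \<union> {i \<in> I. \<psi> i \<noteq> \<zero>\<^bsub>D i\<^esub>}"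
    have T: "finite ?T" "?T \<subseteq> I" using S dsum_carrierD(3)[OF \<psi>] by auto
    have "h (\<phi> \<oplus>\<^bsub>?A\<^esub> \<psi>) = finsum B (\<lambda>i. f i ((\<phi> \<oplus>\<^bsub>?A\<^esub> \<psi>) i)) ?T"
      by (rule h[OF mod_add[OF A \<phi> \<psi>] T(1)]) (use D in auto)
    also have "\<dots> = finsum B (\<lambda>i. f i (\<phi> i) \<oplus>\<^bsub>B\<^esub> f i (\<psi> i)) ?T"
      by (rule B.finsum_cong') (use dsum_carrierD(2)[OF \<phi>] dsum_carrierD(2)[OF \<psi>] lin_closed[OF f]
          lin_add[OF f] in auto)
    also have "\<dots> = h \<phi> \<oplus>\<^bsub>B\<^esub> h \<psi>"
      using B.finsum_addf[OF fin[OF \<phi> T(2)] fin[OF \<psi> T(2)]] h[OF \<phi> T(1) _ T(2)] h[OF \<psi> T(1) _ T(2)] by simp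
    finally show "h (\<phi> \<oplus>\<^bsub>?A\<^esub> \<psi>) = h \<phi> \<oplus>\<^bsub>B\<^esub> h \<psi>" .
  qed
  moreover have "h (dsum_single I D i x) = f i x" if "i \<in> I" "x \<in> carrier (D i)" for i x
  proof -
    have "h (dsum_single I D i x) = finsum B (\<lambda>j. f j (dsum_single I D i x j)) {i}"
      by (rule h[OF dsum_single_closed[of I D, OF D that]]) (use that in \<open>auto simp: dsum_single_def\<close>)
    also have "\<dots> = f i x"
      using lin_closed[OF f[OF that(1)] that(2)] that(1) by (simp add: dsum_single_def)
    finally show ?thesis .
  qed
  ultimately show ?thesis by blast
qed


subsection \<open>Tensor products\<close>

lemma ring_module_simps [simp]:
  "carrier (ring_module R) = carrier R"
  "\<zero>\<^bsub>ring_module R\<^esub> = \<zero>"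
  "x \<oplus>\<^bsub>ring_module R\<^esub> y = x \<oplus> y"
  "a \<odot>\<^bsub>ring_module R\<^esub> x = a \<otimes> x"
  by (simp_all add: ring_module_def)

lemma ring_module_is_module: "module R (ring_module R)"
proof (rule moduleI[OF is_cring])
  show "abelian_group (ring_module R)"
  proof (rule abelian_groupI)
    show "\<exists>y\<in>carrier (ring_module R). y \<oplus>\<^bsub>ring_module R\<^esub> x = \<zero>\<^bsub>ring_module R\<^esub>"
      if "x \<in> carrier (ring_module R)" for x
      using that l_neg by auto
  qed (auto simp: a_ac)
qed (auto simp: l_distr r_distr m_assoc)

text \<open>A linear map out of \<open>R\<close> multiplies a fixed element by scalars, and the free
  module is a direct sum of copies of \<open>R\<close>.\<close>

lemma free_lift:
  assumes B: "module R B" and g: "\<And>i. i \<in> I \<Longrightarrow> g i \<in> carrier B"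
  shows "\<exists>h\<in>lin_maps R (free_module R I) B. \<forall>i\<in>I. h (free_gen R I i) = g i"
proof -
  have "(\<lambda>a\<in>carrier R. a \<odot>\<^bsub>B\<^esub> g i) \<in> lin_maps R (ring_module R) B" if "i \<in> I" for i
    using B g[OF that] by (intro lin_mapsI) (simp_all add: mod_add_smult mod_smult_smult)
  from dsum_lift[of I "\<lambda>_. ring_module R" B "\<lambda>i. \<lambda>a\<in>carrier R. a \<odot>\<^bsub>B\<^esub> g i", OF ring_module_is_module B this]
  obtain h where "h \<in> lin_maps R (free_module R I) B"
    "\<And>i x. i \<in> I \<Longrightarrow> x \<in> carrier R \<Longrightarrow> h (dsum_single I (\<lambda>_. ring_module R) i x) = x \<odot>\<^bsub>B\<^esub> g i"
    by auto
  then show ?thesis using B g by (intro bexI[of _ h]) (auto simp: free_gen_def)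
qed

lemma free_gen_closed: "i \<in> I \<Longrightarrow> free_gen R I i \<in> carrier (free_module R I)"
  unfolding free_gen_def
  by (rule dsum_single_closed[of I "\<lambda>_. ring_module R", OF ring_module_is_module]) auto

lemma free_single:
  assumes "a \<in> carrier R"
  shows "dsum_single I (\<lambda>_. ring_module R) i a = a \<odot>\<^bsub>free_module R I\<^esub> free_gen R I i"
  using dsum_single_smult[of I "\<lambda>_. ring_module R", OF ring_module_is_module assms, where x = \<one>]
    assms by (simp add: free_gen_def)

context
  fixes A :: "('a, 'c) module" and B :: "('a, 'd) module"
  assumes A: "module R A" and B: "module R B"
begin

private abbreviation "X \<equiv> carrier A \<times> carrier B"
private abbreviation "F \<equiv> free_module R X"
private abbreviation "e \<equiv> \<lambda>m n. free_gen R X (m, n)"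

private lemma F: "module R F"
  by (rule dsum_module_is_module[OF ring_module_is_module])

private lemma e: "m \<in> carrier A \<Longrightarrow> n \<in> carrier B \<Longrightarrow> e m n \<in> carrier F"
  by (rule free_gen_closed) simp

private lemma rels_closed: "tensor_rels R A B \<subseteq> carrier F"
  unfolding tensor_rels_def Let_def
  by (auto intro!: mod_minus[OF F] mod_add[OF F] mod_smult[OF F] e A B simp del: dsum_simps)

private lemmas quot = quot_span[OF F rels_closed]

lemma tensor_module_is_module: "module R (tensor_module R A B)"
  using quot(2) by (simp add: tensor_module_def Let_def)

private abbreviation "\<pi> \<equiv> \<lambda>x. span_module R F (tensor_rels R A B) +>\<^bsub>F\<^esub> x"

private lemma pure_eq: "tensor_pure R A B m n = \<pi> (e m n)"
  by (simp add: tensor_pure_def Let_def)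

private lemma onto: "lin_onto R \<pi> F (tensor_module R A B)"
  using quot(1) by (simp add: tensor_module_def Let_def)

private lemma rel:
  assumes "x \<ominus>\<^bsub>F\<^esub> y \<in> tensor_rels R A B" "x \<in> carrier F" "y \<in> carrier F"
  shows "\<pi> x = \<pi> y"
  using quot(3)[OF assms(2,3,1)] .

lemma tensor_pure_bilin: "bilin R A B (tensor_module R A B) (tensor_pure R A B)"
proof (rule bilinI)
  fix m n assume m: "m \<in> carrier A" and n: "n \<in> carrier B"
  show "tensor_pure R A B m n \<in> carrier (tensor_module R A B)"
    unfolding pure_eq by (rule lin_onto_closed[OF onto e[OF m n]])
  show "tensor_pure R A B (m \<oplus>\<^bsub>A\<^esub> m') n =
      tensor_pure R A B m n \<oplus>\<^bsub>tensor_module R A B\<^esub> tensor_pure R A B m' n"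
    if m': "m' \<in> carrier A" for m'
    unfolding pure_eq lin_onto_add[OF onto e[OF m n] e[OF m' n], symmetric]
    by (rule rel[OF _ e[OF mod_add[OF A m m'] n] mod_add[OF F e[OF m n] e[OF m' n]]])
      (unfold tensor_rels_def Let_def, use m m' n in blast)
  show "tensor_pure R A B m (n \<oplus>\<^bsub>B\<^esub> n') =
      tensor_pure R A B m n \<oplus>\<^bsub>tensor_module R A B\<^esub> tensor_pure R A B m n'"
    if n': "n' \<in> carrier B" for n'
    unfolding pure_eq lin_onto_add[OF onto e[OF m n] e[OF m n'], symmetric]
    by (rule rel[OF _ e[OF m mod_add[OF B n n']] mod_add[OF F e[OF m n] e[OF m n']]])
      (unfold tensor_rels_def Let_def, use m n n' in blast)
  fix a assume a: "a \<in> carrier R"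
  show "tensor_pure R A B (a \<odot>\<^bsub>A\<^esub> m) n = a \<odot>\<^bsub>tensor_module R A B\<^esub> tensor_pure R A B m n"
    unfolding pure_eq lin_onto_smult[OF onto a e[OF m n], symmetric]
    by (rule rel[OF _ e[OF mod_smult[OF A a m] n] mod_smult[OF F a e[OF m n]]])
      (unfold tensor_rels_def Let_def, use a m n in blast)
  show "tensor_pure R A B m (a \<odot>\<^bsub>B\<^esub> n) = a \<odot>\<^bsub>tensor_module R A B\<^esub> tensor_pure R A B m n"
    unfolding pure_eq lin_onto_smult[OF onto a e[OF m n], symmetric]
    by (rule rel[OF _ e[OF m mod_smult[OF B a n]] mod_smult[OF F a e[OF m n]]])
      (unfold tensor_rels_def Let_def, use a m n in blast)
qed

text \<open>Zero is the pure tensor of two zeros, and scalars are absorbed into the first factor, so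
  linear combinations of pure tensors reduce to sums of pure tensors.\<close>

lemma tensor_induct [consumes 1, case_names pure add]:
  assumes z: "z \<in> carrier (tensor_module R A B)"
    and pure: "\<And>m n. m \<in> carrier A \<Longrightarrow> n \<in> carrier B \<Longrightarrow> P (tensor_pure R A B m n)"
    and add: "\<And>y z. y \<in> carrier (tensor_module R A B) \<Longrightarrow> z \<in> carrier (tensor_module R A B) \<Longrightarrow>
      P y \<Longrightarrow> P z \<Longrightarrow> P (y \<oplus>\<^bsub>tensor_module R A B\<^esub> z)"
  shows "P z"
proof -
  have "P (\<pi> \<phi>)" if "\<phi> \<in> carrier F" for \<phi>
    using that
  proof (induction \<phi> rule: dsum_induct)
    case (module i)
    show ?case by (rule ring_module_is_module)
  next
    case zero
    have "P (tensor_pure R A B \<zero>\<^bsub>A\<^esub> \<zero>\<^bsub>B\<^esub>)" by (rule pure[OF mod_zero[OF A] mod_zero[OF B]])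
    then show ?case
      by (simp only: lin_onto_zero[OF onto, symmetric]
          bilin_zero_left[OF tensor_pure_bilin A tensor_module_is_module mod_zero[OF B]])
  next
    case (single i a)
    then obtain m n where i: "i = (m, n)" and m: "m \<in> carrier A" and n: "n \<in> carrier B"
      and a: "a \<in> carrier R" by auto
    have "\<pi> (dsum_single X (\<lambda>_. ring_module R) i a) = tensor_pure R A B (a \<odot>\<^bsub>A\<^esub> m) n"
      unfolding i free_single[OF a] lin_onto_smult[OF onto a e[OF m n]]
        bilin_smult_left[OF tensor_pure_bilin a m n]
      unfolding pure_eq ..
    then show ?case
      using pure[OF mod_smult[OF A a m] n] by simp
  next
    case (add \<phi> \<psi>)
    from assms(3)[OF lin_onto_closed[OF onto add(1)] lin_onto_closed[OF onto add(2)] add(3,4)]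
    show ?case by (simp only: lin_onto_add[OF onto add(1,2)])
  qed
  then show ?thesis using z lin_onto_image[OF onto] by auto
qed

text \<open>Bilinearity of \<open>\<beta>\<close> says exactly that the linear extension to the free
  module kills the four kinds of relations, so it descends to the quotient.\<close>

lemma tensor_lift:
  fixes C :: "('a, 'e) module"
  assumes C: "module R C" and \<beta>: "bilin R A B C \<beta>"
  shows "\<exists>h\<in>lin_maps R (tensor_module R A B) C.
    \<forall>m\<in>carrier A. \<forall>n\<in>carrier B. h (tensor_pure R A B m n) = \<beta> m n"
proof -
  obtain g where g: "g \<in> lin_maps R F C"
    and ge: "\<And>m n. m \<in> carrier A \<Longrightarrow> n \<in> carrier B \<Longrightarrow> g (e m n) = \<beta> m n"
    using free_lift[OF C, of X "\<lambda>(m, n). \<beta> m n"] bilin_closed[OF \<beta>] by fastforce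
  have d: "g (x \<ominus>\<^bsub>F\<^esub> y) = \<zero>\<^bsub>C\<^esub>" if "x \<in> carrier F" "y \<in> carrier F" "g x = g y" for x y
    unfolding lin_minus[OF F C g that(1,2)]
    using mod_minus_eq_zero[OF C lin_closed[OF g that(1)] lin_closed[OF g that(2)]] that(3) by simp
  have "g x = \<zero>\<^bsub>C\<^esub>" if "x \<in> tensor_rels R A B" for x
    using that unfolding tensor_rels_def Let_def
    by (auto intro!: d e mod_add[OF F] mod_smult[OF F] A B simp del: dsum_simps
        simp: lin_add[OF g] lin_smult[OF g] e ge A B bilin_add_left[OF \<beta>] bilin_add_right[OF \<beta>]
          bilin_smult_left[OF \<beta>] bilin_smult_right[OF \<beta>])
  from quot(4)[OF C g this]
  obtain h where h: "h \<in> lin_maps R (tensor_module R A B) C"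
    and h': "\<forall>x\<in>carrier F. h (\<pi> x) = g x"
    unfolding tensor_module_def Let_def by blast
  have "h (tensor_pure R A B m n) = \<beta> m n" if "m \<in> carrier A" "n \<in> carrier B" for m n
    unfolding pure_eq by (simp only: h'[rule_format, OF e[OF that]] ge[OF that])
  with h show ?thesis by blast
qed

lemma tensor_lin_eqI:
  assumes "f \<in> lin_maps R (tensor_module R A B) C" "g \<in> lin_maps R (tensor_module R A B) C"
    and "\<And>m n. m \<in> carrier A \<Longrightarrow> n \<in> carrier B \<Longrightarrow> f (tensor_pure R A B m n) = g (tensor_pure R A B m n)"
  shows "f = g"
proof (rule lin_maps_eqI[OF assms(1,2)])
  fix z assume "z \<in> carrier (tensor_module R A B)"
  then show "f z = g z"
    by (induction rule: tensor_induct) (simp_all only: assms(3) lin_add[OF assms(1)] lin_add[OF assms(2)])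
qed

end

lemma bilin_compose:
  assumes f: "f \<in> lin_maps R A A'" and g: "g \<in> lin_maps R B B'" and \<beta>: "bilin R A' B' C \<beta>"
  shows "bilin R A B C (\<lambda>m n. \<beta> (f m) (g n))"
  by (rule bilinI) (simp_all add: bilin_closed[OF \<beta>] bilin_add_left[OF \<beta>] bilin_add_right[OF \<beta>]
      bilin_smult_left[OF \<beta>] bilin_smult_right[OF \<beta>] lin_closed[OF f] lin_closed[OF g]
      lin_add[OF f] lin_add[OF g] lin_smult[OF f] lin_smult[OF g])

text \<open>Turns the definite description into usable facts: existence is the universal property
  for the bilinear map of pure tensors precomposed with \<open>f\<close> and \<open>g\<close>,
  uniqueness is agreement on pure tensors.\<close>

lemma tensor_map:
  assumes A: "module R A" "module R A'" and B: "module R B" "module R B'"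
    and f: "f \<in> lin_maps R A A'" and g: "g \<in> lin_maps R B B'"
  shows "tensor_map R A A' B B' f g \<in> lin_maps R (tensor_module R A B) (tensor_module R A' B')"
    and "\<And>m n. m \<in> carrier A \<Longrightarrow> n \<in> carrier B \<Longrightarrow>
      tensor_map R A A' B B' f g (tensor_pure R A B m n) = tensor_pure R A' B' (f m) (g n)"
proof -
  let ?P = "\<lambda>h. h \<in> lin_maps R (tensor_module R A B) (tensor_module R A' B') \<and>
        (\<forall>m\<in>carrier A. \<forall>n\<in>carrier B.
           h (tensor_pure R A B m n) = tensor_pure R A' B' (f m) (g n))"
  obtain h where h: "?P h"
    using tensor_lift[OF A(1) B(1) tensor_module_is_module[OF A(2) B(2)]
        bilin_compose[OF f g tensor_pure_bilin[OF A(2) B(2)]]] by blast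
  have "\<exists>!h. ?P h"
  proof (rule ex1I[of ?P, OF h])
    fix h' assume h': "?P h'"
    show "h' = h" by (rule tensor_lin_eqI[OF A(1) B(1)]) (use h h' in auto)
  qed
  from theI'[OF this] show "tensor_map R A A' B B' f g \<in> lin_maps R (tensor_module R A B)
      (tensor_module R A' B')"
    and "\<And>m n. m \<in> carrier A \<Longrightarrow> n \<in> carrier B \<Longrightarrow>
      tensor_map R A A' B B' f g (tensor_pure R A B m n) = tensor_pure R A' B' (f m) (g n)"
    unfolding tensor_map_def by blast+
qed

subsection \<open>Colimits\<close>

context
  fixes I :: "'i set" and leq :: "'i \<Rightarrow> 'i \<Rightarrow> bool" and D :: "'i \<Rightarrow> ('a, 'c) module"
    and d :: "'i \<Rightarrow> 'i \<Rightarrow> 'c \<Rightarrow> 'c"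
  assumes D_all: "\<forall>i\<in>I. module R (D i)"
    and d_all: "\<forall>i\<in>I. \<forall>j\<in>I. leq i j \<longrightarrow> (\<forall>x\<in>carrier (D i). d i j x \<in> carrier (D j))"
begin

private lemma D: "i \<in> I \<Longrightarrow> module R (D i)"
  using D_all by blast

private lemma d: "i \<in> I \<Longrightarrow> j \<in> I \<Longrightarrow> leq i j \<Longrightarrow> x \<in> carrier (D i) \<Longrightarrow> d i j x \<in> carrier (D j)"
  using d_all by blast

private abbreviation "S \<equiv> dsum_module I D"
private abbreviation "\<iota> \<equiv> dsum_single I D"
private abbreviation "\<kappa> \<equiv> \<lambda>x. span_module R S (colim_rels I leq D d) +>\<^bsub>S\<^esub> x"
private abbreviation "Q \<equiv> colim_module R I leq D d"

private lemma S: "module R S"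
  by (rule dsum_module_is_module[of I D, OF D])

private lemma \<iota>: "i \<in> I \<Longrightarrow> x \<in> carrier (D i) \<Longrightarrow> \<iota> i x \<in> carrier S"
  by (rule dsum_single_closed[of I D, OF D])

private lemma colim_rels_closed: "colim_rels I leq D d \<subseteq> carrier S"
  unfolding colim_rels_def by (auto intro!: mod_minus[OF S] \<iota> d simp del: dsum_simps)

private lemmas cquot = quot_span[OF S colim_rels_closed]

private lemma conto: "lin_onto R \<kappa> S Q"
  using cquot(1) by (simp add: colim_module_def)

private lemma in_eq: "colim_in R I leq D d i x = \<kappa> (\<iota> i x)"
  by (simp add: colim_in_def)

lemma colim_module_is_module: "module R (colim_module R I leq D d)"
  using cquot(2) by (simp add: colim_module_def)

lemma colim_in_closed:
  "i \<in> I \<Longrightarrow> x \<in> carrier (D i) \<Longrightarrow> colim_in R I leq D d i x \<in> carrier (colim_module R I leq D d)"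
  unfolding in_eq by (rule lin_onto_closed[OF conto \<iota>])

lemma colim_in_add:
  assumes "i \<in> I" "x \<in> carrier (D i)" "y \<in> carrier (D i)"
  shows "colim_in R I leq D d i (x \<oplus>\<^bsub>D i\<^esub> y) =
    colim_in R I leq D d i x \<oplus>\<^bsub>colim_module R I leq D d\<^esub> colim_in R I leq D d i y"
proof -
  have eq: "\<iota> i (x \<oplus>\<^bsub>D i\<^esub> y) = \<iota> i x \<oplus>\<^bsub>S\<^esub> \<iota> i y"
    by (rule dsum_single_add[of I D, OF D])
  show ?thesis
    unfolding in_eq eq by (rule lin_onto_add[OF conto \<iota>[OF assms(1,2)] \<iota>[OF assms(1,3)]])
qed

lemma colim_in_smult:
  assumes "i \<in> I" "x \<in> carrier (D i)" "a \<in> carrier R"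
  shows "colim_in R I leq D d i (a \<odot>\<^bsub>D i\<^esub> x) =
    a \<odot>\<^bsub>colim_module R I leq D d\<^esub> colim_in R I leq D d i x"
proof -
  have eq: "\<iota> i (a \<odot>\<^bsub>D i\<^esub> x) = a \<odot>\<^bsub>S\<^esub> \<iota> i x"
    by (rule dsum_single_smult[of I D, OF D assms(3)])
  show ?thesis
    unfolding in_eq eq by (rule lin_onto_smult[OF conto assms(3) \<iota>[OF assms(1,2)]])
qed

lemma colim_in_transition:
  assumes "i \<in> I" "j \<in> I" "leq i j" "x \<in> carrier (D i)"
  shows "colim_in R I leq D d j (d i j x) = colim_in R I leq D d i x"
  unfolding in_eq
  by (rule cquot(3)[OF \<iota>[OF assms(2) d[OF assms]] \<iota>[OF assms(1,4)]])
    (unfold colim_rels_def, use assms in blast)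

text \<open>The zero case is present because the index set may be empty, and then no generator
  produces zero.\<close>

lemma colim_induct [consumes 1, case_names zero inj add]:
  assumes z: "z \<in> carrier (colim_module R I leq D d)"
    and zero: "P \<zero>\<^bsub>colim_module R I leq D d\<^esub>"
    and inj: "\<And>i x. i \<in> I \<Longrightarrow> x \<in> carrier (D i) \<Longrightarrow> P (colim_in R I leq D d i x)"
    and add: "\<And>y z. y \<in> carrier (colim_module R I leq D d) \<Longrightarrow> z \<in> carrier (colim_module R I leq D d) \<Longrightarrow>
      P y \<Longrightarrow> P z \<Longrightarrow> P (y \<oplus>\<^bsub>colim_module R I leq D d\<^esub> z)"
  shows "P z"
proof -
  have "P (\<kappa> \<phi>)" if "\<phi> \<in> carrier S" for \<phi>
    using that
  proof (induction \<phi> rule: dsum_induct)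
    case (module i)
    then show ?case by (rule D)
  next
    case zero
    show ?case using assms(2) by (simp only: lin_onto_zero[OF conto])
  next
    case (single i x)
    then show ?case using inj[OF single] by (simp only: in_eq)
  next
    case (add \<phi> \<psi>)
    from assms(4)[OF lin_onto_closed[OF conto add(1)] lin_onto_closed[OF conto add(2)] add(3,4)]
    show ?case by (simp only: lin_onto_add[OF conto add(1,2)])
  qed
  then show ?thesis using z lin_onto_image[OF conto] by auto
qed

text \<open>The maps assemble on the direct sum, and compatibility with the transitions says that
  the result vanishes on \<open>colim_rels\<close>.\<close>

lemma colim_lift:
  fixes B :: "('a, 'e) module"
  assumes B: "module R B" and f: "\<And>i. i \<in> I \<Longrightarrow> f i \<in> lin_maps R (D i) B"
    and comp: "\<And>i j x. i \<in> I \<Longrightarrow> j \<in> I \<Longrightarrow> leq i j \<Longrightarrow> x \<in> carrier (D i) \<Longrightarrow> f j (d i j x) = f i x"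
  shows "\<exists>h\<in>lin_maps R (colim_module R I leq D d) B.
    \<forall>i\<in>I. \<forall>x\<in>carrier (D i). h (colim_in R I leq D d i x) = f i x"
proof -
  obtain g where g: "g \<in> lin_maps R S B"
    and g': "\<forall>i\<in>I. \<forall>x\<in>carrier (D i). g (\<iota> i x) = f i x"
    using dsum_lift[of I D, OF D B f] by blast
  have z: "g (\<iota> j (d i j x) \<ominus>\<^bsub>S\<^esub> \<iota> i x) = \<zero>\<^bsub>B\<^esub>"
    if "i \<in> I" "j \<in> I" "leq i j" "x \<in> carrier (D i)" for i j x
    unfolding lin_minus[OF S B g \<iota>[OF that(2) d[OF that]] \<iota>[OF that(1,4)]]
    using mod_minus_eq_zero[OF B] lin_closed[OF f[OF that(1)] that(4)]
    by (simp add: g' that d[OF that] comp[OF that])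
  have "g x = \<zero>\<^bsub>B\<^esub>" if "x \<in> colim_rels I leq D d" for x
    using that z unfolding colim_rels_def by blast
  from cquot(4)[OF B g this]
  obtain h where h: "h \<in> lin_maps R Q B" and h': "\<forall>x\<in>carrier S. h (\<kappa> x) = g x"
    unfolding colim_module_def by blast
  have "h (colim_in R I leq D d i x) = f i x" if "i \<in> I" "x \<in> carrier (D i)" for i x
    unfolding in_eq by (simp only: h'[rule_format, OF \<iota>[OF that]] g'[rule_format, OF that])
  with h show ?thesis by blast
qed

end

end

section \<open>Size\<close>

text \<open>Sets of any type can be measured against \<open>\<V>\<close> in this way, whereas
  membership in \<open>\<V>\<close> makes sense only for sets over the ambient type.\<close>

definition small :: "'u set set \<Rightarrow> 'a set \<Rightarrow> bool" where
  "small \<V> X \<longleftrightarrow> (\<exists>A\<in>\<V>. X \<lesssim> A)"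

lemma smallI: "A \<in> \<V> \<Longrightarrow> X \<lesssim> A \<Longrightarrow> small \<V> X"
  by (auto simp: small_def)

lemma small_lepoll: "small \<V> Y \<Longrightarrow> X \<lesssim> Y \<Longrightarrow> small \<V> X"
  unfolding small_def using lepoll_trans by blast

lemma small_subset: "small \<V> Y \<Longrightarrow> X \<subseteq> Y \<Longrightarrow> small \<V> X"
  using small_lepoll subset_imp_lepoll by blast

lemma small_image: "small \<V> X \<Longrightarrow> small \<V> (f ` X)"
  using small_lepoll image_lepoll by blast

lemma lepoll_Times_self:
  assumes "infinite A"
  shows "A \<times> A \<lesssim> A"
  using card_of_Times_same_infinite[OF assms] ordIso_imp_ordLeq by (auto simp: lepoll_iff_ordLeq)

lemma lists_lepoll_self:
  assumes "infinite A"
  shows "lists A \<lesssim> A"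
proof -
  obtain p where p: "inj_on p (A \<times> A)" "p ` (A \<times> A) \<subseteq> A"
    using lepoll_Times_self[OF assms] by (auto simp: lepoll_def)
  obtain n :: "nat \<Rightarrow> 'a" where n: "inj n" "range n \<subseteq> A"
    using assms infinite_le_lepoll by (metis lepoll_def)
  have pi: "p (x, y) \<in> A" if "x \<in> A" "y \<in> A" for x y using p(2) that by auto
  have peq: "p (x, y) = p (x', y') \<longleftrightarrow> x = x' \<and> y = y'"
    if "x \<in> A" "y \<in> A" "x' \<in> A" "y' \<in> A" for x y x' y'
    using p(1) that by (auto simp: inj_on_def)
  \<comment> \<open>The end marker \<open>n 0\<close> may itself be the code of a pair, so this
    folding is shown to be injective only among lists of equal length. The final injection therefore
    records the length as well.\<close>
  define enc where "enc = (\<lambda>xs. foldr (\<lambda>x acc. p (x, acc)) xs (n 0))"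
  have encA: "enc xs \<in> A" if "xs \<in> lists A" for xs
    using that by (induction xs) (use n(2) in \<open>auto simp: enc_def intro: pi\<close>)
  have inj: "xs = ys" if "length xs = length ys" "xs \<in> lists A" "ys \<in> lists A" "enc xs = enc ys" for xs ys
    using that
  proof (induction xs ys rule: list_induct2)
    case (Cons x xs y ys)
    then have "p (x, enc xs) = p (y, enc ys)" by (simp add: enc_def)
    then show ?case using Cons by (simp add: peq encA)
  qed simp
  have "inj_on (\<lambda>xs. p (n (length xs), enc xs)) (lists A)"
  proof (rule inj_onI)
    fix xs ys assume xy: "xs \<in> lists A" "ys \<in> lists A"
      and eq: "p (n (length xs), enc xs) = p (n (length ys), enc ys)"
    have "n (length xs) \<in> A" "n (length ys) \<in> A" using n(2) by auto
    with eq have "n (length xs) = n (length ys)" "enc xs = enc ys"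
      using peq encA xy by blast+
    then show "xs = ys" using inj xy n(1) by (simp add: inj_def)
  qed
  moreover have "(\<lambda>xs. p (n (length xs), enc xs)) ` lists A \<subseteq> A"
    using n(2) encA pi by blast
  ultimately show ?thesis by (auto simp: lepoll_def)
qed

section \<open>Closure properties of a universe\<close>

context
  fixes P :: "'p set" and K :: "'k set" and \<V> :: "'u set set"
  assumes V: "universe P K \<V>"
begin

text \<open>Justifies the choice in \<open>code\<close>: if \<open>X\<close> injects into a member
  of \<open>\<V>\<close>, its image is no larger than that member and hence is itself a
  member.\<close>

lemma code_inj_image:
  assumes "small \<V> X"
  shows "inj_on (code \<V> X) X" and "code \<V> X ` X \<in> \<V>"
proof -
  obtain A f where A: "A \<in> \<V>" "inj_on f X" "f ` X \<subseteq> A"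
    using assms by (auto simp: small_def lepoll_def)
  moreover have "f ` X \<lesssim> A" using A(3) by (rule subset_imp_lepoll)
  ultimately have "f ` X \<in> \<V>" using V unfolding universe_def by blast
  with A(2) have "\<exists>f. inj_on f X \<and> f ` X \<in> \<V>" by blast
  from someI_ex[OF this] show "inj_on (code \<V> X) X" "code \<V> X ` X \<in> \<V>"
    unfolding code_def by blast+
qed

text \<open>An infinite member of the universe is joined to the two bounds, so that pairs and lists
  over the common bound do not exceed it.\<close>

lemma infinite_small_bound:
  assumes "small \<V> X" "small \<V> Y"
  obtains A where "A \<in> \<V>" "infinite A" "X \<lesssim> A" "Y \<lesssim> A"
proof -
  obtain B C where BC: "B \<in> \<V>" "X \<lesssim> B" "C \<in> \<V>" "Y \<lesssim> C" using assms by (auto simp: small_def)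
  obtain D where D: "D \<in> \<V>" "infinite D" using V unfolding universe_def by blast
  have "B \<union> C \<union> D \<in> \<V>" using V BC D by (simp add: universe_def)
  moreover have "X \<lesssim> B \<union> C \<union> D" "Y \<lesssim> B \<union> C \<union> D"
    by (rule lepoll_trans[OF BC(2) subset_imp_lepoll], blast)
      (rule lepoll_trans[OF BC(4) subset_imp_lepoll], blast)
  ultimately show thesis using that D(2) by simp
qed

lemma small_Times: 
  assumes "small \<V> X" "small \<V> Y"
  shows "small \<V> (X \<times> Y)"
proof -
  obtain A where A: "A \<in> \<V>" "infinite A" "X \<lesssim> A" "Y \<lesssim> A" by (rule infinite_small_bound[OF assms])
  show ?thesis
    by (rule smallI[OF A(1) lepoll_trans[OF times_lepoll_mono[OF A(3,4)] lepoll_Times_self[OF A(2)]]])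
qed

lemma small_lists:
  assumes "small \<V> X"
  shows "small \<V> (lists X)"
proof -
  obtain A where A: "A \<in> \<V>" "infinite A" "X \<lesssim> A" by (rule infinite_small_bound[OF assms assms])
  show ?thesis
    by (rule smallI[OF A(1) lepoll_trans[OF lists_lepoll_mono[OF A(3)] lists_lepoll_self[OF A(2)]]])
qed

lemma small_UN: "(\<And>x. x \<in> P \<Longrightarrow> A x \<in> \<V>) \<Longrightarrow> small \<V> (\<Union>x\<in>P. A x)"
  using V unfolding universe_def by (intro smallI[OF _ lepoll_refl]) blast

lemma small_index: "small \<V> P" and small_coefficients: "small \<V> K"
  using V unfolding universe_def small_def by blast+

end

lemma decode_code: "inj_on (code \<V> X) X \<Longrightarrow> x \<in> X \<Longrightarrow> decode \<V> X (code \<V> X x) = x"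
  by (simp add: decode_def)

lemma carrier_copy_module: "carrier (copy_module \<V> A) = code \<V> (carrier A) ` carrier A"
  by (simp add: copy_module_def Let_def)

text \<open>Coding takes the same form as a quotient projection, so structure and maps pass to the
  copy by the same lemmas.\<close>

lemma (in cring) copy_module_onto:
  assumes inj: "inj_on (code \<V> (carrier A)) (carrier A)" and A: "module R A"
  shows "lin_onto R (code \<V> (carrier A)) A (copy_module \<V> A)"
  by (rule lin_ontoI) (simp_all add: copy_module_def Let_def decode_code[OF inj] A)

section \<open>The tensor product of persistence modules\<close>

abbreviation el :: "('p, 'r, 'u) pmod \<Rightarrow> 'p \<Rightarrow> 'u set" where
  "el M x \<equiv> carrier (stalk M x)"

lemma pmodsD:
  assumes "M \<in> pmods R \<V>"
  shows pmod_stalk: "module R (stalk M x)"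
    and pmod_tmap: "x \<le> y \<Longrightarrow> tmap M x y \<in> lin_maps R (stalk M x) (stalk M y)"
    and pmod_tmap_refl: "m \<in> el M x \<Longrightarrow> tmap M x x m = m"
    and pmod_tmap_tmap: "x \<le> y \<Longrightarrow> y \<le> z \<Longrightarrow> m \<in> el M x \<Longrightarrow>
      tmap M y z (tmap M x y m) = tmap M x z m"
    and pmod_carrier: "el M x \<in> \<V>"
  using assms by (simp_all add: pmods_def persistence_module_def)

lemma pmod_tmap_closed:
  "M \<in> pmods R \<V> \<Longrightarrow> x \<le> y \<Longrightarrow> m \<in> el M x \<Longrightarrow> tmap M x y m \<in> el M y"
  by (rule lin_closed[OF pmod_tmap])

lemma preordered_add_mono:
  fixes a b c d :: "'p::preordered_ab_group_add"
  assumes "a \<le> b" "c \<le> d"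
  shows "a + c \<le> b + d"
  by (metis add.commute add_right_mono_preorder assms order_trans)

text \<open>The parameter \<open>P\<close> only names the type over which the universe is closed under unions.\<close>

locale persistence = cring R for R (structure) +
  fixes \<V> :: "'u set set" and P :: "'p::preordered_ab_group_add set"
  assumes V': "universe P (carrier R) \<V>" and P: "P = UNIV"
begin

lemma V: "universe (UNIV :: 'p set) (carrier R) \<V>"
  using V' P by simp

abbreviation pm :: "('p, 'a, 'u) pmod set" where "pm \<equiv> pmods R \<V>"
abbreviation gt :: "('p, 'a, 'u) pmod \<Rightarrow> ('p, 'a, 'u) pmod \<Rightarrow> ('p, 'a, 'u) pmod" (infixl \<open>\<boxtimes>\<close> 70)
  where "M \<boxtimes> N \<equiv> gr_tensor R \<V> M N"

abbreviation gp where "gp \<equiv> gr_pure R \<V>"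

section \<open>The tensor product of two fixed persistence modules: raw colimit, coded copy,
  transition maps\<close>

context
  fixes M N :: "('p, 'a, 'u) pmod"
  assumes M: "M \<in> pm" and N: "N \<in> pm"
begin

private abbreviation "D \<equiv> gr_diag R M N"
private abbreviation "d \<equiv> gr_diag_map R M N"
private abbreviation "c \<equiv> \<lambda>r. code \<V> (carrier (gr_stalk R M N r))"
private abbreviation "\<tau> \<equiv> \<lambda>s t. tensor_pure R (stalk M s) (stalk N t)"
private abbreviation "\<gamma> \<equiv> \<lambda>r i z. colim_in R (gr_index r) prod_le D d i z"

private lemma D: "module R (D i)"
  unfolding gr_diag_def by (cases i) (simp add: tensor_module_is_module pmod_stalk[OF M] pmod_stalk[OF N])

private lemma D_pair: "D (s, t) = tensor_module R (stalk M s) (stalk N t)"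
  by (simp add: gr_diag_def)

private lemma d_lin: "prod_le i j \<Longrightarrow> d i j \<in> lin_maps R (D i) (D j)"
  unfolding gr_diag_def gr_diag_map_def prod_le_def
  by (cases i; cases j) (simp add: tensor_map(1) pmod_stalk[OF M] pmod_stalk[OF N] pmod_tmap[OF M]
      pmod_tmap[OF N])

private lemma d_pure:
  assumes "s \<le> s'" "t \<le> t'" "m \<in> el M s" "n \<in> el N t"
  shows "d (s, t) (s', t') (\<tau> s t m n) = \<tau> s' t' (tmap M s s' m) (tmap N t t' n)"
  unfolding gr_diag_map_def
  by (simp add: tensor_map(2) pmod_stalk[OF M] pmod_stalk[OF N] pmod_tmap[OF M] pmod_tmap[OF N] assms)

private lemma D_all: "\<forall>i\<in>I. module R (D i)"
  by (simp add: D)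

private lemma d_closed:
  "\<forall>i\<in>I. \<forall>j\<in>I. prod_le i j \<longrightarrow> (\<forall>x\<in>carrier (D i). d i j x \<in> carrier (D j))"
  using lin_closed[OF d_lin] by blast

private lemmas stalk_module = colim_module_is_module[where I="gr_index r" and D=D and d=d and leq=prod_le
    for r, OF D_all d_closed, folded gr_stalk_def]

private lemmas \<gamma>_closed = colim_in_closed[where I="gr_index r" and D=D and d=d and leq=prod_le
    for r, OF D_all d_closed, folded gr_stalk_def]
private lemmas \<gamma>_add = colim_in_add[where I="gr_index r" and D=D and d=d and leq=prod_le
    for r, OF D_all d_closed, folded gr_stalk_def]
private lemmas \<gamma>_smult = colim_in_smult[where I="gr_index r" and D=D and d=d and leq=prod_le
    for r, OF D_all d_closed, folded gr_stalk_def]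
private lemmas \<gamma>_transition = colim_in_transition[where I="gr_index r" and D=D and d=d and leq=prod_le
    for r, OF D_all d_closed, folded gr_stalk_def]
private lemmas \<gamma>_induct = colim_induct[where I="gr_index r" and D=D and d=d and leq=prod_le
    for r, OF D_all d_closed, folded gr_stalk_def, consumes 1, case_names zero inj add]
private lemmas \<gamma>_lift = colim_lift[where I="gr_index r" and D=D and d=d and leq=prod_le
    for r, OF D_all d_closed, folded gr_stalk_def]

private lemma \<tau>: "bilin R (stalk M s) (stalk N t) (D (s, t)) (\<tau> s t)"
  unfolding D_pair by (rule tensor_pure_bilin[OF pmod_stalk[OF M] pmod_stalk[OF N]])

text \<open>The prefix \<open>raw\<close> marks facts about the colimit itself, before it is copied
  into \<open>\<V>\<close>.\<close>

private lemma raw_bilin: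
  assumes "s + t \<le> r"
  shows "bilin R (stalk M s) (stalk N t) (gr_stalk R M N r) (\<lambda>m n. \<gamma> r (s, t) (\<tau> s t m n))"
proof -
  have i: "(s, t) \<in> gr_index r" using assms by (simp add: gr_index_def)
  show ?thesis
    by (rule bilinI)
      (simp_all add: \<gamma>_closed[OF i] \<gamma>_add[OF i] \<gamma>_smult[OF i] bilin_closed[OF \<tau>] bilin_add_left[OF \<tau>]
        bilin_add_right[OF \<tau>] bilin_smult_left[OF \<tau>] bilin_smult_right[OF \<tau>])
qed

private lemma raw_induct [consumes 1, case_names pure add]:
  assumes z: "z \<in> carrier (gr_stalk R M N r)"
    and pure: "\<And>s t m n. s + t \<le> r \<Longrightarrow> m \<in> el M s \<Longrightarrow> n \<in> el N t \<Longrightarrow>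
      Q (\<gamma> r (s, t) (\<tau> s t m n))"
    and add: "\<And>y z. y \<in> carrier (gr_stalk R M N r) \<Longrightarrow> z \<in> carrier (gr_stalk R M N r) \<Longrightarrow>
      Q y \<Longrightarrow> Q z \<Longrightarrow> Q (y \<oplus>\<^bsub>gr_stalk R M N r\<^esub> z)"
  shows "Q z"
  using z
proof (induction rule: \<gamma>_induct)
  case zero
  \<comment> \<open>The pair \<open>(r, 0)\<close> always lies in the index set, so zero is a pure
    tensor and the induction rule can do without a case for it.\<close>
  have "\<gamma> r (r, 0) (\<tau> r 0 \<zero>\<^bsub>stalk M r\<^esub> \<zero>\<^bsub>stalk N 0\<^esub>) = \<zero>\<^bsub>gr_stalk R M N r\<^esub>"
    by (rule bilin_zero_left[OF raw_bilin pmod_stalk[OF M] stalk_module mod_zero[OF pmod_stalk[OF N]]]) simp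
  with pure[of r 0 "\<zero>\<^bsub>stalk M r\<^esub>" "\<zero>\<^bsub>stalk N 0\<^esub>"] show ?case
    by (simp add: mod_zero[OF pmod_stalk[OF N]] mod_zero[OF pmod_stalk[OF M]])
next
  case (inj i z)
  obtain s t where i: "i = (s, t)" by (cases i)
  have st: "s + t \<le> r" using inj(1) by (simp add: i gr_index_def)
  have "z \<in> carrier (tensor_module R (stalk M s) (stalk N t))" using inj(2) by (simp add: i D_pair)
  then show ?case unfolding i
  proof (induction rule: tensor_induct[OF pmod_stalk[OF M] pmod_stalk[OF N], consumes 1, case_names pure add])
    case (pure m n)
    with st show ?case by (rule assms(2))
  next
    case (add y z)
    with assms(3)[of "\<gamma> r (s, t) y" "\<gamma> r (s, t) z"] show ?case
      using inj(1) by (simp add: i \<gamma>_add \<gamma>_closed D_pair[symmetric])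
  qed
qed (rule add)

private lemma raw_small: "small \<V> (carrier (gr_stalk R M N r))"
proof -
  let ?A = "gr_stalk R M N r"
  let ?X = "UNIV \<times> UNIV \<times> (\<Union>x. el M x) \<times> (\<Union>x. el N x)"
  \<comment> \<open>A list of data for pure tensors is evaluated to their sum, so that concatenation
    becomes addition. Lists violating \<open>?ok\<close> may give anything: only the inclusion of
    the carrier in the image of all lists matters.\<close>
  define f where "f = (\<lambda>xs. foldr (\<lambda>(s, t, m, n) z. \<gamma> r (s, t) (\<tau> s t m n) \<oplus>\<^bsub>?A\<^esub> z) xs \<zero>\<^bsub>?A\<^esub>)"
  let ?ok = "\<lambda>xs. \<forall>(s, t, m, n)\<in>set xs. s + t \<le> r \<and> m \<in> el M s \<and> n \<in> el N t"
  have f: "f xs \<in> carrier ?A" if "?ok xs" for xs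
    using that by (induction xs) (auto simp: f_def stalk_module bilin_closed[OF raw_bilin])
  have app: "f (xs @ ys) = f xs \<oplus>\<^bsub>?A\<^esub> f ys" if "?ok xs" "?ok ys" for xs ys
    using that(1)
  proof (induction xs)
    case Nil
    then show ?case using f[OF that(2)] by (simp add: f_def stalk_module)
  next
    case (Cons x xs)
    then show ?case
      using f[OF that(2)] f[of xs] by (auto simp: f_def stalk_module bilin_closed[OF raw_bilin] mod_a_assoc)
  qed
  have "\<exists>xs. z = f xs \<and> ?ok xs" if "z \<in> carrier ?A" for z
    using that
  proof (induction rule: raw_induct)
    case (pure s t m n)
    then show ?case
      by (intro exI[of _ "[(s, t, m, n)]"]) (simp add: f_def stalk_module bilin_closed[OF raw_bilin])
  next
    case (add y z)
    then obtain xs ys where "y = f xs" "?ok xs" "z = f ys" "?ok ys" by blast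
    then show ?case by (intro exI[of _ "xs @ ys"]) (auto simp: app)
  qed
  then have "carrier ?A \<subseteq> f ` lists ?X" by (fastforce simp: lists_eq_set)
  moreover have "small \<V> (f ` lists ?X)"
    by (intro small_image small_lists[OF V] small_Times[OF V] small_index[OF V] small_UN[OF V]
        pmod_carrier[OF M] pmod_carrier[OF N])
  ultimately show ?thesis by (rule small_subset[rotated])
qed

private lemmas c_inj = code_inj_image(1)[OF V raw_small]
private lemmas c_image = code_inj_image(2)[OF V raw_small]
private lemmas c_onto = copy_module_onto[OF c_inj stalk_module]

private lemma stalk_eq: "stalk (M \<boxtimes> N) r = copy_module \<V> (gr_stalk R M N r)"
  by (simp add: gr_tensor_def)

private lemma gt_module: "module R (stalk (M \<boxtimes> N) r)"
  unfolding stalk_eq by (rule lin_onto_module[OF stalk_module c_onto])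

private lemma gt_carrier: "el (M \<boxtimes> N) r \<in> \<V>"
  unfolding stalk_eq carrier_copy_module by (rule c_image)

private lemma gr_pure_eq: "gp M N s t r m n = c r (\<gamma> r (s, t) (\<tau> s t m n))"
  by (simp add: gr_pure_def gr_in_def)

private lemma gr_in_eq: "gr_in R \<V> M N r i z = c r (\<gamma> r i z)"
  by (simp add: gr_in_def)

lemma gr_pure_bilin:
  assumes "s + t \<le> r"
  shows "bilin R (stalk M s) (stalk N t) (stalk (M \<boxtimes> N) r) (gp M N s t r)"
proof -
  note b = raw_bilin[OF assms]
  show ?thesis
    unfolding stalk_eq gr_pure_eq
    by (rule bilinI)
      (simp_all add: bilin_add_left[OF b] bilin_add_right[OF b] bilin_smult_left[OF b] bilin_smult_right[OF b]
        lin_onto_closed[OF c_onto] lin_onto_add[OF c_onto] lin_onto_smult[OF c_onto] bilin_closed[OF b])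
qed

lemma gr_pure_transition:
  assumes "s \<le> s'" "t \<le> t'" "s' + t' \<le> r" "m \<in> el M s" "n \<in> el N t"
  shows "gp M N s' t' r (tmap M s s' m) (tmap N t t' n) = gp M N s t r m n"
proof -
  have "s + t \<le> r" using preordered_add_mono[OF assms(1,2)] assms(3) by (rule order_trans)
  then show ?thesis
    unfolding gr_pure_eq using assms \<gamma>_transition[of "(s, t)" r "(s', t')" "\<tau> s t m n"]
    by (simp add: d_pure bilin_closed[OF \<tau>] prod_le_def gr_index_def)
qed

lemma gr_induct [consumes 1, case_names pure add]:
  assumes z: "z \<in> el (M \<boxtimes> N) r"
    and pure: "\<And>s t m n. s + t \<le> r \<Longrightarrow> m \<in> el M s \<Longrightarrow> n \<in> el N t \<Longrightarrow>
      Q (gp M N s t r m n)"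
    and add: "\<And>y z. y \<in> el (M \<boxtimes> N) r \<Longrightarrow> z \<in> el (M \<boxtimes> N) r \<Longrightarrow>
      Q y \<Longrightarrow> Q z \<Longrightarrow> Q (y \<oplus>\<^bsub>stalk (M \<boxtimes> N) r\<^esub> z)"
  shows "Q z"
proof -
  have "Q (c r z)" if "z \<in> carrier (gr_stalk R M N r)" for z
    using that
  proof (induction rule: raw_induct)
    case (pure s t m n)
    then show ?case using assms(2) by (simp add: gr_pure_eq)
  next
    case (add y z)
    from assms(3)[unfolded stalk_eq, OF lin_onto_closed[OF c_onto add(1)] lin_onto_closed[OF c_onto add(2)]
        add(3,4)]
    show ?case by (simp only: lin_onto_add[OF c_onto add(1,2)])
  qed
  then show ?thesis using z unfolding stalk_eq carrier_copy_module by auto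
qed

private lemma gr_in_lift:
  fixes C :: "('a, 'e) module"
  assumes C: "module R C" and f: "\<And>i. i \<in> gr_index r \<Longrightarrow> f i \<in> lin_maps R (D i) C"
    and comp: "\<And>i j x. i \<in> gr_index r \<Longrightarrow> j \<in> gr_index r \<Longrightarrow> prod_le i j \<Longrightarrow> x \<in> carrier (D i) \<Longrightarrow>
      f j (d i j x) = f i x"
  shows "\<exists>h\<in>lin_maps R (stalk (M \<boxtimes> N) r) C.
    \<forall>i\<in>gr_index r. \<forall>z\<in>carrier (D i). h (gr_in R \<V> M N r i z) = f i z"
proof -
  obtain g where g: "g \<in> lin_maps R (gr_stalk R M N r) C"
    and g': "\<forall>i\<in>gr_index r. \<forall>x\<in>carrier (D i). g (\<gamma> r i x) = f i x"
    using \<gamma>_lift[of C r f, OF C f comp] by blast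
  \<comment> \<open>The coding is injective, so every linear map on the raw colimit factors through
    it.\<close>
  have "g x = g y" if "x \<in> carrier (gr_stalk R M N r)" "y \<in> carrier (gr_stalk R M N r)" "c r x = c r y"
      for x y
    using inj_onD[OF c_inj that(3,1,2)] by simp
  from lin_onto_lift[OF stalk_module c_onto g this]
  obtain h where "h \<in> lin_maps R (copy_module \<V> (gr_stalk R M N r)) C"
    and h: "\<forall>x\<in>carrier (gr_stalk R M N r). h (c r x) = g x" by blast
  then show ?thesis
    unfolding stalk_eq gr_in_eq using g' \<gamma>_closed by (intro bexI[of _ h]) auto
qed

text \<open>The two universal properties combined: each \<open>\<beta> s t\<close> extends over a
  tensor product of modules, and the extensions form a cocone because compatibility can be checked
  on pure tensors.\<close>

lemma gr_stalk_lift: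
  fixes C :: "('a, 'e) module"
  assumes C: "module R C" and \<beta>: "\<And>s t. s + t \<le> r \<Longrightarrow> bilin R (stalk M s) (stalk N t) C (\<beta> s t)"
    and comp: "\<And>s t s' t' m n. s \<le> s' \<Longrightarrow> t \<le> t' \<Longrightarrow> s' + t' \<le> r \<Longrightarrow> m \<in> el M s \<Longrightarrow>
      n \<in> el N t \<Longrightarrow> \<beta> s' t' (tmap M s s' m) (tmap N t t' n) = \<beta> s t m n"
  shows "\<exists>h\<in>lin_maps R (stalk (M \<boxtimes> N) r) C. \<forall>s t m n. s + t \<le> r \<longrightarrow> m \<in> el M s \<longrightarrow>
    n \<in> el N t \<longrightarrow> h (gp M N s t r m n) = \<beta> s t m n"
proof -
  let ?Q = "\<lambda>s t g. g \<in> lin_maps R (D (s, t)) C \<and>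
    (\<forall>m\<in>el M s. \<forall>n\<in>el N t. g (\<tau> s t m n) = \<beta> s t m n)"
  \<comment> \<open>One extension is chosen for all pairs of degrees at once, which makes a single
    family for the colimit; it is meaningful for \<open>s + t \<le> r\<close>.\<close>
  define g where "g = (\<lambda>s t. SOME h. ?Q s t h)"
  have "?Q s t (g s t)" if "s + t \<le> r" for s t
  proof -
    have "\<exists>h. ?Q s t h"
      using tensor_lift[OF pmod_stalk[OF M] pmod_stalk[OF N] C \<beta>[OF that]] unfolding D_pair by blast
    then show ?thesis unfolding g_def by (rule someI_ex)
  qed
  then have g: "g s t \<in> lin_maps R (D (s, t)) C"
    and g': "m \<in> el M s \<Longrightarrow> n \<in> el N t \<Longrightarrow> g s t (\<tau> s t m n) = \<beta> s t m n"
    if "s + t \<le> r" for s t m n using that by blast+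
  have gd: "g s' t' (d (s, t) (s', t') x) = g s t x"
    if "s \<le> s'" "t \<le> t'" "s' + t' \<le> r" "x \<in> carrier (D (s, t))" for s t s' t' x
  proof -
    have st: "s + t \<le> r" using preordered_add_mono[OF that(1,2)] that(3) by (rule order_trans)
    have pl: "prod_le (s, t) (s', t')" using that by (simp add: prod_le_def)
    have "compose (carrier (D (s, t))) (g s' t') (d (s, t) (s', t')) = g s t"
    proof (rule tensor_lin_eqI[OF pmod_stalk[OF M] pmod_stalk[OF N]])
      show "compose (carrier (D (s, t))) (g s' t') (d (s, t) (s', t'))
          \<in> lin_maps R (tensor_module R (stalk M s) (stalk N t)) C"
        using lin_comp[OF d_lin[OF pl] g[OF that(3)] D] by (simp add: D_pair)
      show "g s t \<in> lin_maps R (tensor_module R (stalk M s) (stalk N t)) C"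
        using g[OF st] by (simp add: D_pair)
      fix m n assume mn: "m \<in> el M s" "n \<in> el N t"
      then show "compose (carrier (D (s, t))) (g s' t') (d (s, t) (s', t')) (\<tau> s t m n) = g s t (\<tau> s t m n)"
        using that by (simp add: compose_def bilin_closed[OF \<tau>] d_pure g' st comp
            pmod_tmap_closed[OF M] pmod_tmap_closed[OF N])
    qed
    from fun_cong[OF this, of x] show ?thesis using that(4) by (simp add: compose_def)
  qed
  have "\<exists>h\<in>lin_maps R (stalk (M \<boxtimes> N) r) C.
    \<forall>i\<in>gr_index r. \<forall>z\<in>carrier (D i). h (gr_in R \<V> M N r i z) = (\<lambda>(s, t). g s t) i z"
    by (rule gr_in_lift[OF C]) (auto simp: gr_index_def prod_le_def g gd)
  then obtain h where h: "h \<in> lin_maps R (stalk (M \<boxtimes> N) r) C"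
    and h': "\<And>s t z. (s, t) \<in> gr_index r \<Longrightarrow> z \<in> carrier (D (s, t)) \<Longrightarrow>
      h (gr_in R \<V> M N r (s, t) z) = g s t z"
    by auto
  show ?thesis
    using h by (rule bexI[rotated]) (simp add: gr_pure_def gr_index_def h' g' bilin_closed[OF \<tau>])
qed

lemma gr_tmap:
  assumes "r \<le> r'"
  shows "tmap (M \<boxtimes> N) r r' \<in> lin_maps R (stalk (M \<boxtimes> N) r) (stalk (M \<boxtimes> N) r')"
    and "s + t \<le> r \<Longrightarrow> m \<in> el M s \<Longrightarrow> n \<in> el N t \<Longrightarrow>
      tmap (M \<boxtimes> N) r r' (gp M N s t r m n) = gp M N s t r' m n"
proof -
  let ?Q = "\<lambda>h. h \<in> lin_maps R (stalk (M \<boxtimes> N) r) (stalk (M \<boxtimes> N) r') \<and>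
    (\<forall>i\<in>gr_index r. \<forall>z\<in>carrier (D i). h (gr_in R \<V> M N r i z) = gr_in R \<V> M N r' i z)"
  have sub: "i \<in> gr_index r'" if "i \<in> gr_index r" for i
    using that assms by (auto simp: gr_index_def intro: order_trans)
  \<comment> \<open>Enlarging the index set induces a map of colimits. The canonical maps into the
    larger one are cut down by \<open>restrict\<close>, because \<open>lin_maps\<close> demands
    extensional functions.\<close>
  have "\<exists>h\<in>lin_maps R (stalk (M \<boxtimes> N) r) (stalk (M \<boxtimes> N) r').
    \<forall>i\<in>gr_index r. \<forall>z\<in>carrier (D i). h (gr_in R \<V> M N r i z) = restrict (gr_in R \<V> M N r' i) (carrier (D i))
        z"
  proof (rule gr_in_lift[OF gt_module])
    fix i assume "i \<in> gr_index r"
    note i = sub[OF this]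
    show "restrict (gr_in R \<V> M N r' i) (carrier (D i)) \<in> lin_maps R (D i) (stalk (M \<boxtimes> N) r')"
      unfolding stalk_eq gr_in_eq
      by (rule lin_mapsI) (simp_all add: D \<gamma>_closed[OF i] \<gamma>_add[OF i] \<gamma>_smult[OF i]
          lin_onto_closed[OF c_onto] lin_onto_add[OF c_onto] lin_onto_smult[OF c_onto])
    fix j x assume j: "j \<in> gr_index r" and ij: "prod_le i j" and x: "x \<in> carrier (D i)"
    show "restrict (gr_in R \<V> M N r' j) (carrier (D j)) (d i j x) =
        restrict (gr_in R \<V> M N r' i) (carrier (D i)) x"
      using x lin_closed[OF d_lin[OF ij] x] by (simp add: gr_in_eq \<gamma>_transition[OF i sub[OF j] ij x])
  qed
  then obtain h where h: "?Q h" by auto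
  have ex: "\<exists>!h. ?Q h"
  proof (rule ex1I[of ?Q, OF h])
    fix h' assume h': "?Q h'"
    show "h' = h"
    proof (rule lin_maps_eqI)
      fix z assume "z \<in> el (M \<boxtimes> N) r"
      then show "h' z = h z"
      proof (induction rule: gr_induct)
        case (pure s t m n)
        then have "(s, t) \<in> gr_index r" "\<tau> s t m n \<in> carrier (D (s, t))"
          by (simp_all add: gr_index_def bilin_closed[OF \<tau>])
        then show ?case using h h' unfolding gr_pure_def by simp
      next
        case (add y z)
        then show ?case
          by (simp add: lin_add[OF conjunct1[OF h]] lin_add[OF conjunct1[OF h']])
      qed
    qed (use h h' in auto)
  qed
  have eq: "tmap (M \<boxtimes> N) r r' = (THE h. ?Q h)"
    by (simp add: gr_tensor_def)
  have *: "?Q (tmap (M \<boxtimes> N) r r')" unfolding eq by (rule theI'[OF ex])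
  then show "tmap (M \<boxtimes> N) r r' \<in> lin_maps R (stalk (M \<boxtimes> N) r) (stalk (M \<boxtimes> N) r')" by blast
  show "tmap (M \<boxtimes> N) r r' (gp M N s t r m n) = gp M N s t r' m n"
    if "s + t \<le> r" "m \<in> el M s" "n \<in> el N t"
    using * that unfolding gr_pure_def by (simp add: gr_index_def bilin_closed[OF \<tau>])
qed

lemma gr_tensor_pmod: "M \<boxtimes> N \<in> pm"
proof -
  have 1: "tmap (M \<boxtimes> N) x x m = m" if "m \<in> el (M \<boxtimes> N) x" for x m
    using that
  proof (induction rule: gr_induct)
    case (pure s t m n)
    then show ?case by (simp add: gr_tmap(2))
  next
    case (add y z)
    then show ?case by (simp add: lin_add[OF gr_tmap(1)])
  qed
  have 2: "tmap (M \<boxtimes> N) y z (tmap (M \<boxtimes> N) x y m) = tmap (M \<boxtimes> N) x z m"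
    if xyz: "x \<le> y" "y \<le> z" and "m \<in> el (M \<boxtimes> N) x" for x y z m
    using that(3)
  proof (induction rule: gr_induct)
    case (pure s t m n)
    have "x \<le> z" "s + t \<le> y" using xyz pure(1) order_trans by blast+
    then show ?case using pure xyz by (simp add: gr_tmap(2))
  next
    case (add m m')
    have "x \<le> z" using xyz order_trans by blast
    then show ?case using add xyz
      by (simp add: lin_add[OF gr_tmap(1)] lin_closed[OF gr_tmap(1)])
  qed
  show ?thesis
    unfolding pmods_def persistence_module_def
    using 1 2 gt_module gt_carrier gr_tmap(1) by blast
qed

end

end

section \<open>Natural transformations\<close>

lemma shift_simps [simp]:
  "stalk (shift s N) x = stalk N (x + s)" "tmap (shift s N) x y = tmap N (x + s) (y + s)"
  by (simp_all add: shift_def)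

lemma shift_zero [simp]: "shift 0 N = N"
  by (cases N) (simp add: shift_def)

lemma nat_transI:
  assumes "\<And>x. \<eta> x \<in> lin_maps R (stalk M x) (stalk N x)"
    and "\<And>x y m. x \<le> y \<Longrightarrow> m \<in> el M x \<Longrightarrow> \<eta> y (tmap M x y m) = tmap N x y (\<eta> x m)"
  shows "\<eta> \<in> nat_trans R M N"
  using assms by (simp add: nat_trans_def)

lemma nat_lin: "\<eta> \<in> nat_trans R M N \<Longrightarrow> \<eta> x \<in> lin_maps R (stalk M x) (stalk N x)"
  and nat_natural: "\<eta> \<in> nat_trans R M N \<Longrightarrow> x \<le> y \<Longrightarrow> m \<in> el M x \<Longrightarrow>
    \<eta> y (tmap M x y m) = tmap N x y (\<eta> x m)"
  by (simp_all add: nat_trans_def)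

lemma nat_closed: "\<eta> \<in> nat_trans R M N \<Longrightarrow> m \<in> el M x \<Longrightarrow> \<eta> x m \<in> el N x"
  by (rule lin_closed[OF nat_lin])

lemma nat_add: "\<eta> \<in> nat_trans R M N \<Longrightarrow> m \<in> el M x \<Longrightarrow> m' \<in> el M x \<Longrightarrow>
    \<eta> x (m \<oplus>\<^bsub>stalk M x\<^esub> m') = \<eta> x m \<oplus>\<^bsub>stalk N x\<^esub> \<eta> x m'"
  by (rule lin_add[OF nat_lin])

lemma nat_smult: "\<eta> \<in> nat_trans R M N \<Longrightarrow> a \<in> carrier R \<Longrightarrow> m \<in> el M x \<Longrightarrow>
    \<eta> x (a \<odot>\<^bsub>stalk M x\<^esub> m) = a \<odot>\<^bsub>stalk N x\<^esub> \<eta> x m"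
  by (rule lin_smult[OF nat_lin])

text \<open>Components are extensional on the stalks of the common source, so values on the stalks
  decide equality.\<close>

lemma nat_eqI:
  assumes "\<eta> \<in> nat_trans R M N" "\<theta> \<in> nat_trans R M N'"
    and "\<And>x m. m \<in> el M x \<Longrightarrow> \<eta> x m = \<theta> x m"
  shows "\<eta> = \<theta>"
  by (rule ext) (rule lin_maps_eqI[OF nat_lin[OF assms(1)] nat_lin[OF assms(2)] assms(3)])

text \<open>The target degree is a variable with an equation, because it occurs both as
  \<open>x + s\<close> (from \<open>shift\<close>) and as \<open>s + x\<close> (from
  \<open>hom_comp\<close>).\<close>

lemma hm_closed:
  "\<eta> \<in> nat_trans R M (shift s N) \<Longrightarrow> m \<in> el M x \<Longrightarrow> y = x + s \<Longrightarrow>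
    \<eta> x m \<in> el N y"
  using nat_closed[of \<eta> R M "shift s N" m x] by simp

lemma hm_natural:
  "\<eta> \<in> nat_trans R M (shift s N) \<Longrightarrow> x \<le> y \<Longrightarrow> m \<in> el M x \<Longrightarrow>
    \<eta> y (tmap M x y m) = tmap N (x + s) (y + s) (\<eta> x m)"
  using nat_natural[of \<eta> R M "shift s N" x y m] by simp

lemma hm_add: "\<eta> \<in> nat_trans R M (shift s N) \<Longrightarrow> m \<in> el M x \<Longrightarrow> m' \<in> el M x \<Longrightarrow>
    \<eta> x (m \<oplus>\<^bsub>stalk M x\<^esub> m') = \<eta> x m \<oplus>\<^bsub>stalk N (x + s)\<^esub> \<eta> x m'"
  using nat_add[of \<eta> R M "shift s N" m x m'] by simp

lemma hm_smult: "\<eta> \<in> nat_trans R M (shift s N) \<Longrightarrow> a \<in> carrier R \<Longrightarrow> m \<in> el M x \<Longrightarrow>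
    \<eta> x (a \<odot>\<^bsub>stalk M x\<^esub> m) = a \<odot>\<^bsub>stalk N (x + s)\<^esub> \<eta> x m"
  using nat_smult[of \<eta> R M "shift s N" a m x] by simp

lemma hom_comp_apply [simp]:
  "m \<in> el M x \<Longrightarrow> hom_comp M s \<beta> \<alpha> x m = \<beta> (s + x) (\<alpha> x m)"
  by (simp add: hom_comp_def compose_def)

lemma id_trans_apply [simp]: "m \<in> el M x \<Longrightarrow> id_trans M x m = m"
  by (simp add: id_trans_def)

lemma hom_module_simps [simp]:
  "carrier (hom_module R M N) = nat_trans R M N"
  "\<zero>\<^bsub>hom_module R M N\<^esub> = (\<lambda>x. \<lambda>m\<in>el M x. \<zero>\<^bsub>stalk N x\<^esub>)"
  "\<eta> \<oplus>\<^bsub>hom_module R M N\<^esub> \<theta> = (\<lambda>x. \<lambda>m\<in>el M x. \<eta> x m \<oplus>\<^bsub>stalk N x\<^esub> \<theta> x m)"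
  "a \<odot>\<^bsub>hom_module R M N\<^esub> \<eta> = (\<lambda>x. \<lambda>m\<in>el M x. a \<odot>\<^bsub>stalk N x\<^esub> \<eta> x m)"
  by (simp_all add: hom_module_def)

context persistence
begin

abbreviation hm :: "('p, 'a, 'u) pmod \<Rightarrow> ('p, 'a, 'u) pmod \<Rightarrow> 'p \<Rightarrow> ('p \<Rightarrow> 'u \<Rightarrow> 'u) set" where
  "hm M N s \<equiv> nat_trans R M (shift s N)"

lemma shift_pmod [simp]: "M \<in> pmods R \<U> \<Longrightarrow> shift (s :: 'p) M \<in> pmods R \<U>"
  by (simp add: pmods_def persistence_module_def add_right_mono_preorder)

lemma tmap_add: "M \<in> pmods R \<U> \<Longrightarrow> x \<le> y \<Longrightarrow> m \<in> el M x \<Longrightarrow> m' \<in> el M x \<Longrightarrow>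
    tmap M x y (m \<oplus>\<^bsub>stalk M x\<^esub> m') = tmap M x y m \<oplus>\<^bsub>stalk M y\<^esub> tmap M x y m'"
  by (rule lin_add[OF pmod_tmap])

lemma tmap_smult: "M \<in> pmods R \<U> \<Longrightarrow> x \<le> y \<Longrightarrow> a \<in> carrier R \<Longrightarrow> m \<in> el M x \<Longrightarrow>
    tmap M x y (a \<odot>\<^bsub>stalk M x\<^esub> m) = a \<odot>\<^bsub>stalk M y\<^esub> tmap M x y m"
  by (rule lin_smult[OF pmod_tmap])

lemma tmap_zero: "M \<in> pmods R \<U> \<Longrightarrow> x \<le> y \<Longrightarrow> tmap M x y \<zero>\<^bsub>stalk M x\<^esub> = \<zero>\<^bsub>stalk M y\<^esub>"
  by (rule lin_zero[OF pmod_stalk pmod_stalk pmod_tmap])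

lemma hom_module_is_module:
  assumes M: "M \<in> pmods R \<U>" and N: "N \<in> pmods R \<U>'"
  shows "module R (hom_module R M N)"
proof -
  let ?A = "hom_module R M N"
  note [simp] = pmod_stalk[OF M] pmod_stalk[OF N]
  note tm = pmod_tmap_closed[OF M] pmod_tmap_closed[OF N] tmap_add[OF N] tmap_smult[OF N] tmap_zero[OF N]
  have add: "\<eta> \<oplus>\<^bsub>?A\<^esub> \<theta> \<in> carrier ?A" if \<eta>: "\<eta> \<in> carrier ?A" and \<theta>: "\<theta> \<in> carrier ?A" for \<eta> \<theta>
    using \<eta>[simplified] \<theta>[simplified]
    by (auto intro!: nat_transI lin_mapsI
        simp: nat_closed nat_add nat_smult nat_natural tm mod_smult_add mod_a_assoc mod_a_comm mod_a_lcomm)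
  have zero: "\<zero>\<^bsub>?A\<^esub> \<in> carrier ?A"
    by (auto intro!: nat_transI lin_mapsI simp: tm)
  have smult: "a \<odot>\<^bsub>?A\<^esub> \<eta> \<in> carrier ?A" if a: "a \<in> carrier R" and \<eta>: "\<eta> \<in> carrier ?A" for a \<eta>
    using a \<eta>[simplified]
    by (auto intro!: nat_transI lin_mapsI
        simp: nat_closed nat_add nat_smult nat_natural tm mod_smult_add mod_smult_smult m_comm)
  have eqI: "\<eta> = \<theta>" if "\<eta> \<in> carrier ?A" "\<theta> \<in> carrier ?A"
    "\<And>x m. m \<in> el M x \<Longrightarrow> \<eta> x m = \<theta> x m" for \<eta> \<theta>
    using that by (auto intro: nat_eqI)
  have "abelian_group ?A"
  proof (rule abelian_groupI)
    fix \<eta> assume \<eta>: "\<eta> \<in> carrier ?A"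
    show "\<zero>\<^bsub>?A\<^esub> \<oplus>\<^bsub>?A\<^esub> \<eta> = \<eta>"
      by (rule eqI[OF add[OF zero \<eta>] \<eta>]) (use \<eta> in \<open>simp add: nat_closed\<close>)
    have 1: "(\<ominus> \<one>) \<odot>\<^bsub>?A\<^esub> \<eta> \<in> carrier ?A" by (rule smult[OF _ \<eta>]) simp
    have "(\<ominus> \<one>) \<odot>\<^bsub>?A\<^esub> \<eta> \<oplus>\<^bsub>?A\<^esub> \<eta> = \<zero>\<^bsub>?A\<^esub>"
    proof (rule eqI[OF add[OF 1 \<eta>] zero])
      fix x m assume m: "m \<in> el M x"
      interpret N: module R "stalk N x" by simp
      show "((\<ominus> \<one>) \<odot>\<^bsub>?A\<^esub> \<eta> \<oplus>\<^bsub>?A\<^esub> \<eta>) x m = \<zero>\<^bsub>?A\<^esub> x m"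
        using m \<eta> by (simp add: mod_smult_uminus nat_closed N.l_neg)
    qed
    then show "\<exists>\<theta>\<in>carrier ?A. \<theta> \<oplus>\<^bsub>?A\<^esub> \<eta> = \<zero>\<^bsub>?A\<^esub>" using 1 by blast
    fix \<theta> assume \<theta>: "\<theta> \<in> carrier ?A"
    show "\<eta> \<oplus>\<^bsub>?A\<^esub> \<theta> \<in> carrier ?A" by (rule add[OF \<eta> \<theta>])
    show "\<eta> \<oplus>\<^bsub>?A\<^esub> \<theta> = \<theta> \<oplus>\<^bsub>?A\<^esub> \<eta>"
      by (rule eqI[OF add[OF \<eta> \<theta>] add[OF \<theta> \<eta>]]) (use \<eta> \<theta> in \<open>simp add: nat_closed mod_a_comm\<close>)
    fix \<zeta> assume \<zeta>: "\<zeta> \<in> carrier ?A"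
    show "\<eta> \<oplus>\<^bsub>?A\<^esub> \<theta> \<oplus>\<^bsub>?A\<^esub> \<zeta> = \<eta> \<oplus>\<^bsub>?A\<^esub> (\<theta> \<oplus>\<^bsub>?A\<^esub> \<zeta>)"
      by (rule eqI[OF add[OF add[OF \<eta> \<theta>] \<zeta>] add[OF \<eta> add[OF \<theta> \<zeta>]]])
        (use \<eta> \<theta> \<zeta> in \<open>simp add: nat_closed mod_a_assoc\<close>)
  qed (rule zero)
  then show ?thesis
  proof (rule moduleI[OF is_cring])
    fix \<eta> assume \<eta>: "\<eta> \<in> carrier ?A"
    show "\<one> \<odot>\<^bsub>?A\<^esub> \<eta> = \<eta>"
      by (rule eqI[OF smult[OF one_closed \<eta>] \<eta>]) (use \<eta> in \<open>simp add: nat_closed\<close>)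
    fix a assume a: "a \<in> carrier R"
    show "a \<odot>\<^bsub>?A\<^esub> \<eta> \<in> carrier ?A" by (rule smult[OF a \<eta>])
    show "a \<odot>\<^bsub>?A\<^esub> (\<eta> \<oplus>\<^bsub>?A\<^esub> \<theta>) = a \<odot>\<^bsub>?A\<^esub> \<eta> \<oplus>\<^bsub>?A\<^esub> a \<odot>\<^bsub>?A\<^esub> \<theta>" if \<theta>: "\<theta> \<in> carrier ?A" for \<theta>
      by (rule eqI[OF smult[OF a add[OF \<eta> \<theta>]] add[OF smult[OF a \<eta>] smult[OF a \<theta>]]])
        (use a \<eta> \<theta> in \<open>simp add: nat_closed mod_smult_add\<close>)
    fix b assume b: "b \<in> carrier R"
    show "(a \<oplus> b) \<odot>\<^bsub>?A\<^esub> \<eta> = a \<odot>\<^bsub>?A\<^esub> \<eta> \<oplus>\<^bsub>?A\<^esub> b \<odot>\<^bsub>?A\<^esub> \<eta>"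
      by (rule eqI[OF smult[OF a_closed[OF a b] \<eta>] add[OF smult[OF a \<eta>] smult[OF b \<eta>]]])
        (use a b \<eta> in \<open>simp add: nat_closed mod_add_smult\<close>)
    show "a \<otimes> b \<odot>\<^bsub>?A\<^esub> \<eta> = a \<odot>\<^bsub>?A\<^esub> (b \<odot>\<^bsub>?A\<^esub> \<eta>)"
      by (rule eqI[OF smult[OF m_closed[OF a b] \<eta>] smult[OF a smult[OF b \<eta>]]])
        (use a b \<eta> in \<open>simp add: nat_closed mod_smult_smult\<close>)
  qed
qed

lemma id_trans_hm: "M \<in> pmods R \<U> \<Longrightarrow> id_trans M \<in> hm M M 0"
  by (auto intro!: nat_transI lin_mapsI simp: id_trans_def pmod_stalk pmod_tmap_closed)

lemma hom_comp_hm: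
  assumes M: "M \<in> pmods R \<U>" and \<alpha>: "\<alpha> \<in> hm M N s" and \<beta>: "\<beta> \<in> hm N L t"
  shows "hom_comp M s \<beta> \<alpha> \<in> hm M L (s + t)"
proof (rule nat_transI)
  fix x
  have \<alpha>x: "\<alpha> x m \<in> el N (s + x)" if "m \<in> el M x" for m
    by (rule hm_closed[OF \<alpha> that]) (simp add: add.commute)
  have eq: "x + (s + t) = s + x + t" by (simp add: add_ac)
  have \<beta>': "\<beta> (s + x) \<in> lin_maps R (stalk N (s + x)) (stalk (shift t L) (s + x))" by (rule nat_lin[OF \<beta>])
  have \<alpha>': "\<alpha> x \<in> lin_maps R (stalk M x) (stalk N (s + x))"
    using nat_lin[OF \<alpha>, of x] by (simp add: add.commute)
  show "hom_comp M s \<beta> \<alpha> x \<in> lin_maps R (stalk M x) (stalk (shift (s + t) L) x)"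
    using lin_comp[OF \<alpha>' \<beta>' pmod_stalk[OF M]] by (simp add: hom_comp_def eq)
  fix y m assume xy: "x \<le> y" and m: "m \<in> el M x"
  have "x + s \<le> y + s" by (rule add_right_mono_preorder[OF xy])
  then show "hom_comp M s \<beta> \<alpha> y (tmap M x y m) = tmap (shift (s + t) L) x y (hom_comp M s \<beta> \<alpha> x m)"
    using xy m \<alpha>x[OF m] hm_natural[OF \<beta>, of "x + s" "y + s" "\<alpha> x m"]
    by (simp add: pmod_tmap_closed[OF M] hm_natural[OF \<alpha>] add_ac)
qed

lemma hom_comp_assoc:
  assumes \<alpha>: "\<alpha> \<in> hm M N s"
  shows "hom_comp M s (hom_comp N t \<gamma> \<beta>) \<alpha> = hom_comp M (s + t) \<gamma> (hom_comp M s \<beta> \<alpha>)"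
proof (intro ext)
  fix x m
  show "hom_comp M s (hom_comp N t \<gamma> \<beta>) \<alpha> x m = hom_comp M (s + t) \<gamma> (hom_comp M s \<beta> \<alpha>) x m"
  proof (cases "m \<in> el M x")
    case True
    have "\<alpha> x m \<in> el N (s + x)" by (rule hm_closed[OF \<alpha> True]) (simp add: add.commute)
    then show ?thesis using True by (simp add: add_ac)
  qed (simp add: hom_comp_def compose_def)
qed

lemma hom_comp_id_left:
  assumes M: "M \<in> pmods R \<U>" and N: "N \<in> pmods R \<U>" and \<alpha>: "\<alpha> \<in> hm M N s"
  shows "hom_comp M s (id_trans N) \<alpha> = \<alpha>"
proof (rule nat_eqI[OF _ \<alpha>])
  show "hom_comp M s (id_trans N) \<alpha> \<in> hm M N (s + 0)" by (rule hom_comp_hm[OF M \<alpha> id_trans_hm[OF N]])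
  fix x m assume m: "m \<in> el M x"
  have "\<alpha> x m \<in> el N (s + x)" by (rule hm_closed[OF \<alpha> m]) (simp add: add.commute)
  with m show "hom_comp M s (id_trans N) \<alpha> x m = \<alpha> x m" by simp
qed

lemma hom_comp_id_right:
  assumes M: "M \<in> pmods R \<U>" and \<alpha>: "\<alpha> \<in> hm M N s"
  shows "hom_comp M 0 \<alpha> (id_trans M) = \<alpha>"
proof (rule nat_eqI[OF _ \<alpha>])
  show "hom_comp M 0 \<alpha> (id_trans M) \<in> hm M N (0 + s)" by (rule hom_comp_hm[OF M id_trans_hm[OF M] \<alpha>])
qed simp

section \<open>Bilinear maps of persistence modules\<close>

text \<open>These are the transformations from the external tensor product on
  \<open>P \<times> P\<close> to \<open>K\<close> pulled back along addition. The tensor product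
  represents them: it is the left Kan extension along addition, that is, Day convolution. Stating
  naturality one variable at a time makes it easy to freeze the other.\<close>

definition bimap :: "('p, 'a, 'u) pmod \<Rightarrow> ('p, 'a, 'u) pmod \<Rightarrow> ('p, 'a, 'u) pmod \<Rightarrow>
    ('p \<Rightarrow> 'p \<Rightarrow> 'u \<Rightarrow> 'u \<Rightarrow> 'u) \<Rightarrow> bool" where
  "bimap M N K \<beta> \<longleftrightarrow>
    (\<forall>s t. bilin R (stalk M s) (stalk N t) (stalk K (s + t)) (\<beta> s t)) \<and>
    (\<forall>s s' t. s \<le> s' \<longrightarrow> (\<forall>m\<in>el M s. \<forall>n\<in>el N t.
       \<beta> s' t (tmap M s s' m) n = tmap K (s + t) (s' + t) (\<beta> s t m n))) \<and>
    (\<forall>s t t'. t \<le> t' \<longrightarrow> (\<forall>m\<in>el M s. \<forall>n\<in>el N t.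
       \<beta> s t' m (tmap N t t' n) = tmap K (s + t) (s + t') (\<beta> s t m n)))"

lemma bimapI:
  assumes "\<And>s t. bilin R (stalk M s) (stalk N t) (stalk K (s + t)) (\<beta> s t)"
    and "\<And>s s' t m n. s \<le> s' \<Longrightarrow> m \<in> el M s \<Longrightarrow> n \<in> el N t \<Longrightarrow>
       \<beta> s' t (tmap M s s' m) n = tmap K (s + t) (s' + t) (\<beta> s t m n)"
    and "\<And>s t t' m n. t \<le> t' \<Longrightarrow> m \<in> el M s \<Longrightarrow> n \<in> el N t \<Longrightarrow>
       \<beta> s t' m (tmap N t t' n) = tmap K (s + t) (s + t') (\<beta> s t m n)"
  shows "bimap M N K \<beta>"
  using assms by (simp add: bimap_def)

lemma bimapD:
  assumes "bimap M N K \<beta>"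
  shows bimap_bilin: "bilin R (stalk M s) (stalk N t) (stalk K (s + t)) (\<beta> s t)"
    and bimap_left: "s \<le> s' \<Longrightarrow> m \<in> el M s \<Longrightarrow> n \<in> el N t \<Longrightarrow>
       \<beta> s' t (tmap M s s' m) n = tmap K (s + t) (s' + t) (\<beta> s t m n)"
    and bimap_right: "t \<le> t' \<Longrightarrow> m \<in> el M s \<Longrightarrow> n \<in> el N t \<Longrightarrow>
       \<beta> s t' m (tmap N t t' n) = tmap K (s + t) (s + t') (\<beta> s t m n)"
  using assms by (simp_all add: bimap_def)

text \<open>Rests on commutativity of \<open>P\<close>, as the target degree changes from
  \<open>t + s\<close> to \<open>s + t\<close>. Facts about the right factor are deduced from those
  about the left one.\<close>

lemma bimap_swap:
  assumes "bimap M N K \<beta>"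
  shows "bimap N M K (\<lambda>s t n m. \<beta> t s m n)"
proof (rule bimapI)
  fix s t
  note b = bimap_bilin[OF assms, of t s]
  show "bilin R (stalk N s) (stalk M t) (stalk K (s + t)) (\<lambda>n m. \<beta> t s m n)"
    using b by (simp add: bilin_def add.commute)
qed (simp_all add: bimap_left[OF assms] bimap_right[OF assms] add.commute)

lemma gr_pure_closed:
  assumes "M \<in> pm" "N \<in> pm" "s + t \<le> r" "m \<in> el M s" "n \<in> el N t"
  shows "gp M N s t r m n \<in> el (M \<boxtimes> N) r"
  using bilin_closed[OF gr_pure_bilin[OF assms(1-3)] assms(4,5)] .

lemma gr_pure_left:
  assumes M: "M \<in> pm" and N: "N \<in> pm" and "s \<le> s'" "s' + t \<le> r" "m \<in> el M s" "n \<in> el N t"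
  shows "gp M N s' t r (tmap M s s' m) n = gp M N s t r m n"
  using gr_pure_transition[OF M N assms(3) order_refl assms(4,5,6)] assms by (simp add: pmod_tmap_refl)

lemma gr_pure_right:
  assumes M: "M \<in> pm" and N: "N \<in> pm" and "t \<le> t'" "s + t' \<le> r" "m \<in> el M s" "n \<in> el N t"
  shows "gp M N s t' r m (tmap N t t' n) = gp M N s t r m n"
  using gr_pure_transition[OF M N order_refl assms(3,4,5,6)] assms by (simp add: pmod_tmap_refl)

lemma gr_pure_bimap:
  assumes M: "M \<in> pm" and N: "N \<in> pm"
  shows "bimap M N (M \<boxtimes> N) (\<lambda>s t. gp M N s t (s + t))"
  by (rule bimapI)
    (simp_all add: gr_pure_bilin M N gr_tmap(2) gr_pure_left gr_pure_right preordered_add_mono)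

text \<open>Degrees regroup as \<open>(s + u) + (t + v) = (s + t) + (u + v)\<close>, so applying
  morphisms of degrees \<open>u\<close> and \<open>v\<close> to the two arguments costs a shift of
  the target by \<open>u + v\<close>.\<close>

lemma bimap_comp_homs:
  assumes f: "f \<in> hm M M' u" and g: "g \<in> hm N N' v" and \<beta>: "bimap M' N' K \<beta>"
  shows "bimap M N (shift (u + v) K) (\<lambda>s t m n. \<beta> (s + u) (t + v) (f s m) (g t n))"
proof (rule bimapI)
  fix s t
  have "f s \<in> lin_maps R (stalk M s) (stalk M' (s + u))" "g t \<in> lin_maps R (stalk N t) (stalk N' (t + v))"
    using nat_lin[OF f] nat_lin[OF g] by simp_all
  from bilin_compose[OF this bimap_bilin[OF \<beta>]]
  show "bilin R (stalk M s) (stalk N t) (stalk (shift (u + v) K) (s + t)) (\<lambda>m n. \<beta> (s + u) (t + v) (f s m)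
      (g t n))"
    by (simp add: add_ac)
qed (simp_all add: hm_natural[OF f] hm_natural[OF g] bimap_left[OF \<beta>] bimap_right[OF \<beta>]
    hm_closed[OF f] hm_closed[OF g] add_right_mono_preorder, simp_all add: add_ac)

text \<open>The pure tensor in degree \<open>r\<close> is the transition image of the one in degree
  \<open>s + t\<close>, so naturality determines the value at \<open>r\<close>. This is why tests
  are made at \<open>r = s + t\<close> only.\<close>

lemma nat_gr_pure:
  assumes M: "M \<in> pm" and N: "N \<in> pm" and h: "h \<in> nat_trans R (M \<boxtimes> N) K"
    and "s + t \<le> r" "m \<in> el M s" "n \<in> el N t"
  shows "h r (gp M N s t r m n) = tmap K (s + t) r (h (s + t) (gp M N s t (s + t) m n))"
  using nat_natural[OF h assms(4) gr_pure_closed[OF M N order_refl assms(5,6)]]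
    gr_tmap(2)[OF M N assms(4) order_refl assms(5,6)] by simp

lemma gr_ext:
  assumes M: "M \<in> pm" and N: "N \<in> pm"
    and h: "h \<in> nat_trans R (M \<boxtimes> N) K" and h': "h' \<in> nat_trans R (M \<boxtimes> N) K"
    and eq: "\<And>s t m n. m \<in> el M s \<Longrightarrow> n \<in> el N t \<Longrightarrow>
      h (s + t) (gp M N s t (s + t) m n) = h' (s + t) (gp M N s t (s + t) m n)"
  shows "h = h'"
proof (rule nat_eqI[OF h h'])
  fix r z assume "z \<in> el (M \<boxtimes> N) r"
  then show "h r z = h' r z"
  proof (induction rule: gr_induct[OF M N, consumes 1, case_names pure add])
    case (pure s t m n)
    then show ?case
      by (simp only: nat_gr_pure[OF M N h pure] nat_gr_pure[OF M N h' pure] eq)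
  next
    case (add y z)
    then show ?case by (simp add: nat_add[OF h] nat_add[OF h'])
  qed
qed

lemma gr_lift:
  assumes M: "M \<in> pm" and N: "N \<in> pm" and K: "K \<in> pm" and \<beta>: "bimap M N K \<beta>"
  obtains h where "h \<in> nat_trans R (M \<boxtimes> N) K"
    and "\<And>s t r m n. s + t \<le> r \<Longrightarrow> m \<in> el M s \<Longrightarrow> n \<in> el N t \<Longrightarrow>
      h r (gp M N s t r m n) = tmap K (s + t) r (\<beta> s t m n)"
proof -
  note c = bilin_closed[OF bimap_bilin[OF \<beta>]]
  note tm = pmod_tmap_closed[OF K] tmap_add[OF K] tmap_smult[OF K]
  have "\<exists>h\<in>lin_maps R (stalk (M \<boxtimes> N) r) (stalk K r). \<forall>s t m n. s + t \<le> r \<longrightarrow> m \<in> el M s \<longrightarrow>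
    n \<in> el N t \<longrightarrow> h (gp M N s t r m n) = tmap K (s + t) r (\<beta> s t m n)" for r
  proof (rule gr_stalk_lift[OF M N pmod_stalk[OF K]])
    fix s t assume st: "s + t \<le> r"
    note b = bimap_bilin[OF \<beta>, of s t]
    show "bilin R (stalk M s) (stalk N t) (stalk K r) (\<lambda>m n. tmap K (s + t) r (\<beta> s t m n))"
      by (rule bilinI) (simp_all add: st tm c bilin_add_left[OF b] bilin_add_right[OF b]
          bilin_smult_left[OF b] bilin_smult_right[OF b])
  next
    fix s t s' t' m n
    assume a: "s \<le> s'" "t \<le> t'" "s' + t' \<le> r" "m \<in> el M s" "n \<in> el N t"
    have i: "s + t \<le> s' + t" "s' + t \<le> s' + t'" using a by (simp_all add: preordered_add_mono)
    then have j: "s' + t \<le> r" "s + t \<le> s' + t'" using a(3) order_trans by blast+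
    \<comment> \<open>Moving both degrees up at once is factored through \<open>s' + t\<close>:
      first the left variable moves, then the right one.\<close>
    have "tmap K (s' + t') r (\<beta> s' t' (tmap M s s' m) (tmap N t t' n)) =
      tmap K (s' + t') r (tmap K (s' + t) (s' + t') (tmap K (s + t) (s' + t) (\<beta> s t m n)))"
      using a by (simp add: bimap_left[OF \<beta>] bimap_right[OF \<beta>] pmod_tmap_closed[OF M])
    also have "\<dots> = tmap K (s + t) r (\<beta> s t m n)"
      using a i j c[OF a(4,5)] by (simp add: pmod_tmap_tmap[OF K] tm)
    finally show "tmap K (s' + t') r (\<beta> s' t' (tmap M s s' m) (tmap N t t' n)) =
        tmap K (s + t) r (\<beta> s t m n)" .
  qed
  then obtain h where h: "\<And>r. h r \<in> lin_maps R (stalk (M \<boxtimes> N) r) (stalk K r)"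
    and h': "\<And>s t r m n. s + t \<le> r \<Longrightarrow> m \<in> el M s \<Longrightarrow> n \<in> el N t \<Longrightarrow>
      h r (gp M N s t r m n) = tmap K (s + t) r (\<beta> s t m n)"
    by metis
  have "h \<in> nat_trans R (M \<boxtimes> N) K"
  proof (rule nat_transI[OF h])
    fix x y z assume xy: "x \<le> y" and z: "z \<in> el (M \<boxtimes> N) x"
    from z show "h y (tmap (M \<boxtimes> N) x y z) = tmap K x y (h x z)"
    proof (induction rule: gr_induct[OF M N, consumes 1, case_names pure add])
      case (pure s t m n)
      have "s + t \<le> y" using pure(1) xy by (rule order_trans)
      then show ?case using pure xy by (simp add: gr_tmap(2)[OF M N] h' pmod_tmap_tmap[OF K] c)
    next
      case (add z z')
      then show ?case using xy
        by (simp add: lin_add[OF gr_tmap(1)[OF M N]] lin_closed[OF gr_tmap(1)[OF M N]]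
            lin_add[OF h] tmap_add[OF K] lin_closed[OF h])
    qed
  qed
  with h' that show thesis by blast
qed

text \<open>With \<open>l\<close> frozen, the dependence on the other argument is a morphism of
  degree \<open>w\<close>. Extensionality for one tensor product thereby becomes applicable inside
  another.\<close>

lemma curry_left:
  assumes A: "A \<in> pm" and L: "L \<in> pm" and h: "h \<in> nat_trans R (A \<boxtimes> L) K" and l: "l \<in> el L w"
  shows "(\<lambda>u. \<lambda>z\<in>el A u. h (u + w) (gp A L u w (u + w) z l)) \<in> hm A K w"
proof (rule nat_transI)
  fix u
  note b = gr_pure_bilin[OF A L order_refl, of u w]
  show "(\<lambda>z\<in>el A u. h (u + w) (gp A L u w (u + w) z l)) \<in> lin_maps R (stalk A u) (stalk (shift w K) u)"
    by (rule lin_mapsI) (simp_all add: l pmod_stalk[OF A] bilin_closed[OF b] bilin_add_left[OF b]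
        bilin_smult_left[OF b] nat_closed[OF h] nat_add[OF h] nat_smult[OF h])
next
  fix x y z assume "x \<le> y" "z \<in> el A x"
  then show "(\<lambda>z\<in>el A y. h (y + w) (gp A L y w (y + w) z l)) (tmap A x y z) =
    tmap (shift w K) x y ((\<lambda>z\<in>el A x. h (x + w) (gp A L x w (x + w) z l)) z)"
    using l by (simp add: pmod_tmap_closed[OF A] gr_pure_left[OF A L] nat_gr_pure[OF A L h, of x w "y + w"]
        preordered_add_mono)
qed

lemma curry_right:
  assumes A: "A \<in> pm" and L: "L \<in> pm" and h: "h \<in> nat_trans R (A \<boxtimes> L) K" and z: "z \<in> el A u"
  shows "(\<lambda>w. \<lambda>l\<in>el L w. h (u + w) (gp A L u w (u + w) z l)) \<in> hm L K u"
proof (rule nat_transI)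
  fix w
  note b = gr_pure_bilin[OF A L order_refl, of u w]
  have "(\<lambda>l\<in>el L w. h (u + w) (gp A L u w (u + w) z l)) \<in> lin_maps R (stalk L w) (stalk K (u + w))"
    by (rule lin_mapsI) (simp_all add: z pmod_stalk[OF L] bilin_closed[OF b] bilin_add_right[OF b]
        bilin_smult_right[OF b] nat_closed[OF h] nat_add[OF h] nat_smult[OF h])
  then show "(\<lambda>l\<in>el L w. h (u + w) (gp A L u w (u + w) z l)) \<in> lin_maps R (stalk L w) (stalk (shift u K) w)"
    by (simp add: add.commute)
next
  fix x y l assume "x \<le> y" "l \<in> el L x"
  then show "(\<lambda>l\<in>el L y. h (u + y) (gp A L u y (u + y) z l)) (tmap L x y l) =
    tmap (shift u K) x y ((\<lambda>l\<in>el L x. h (u + x) (gp A L u x (u + x) z l)) l)"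
    using z by (simp add: pmod_tmap_closed[OF L] gr_pure_right[OF A L] nat_gr_pure[OF A L h, of u x "u + y"]
        preordered_add_mono add.commute[of x] add.commute[of y])
qed


lemma bimap_left_hm:
  assumes M: "M \<in> pmods R \<U>" and \<beta>: "bimap M N K \<beta>" and n: "n \<in> el N t"
  shows "(\<lambda>s. \<lambda>m\<in>el M s. \<beta> s t m n) \<in> hm M K t"
proof (rule nat_transI)
  fix s
  note b = bimap_bilin[OF \<beta>, of s t]
  show "(\<lambda>m\<in>el M s. \<beta> s t m n) \<in> lin_maps R (stalk M s) (stalk (shift t K) s)"
    by (rule lin_mapsI) (simp_all add: n pmod_stalk[OF M] bilin_closed[OF b] bilin_add_left[OF b]
        bilin_smult_left[OF b])
qed (simp add: pmod_tmap_closed[OF M] bimap_left[OF \<beta>] n)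

lemma bimap_right_hm:
  assumes N: "N \<in> pmods R \<U>" and \<beta>: "bimap M N K \<beta>" and m: "m \<in> el M s"
  shows "(\<lambda>t. \<lambda>n\<in>el N t. \<beta> s t m n) \<in> hm N K s"
  by (rule bimap_left_hm[OF N bimap_swap[OF \<beta>] m])

text \<open>Families obtained by composition contain restricted functions and identities; they can
  be exchanged for a plain formula that agrees on the stalks.\<close>

lemma bimap_cong:
  assumes "bimap M N K \<beta>" "M \<in> pmods R \<U>" "N \<in> pmods R \<U>'"
    and "\<And>s t m n. m \<in> el M s \<Longrightarrow> n \<in> el N t \<Longrightarrow> \<beta> s t m n = \<beta>' s t m n"
  shows "bimap M N K \<beta>'"
  using assms(1)
  by (simp add: bimap_def bilin_def pmod_stalk[OF assms(2)] pmod_stalk[OF assms(3)]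
      pmod_tmap_closed[OF assms(2)] pmod_tmap_closed[OF assms(3)] flip: assms(4))

lemma hm_cong:
  assumes "\<eta> \<in> hm M K s" "\<And>x. \<theta> x \<in> extensional (el M x)"
    and "\<And>x m. m \<in> el M x \<Longrightarrow> \<eta> x m = \<theta> x m"
  shows "\<theta> \<in> hm M K s"
proof -
  have "\<eta> = \<theta>"
  proof
    fix x
    show "\<eta> x = \<theta> x"
      by (rule extensionalityI[OF lin_extensional[OF nat_lin[OF assms(1)]] assms(2,3)])
  qed
  with assms(1) show ?thesis by simp
qed

section \<open>Tensor products of graded morphisms, triple tensor products and the
  associator\<close>

abbreviation th where
  "th M M' N N' u v f g \<equiv> gr_tensor_hom R \<V> M M' N N' u v f g"

lemma gr_tensor_hom:
  assumes pm: "M \<in> pm" "M' \<in> pm" "N \<in> pm" "N' \<in> pm" and f: "f \<in> hm M M' u" and g: "g \<in> hm N N' v"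
  shows gr_tensor_hom_hm: "th M M' N N' u v f g \<in> hm (M \<boxtimes> N) (M' \<boxtimes> N') (u + v)"
    and gr_tensor_hom_pure: "\<And>s t r m n. s + t \<le> r \<Longrightarrow> m \<in> el M s \<Longrightarrow> n \<in> el N t \<Longrightarrow>
      th M M' N N' u v f g r (gp M N s t r m n) =
        gp M' N' (s + u) (t + v) (r + (u + v)) (f s m) (g t n)"
proof -
  let ?K = "shift (u + v) (M' \<boxtimes> N')"
  let ?Q = "\<lambda>h. h \<in> hm (M \<boxtimes> N) (M' \<boxtimes> N') (u + v) \<and>
        (\<forall>s t r. s + t \<le> r \<longrightarrow> (\<forall>m\<in>el M s. \<forall>n\<in>el N t.
           h r (gp M N s t r m n) =
           gp M' N' (s + u) (t + v) (r + (u + v)) (f s m) (g t n)))"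
  have K: "?K \<in> pm" by (simp add: gr_tensor_pmod pm)
  obtain h where h: "h \<in> nat_trans R (M \<boxtimes> N) ?K" and
    h': "\<And>s t r m n. s + t \<le> r \<Longrightarrow> m \<in> el M s \<Longrightarrow> n \<in> el N t \<Longrightarrow>
      h r (gp M N s t r m n) = tmap ?K (s + t) r
        (gp M' N' (s + u) (t + v) (s + u + (t + v)) (f s m) (g t n))"
    by (rule gr_lift[OF pm(1,3) K bimap_comp_homs[OF f g gr_pure_bimap[OF pm(2,4)]]]) blast
  have "?Q h"
  proof (intro conjI h allI impI ballI)
    fix s t r m n
    assume str: "s + t \<le> r" and m: "m \<in> el M s" and n: "n \<in> el N t"
    \<comment> \<open>The family lands in degree \<open>(s + u) + (t + v)\<close>, the shifted
      target counts it as \<open>(s + t) + (u + v)\<close>. Once the two are identified, the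
      transition up to \<open>r + (u + v)\<close> is absorbed into \<open>gp\<close>.\<close>
    have e: "s + u + (t + v) = s + t + (u + v)" by (simp add: add_ac)
    have le: "s + t + (u + v) \<le> r + (u + v)" by (rule add_right_mono_preorder[OF str])
    have le': "s + u + (t + v) \<le> s + t + (u + v)" by (simp add: add_ac)
    have fm: "f s m \<in> el M' (s + u)" and gn: "g t n \<in> el N' (t + v)"
      by (rule hm_closed[OF f m refl]) (rule hm_closed[OF g n refl])
    show "h r (gp M N s t r m n) =
           gp M' N' (s + u) (t + v) (r + (u + v)) (f s m) (g t n)"
      using h'[OF str m n] gr_tmap(2)[OF pm(2,4) le le' fm gn] by (simp add: e)
  qed
  moreover have "h'' = h" if "?Q h''" for h''
  proof (rule gr_ext[OF pm(1,3)])
    show "h'' \<in> nat_trans R (M \<boxtimes> N) ?K" "h \<in> nat_trans R (M \<boxtimes> N) ?K" using that h by auto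
  qed (use that \<open>?Q h\<close> in auto)
  ultimately have ex: "\<exists>!h. ?Q h" by (intro ex1I[of ?Q]) auto
  have *: "?Q (th M M' N N' u v f g)"
    unfolding gr_tensor_hom_def by (rule theI'[OF ex])
  then show "th M M' N N' u v f g \<in> hm (M \<boxtimes> N) (M' \<boxtimes> N') (u + v)" by blast
  show "th M M' N N' u v f g r (gp M N s t r m n) =
        gp M' N' (s + u) (t + v) (r + (u + v)) (f s m) (g t n)"
    if "s + t \<le> r" "m \<in> el M s" "n \<in> el N t" for s t r m n
    using * that by blast
qed

text \<open>With \<open>l\<close> frozen, \<open>curry_left\<close> leaves two maps out of
  \<open>M \<boxtimes> N\<close>, which are compared on pure tensors; this covers the non-pure
  elements of the inner product.\<close>

lemma gr_ext_left:
  assumes M: "M \<in> pm" and N: "N \<in> pm" and L: "L \<in> pm"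
    and h: "h \<in> nat_trans R ((M \<boxtimes> N) \<boxtimes> L) K" and h': "h' \<in> nat_trans R ((M \<boxtimes> N) \<boxtimes> L) K"
    and eq: "\<And>a b c m n l. m \<in> el M a \<Longrightarrow> n \<in> el N b \<Longrightarrow> l \<in> el L c \<Longrightarrow>
      h (a + b + c) (gp (M \<boxtimes> N) L (a + b) c (a + b + c) (gp M N a b (a + b) m n) l) =
      h' (a + b + c) (gp (M \<boxtimes> N) L (a + b) c (a + b + c) (gp M N a b (a + b) m n) l)"
  shows "h = h'"
proof -
  note MN = gr_tensor_pmod[OF M N]
  show ?thesis
  proof (rule gr_ext[OF MN L h h'])
    fix u w z l assume z: "z \<in> el (M \<boxtimes> N) u" and l: "l \<in> el L w"
    from gr_ext[OF M N curry_left[OF MN L h l] curry_left[OF MN L h' l]]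
    have "(\<lambda>u. \<lambda>z\<in>el (M \<boxtimes> N) u. h (u + w) (gp (M \<boxtimes> N) L u w (u + w) z l)) =
      (\<lambda>u. \<lambda>z\<in>el (M \<boxtimes> N) u. h' (u + w) (gp (M \<boxtimes> N) L u w (u + w) z l))"
      by (simp add: eq l gr_pure_closed M N)
    from fun_cong[OF fun_cong[OF this], of u z] z
    show "h (u + w) (gp (M \<boxtimes> N) L u w (u + w) z l) = h' (u + w) (gp (M \<boxtimes> N) L u w (u + w) z l)"
      by simp
  qed
qed

lemma gr_ext_right:
  assumes M: "M \<in> pm" and N: "N \<in> pm" and L: "L \<in> pm"
    and h: "h \<in> nat_trans R (M \<boxtimes> (N \<boxtimes> L)) K" and h': "h' \<in> nat_trans R (M \<boxtimes> (N \<boxtimes> L)) K"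
    and eq: "\<And>a b c m n l. m \<in> el M a \<Longrightarrow> n \<in> el N b \<Longrightarrow> l \<in> el L c \<Longrightarrow>
      h (a + (b + c)) (gp M (N \<boxtimes> L) a (b + c) (a + (b + c)) m (gp N L b c (b + c) n l)) =
      h' (a + (b + c)) (gp M (N \<boxtimes> L) a (b + c) (a + (b + c)) m (gp N L b c (b + c) n l))"
  shows "h = h'"
proof -
  note NL = gr_tensor_pmod[OF N L]
  show ?thesis
  proof (rule gr_ext[OF M NL h h'])
    fix u w m z assume m: "m \<in> el M u" and z: "z \<in> el (N \<boxtimes> L) w"
    from gr_ext[OF N L curry_right[OF M NL h m] curry_right[OF M NL h' m]]
    have "(\<lambda>w. \<lambda>z\<in>el (N \<boxtimes> L) w. h (u + w) (gp M (N \<boxtimes> L) u w (u + w) m z)) =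
      (\<lambda>w. \<lambda>z\<in>el (N \<boxtimes> L) w. h' (u + w) (gp M (N \<boxtimes> L) u w (u + w) m z))"
      by (simp add: eq m gr_pure_closed N L)
    from fun_cong[OF fun_cong[OF this], of w z] z
    show "h (u + w) (gp M (N \<boxtimes> L) u w (u + w) m z) = h' (u + w) (gp M (N \<boxtimes> L) u w (u + w) m z)"
      by simp
  qed
qed

text \<open>The universal property concerns two factors only. For each \<open>l\<close> the family
  is lifted in \<open>m\<close> and \<open>n\<close> by \<open>T1\<close>; the lifts
  \<open>H c l\<close> are then shown to depend linearly and naturally on \<open>l\<close>, so that
  a second lift produces the map on the triple product.\<close>

lemma gr_trilift:
  assumes M: "M \<in> pm" and N: "N \<in> pm" and L: "L \<in> pm" and K: "K \<in> pm"
    and T1: "\<And>c l. l \<in> el L c \<Longrightarrow> bimap M N (shift c K) (\<lambda>a b m n. \<tau> a b c m n l)"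
    and T2: "\<And>a b m n. m \<in> el M a \<Longrightarrow> n \<in> el N b \<Longrightarrow>
      (\<lambda>c. \<lambda>l\<in>el L c. \<tau> a b c m n l) \<in> hm L K (a + b)"
  obtains h where "h \<in> nat_trans R ((M \<boxtimes> N) \<boxtimes> L) K"
    and "\<And>a b c m n l. m \<in> el M a \<Longrightarrow> n \<in> el N b \<Longrightarrow> l \<in> el L c \<Longrightarrow>
      h (a + b + c) (gp (M \<boxtimes> N) L (a + b) c (a + b + c) (gp M N a b (a + b) m n) l) =
      \<tau> a b c m n l"
proof -
  note MN = gr_tensor_pmod[OF M N]
  have \<tau>_closed: "\<tau> a b c m n l \<in> el K (a + b + c)"
    if "m \<in> el M a" "n \<in> el N b" "l \<in> el L c" for a b c m n l
    using bilin_closed[OF bimap_bilin[OF T1[OF that(3)]] that(1,2)] by simp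
  have \<tau>_add: "\<tau> a b c m n (l \<oplus>\<^bsub>stalk L c\<^esub> l') = \<tau> a b c m n l \<oplus>\<^bsub>stalk K (a + b + c)\<^esub> \<tau> a b c m n l'"
    if "m \<in> el M a" "n \<in> el N b" "l \<in> el L c" "l' \<in> el L c"
    for a b c m n l l'
    using hm_add[OF T2[OF that(1,2)] that(3,4)] that by (simp add: pmod_stalk[OF L] add_ac)
  have \<tau>_smult: "\<tau> a b c m n (x \<odot>\<^bsub>stalk L c\<^esub> l) = x \<odot>\<^bsub>stalk K (a + b + c)\<^esub> \<tau> a b c m n l"
    if "m \<in> el M a" "n \<in> el N b" "l \<in> el L c" "x \<in> carrier R"
    for a b c m n l x
    using hm_smult[OF T2[OF that(1,2)] that(4,3)] that by (simp add: pmod_stalk[OF L] add_ac)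
  have \<tau>_natural: "\<tau> a b c' m n (tmap L c c' l) = tmap K (a + b + c) (a + b + c') (\<tau> a b c m n l)"
    if "m \<in> el M a" "n \<in> el N b" "l \<in> el L c" "c \<le> c'"
    for a b c c' m n l
    using hm_natural[OF T2[OF that(1,2)] that(4,3)] that by (simp add: pmod_tmap_closed[OF L] add_ac)
  let ?Q = "\<lambda>c l h. h \<in> hm (M \<boxtimes> N) K c \<and>
    (\<forall>a b r m n. a + b \<le> r \<longrightarrow> m \<in> el M a \<longrightarrow> n \<in> el N b \<longrightarrow>
      h r (gp M N a b r m n) = tmap K (a + b + c) (r + c) (\<tau> a b c m n l))"
  \<comment> \<open>Any choice will do, since the values on pure tensors pin it down.\<close>
  define H where "H = (\<lambda>c l. SOME h. ?Q c l h)"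
  have HQ: "?Q c l (H c l)" if "l \<in> el L c" for c l
  proof -
    have "\<exists>h. ?Q c l h"
      by (rule gr_lift[OF M N shift_pmod[OF K] T1[OF that]]) auto
    then show ?thesis unfolding H_def by (rule someI_ex)
  qed
  have H: "H c l \<in> hm (M \<boxtimes> N) K c" if "l \<in> el L c" for c l
    using HQ[OF that] by blast
  have H': "H c l r (gp M N a b r m n) = tmap K (a + b + c) (r + c) (\<tau> a b c m n l)"
    if "l \<in> el L c" "a + b \<le> r" "m \<in> el M a" "n \<in> el N b"
    for c l a b r m n
    using HQ[OF that(1)] that(2-4) by blast
  have Hc: "H c l u z \<in> el K (u + c)"
    if "l \<in> el L c" "z \<in> el (M \<boxtimes> N) u" for c l u z
    by (rule hm_closed[OF H[OF that(1)] that(2) refl])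
  note Ka = tmap_add[OF K] tmap_smult[OF K] pmod_stalk[OF K] pmod_tmap_closed[OF K]
  have "bimap (M \<boxtimes> N) L K (\<lambda>u c z l. H c l u z)"
  proof (rule bimapI)
    fix u c
    show "bilin R (stalk (M \<boxtimes> N) u) (stalk L c) (stalk K (u + c)) (\<lambda>z l. H c l u z)"
    proof (rule bilinI)
      \<comment> \<open>Additivity in \<open>l\<close> is not part of what the first lift provides.
        It is verified for pure \<open>z\<close>, where it comes from \<open>T2\<close>, and carried
        over sums by induction on \<open>z\<close>.\<close>
      fix z l l' assume z: "z \<in> el (M \<boxtimes> N) u" and l: "l \<in> el L c" and l': "l' \<in> el L c"
      have ll': "l \<oplus>\<^bsub>stalk L c\<^esub> l' \<in> el L c" by (rule mod_add[OF pmod_stalk[OF L] l l'])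
      from z show "H c (l \<oplus>\<^bsub>stalk L c\<^esub> l') u z = H c l u z \<oplus>\<^bsub>stalk K (u + c)\<^esub> H c l' u z"
      proof (induction rule: gr_induct[OF M N, consumes 1, case_names pure add])
        case (pure a b m n)
        then show ?case
          by (simp add: H'[OF l] H'[OF l'] H'[OF ll'] \<tau>_add l l' \<tau>_closed Ka add_right_mono_preorder)
      next
        case (add y z)
        then show ?case
          by (simp add: hm_add[OF H[OF l]] hm_add[OF H[OF l']] hm_add[OF H[OF ll']] Hc[OF l] Hc[OF l'] Ka
              mod_a_assoc mod_a_comm mod_a_lcomm)
      qed
    next
      fix z l x assume x: "x \<in> carrier R" and z: "z \<in> el (M \<boxtimes> N) u" and l: "l \<in> el L c"
      have xl: "x \<odot>\<^bsub>stalk L c\<^esub> l \<in> el L c" by (rule mod_smult[OF pmod_stalk[OF L] x l])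
      from z show "H c (x \<odot>\<^bsub>stalk L c\<^esub> l) u z = x \<odot>\<^bsub>stalk K (u + c)\<^esub> H c l u z"
      proof (induction rule: gr_induct[OF M N, consumes 1, case_names pure add])
        case (pure a b m n)
        then show ?case
          by (simp add: H'[OF l] H'[OF xl] \<tau>_smult x l \<tau>_closed Ka add_right_mono_preorder)
      next
        case (add y z)
        then show ?case
          by (simp add: hm_add[OF H[OF l]] hm_add[OF H[OF xl]] Hc[OF l] Ka mod_smult_add x)
      qed
    qed (simp_all add: Hc hm_add[OF H] hm_smult[OF H])
  next
    fix u c c' z l assume cc: "c \<le> c'" and z: "z \<in> el (M \<boxtimes> N) u" and l: "l \<in> el L c"
    have tl: "tmap L c c' l \<in> el L c'" by (rule pmod_tmap_closed[OF L cc l])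
    have ucc: "u + c \<le> u + c'" by (rule preordered_add_mono[OF order_refl cc])
    from z show "H c' (tmap L c c' l) u z = tmap K (u + c) (u + c') (H c l u z)"
    proof (induction rule: gr_induct[OF M N, consumes 1, case_names pure add])
      case (pure a b m n)
      then show ?case using ucc cc
        by (simp add: H'[OF l] H'[OF tl] \<tau>_natural l \<tau>_closed pmod_tmap_tmap[OF K] preordered_add_mono)
    next
      case (add y z)
      then show ?case using ucc
        by (simp add: hm_add[OF H[OF l]] hm_add[OF H[OF tl]] Hc[OF l] Ka)
    qed
  qed (simp add: hm_natural[OF H])
  from gr_lift[OF MN L K this] obtain h where h: "h \<in> nat_trans R ((M \<boxtimes> N) \<boxtimes> L) K"
    and h': "\<And>u c r z l. u + c \<le> r \<Longrightarrow> z \<in> el (M \<boxtimes> N) u \<Longrightarrow> l \<in> el L c \<Longrightarrow>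
      h r (gp (M \<boxtimes> N) L u c r z l) = tmap K (u + c) r (H c l u z)"
    by auto
  show thesis
    by (rule that[OF h]) (simp add: h' H' gr_pure_closed M N \<tau>_closed pmod_tmap_refl[OF K])
qed

text \<open>An auxiliary symmetry, used to transport the inverse of the associator; any
  transformation with the given values is good enough, hence \<open>SOME\<close>.\<close>

definition gr_swap :: "('p, 'a, 'u) pmod \<Rightarrow> ('p, 'a, 'u) pmod \<Rightarrow> 'p \<Rightarrow> 'u \<Rightarrow> 'u" where
  "gr_swap M N = (SOME h. h \<in> nat_trans R (M \<boxtimes> N) (N \<boxtimes> M) \<and>
    (\<forall>s t m n. m \<in> el M s \<longrightarrow> n \<in> el N t \<longrightarrow>
      h (s + t) (gp M N s t (s + t) m n) = gp N M t s (s + t) n m))"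

lemma gr_swap:
  assumes M: "M \<in> pm" and N: "N \<in> pm"
  shows gr_swap_nat: "gr_swap M N \<in> nat_trans R (M \<boxtimes> N) (N \<boxtimes> M)"
    and gr_swap_pure: "m \<in> el M s \<Longrightarrow> n \<in> el N t \<Longrightarrow>
      gr_swap M N (s + t) (gp M N s t (s + t) m n) = gp N M t s (s + t) n m"
proof -
  note NM = gr_tensor_pmod[OF N M]
  from gr_lift[OF M N NM bimap_swap[OF gr_pure_bimap[OF N M]]]
  obtain h where h: "h \<in> nat_trans R (M \<boxtimes> N) (N \<boxtimes> M)"
    and h': "\<And>s t r m n. s + t \<le> r \<Longrightarrow> m \<in> el M s \<Longrightarrow> n \<in> el N t \<Longrightarrow>
      h r (gp M N s t r m n) = tmap (N \<boxtimes> M) (s + t) r (gp N M t s (t + s) n m)"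
    by auto
  have "\<forall>s t m n. m \<in> el M s \<longrightarrow> n \<in> el N t \<longrightarrow>
      h (s + t) (gp M N s t (s + t) m n) = gp N M t s (s + t) n m"
  proof (intro allI impI)
    fix s t m n assume mn: "m \<in> el M s" "n \<in> el N t"
    have "gp N M t s (s + t) n m \<in> el (N \<boxtimes> M) (s + t)"
      by (rule gr_pure_closed[OF N M _ mn(2,1)]) (simp add: add.commute)
    then show "h (s + t) (gp M N s t (s + t) m n) = gp N M t s (s + t) n m"
      using mn by (simp add: h' pmod_tmap_refl[OF NM] add.commute[of t s])
  qed
  with h have "\<exists>h. h \<in> nat_trans R (M \<boxtimes> N) (N \<boxtimes> M) \<and>
    (\<forall>s t m n. m \<in> el M s \<longrightarrow> n \<in> el N t \<longrightarrow>
      h (s + t) (gp M N s t (s + t) m n) = gp N M t s (s + t) n m)" by blast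
  from someI_ex[OF this] show "gr_swap M N \<in> nat_trans R (M \<boxtimes> N) (N \<boxtimes> M)"
    "m \<in> el M s \<Longrightarrow> n \<in> el N t \<Longrightarrow>
      gr_swap M N (s + t) (gp M N s t (s + t) m n) = gp N M t s (s + t) n m"
    unfolding gr_swap_def by blast+
qed

lemma gr_pure_left_hm:
  assumes "M \<in> pm" "N \<in> pm" "n \<in> el N t"
  shows "(\<lambda>s. \<lambda>m\<in>el M s. gp M N s t (s + t) m n) \<in> hm M (M \<boxtimes> N) t"
  by (rule bimap_left_hm[OF assms(1) gr_pure_bimap[OF assms(1,2)] assms(3)])

lemma gr_pure_right_hm:
  assumes "M \<in> pm" "N \<in> pm" "m \<in> el M s"
  shows "(\<lambda>t. \<lambda>n\<in>el N t. gp M N s t (s + t) m n) \<in> hm N (M \<boxtimes> N) s"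
  by (rule bimap_right_hm[OF assms(2) gr_pure_bimap[OF assms(1,2)] assms(3)])

text \<open>The inner tensor in degree \<open>p\<close> is a transition image from
  \<open>a + b\<close>, and the outer pure tensor is insensitive to transitions. It extends the
  formula for the associator from the exact inner degree to every \<open>p\<close> above it.\<close>

lemma gr_pure_shrink_left:
  assumes M: "M \<in> pm" and N: "N \<in> pm" and L: "L \<in> pm" and "a + b \<le> p" "p + c \<le> r"
    and m: "m \<in> el M a" and n: "n \<in> el N b" and l: "l \<in> el L c"
  shows "gp (M \<boxtimes> N) L p c r (gp M N a b p m n) l =
    gp (M \<boxtimes> N) L (a + b) c r (gp M N a b (a + b) m n) l"
  using gr_pure_left[OF gr_tensor_pmod[OF M N] L assms(4,5) gr_pure_closed[OF M N order_refl m n] l]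
    gr_tmap(2)[OF M N assms(4) order_refl m n] by simp

lemma gr_assoc:
  assumes M: "M \<in> pm" and N: "N \<in> pm" and L: "L \<in> pm"
  shows gr_assoc_nat: "gr_assoc R \<V> M N L \<in> nat_trans R ((M \<boxtimes> N) \<boxtimes> L) (M \<boxtimes> (N \<boxtimes> L))"
    and gr_assoc_pure: "\<And>a b c p r m n l. a + b \<le> p \<Longrightarrow> p + c \<le> r \<Longrightarrow>
      m \<in> el M a \<Longrightarrow> n \<in> el N b \<Longrightarrow> l \<in> el L c \<Longrightarrow>
      gr_assoc R \<V> M N L r (gp (M \<boxtimes> N) L p c r (gp M N a b p m n) l) =
      gp M (N \<boxtimes> L) a (b + c) r m (gp N L b c (b + c) n l)"
proof -
  note MN = gr_tensor_pmod[OF M N] and NL = gr_tensor_pmod[OF N L]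
  note K = gr_tensor_pmod[OF M NL]
  let ?K = "M \<boxtimes> (N \<boxtimes> L)"
  let ?\<tau> = "\<lambda>a b c m n l. gp M (N \<boxtimes> L) a (b + c) (a + b + c) m (gp N L b c (b + c) n l)"
  \<comment> \<open>With \<open>l\<close> fixed, tensoring with \<open>l\<close> is a morphism of
    degree \<open>c\<close> out of \<open>N\<close>; together with the identity of \<open>M\<close>
    it is plugged into the universal bilinear map.\<close>
  have T1: "bimap M N (shift c ?K) (\<lambda>a b m n. ?\<tau> a b c m n l)" if "l \<in> el L c" for c l
    using bimap_cong[OF bimap_comp_homs[OF id_trans_hm[OF M] gr_pure_left_hm[OF N L that]
        gr_pure_bimap[OF M NL]] M N,
        of "\<lambda>a b m n. ?\<tau> a b c m n l"]
    by (simp add: add.assoc)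
  \<comment> \<open>With \<open>m\<close> and \<open>n\<close> fixed, the family is a composite of
    two morphisms, tensoring with \<open>n\<close> (degree \<open>b\<close>) and then with
    \<open>m\<close> (degree \<open>a\<close>).\<close>
  have T2: "(\<lambda>c. \<lambda>l\<in>el L c. ?\<tau> a b c m n l) \<in> hm L ?K (a + b)"
    if m: "m \<in> el M a" and n: "n \<in> el N b" for a b m n
  proof -
    note h = hom_comp_hm[OF L gr_pure_right_hm[OF N L n] gr_pure_right_hm[OF M NL m]]
    show ?thesis
      by (rule hm_cong[OF h[unfolded add.commute[of b a]]]) (simp_all add: gr_pure_closed N L n add.assoc)
  qed
  let ?Q = "\<lambda>h. h \<in> nat_trans R ((M \<boxtimes> N) \<boxtimes> L) ?K \<and>
        (\<forall>a b c r. a + b + c \<le> r \<longrightarrow>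
          (\<forall>m\<in>el M a. \<forall>n\<in>el N b. \<forall>l\<in>el L c.
             h r (gp (M \<boxtimes> N) L (a + b) c r (gp M N a b (a + b) m n) l) =
             gp M (N \<boxtimes> L) a (b + c) r m (gp N L b c (b + c) n l)))"
  from gr_trilift[OF M N L K T1 T2]
  obtain h where h: "h \<in> nat_trans R ((M \<boxtimes> N) \<boxtimes> L) ?K" and
    h': "\<And>a b c m n l. m \<in> el M a \<Longrightarrow> n \<in> el N b \<Longrightarrow> l \<in> el L c \<Longrightarrow>
      h (a + b + c) (gp (M \<boxtimes> N) L (a + b) c (a + b + c) (gp M N a b (a + b) m n) l) = ?\<tau> a b c m n l"
    by blast
  have Q: "?Q h"
  proof (intro conjI h allI impI ballI)
    fix a b c r m n l
    assume r: "a + b + c \<le> r" and m: "m \<in> el M a" and n: "n \<in> el N b" and l: "l \<in> el L c"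
    have e: "a + (b + c) \<le> a + b + c" by (simp add: add.assoc)
    show "h r (gp (M \<boxtimes> N) L (a + b) c r (gp M N a b (a + b) m n) l) =
             gp M (N \<boxtimes> L) a (b + c) r m (gp N L b c (b + c) n l)"
      using nat_gr_pure[OF MN L h r gr_pure_closed[OF M N order_refl m n] l]
        gr_tmap(2)[OF M NL r e m gr_pure_closed[OF N L order_refl n l]] h'[OF m n l] by simp
  qed
  moreover have "h'' = h" if "?Q h''" for h''
    by (rule gr_ext_left[OF M N L]) (use that Q in auto)
  ultimately have ex: "\<exists>!h. ?Q h" by (intro ex1I[of ?Q]) auto
  have *: "?Q (gr_assoc R \<V> M N L)"
    unfolding gr_assoc_def by (rule theI'[OF ex])
  then show "gr_assoc R \<V> M N L \<in> nat_trans R ((M \<boxtimes> N) \<boxtimes> L) ?K" by blast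
  show "gr_assoc R \<V> M N L r (gp (M \<boxtimes> N) L p c r (gp M N a b p m n) l) =
      gp M (N \<boxtimes> L) a (b + c) r m (gp N L b c (b + c) n l)"
    if p: "a + b \<le> p" and r: "p + c \<le> r" and mnl: "m \<in> el M a" "n \<in> el N b" "l \<in> el L c"
    for a b c p r m n l
  proof -
    have "a + b + c \<le> r" using add_right_mono_preorder[OF p] r by (rule order_trans)
    then show ?thesis
      using * mnl by (simp add: gr_pure_shrink_left[OF M N L p r mnl])
  qed
qed

text \<open>The inverse of the associator is a trilinear lift from \<open>(N \<boxtimes> L) \<boxtimes> M\<close>, transported along the swap
  of the outer factors.\<close>

lemma gr_assoc_inverse:
  assumes M: "M \<in> pm" and N: "N \<in> pm" and L: "L \<in> pm"
  obtains k where "k \<in> nat_trans R (M \<boxtimes> (N \<boxtimes> L)) ((M \<boxtimes> N) \<boxtimes> L)"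
    and "hom_comp ((M \<boxtimes> N) \<boxtimes> L) 0 k (gr_assoc R \<V> M N L) = id_trans ((M \<boxtimes> N) \<boxtimes> L)"
    and "hom_comp (M \<boxtimes> (N \<boxtimes> L)) 0 (gr_assoc R \<V> M N L) k = id_trans (M \<boxtimes> (N \<boxtimes> L))"
proof -
  note MN = gr_tensor_pmod[OF M N] and NL = gr_tensor_pmod[OF N L]
  note K = gr_tensor_pmod[OF MN L] and K' = gr_tensor_pmod[OF M NL]
  let ?K = "(M \<boxtimes> N) \<boxtimes> L"
  \<comment> \<open>\<open>gr_trilift\<close> lifts out of left-nested products, hence the cyclic
    order of the arguments with \<open>m\<close> last.\<close>
  let ?\<tau> = "\<lambda>b c a n l m. gp (M \<boxtimes> N) L (a + b) c (a + b + c) (gp M N a b (a + b) m n) l"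
  have T1: "bimap N L (shift a ?K) (\<lambda>b c n l. ?\<tau> b c a n l m)" if "m \<in> el M a" for a m
    using bimap_cong[OF bimap_comp_homs[OF gr_pure_right_hm[OF M N that] id_trans_hm[OF L]
        gr_pure_bimap[OF MN L]] N L,
        of "\<lambda>b c n l. ?\<tau> b c a n l m"]
    by (simp add: add.commute[of _ a])
  have T2: "(\<lambda>a. \<lambda>m\<in>el M a. ?\<tau> b c a n l m) \<in> hm M ?K (b + c)"
    if n: "n \<in> el N b" and l: "l \<in> el L c" for b c n l
  proof -
    note h = hom_comp_hm[OF M gr_pure_left_hm[OF M N n] gr_pure_left_hm[OF MN L l]]
    show ?thesis
      by (rule hm_cong[OF h]) (simp_all add: gr_pure_closed M N n add.commute[of b])
  qed
  from gr_trilift[OF N L M K T1 T2]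
  obtain h where h: "h \<in> nat_trans R ((N \<boxtimes> L) \<boxtimes> M) ?K" and
    h': "\<And>b c a n l m. n \<in> el N b \<Longrightarrow> l \<in> el L c \<Longrightarrow> m \<in> el M a \<Longrightarrow>
      h (b + c + a) (gp (N \<boxtimes> L) M (b + c) a (b + c + a) (gp N L b c (b + c) n l) m) = ?\<tau> b c a n l m"
    by blast
  define k where "k = hom_comp (M \<boxtimes> (N \<boxtimes> L)) 0 h (gr_swap M (N \<boxtimes> L))"
  have k: "k \<in> nat_trans R (M \<boxtimes> (N \<boxtimes> L)) ?K"
    using hom_comp_hm[OF K', of "gr_swap M (N \<boxtimes> L)" 0 "(N \<boxtimes> L) \<boxtimes> M" h 0 ?K] gr_swap_nat[OF M NL] h
    by (simp add: k_def)
  have kv: "k (a + (b + c)) (gp M (N \<boxtimes> L) a (b + c) (a + (b + c)) m (gp N L b c (b + c) n l)) =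
      ?\<tau> b c a n l m"
    if "m \<in> el M a" "n \<in> el N b" "l \<in> el L c" for a b c m n l
    using h'[OF that(2,3,1), unfolded add.commute[of "b + c" a]] that
    by (simp add: k_def gr_pure_closed M N L NL gr_swap_pure[OF M NL])
  have \<alpha>: "gr_assoc R \<V> M N L \<in> nat_trans R ?K (M \<boxtimes> (N \<boxtimes> L))" by (rule gr_assoc_nat[OF M N L])
  show thesis
  proof (rule that[OF k])
    show "hom_comp ?K 0 k (gr_assoc R \<V> M N L) = id_trans ?K"
    proof (rule gr_ext_left[OF M N L])
      show "hom_comp ?K 0 k (gr_assoc R \<V> M N L) \<in> nat_trans R ?K ?K"
        using hom_comp_hm[OF K, of "gr_assoc R \<V> M N L" 0 "M \<boxtimes> (N \<boxtimes> L)" k 0 ?K] \<alpha> k by simp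
      show "id_trans ?K \<in> nat_trans R ?K ?K" using id_trans_hm[OF K] by simp
      fix a b c m n l assume mnl: "m \<in> el M a" "n \<in> el N b" "l \<in> el L c"
      then show "hom_comp ?K 0 k (gr_assoc R \<V> M N L) (a + b + c)
          (gp (M \<boxtimes> N) L (a + b) c (a + b + c) (gp M N a b (a + b) m n) l) =
        id_trans ?K (a + b + c) (gp (M \<boxtimes> N) L (a + b) c (a + b + c) (gp M N a b (a + b) m n) l)"
        using kv[OF mnl] by (simp add: gr_pure_closed M N L MN gr_assoc_pure[OF M N L] add.assoc)
    qed
    show "hom_comp (M \<boxtimes> (N \<boxtimes> L)) 0 (gr_assoc R \<V> M N L) k = id_trans (M \<boxtimes> (N \<boxtimes> L))"
    proof (rule gr_ext_right[OF M N L])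
      show "hom_comp (M \<boxtimes> (N \<boxtimes> L)) 0 (gr_assoc R \<V> M N L) k \<in> nat_trans R (M \<boxtimes> (N \<boxtimes> L)) (M \<boxtimes> (N \<boxtimes> L))"
        using hom_comp_hm[OF K', of k 0 ?K "gr_assoc R \<V> M N L" 0 "M \<boxtimes> (N \<boxtimes> L)"] \<alpha> k by simp
      show "id_trans (M \<boxtimes> (N \<boxtimes> L)) \<in> nat_trans R (M \<boxtimes> (N \<boxtimes> L)) (M \<boxtimes> (N \<boxtimes> L))" using id_trans_hm[OF K'] by simp
      fix a b c m n l assume mnl: "m \<in> el M a" "n \<in> el N b" "l \<in> el L c"
      then show "hom_comp (M \<boxtimes> (N \<boxtimes> L)) 0 (gr_assoc R \<V> M N L) k (a + (b + c))
          (gp M (N \<boxtimes> L) a (b + c) (a + (b + c)) m (gp N L b c (b + c) n l)) =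
        id_trans (M \<boxtimes> (N \<boxtimes> L)) (a + (b + c))
          (gp M (N \<boxtimes> L) a (b + c) (a + (b + c)) m (gp N L b c (b + c) n l))"
        by (simp add: gr_pure_closed M N L NL kv gr_assoc_pure[OF M N L] add.assoc)
    qed
  qed
qed


subsection \<open>The unit\<close>

abbreviation I where "I \<equiv> (unit_pmod R \<V> :: ('p, 'a, 'u) pmod)"
abbreviation unit_gen (\<open>\<upsilon>\<close>) where "\<upsilon> \<equiv> unit_elem R \<V>"

lemma unit_code_inj: "inj_on (code \<V> (carrier R)) (carrier R)"
  by (rule code_inj_image(1)[OF V small_coefficients[OF V]])

lemma unit_copy_onto: "lin_onto R \<upsilon> (ring_module R) (copy_module \<V> (ring_module R))"
  using copy_module_onto[of \<V> "ring_module R", OF _ ring_module_is_module] unit_code_inj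
  by (simp add: unit_elem_def)

lemma unit_stalk_pos: "0 \<le> x \<Longrightarrow> stalk I x = copy_module \<V> (ring_module R)"
  and unit_stalk_neg: "\<not> 0 \<le> x \<Longrightarrow> stalk I x = (copy_module \<V> (ring_module R))\<lparr>carrier := {\<upsilon> \<zero>}\<rparr>"
  using lin_onto_zero[OF unit_copy_onto] by (simp_all add: unit_pmod_def Let_def)

lemma unit_onto: "0 \<le> x \<Longrightarrow> lin_onto R \<upsilon> (ring_module R) (stalk I x)"
  by (simp add: unit_stalk_pos unit_copy_onto)

lemma unit_zero: "\<zero>\<^bsub>stalk I x\<^esub> = \<upsilon> \<zero>"
  using lin_onto_zero[OF unit_copy_onto] by (simp add: unit_pmod_def Let_def)

lemma unit_carrier_neg: "\<not> 0 \<le> x \<Longrightarrow> el I x = {\<zero>\<^bsub>stalk I x\<^esub>}"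
  unfolding unit_zero by (simp add: unit_stalk_neg)

lemma unit_carrier_pos: "0 \<le> x \<Longrightarrow> el I x = \<upsilon> ` carrier R"
  using lin_onto_image[OF unit_onto] by simp

lemma unit_elem_closed: "0 \<le> x \<Longrightarrow> a \<in> carrier R \<Longrightarrow> \<upsilon> a \<in> el I x"
  by (simp add: unit_carrier_pos)

lemma unit_elem_smult: "0 \<le> x \<Longrightarrow> a \<in> carrier R \<Longrightarrow> a \<odot>\<^bsub>stalk I x\<^esub> \<upsilon> \<one> = \<upsilon> a"
  using lin_onto_smult[OF unit_onto, of x a \<one>] by simp

lemma unit_module: "module R (stalk I x)"
proof (cases "0 \<le> x")
  case True
  then show ?thesis using lin_onto_module[OF ring_module_is_module unit_onto] by blast
next
  case False
  let ?K = "copy_module \<V> (ring_module R)"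
  have K: "module R ?K" by (rule lin_onto_module[OF ring_module_is_module unit_copy_onto])
  interpret K: module R ?K by (rule K)
  have z: "\<upsilon> \<zero> = \<zero>\<^bsub>?K\<^esub>" using lin_onto_zero[OF unit_copy_onto] by simp
  have "submodule {\<zero>\<^bsub>?K\<^esub>} R ?K"
    by (rule K.submoduleI) (use K in auto)
  from submodule.submodule_is_module[OF this K] False show ?thesis
    by (simp add: unit_stalk_neg z)
qed

lemma unit_tmap: "0 \<le> x \<Longrightarrow> a \<in> carrier R \<Longrightarrow> tmap I x y (\<upsilon> a) = \<upsilon> a"
  using lin_onto_closed[OF unit_copy_onto, of a] by (simp add: unit_pmod_def Let_def)

lemma unit_tmap_zero: "tmap I x y \<zero>\<^bsub>stalk I x\<^esub> = \<zero>\<^bsub>stalk I y\<^esub>"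
  using unit_tmap[of x \<zero>] lin_onto_zero[OF unit_copy_onto]
  by (cases "0 \<le> x") (auto simp: unit_zero unit_pmod_def Let_def)

lemma unit_cases:
  assumes "z \<in> el I x"
  obtains (pos) a where "0 \<le> x" "a \<in> carrier R" "z = \<upsilon> a" | (neg) "\<not> 0 \<le> x" "z = \<zero>\<^bsub>stalk I x\<^esub>"
  using assms unit_carrier_pos[of x] unit_carrier_neg[of x] by (cases "0 \<le> x") auto

lemma unit_pmod: "I \<in> pm"
proof -
  note K = lin_onto_module[OF ring_module_is_module unit_copy_onto]
  have lin: "tmap I x y \<in> lin_maps R (stalk I x) (stalk I y)" if xy: "x \<le> y" for x y
  proof (cases "0 \<le> x")
    case True
    then have "0 \<le> y" using xy by (rule order_trans)
    with True K show ?thesis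
      by (intro lin_mapsI) (auto simp: unit_stalk_pos unit_pmod_def Let_def restrict_def extensional_def)
  next
    case False
    note c = unit_carrier_neg[OF False]
    show ?thesis
    proof (rule lin_mapsI)
      show "tmap I x y \<in> extensional (el I x)"
        using False by (auto simp: unit_pmod_def Let_def)
    qed (use unit_module[of x] unit_module[of y] in \<open>simp_all add: c unit_tmap_zero\<close>)
  qed
  have "el I x \<in> \<V>" for x
  proof -
    \<comment> \<open>Where \<open>0 \<le> x\<close> fails the stalk is just the coded zero, so
      every stalk lies in the coded ring, and closure under smaller sets applies.\<close>
    have "el I x \<subseteq> \<upsilon> ` carrier R"
      by (cases "0 \<le> x") (auto simp: unit_carrier_pos unit_carrier_neg unit_zero)
    moreover have "\<upsilon> ` carrier R \<in> \<V>"
      unfolding unit_elem_def by (rule code_inj_image(2)[OF V small_coefficients[OF V]])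
    ultimately show ?thesis
      using V subset_imp_lepoll unfolding universe_def by blast
  qed
  moreover have "tmap I x x m = m" if "m \<in> el I x" for x m
    using that by (cases rule: unit_cases) (simp_all add: unit_tmap unit_tmap_zero)
  moreover have "tmap I y z (tmap I x y m) = tmap I x z m"
    if "x \<le> y" "y \<le> z" "m \<in> el I x" for x y z m
    using that(3)
  proof (cases rule: unit_cases)
    case (pos a)
    then have "0 \<le> y" using that(1) order_trans by blast
    with pos show ?thesis by (simp add: unit_tmap)
  qed (simp add: unit_tmap_zero)
  ultimately show ?thesis
    using lin unit_module unfolding pmods_def persistence_module_def by blast
qed

text \<open>The Yoneda map: the transformation out of the unit that takes the generator in degree 0
  to \<open>k\<close>. Decoding recovers the scalar from an element of the unit.\<close>

definition unit_map :: "('p, 'a, 'u) pmod \<Rightarrow> 'u \<Rightarrow> 'p \<Rightarrow> 'u \<Rightarrow> 'u" where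
  "unit_map K k = (\<lambda>x. \<lambda>z\<in>el I x.
     if 0 \<le> x then decode \<V> (carrier R) z \<odot>\<^bsub>stalk K x\<^esub> tmap K 0 x k else \<zero>\<^bsub>stalk K x\<^esub>)"

lemma unit_map_elem: "0 \<le> x \<Longrightarrow> a \<in> carrier R \<Longrightarrow> unit_map K k x (\<upsilon> a) = a \<odot>\<^bsub>stalk K x\<^esub> tmap K 0 x k"
  by (simp add: unit_map_def unit_elem_closed) (simp add: unit_elem_def decode_code[OF unit_code_inj])

lemma unit_map_neg: "\<not> 0 \<le> x \<Longrightarrow> z \<in> el I x \<Longrightarrow> unit_map K k x z = \<zero>\<^bsub>stalk K x\<^esub>"
  by (simp add: unit_map_def)

lemma unit_map_nat:
  assumes K: "K \<in> pmods R \<U>" and k: "k \<in> el K 0"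
  shows "unit_map K k \<in> nat_trans R I K" and "unit_map K k 0 (\<upsilon> \<one>) = k"
proof -
  note [simp] = pmod_stalk[OF K]
  have tk: "tmap K 0 x k \<in> el K x" if "0 \<le> x" for x
    by (rule pmod_tmap_closed[OF K that k])
  show "unit_map K k 0 (\<upsilon> \<one>) = k"
    using unit_map_elem[of 0 \<one> K k] k by (simp add: pmod_tmap_refl[OF K])
  show "unit_map K k \<in> nat_trans R I K"
  proof (rule nat_transI)
    fix x
    show "unit_map K k x \<in> lin_maps R (stalk I x) (stalk K x)"
    proof (cases "0 \<le> x")
      case True
      note o = unit_onto[OF True] and c = unit_carrier_pos[OF True]
      have ad: "\<upsilon> a \<oplus>\<^bsub>stalk I x\<^esub> \<upsilon> b = \<upsilon> (a \<oplus> b)" if "a \<in> carrier R" "b \<in> carrier R" for a b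
        using lin_onto_add[OF o] that by simp
      have sm: "a \<odot>\<^bsub>stalk I x\<^esub> \<upsilon> b = \<upsilon> (a \<otimes> b)" if "a \<in> carrier R" "b \<in> carrier R" for a b
        using lin_onto_smult[OF o] that by simp
      show ?thesis
      proof (rule lin_mapsI)
        show "unit_map K k x \<in> extensional (el I x)" by (simp add: unit_map_def)
      qed (auto simp: c unit_map_elem[OF True] ad sm tk[OF True] mod_add_smult mod_smult_smult)
    next
      case False
      note c = unit_carrier_neg[OF False]
      show ?thesis
      proof (rule lin_mapsI)
        show "unit_map K k x \<in> extensional (el I x)" by (simp add: unit_map_def)
      qed (use unit_module[of x] in \<open>simp_all add: c unit_map_neg[OF False]\<close>)
    qed
    fix y z assume xy: "x \<le> y" and z: "z \<in> el I x"
    from z show "unit_map K k y (tmap I x y z) = tmap K x y (unit_map K k x z)"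
    proof (cases rule: unit_cases)
      case (pos a)
      then have y: "0 \<le> y" using xy order_trans by blast
      show ?thesis
        using pos xy y k tk by (simp add: unit_tmap unit_map_elem tmap_smult[OF K] pmod_tmap_tmap[OF K])
    next
      case neg
      have "unit_map K k y \<zero>\<^bsub>stalk I y\<^esub> = \<zero>\<^bsub>stalk K y\<^esub>"
      proof (cases "0 \<le> y")
        case True
        then show ?thesis using tk by (simp add: unit_zero unit_map_elem)
      qed (simp add: unit_map_neg mod_zero[OF unit_module])
      with neg xy z show ?thesis by (simp add: unit_tmap_zero unit_map_neg tmap_zero[OF K])
    qed
  qed
qed

text \<open>The element \<open>\<upsilon> a\<close> is \<open>a\<close> times the transported
  generator, so linearity and naturality fix its image.\<close>

lemma unit_nat_value:
  assumes h: "h \<in> nat_trans R I K" and x: "0 \<le> x" and a: "a \<in> carrier R"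
  shows "h x (\<upsilon> a) = a \<odot>\<^bsub>stalk K x\<^esub> tmap K 0 x (h 0 (\<upsilon> \<one>))"
  using nat_smult[OF h a unit_elem_closed[OF x one_closed]] nat_natural[OF h x unit_elem_closed[OF order_refl
      one_closed]]
  by (simp add: unit_elem_smult x a unit_tmap)

lemma unit_ext:
  assumes h: "h \<in> nat_trans R I K" and h': "h' \<in> nat_trans R I K" and K: "K \<in> pmods R \<U>"
    and eq: "h 0 (\<upsilon> \<one>) = h' 0 (\<upsilon> \<one>)"
  shows "h = h'"
proof (rule nat_eqI[OF h h'])
  fix x z assume "z \<in> el I x"
  then show "h x z = h' x z"
  proof (cases rule: unit_cases)
    case (pos a)
    show ?thesis
      by (simp only: pos(3) unit_nat_value[OF h pos(1,2)] unit_nat_value[OF h' pos(1,2)] eq)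
  next
    case neg
    then show ?thesis
      using lin_zero[OF unit_module pmod_stalk[OF K] nat_lin[OF h]]
        lin_zero[OF unit_module pmod_stalk[OF K] nat_lin[OF h']] by simp
  qed
qed

lemma unit_one_closed [simp]: "\<upsilon> \<one> \<in> el I 0"
  by (rule unit_elem_closed) simp_all

text \<open>The scalar action as a bilinear family: \<open>m\<close> of degree \<open>t\<close> is
  classified by a map from the unit to \<open>shift t M\<close>, which settles the scalar argument,
  and the argument \<open>m\<close> is treated by cases on the unit. From \<open>0 \<le> s\<close>
  follows \<open>t \<le> s + t\<close>, so the required transition maps exist.\<close>

lemma lunit_bimap:
  assumes M: "M \<in> pm"
  shows "bimap I M M (\<lambda>s t z m. unit_map (shift t M) m s z)"
proof -
  note [simp] = pmod_stalk[OF M]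
  have n: "unit_map (shift t M) m \<in> hm I M t" if "m \<in> el M t" for t m
    using unit_map_nat(1)[OF shift_pmod[OF M], of m t] that by simp
  have le: "t \<le> s + t" if "0 \<le> s" for s t :: 'p
    using add_right_mono_preorder[OF that, of t] by simp
  note tm = pmod_tmap_closed[OF M le] tmap_add[OF M le] tmap_smult[OF M le]
  show ?thesis
  proof (rule bimapI)
    fix s t
    show "bilin R (stalk I s) (stalk M t) (stalk M (s + t)) (\<lambda>z m. unit_map (shift t M) m s z)"
    proof (rule bilinI)
      fix z m m' assume z: "z \<in> el I s" and m: "m \<in> el M t" "m' \<in> el M t"
      from z show "unit_map (shift t M) (m \<oplus>\<^bsub>stalk M t\<^esub> m') s z =
        unit_map (shift t M) m s z \<oplus>\<^bsub>stalk M (s + t)\<^esub> unit_map (shift t M) m' s z"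
        by (cases rule: unit_cases) (use z m in \<open>simp_all add: unit_map_elem unit_map_neg tm mod_smult_add\<close>)
    next
      fix a z m assume a: "a \<in> carrier R" and z: "z \<in> el I s" and m: "m \<in> el M t"
      from z show "unit_map (shift t M) (a \<odot>\<^bsub>stalk M t\<^esub> m) s z = a \<odot>\<^bsub>stalk M (s + t)\<^esub> unit_map (shift t M) m s z"
        by (cases rule: unit_cases) (use z a m in \<open>simp_all add: unit_map_elem unit_map_neg tm mod_smult_smult
            m_comm\<close>)
    qed (simp_all add: hm_closed[OF n] hm_add[OF n] hm_smult[OF n])
  next
    fix s t t' z m assume t: "t \<le> t'" and z: "z \<in> el I s" and m: "m \<in> el M t"
    have st: "s + t \<le> s + t'" by (rule preordered_add_mono[OF order_refl t])
    from z show "unit_map (shift t' M) (tmap M t t' m) s z =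
        tmap M (s + t) (s + t') (unit_map (shift t M) m s z)"
    proof (cases rule: unit_cases)
      case (pos a)
      then show ?thesis using t m st
        by (simp add: unit_map_elem tm tmap_smult[OF M st] pmod_tmap_tmap[OF M] le)
    next
      case neg
      then show ?thesis using z st by (simp add: unit_map_neg tmap_zero[OF M])
    qed
  qed (simp add: hm_natural[OF n])
qed

text \<open>Freezing \<open>m\<close> leaves maps out of the unit, and \<open>unit_ext\<close> tests
  those on the generator alone.\<close>

lemma gr_ext_lunit:
  assumes M: "M \<in> pm" and K: "K \<in> pm"
    and h: "h \<in> nat_trans R (I \<boxtimes> M) K" and h': "h' \<in> nat_trans R (I \<boxtimes> M) K"
    and eq: "\<And>t m. m \<in> el M t \<Longrightarrow> h t (gp I M 0 t t (\<upsilon> \<one>) m) = h' t (gp I M 0 t t (\<upsilon> \<one>) m)"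
  shows "h = h'"
proof (rule gr_ext[OF unit_pmod M h h'])
  fix s t z m assume z: "z \<in> el I s" and m: "m \<in> el M t"
  have "(\<lambda>s. \<lambda>z\<in>el I s. h (s + t) (gp I M s t (s + t) z m)) =
    (\<lambda>s. \<lambda>z\<in>el I s. h' (s + t) (gp I M s t (s + t) z m))"
    by (rule unit_ext[OF curry_left[OF unit_pmod M h m] curry_left[OF unit_pmod M h' m] shift_pmod[OF K]])
      (simp add: eq m)
  from fun_cong[OF fun_cong[OF this], of s z] z
  show "h (s + t) (gp I M s t (s + t) z m) = h' (s + t) (gp I M s t (s + t) z m)" by simp
qed

lemma gr_ext_runit:
  assumes M: "M \<in> pm" and K: "K \<in> pm"
    and h: "h \<in> nat_trans R (M \<boxtimes> I) K" and h': "h' \<in> nat_trans R (M \<boxtimes> I) K"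
    and eq: "\<And>t m. m \<in> el M t \<Longrightarrow> h t (gp M I t 0 t m (\<upsilon> \<one>)) = h' t (gp M I t 0 t m (\<upsilon> \<one>))"
  shows "h = h'"
proof (rule gr_ext[OF M unit_pmod h h'])
  fix s t z m assume m: "m \<in> el M s" and z: "z \<in> el I t"
  have "(\<lambda>t. \<lambda>z\<in>el I t. h (s + t) (gp M I s t (s + t) m z)) =
    (\<lambda>t. \<lambda>z\<in>el I t. h' (s + t) (gp M I s t (s + t) m z))"
    by (rule unit_ext[OF curry_right[OF M unit_pmod h m] curry_right[OF M unit_pmod h' m] shift_pmod[OF K]])
      (simp add: eq m)
  from fun_cong[OF fun_cong[OF this], of t z] z
  show "h (s + t) (gp M I s t (s + t) m z) = h' (s + t) (gp M I s t (s + t) m z)" by simp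
qed

lemma gr_lunit:
  assumes M: "M \<in> pm"
  shows gr_lunit_nat: "gr_lunit R \<V> M \<in> nat_trans R (I \<boxtimes> M) M"
    and gr_lunit_pure: "m \<in> el M t \<Longrightarrow> gr_lunit R \<V> M t (gp I M 0 t t (\<upsilon> \<one>) m) = m"
proof -
  let ?Q = "\<lambda>h. h \<in> nat_trans R (I \<boxtimes> M) M \<and>
        (\<forall>s t r. 0 \<le> s \<longrightarrow> s + t \<le> r \<longrightarrow> (\<forall>a\<in>carrier R. \<forall>m\<in>el M t.
             h r (gp I M s t r (\<upsilon> a) m) = a \<odot>\<^bsub>stalk M r\<^esub> tmap M t r m))"
  obtain h where h: "h \<in> nat_trans R (I \<boxtimes> M) M" and
    h': "\<And>s t r z m. s + t \<le> r \<Longrightarrow> z \<in> el I s \<Longrightarrow> m \<in> el M t \<Longrightarrow>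
      h r (gp I M s t r z m) = tmap M (s + t) r (unit_map (shift t M) m s z)"
    by (rule gr_lift[OF unit_pmod M M lunit_bimap[OF M]]) blast
  have Q: "?Q h"
  proof (intro conjI h allI impI ballI)
    fix s t r a m assume s: "0 \<le> s" and r: "s + t \<le> r" and a: "a \<in> carrier R" and m: "m \<in> el M t"
    have t: "t \<le> s + t" using add_right_mono_preorder[OF s, of t] by simp
    show "h r (gp I M s t r (\<upsilon> a) m) = a \<odot>\<^bsub>stalk M r\<^esub> tmap M t r m"
      using s r a m t
      by (simp add: h' unit_elem_closed unit_map_elem tmap_smult[OF M] pmod_tmap_closed[OF M]
          pmod_tmap_tmap[OF M])
  qed
  have one: "h'' t (gp I M 0 t t (\<upsilon> \<one>) m) = m" if "?Q h''" "m \<in> el M t" for h'' t m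
  proof -
    have "h'' t (gp I M 0 t t (\<upsilon> \<one>) m) = \<one> \<odot>\<^bsub>stalk M t\<^esub> tmap M t t m"
      using that by simp
    then show ?thesis using that(2) by (simp add: pmod_tmap_refl[OF M] pmod_stalk[OF M])
  qed
  have "h'' = h" if "?Q h''" for h''
    by (rule gr_ext_lunit[OF M M]) (use that Q one[OF that] one[OF Q] in auto)
  with Q have ex: "\<exists>!h. ?Q h" by (intro ex1I[of ?Q]) auto
  have *: "?Q (gr_lunit R \<V> M)"
    unfolding gr_lunit_def by (rule theI'[OF ex])
  then show "gr_lunit R \<V> M \<in> nat_trans R (I \<boxtimes> M) M" by blast
  show "m \<in> el M t \<Longrightarrow> gr_lunit R \<V> M t (gp I M 0 t t (\<upsilon> \<one>) m) = m"
    by (rule one[OF *])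
qed

lemma gr_runit:
  assumes M: "M \<in> pm"
  shows gr_runit_nat: "gr_runit R \<V> M \<in> nat_trans R (M \<boxtimes> I) M"
    and gr_runit_pure: "m \<in> el M t \<Longrightarrow> gr_runit R \<V> M t (gp M I t 0 t m (\<upsilon> \<one>)) = m"
proof -
  let ?Q = "\<lambda>h. h \<in> nat_trans R (M \<boxtimes> I) M \<and>
        (\<forall>s t r. 0 \<le> t \<longrightarrow> s + t \<le> r \<longrightarrow> (\<forall>a\<in>carrier R. \<forall>m\<in>el M s.
             h r (gp M I s t r m (\<upsilon> a)) = a \<odot>\<^bsub>stalk M r\<^esub> tmap M s r m))"
  \<comment> \<open>The right unitor arises from the same scalar action with its two arguments
    exchanged.\<close>
  obtain h where h: "h \<in> nat_trans R (M \<boxtimes> I) M" and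
    h': "\<And>s t r m z. s + t \<le> r \<Longrightarrow> m \<in> el M s \<Longrightarrow> z \<in> el I t \<Longrightarrow>
      h r (gp M I s t r m z) = tmap M (s + t) r (unit_map (shift s M) m t z)"
    by (rule gr_lift[OF M unit_pmod M bimap_swap[OF lunit_bimap[OF M]]]) blast
  have Q: "?Q h"
  proof (intro conjI h allI impI ballI)
    fix s t r a m assume t: "0 \<le> t" and r: "s + t \<le> r" and a: "a \<in> carrier R" and m: "m \<in> el M s"
    have s: "s \<le> s + t" using preordered_add_mono[OF order_refl t, of s] by simp
    show "h r (gp M I s t r m (\<upsilon> a)) = a \<odot>\<^bsub>stalk M r\<^esub> tmap M s r m"
      using s r a m t
      by (simp add: h' unit_elem_closed unit_map_elem add.commute[of t s] tmap_smult[OF M]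
          pmod_tmap_closed[OF M] pmod_tmap_tmap[OF M])
  qed
  have one: "h'' t (gp M I t 0 t m (\<upsilon> \<one>)) = m" if "?Q h''" "m \<in> el M t" for h'' t m
  proof -
    have "h'' t (gp M I t 0 t m (\<upsilon> \<one>)) = \<one> \<odot>\<^bsub>stalk M t\<^esub> tmap M t t m"
      using that by simp
    then show ?thesis using that(2) by (simp add: pmod_tmap_refl[OF M] pmod_stalk[OF M])
  qed
  have "h'' = h" if "?Q h''" for h''
    by (rule gr_ext_runit[OF M M]) (use that Q one[OF that] one[OF Q] in auto)
  with Q have ex: "\<exists>!h. ?Q h" by (intro ex1I[of ?Q]) auto
  have *: "?Q (gr_runit R \<V> M)"
    unfolding gr_runit_def by (rule theI'[OF ex])
  then show "gr_runit R \<V> M \<in> nat_trans R (M \<boxtimes> I) M" by blast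
  show "m \<in> el M t \<Longrightarrow> gr_runit R \<V> M t (gp M I t 0 t m (\<upsilon> \<one>)) = m"
    by (rule one[OF *])
qed

lemma hom_comp_nat:
  fixes M N L :: "('p, 'a, 'u) pmod"
  assumes "M \<in> pmods R \<U>" "\<alpha> \<in> nat_trans R M N" "\<beta> \<in> nat_trans R N L"
  shows "hom_comp M 0 \<beta> \<alpha> \<in> nat_trans R M L"
  using hom_comp_hm[of M \<U> \<alpha> 0 N \<beta> 0 L] assms by simp

lemma id_trans_nat: "M \<in> pmods R \<U> \<Longrightarrow> id_trans M \<in> nat_trans R M (M :: ('p, 'a, 'u) pmod)"
  using id_trans_hm[of M \<U>] by simp

text \<open>Given by a formula and not merely as an existing inverse: composition in the underlying
  category of an enrichment involves the inverse left unitor at the unit, which has to be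
  evaluated.\<close>

definition gr_lunit_inv :: "('p, 'a, 'u) pmod \<Rightarrow> 'p \<Rightarrow> 'u \<Rightarrow> 'u" where
  "gr_lunit_inv M = (\<lambda>t. \<lambda>m\<in>el M t. gp I M 0 t t (\<upsilon> \<one>) m)"

lemma gr_lunit_inv:
  assumes M: "M \<in> pm"
  shows gr_lunit_inv_nat: "gr_lunit_inv M \<in> nat_trans R M (I \<boxtimes> M)"
    and "hom_comp (I \<boxtimes> M) 0 (gr_lunit_inv M) (gr_lunit R \<V> M) = id_trans (I \<boxtimes> M)"
    and "hom_comp M 0 (gr_lunit R \<V> M) (gr_lunit_inv M) = id_trans M"
proof -
  note IM = gr_tensor_pmod[OF unit_pmod M]
  show k: "gr_lunit_inv M \<in> nat_trans R M (I \<boxtimes> M)"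
    using gr_pure_right_hm[OF unit_pmod M unit_one_closed] by (simp add: gr_lunit_inv_def)
  show "hom_comp (I \<boxtimes> M) 0 (gr_lunit_inv M) (gr_lunit R \<V> M) = id_trans (I \<boxtimes> M)"
    by (rule gr_ext_lunit[OF M IM hom_comp_nat[OF IM gr_lunit_nat[OF M] k] id_trans_nat[OF IM]])
      (simp add: gr_pure_closed unit_pmod M gr_lunit_pure[OF M] gr_lunit_inv_def)
  show "hom_comp M 0 (gr_lunit R \<V> M) (gr_lunit_inv M) = id_trans M"
    by (rule nat_eqI[OF hom_comp_nat[OF M k gr_lunit_nat[OF M]] id_trans_nat[OF M]])
      (simp add: gr_lunit_pure[OF M] gr_lunit_inv_def)
qed

definition gr_runit_inv :: "('p, 'a, 'u) pmod \<Rightarrow> 'p \<Rightarrow> 'u \<Rightarrow> 'u" where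
  "gr_runit_inv M = (\<lambda>t. \<lambda>m\<in>el M t. gp M I t 0 t m (\<upsilon> \<one>))"

lemma gr_runit_inv:
  assumes M: "M \<in> pm"
  shows gr_runit_inv_nat: "gr_runit_inv M \<in> nat_trans R M (M \<boxtimes> I)"
    and "hom_comp (M \<boxtimes> I) 0 (gr_runit_inv M) (gr_runit R \<V> M) = id_trans (M \<boxtimes> I)"
    and "hom_comp M 0 (gr_runit R \<V> M) (gr_runit_inv M) = id_trans M"
proof -
  note IM = gr_tensor_pmod[OF M unit_pmod]
  show k: "gr_runit_inv M \<in> nat_trans R M (M \<boxtimes> I)"
    using gr_pure_left_hm[OF M unit_pmod unit_one_closed] by (simp add: gr_runit_inv_def)
  show "hom_comp (M \<boxtimes> I) 0 (gr_runit_inv M) (gr_runit R \<V> M) = id_trans (M \<boxtimes> I)"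
    by (rule gr_ext_runit[OF M IM hom_comp_nat[OF IM gr_runit_nat[OF M] k] id_trans_nat[OF IM]])
      (simp add: gr_pure_closed unit_pmod M gr_runit_pure[OF M] gr_runit_inv_def)
  show "hom_comp M 0 (gr_runit R \<V> M) (gr_runit_inv M) = id_trans M"
    by (rule nat_eqI[OF hom_comp_nat[OF M k gr_runit_nat[OF M]] id_trans_nat[OF M]])
      (simp add: gr_runit_pure[OF M] gr_runit_inv_def)
qed

subsection \<open>Functoriality, naturality and coherence\<close>

lemma gr_tensor_hom_id:
  assumes M: "M \<in> pm" and N: "N \<in> pm"
  shows "th M M N N 0 0 (id_trans M) (id_trans N) = id_trans (M \<boxtimes> N)"
proof (rule gr_ext[OF M N])
  note i = id_trans_hm[OF M] id_trans_hm[OF N]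
  show "th M M N N 0 0 (id_trans M) (id_trans N) \<in> nat_trans R (M \<boxtimes> N) (M \<boxtimes> N)"
    using gr_tensor_hom_hm[OF M M N N i] by simp
  show "id_trans (M \<boxtimes> N) \<in> nat_trans R (M \<boxtimes> N) (M \<boxtimes> N)"
    by (rule id_trans_nat[OF gr_tensor_pmod[OF M N]])
qed (simp add: gr_tensor_hom_pure[OF M M N N id_trans_hm[OF M] id_trans_hm[OF N]] gr_pure_closed M N)

text \<open>The extra variable \<open>r'\<close> lets the rule apply when the degree at which the
  morphism is taken and the degree of the element agree only after rearranging a sum.\<close>

lemma gr_tensor_hom_value:
  assumes "M \<in> pm" "M' \<in> pm" "N \<in> pm" "N' \<in> pm" "f \<in> hm M M' u" "g \<in> hm N N' v"
    and "r' = r" "s + t \<le> r" "m \<in> el M s" "n \<in> el N t"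
  shows "th M M' N N' u v f g r' (gp M N s t r m n) =
        gp M' N' (s + u) (t + v) (r + (u + v)) (f s m) (g t n)"
  using gr_tensor_hom_pure[OF assms(1-6,8-10)] assms(7) by simp

text \<open>On a pure tensor both sides apply \<open>f\<close> and \<open>f'\<close> to the left
  factor, \<open>g\<close> and \<open>g'\<close> to the right one. No sign enters the interchange,
  and the total degrees agree because \<open>P\<close> is commutative. The names \<open>w\<close>
  and \<open>z\<close> for the sums make the instance with all degrees 0 available in simplified
  form.\<close>

lemma gr_tensor_hom_comp:
  assumes M: "M \<in> pm" "M' \<in> pm" "M'' \<in> pm" and N: "N \<in> pm" "N' \<in> pm" "N'' \<in> pm"
    and f: "f \<in> hm M M' u" and f': "f' \<in> hm M' M'' u'" and g: "g \<in> hm N N' v" and g': "g' \<in> hm N' N'' v'"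
    and w: "w = u + u'" and z: "z = v + v'"
  shows "th M M'' N N'' w z (hom_comp M u f' f) (hom_comp N v g' g) =
    hom_comp (M \<boxtimes> N) (u + v) (th M' M'' N' N'' u' v' f' g') (th M M' N N' u v f g)"
proof -
  have F: "hom_comp M u f' f \<in> hm M M'' w" and G: "hom_comp N v g' g \<in> hm N N'' z"
    unfolding w z by (rule hom_comp_hm[OF M(1) f f'], rule hom_comp_hm[OF N(1) g g'])
  note T = gr_tensor_hom_hm[OF M(1,2) N(1,2) f g] and T' = gr_tensor_hom_hm[OF M(2,3) N(2,3) f' g']
  note c = hom_comp_hm[OF gr_tensor_pmod[OF M(1) N(1)] T T']
  have e: "u + v + (u' + v') = w + z" by (simp add: w z add_ac)
  show ?thesis
  proof (rule gr_ext[OF M(1) N(1) gr_tensor_hom_hm[OF M(1,3) N(1,3) F G] c[unfolded e]])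
    fix s t m n assume m: "m \<in> el M s" and n: "n \<in> el N t"
    have "th M M'' N N'' w z (hom_comp M u f' f) (hom_comp N v g' g) (s + t) (gp M N s t (s + t) m n) =
      gp M'' N'' (s + w) (t + z) (s + t + (w + z)) (f' (u + s) (f s m)) (g' (v + t) (g t n))"
      using m n by (simp add: gr_tensor_hom_value[OF M(1,3) N(1,3) F G])
    also have "\<dots> = hom_comp (M \<boxtimes> N) (u + v) (th M' M'' N' N'' u' v' f' g') (th M M' N N' u v f g) (s + t)
      (gp M N s t (s + t) m n)"
      using m n
      by (simp add: w z gr_pure_closed M N gr_tensor_hom_value[OF M(1,2) N(1,2) f g]
          gr_tensor_hom_value[OF M(2,3) N(2,3) f' g'] hm_closed[OF f] hm_closed[OF g] add_ac)
    finally show "th M M'' N N'' w z (hom_comp M u f' f) (hom_comp N v g' g) (s + t) (gp M N s t (s + t) m n)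
        =
      hom_comp (M \<boxtimes> N) (u + v) (th M' M'' N' N'' u' v' f' g') (th M M' N N' u v f g) (s + t)
      (gp M N s t (s + t) m n)" .
  qed
qed

lemma gr_assoc_value:
  assumes "M \<in> pm" "N \<in> pm" "L \<in> pm" "r' = r" "a + b \<le> p" "p + c \<le> r"
    "m \<in> el M a" "n \<in> el N b" "l \<in> el L c"
  shows "gr_assoc R \<V> M N L r' (gp (M \<boxtimes> N) L p c r (gp M N a b p m n) l) =
      gp M (N \<boxtimes> L) a (b + c) r m (gp N L b c (b + c) n l)"
  using gr_assoc_pure[OF assms(1-3,5-9)] assms(4) by simp

text \<open>Both sides turn a triple of \<open>m\<close>, \<open>n\<close>, \<open>l\<close> into
  the right-bracketed triple of their images; the chain of equations mainly reconciles differently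
  bracketed degrees. The variables \<open>p\<close> and \<open>q\<close> again permit a clean
  instance in degree 0.\<close>

lemma gr_assoc_natural:
  assumes M: "M \<in> pm" "M' \<in> pm" and N: "N \<in> pm" "N' \<in> pm" and L: "L \<in> pm" "L' \<in> pm"
    and f: "f \<in> hm M M' u" and g: "g \<in> hm N N' v" and h: "h \<in> hm L L' w"
    and p: "p = u + v" and q: "q = v + w"
  shows "hom_comp ((M \<boxtimes> N) \<boxtimes> L) (p + w) (gr_assoc R \<V> M' N' L')
      (th (M \<boxtimes> N) (M' \<boxtimes> N') L L' p w (th M M' N N' u v f g) h) =
    hom_comp ((M \<boxtimes> N) \<boxtimes> L) 0 (th M M' (N \<boxtimes> L) (N' \<boxtimes> L') u q f (th N N' L L' v w g h)) (gr_assoc R \<V> M N L)"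
proof -
  note MN = gr_tensor_pmod[OF M(1) N(1)] gr_tensor_pmod[OF M(2) N(2)]
  note NL = gr_tensor_pmod[OF N(1) L(1)] gr_tensor_pmod[OF N(2) L(2)]
  note MNL = gr_tensor_pmod[OF MN(1) L(1)]
  have fg: "th M M' N N' u v f g \<in> hm (M \<boxtimes> N) (M' \<boxtimes> N') p"
    unfolding p by (rule gr_tensor_hom_hm[OF M N f g])
  have gh: "th N N' L L' v w g h \<in> hm (N \<boxtimes> L) (N' \<boxtimes> L') q"
    unfolding q by (rule gr_tensor_hom_hm[OF N L g h])
  have \<alpha>: "gr_assoc R \<V> M N L \<in> hm ((M \<boxtimes> N) \<boxtimes> L) (M \<boxtimes> (N \<boxtimes> L)) 0"
    "gr_assoc R \<V> M' N' L' \<in> hm ((M' \<boxtimes> N') \<boxtimes> L') (M' \<boxtimes> (N' \<boxtimes> L')) 0"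
    using gr_assoc_nat M N L by simp_all
  have 1: "hom_comp ((M \<boxtimes> N) \<boxtimes> L) (p + w) (gr_assoc R \<V> M' N' L')
      (th (M \<boxtimes> N) (M' \<boxtimes> N') L L' p w (th M M' N N' u v f g) h) \<in> hm ((M \<boxtimes> N) \<boxtimes> L) (M' \<boxtimes> (N' \<boxtimes> L'))
          (p + w + 0)"
    by (rule hom_comp_hm[OF MNL gr_tensor_hom_hm[OF MN L fg h] \<alpha>(2)])
  have 2: "hom_comp ((M \<boxtimes> N) \<boxtimes> L) 0 (th M M' (N \<boxtimes> L) (N' \<boxtimes> L') u q f (th N N' L L' v w g h))
      (gr_assoc R \<V> M N L)
    \<in> hm ((M \<boxtimes> N) \<boxtimes> L) (M' \<boxtimes> (N' \<boxtimes> L')) (0 + (u + q))"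
    by (rule hom_comp_hm[OF MNL \<alpha>(1) gr_tensor_hom_hm[OF M NL f gh]])
  have e: "0 + (u + q) = p + w + 0" by (simp add: p q add_ac)
  show ?thesis
  proof (rule gr_ext_left[OF M(1) N(1) L(1) 1 2[unfolded e]])
    fix a b c m n l assume m: "m \<in> el M a" and n: "n \<in> el N b" and l: "l \<in> el L c"
    let ?x = "gp (M \<boxtimes> N) L (a + b) c (a + b + c) (gp M N a b (a + b) m n) l"
    have x: "?x \<in> el ((M \<boxtimes> N) \<boxtimes> L) (a + b + c)"
      by (rule gr_pure_closed[OF MN(1) L(1) order_refl gr_pure_closed[OF M(1) N(1) order_refl m n] l])
    note fm = hm_closed[OF f m] and gn = hm_closed[OF g n] and hl = hm_closed[OF h l]
    have "hom_comp ((M \<boxtimes> N) \<boxtimes> L) (p + w) (gr_assoc R \<V> M' N' L')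
      (th (M \<boxtimes> N) (M' \<boxtimes> N') L L' p w (th M M' N N' u v f g) h) (a + b + c) ?x =
      gr_assoc R \<V> M' N' L' (p + w + (a + b + c)) (gp (M' \<boxtimes> N') L' (a + b + p) (c + w) (a + b + c + (p + w))
        (gp M' N' (a + u) (b + v) (a + b + (u + v)) (f a m) (g b n)) (h c l))"
      using m n l x
      by (simp add: gr_tensor_hom_value[OF MN L fg h] gr_tensor_hom_value[OF M N f g] gr_pure_closed M N)
    also have "\<dots> = gp M' (N' \<boxtimes> L') (a + u) (b + v + (c + w)) (a + b + c + (p + w)) (f a m)
       (gp N' L' (b + v) (c + w) (b + v + (c + w)) (g b n) (h c l))"
      unfolding p by (rule gr_assoc_value[OF M(2) N(2) L(2)])
        (simp_all add: add_ac fm[OF refl, unfolded add.commute[of a u]] gn[OF refl, unfolded add.commute[of b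
            v]]
          hl[OF refl, unfolded add.commute[of c w]] fm gn hl)
    also have "\<dots> = th M M' (N \<boxtimes> L) (N' \<boxtimes> L') u q f (th N N' L L' v w g h) (a + b + c)
      (gp M (N \<boxtimes> L) a (b + c) (a + b + c) m (gp N L b c (b + c) n l))"
      using m n l
      by (simp add: gr_tensor_hom_value[OF M NL f gh] gr_tensor_hom_value[OF N L g h]
          gr_pure_closed N L add.assoc)
        (simp add: p q add_ac)
    also have "\<dots> = hom_comp ((M \<boxtimes> N) \<boxtimes> L) 0 (th M M' (N \<boxtimes> L) (N' \<boxtimes> L') u q f (th N N' L L' v w g h))
        (gr_assoc R \<V> M N L)
      (a + b + c) ?x"
      using m n l x by (simp add: gr_assoc_value[OF M(1) N(1) L(1)])
    finally show "hom_comp ((M \<boxtimes> N) \<boxtimes> L) (p + w) (gr_assoc R \<V> M' N' L')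
      (th (M \<boxtimes> N) (M' \<boxtimes> N') L L' p w (th M M' N N' u v f g) h) (a + b + c) ?x =
      hom_comp ((M \<boxtimes> N) \<boxtimes> L) 0 (th M M' (N \<boxtimes> L) (N' \<boxtimes> L') u q f (th N N' L L' v w g h)) (gr_assoc R \<V> M N L)
      (a + b + c) ?x" .
  qed
qed

lemma gr_lunit_natural:
  assumes M: "M \<in> pm" and M': "M' \<in> pm" and f: "f \<in> hm M M' s"
  shows "hom_comp (I \<boxtimes> M) s (gr_lunit R \<V> M') (th I I M M' 0 s (id_trans I) f) =
    hom_comp (I \<boxtimes> M) 0 f (gr_lunit R \<V> M)"
proof -
  note IM = gr_tensor_pmod[OF unit_pmod M] and i = id_trans_hm[OF unit_pmod]
  have l: "gr_lunit R \<V> M \<in> hm (I \<boxtimes> M) M 0" "gr_lunit R \<V> M' \<in> hm (I \<boxtimes> M') M' 0"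
    using gr_lunit_nat M M' by simp_all
  have T: "th I I M M' 0 s (id_trans I) f \<in> hm (I \<boxtimes> M) (I \<boxtimes> M') s"
    using gr_tensor_hom_hm[OF unit_pmod unit_pmod M M' i f] by simp
  show ?thesis
  proof (rule gr_ext_lunit[OF M shift_pmod[OF M']])
    show "hom_comp (I \<boxtimes> M) s (gr_lunit R \<V> M') (th I I M M' 0 s (id_trans I) f) \<in> hm (I \<boxtimes> M) M' s"
      using hom_comp_hm[OF IM T l(2)] by simp
    show "hom_comp (I \<boxtimes> M) 0 f (gr_lunit R \<V> M) \<in> hm (I \<boxtimes> M) M' s"
      using hom_comp_hm[OF IM l(1) f] by simp
    fix t m assume m: "m \<in> el M t"
    have fm: "f t m \<in> el M' (s + t)" by (rule hm_closed[OF f m]) (simp add: add.commute)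
    show "hom_comp (I \<boxtimes> M) s (gr_lunit R \<V> M') (th I I M M' 0 s (id_trans I) f) t (gp I M 0 t t (\<upsilon> \<one>) m) =
      hom_comp (I \<boxtimes> M) 0 f (gr_lunit R \<V> M) t (gp I M 0 t t (\<upsilon> \<one>) m)"
      using m fm by (simp add: gr_pure_closed unit_pmod M gr_tensor_hom_value[OF unit_pmod unit_pmod M M' i f]
          gr_lunit_pure M M' add.commute[of t s])
  qed
qed

lemma gr_runit_natural:
  assumes M: "M \<in> pm" and M': "M' \<in> pm" and f: "f \<in> hm M M' s"
  shows "hom_comp (M \<boxtimes> I) s (gr_runit R \<V> M') (th M M' I I s 0 f (id_trans I)) =
    hom_comp (M \<boxtimes> I) 0 f (gr_runit R \<V> M)"
proof -
  note MI = gr_tensor_pmod[OF M unit_pmod] and i = id_trans_hm[OF unit_pmod]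
  have l: "gr_runit R \<V> M \<in> hm (M \<boxtimes> I) M 0" "gr_runit R \<V> M' \<in> hm (M' \<boxtimes> I) M' 0"
    using gr_runit_nat M M' by simp_all
  have T: "th M M' I I s 0 f (id_trans I) \<in> hm (M \<boxtimes> I) (M' \<boxtimes> I) s"
    using gr_tensor_hom_hm[OF M M' unit_pmod unit_pmod f i] by simp
  show ?thesis
  proof (rule gr_ext_runit[OF M shift_pmod[OF M']])
    show "hom_comp (M \<boxtimes> I) s (gr_runit R \<V> M') (th M M' I I s 0 f (id_trans I)) \<in> hm (M \<boxtimes> I) M' s"
      using hom_comp_hm[OF MI T l(2)] by simp
    show "hom_comp (M \<boxtimes> I) 0 f (gr_runit R \<V> M) \<in> hm (M \<boxtimes> I) M' s"
      using hom_comp_hm[OF MI l(1) f] by simp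
    fix t m assume m: "m \<in> el M t"
    have fm: "f t m \<in> el M' (s + t)" by (rule hm_closed[OF f m]) (simp add: add.commute)
    show "hom_comp (M \<boxtimes> I) s (gr_runit R \<V> M') (th M M' I I s 0 f (id_trans I)) t (gp M I t 0 t m (\<upsilon> \<one>)) =
      hom_comp (M \<boxtimes> I) 0 f (gr_runit R \<V> M) t (gp M I t 0 t m (\<upsilon> \<one>))"
      using m fm by (simp add: gr_pure_closed unit_pmod M gr_tensor_hom_value[OF M M' unit_pmod unit_pmod f i]
          gr_runit_pure M M' add.commute[of t s])
  qed
qed

text \<open>The degree 0 form with \<open>shift 0\<close> simplified away, in which the coherence
  laws are stated.\<close>

lemma gr_tensor_hom_nat:
  assumes "M \<in> pm" "M' \<in> pm" "N \<in> pm" "N' \<in> pm" "f \<in> nat_trans R M M'" "g \<in> nat_trans R N N'"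
  shows "th M M' N N' 0 0 f g \<in> nat_trans R (M \<boxtimes> N) (M' \<boxtimes> N')"
  using gr_tensor_hom_hm[OF assms(1-4), of f 0 g 0] assms(5,6) by simp

lemma gr_tensor_hom_nat_value:
  assumes "M \<in> pm" "M' \<in> pm" "N \<in> pm" "N' \<in> pm" "f \<in> nat_trans R M M'" "g \<in> nat_trans R N N'"
    and "r' = r" "s + t \<le> r" "m \<in> el M s" "n \<in> el N t"
  shows "th M M' N N' 0 0 f g r' (gp M N s t r m n) = gp M' N' s t r (f s m) (g t n)"
  using gr_tensor_hom_value[OF assms(1-4), of f 0 g 0 r' r s t m n] assms(5-) by simp

text \<open>Freezing \<open>j\<close> by \<open>curry_left\<close> leaves maps out of a triple
  product, where \<open>gr_ext_left\<close> applies. On a fourfold pure tensor both sides rebracket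
  the same four elements.\<close>

lemma gr_pentagon:
  assumes M: "M \<in> pm" and N: "N \<in> pm" and L: "L \<in> pm" and J: "J \<in> pm"
  shows "hom_comp (((M \<boxtimes> N) \<boxtimes> L) \<boxtimes> J) 0 (gr_assoc R \<V> M N (L \<boxtimes> J)) (gr_assoc R \<V> (M \<boxtimes> N) L J) =
    hom_comp (((M \<boxtimes> N) \<boxtimes> L) \<boxtimes> J) 0
      (hom_comp ((M \<boxtimes> (N \<boxtimes> L)) \<boxtimes> J) 0
        (th M M ((N \<boxtimes> L) \<boxtimes> J) (N \<boxtimes> (L \<boxtimes> J)) 0 0 (id_trans M) (gr_assoc R \<V> N L J))
        (gr_assoc R \<V> M (N \<boxtimes> L) J))
      (th ((M \<boxtimes> N) \<boxtimes> L) (M \<boxtimes> (N \<boxtimes> L)) J J 0 0 (gr_assoc R \<V> M N L) (id_trans J))"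
    (is "?lhs = ?rhs")
proof -
  note [simp] = M N L J gr_tensor_pmod gr_assoc_nat id_trans_nat[where \<U> = \<V>] gr_tensor_hom_nat gr_pure_closed
  have hl: "?lhs \<in> nat_trans R (((M \<boxtimes> N) \<boxtimes> L) \<boxtimes> J) (M \<boxtimes> (N \<boxtimes> (L \<boxtimes> J)))"
    by (rule hom_comp_nat[where \<U> = \<V> and N = "(M \<boxtimes> N) \<boxtimes> (L \<boxtimes> J)"]) simp_all
  have hr: "?rhs \<in> nat_trans R (((M \<boxtimes> N) \<boxtimes> L) \<boxtimes> J) (M \<boxtimes> (N \<boxtimes> (L \<boxtimes> J)))"
    by (rule hom_comp_nat[where \<U> = \<V> and N = "(M \<boxtimes> (N \<boxtimes> L)) \<boxtimes> J"], simp_all,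
        rule hom_comp_nat[where \<U> = \<V> and N = "M \<boxtimes> ((N \<boxtimes> L) \<boxtimes> J)"]) simp_all
  have MNL: "(M \<boxtimes> N) \<boxtimes> L \<in> pm" by simp
  show ?thesis
  proof (rule gr_ext[OF MNL J hl hr])
    fix w d z j assume z: "z \<in> el ((M \<boxtimes> N) \<boxtimes> L) w" and j: "j \<in> el J d"
    have "(\<lambda>w. \<lambda>z\<in>el ((M \<boxtimes> N) \<boxtimes> L) w. ?lhs (w + d) (gp ((M \<boxtimes> N) \<boxtimes> L) J w d (w + d) z j)) =
      (\<lambda>w. \<lambda>z\<in>el ((M \<boxtimes> N) \<boxtimes> L) w. ?rhs (w + d) (gp ((M \<boxtimes> N) \<boxtimes> L) J w d (w + d) z j))"
    proof (rule gr_ext_left[OF M N L curry_left[OF MNL J hl j] curry_left[OF MNL J hr j]])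
      fix a b c m n l
      assume m: "m \<in> el M a" and n: "n \<in> el N b" and l: "l \<in> el L c"
      show "(\<lambda>z\<in>el ((M \<boxtimes> N) \<boxtimes> L) (a + b + c). ?lhs (a + b + c + d) (gp ((M \<boxtimes> N) \<boxtimes> L) J (a + b + c)
          d (a + b + c + d) z j))
          (gp (M \<boxtimes> N) L (a + b) c (a + b + c) (gp M N a b (a + b) m n) l) =
        (\<lambda>z\<in>el ((M \<boxtimes> N) \<boxtimes> L) (a + b + c). ?rhs (a + b + c + d) (gp ((M \<boxtimes> N) \<boxtimes> L) J (a + b + c)
            d (a + b + c + d) z j))
          (gp (M \<boxtimes> N) L (a + b) c (a + b + c) (gp M N a b (a + b) m n) l)"
        using m n l j by (simp add: gr_assoc_value gr_tensor_hom_nat_value add.assoc)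
    qed
    from fun_cong[OF fun_cong[OF this], of w z] z
    show "?lhs (w + d) (gp ((M \<boxtimes> N) \<boxtimes> L) J w d (w + d) z j) =
      ?rhs (w + d) (gp ((M \<boxtimes> N) \<boxtimes> L) J w d (w + d) z j)" by simp
  qed
qed

text \<open>Freezing \<open>n\<close> leaves maps out of \<open>M \<boxtimes> I\<close>, so
  \<open>gr_ext_runit\<close> reduces the claim to the generator of the unit in the middle, which
  both unitors remove.\<close>

lemma gr_triangle:
  assumes M: "M \<in> pm" and N: "N \<in> pm"
  shows "hom_comp ((M \<boxtimes> I) \<boxtimes> N) 0 (th M M (I \<boxtimes> N) N 0 0 (id_trans M) (gr_lunit R \<V> N)) (gr_assoc R \<V> M I N) =
    th (M \<boxtimes> I) M N N 0 0 (gr_runit R \<V> M) (id_trans N)" (is "?lhs = ?rhs")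
proof -
  note [simp] = M N unit_pmod gr_tensor_pmod gr_assoc_nat id_trans_nat[where \<U> = \<V>]
      gr_tensor_hom_nat gr_pure_closed
    gr_lunit_nat gr_runit_nat
  have hl: "?lhs \<in> nat_trans R ((M \<boxtimes> I) \<boxtimes> N) (M \<boxtimes> N)"
    by (rule hom_comp_nat[where \<U> = \<V> and N = "M \<boxtimes> (I \<boxtimes> N)"]) simp_all
  have hr: "?rhs \<in> nat_trans R ((M \<boxtimes> I) \<boxtimes> N) (M \<boxtimes> N)" by simp
  have MI: "M \<boxtimes> I \<in> pm" by simp
  show ?thesis
  proof (rule gr_ext[OF MI N hl hr])
    fix w c z n assume z: "z \<in> el (M \<boxtimes> I) w" and n: "n \<in> el N c"
    have "(\<lambda>w. \<lambda>z\<in>el (M \<boxtimes> I) w. ?lhs (w + c) (gp (M \<boxtimes> I) N w c (w + c) z n)) =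
      (\<lambda>w. \<lambda>z\<in>el (M \<boxtimes> I) w. ?rhs (w + c) (gp (M \<boxtimes> I) N w c (w + c) z n))"
    proof (rule gr_ext_runit[OF M _ curry_left[OF MI N hl n] curry_left[OF MI N hr n]])
      fix a m assume m: "m \<in> el M a"
      show "(\<lambda>z\<in>el (M \<boxtimes> I) a. ?lhs (a + c) (gp (M \<boxtimes> I) N a c (a + c) z n))
          (gp M I a 0 a m (\<upsilon> \<one>)) =
        (\<lambda>z\<in>el (M \<boxtimes> I) a. ?rhs (a + c) (gp (M \<boxtimes> I) N a c (a + c) z n))
          (gp M I a 0 a m (\<upsilon> \<one>))"
        using m n by (simp add: gr_assoc_value gr_tensor_hom_nat_value gr_lunit_pure gr_runit_pure)
    qed simp
    from fun_cong[OF fun_cong[OF this], of w z] z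
    show "?lhs (w + c) (gp (M \<boxtimes> I) N w c (w + c) z n) =
      ?rhs (w + c) (gp (M \<boxtimes> I) N w c (w + c) z n)" by simp
  qed
qed

end

lemma Pow_lepoll_mono:
  assumes "A \<lesssim> B"
  shows "Pow A \<lesssim> Pow B"
proof -
  obtain f where f: "inj_on f A" "f ` A \<subseteq> B" using assms by (auto simp: lepoll_def)
  have "inj_on (image f) (Pow A)" using f(1) by (rule inj_on_image_Pow)
  moreover have "image f ` Pow A \<subseteq> Pow B" using f(2) by auto
  ultimately show ?thesis by (auto simp: lepoll_def)
qed

section \<open>Bilinearity of composition and raising of degrees\<close>

context persistence
begin

text \<open>Addition of transformations is pointwise, so in the outer argument only the degree of
  \<open>\<alpha> x m\<close> has to be tracked; the corresponding law for the inner argument uses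
  additivity of \<open>\<beta>\<close>. Outside the stalks both sides are
  \<open>undefined\<close>.\<close>

lemma hom_comp_add_left:
  assumes \<alpha>: "\<alpha> \<in> hm M N s"
  shows "hom_comp M s (\<beta> \<oplus>\<^bsub>hom_module R N (shift t L)\<^esub> \<beta>') \<alpha> =
    hom_comp M s \<beta> \<alpha> \<oplus>\<^bsub>hom_module R M (shift (s + t) L)\<^esub> hom_comp M s \<beta>' \<alpha>"
proof (intro ext)
  fix x m
  show "hom_comp M s (\<beta> \<oplus>\<^bsub>hom_module R N (shift t L)\<^esub> \<beta>') \<alpha> x m =
    (hom_comp M s \<beta> \<alpha> \<oplus>\<^bsub>hom_module R M (shift (s + t) L)\<^esub> hom_comp M s \<beta>' \<alpha>) x m"
  proof (cases "m \<in> el M x")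
    case True
    have "\<alpha> x m \<in> el N (s + x)" by (rule hm_closed[OF \<alpha> True]) (simp add: add.commute)
    then show ?thesis using True by (simp add: add_ac)
  qed (simp add: hom_comp_def compose_def)
qed

lemma hom_comp_smult_left:
  assumes \<alpha>: "\<alpha> \<in> hm M N s"
  shows "hom_comp M s (a \<odot>\<^bsub>hom_module R N (shift t L)\<^esub> \<beta>) \<alpha> =
    a \<odot>\<^bsub>hom_module R M (shift (s + t) L)\<^esub> hom_comp M s \<beta> \<alpha>"
proof (intro ext)
  fix x m
  show "hom_comp M s (a \<odot>\<^bsub>hom_module R N (shift t L)\<^esub> \<beta>) \<alpha> x m =
    (a \<odot>\<^bsub>hom_module R M (shift (s + t) L)\<^esub> hom_comp M s \<beta> \<alpha>) x m"
  proof (cases "m \<in> el M x")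
    case True
    have "\<alpha> x m \<in> el N (s + x)" by (rule hm_closed[OF \<alpha> True]) (simp add: add.commute)
    then show ?thesis using True by (simp add: add_ac)
  qed (simp add: hom_comp_def compose_def)
qed

lemma hom_comp_add_right:
  assumes \<beta>: "\<beta> \<in> hm N L t" and \<alpha>: "\<alpha> \<in> hm M N s" and \<alpha>': "\<alpha>' \<in> hm M N s"
  shows "hom_comp M s \<beta> (\<alpha> \<oplus>\<^bsub>hom_module R M (shift s N)\<^esub> \<alpha>') =
    hom_comp M s \<beta> \<alpha> \<oplus>\<^bsub>hom_module R M (shift (s + t) L)\<^esub> hom_comp M s \<beta> \<alpha>'"
proof (intro ext)
  fix x m
  show "hom_comp M s \<beta> (\<alpha> \<oplus>\<^bsub>hom_module R M (shift s N)\<^esub> \<alpha>') x m =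
    (hom_comp M s \<beta> \<alpha> \<oplus>\<^bsub>hom_module R M (shift (s + t) L)\<^esub> hom_comp M s \<beta> \<alpha>') x m"
  proof (cases "m \<in> el M x")
    case True
    have "\<alpha> x m \<in> el N (x + s)" "\<alpha>' x m \<in> el N (x + s)"
      using hm_closed[OF \<alpha> True refl] hm_closed[OF \<alpha>' True refl] by simp_all
    from hm_add[OF \<beta> this] show ?thesis using True by (simp add: add_ac)
  qed (simp add: hom_comp_def compose_def)
qed

lemma hom_comp_smult_right:
  assumes \<beta>: "\<beta> \<in> hm N L t" and \<alpha>: "\<alpha> \<in> hm M N s" and a: "a \<in> carrier R"
  shows "hom_comp M s \<beta> (a \<odot>\<^bsub>hom_module R M (shift s N)\<^esub> \<alpha>) =
    a \<odot>\<^bsub>hom_module R M (shift (s + t) L)\<^esub> hom_comp M s \<beta> \<alpha>"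
proof (intro ext)
  fix x m
  show "hom_comp M s \<beta> (a \<odot>\<^bsub>hom_module R M (shift s N)\<^esub> \<alpha>) x m =
    (a \<odot>\<^bsub>hom_module R M (shift (s + t) L)\<^esub> hom_comp M s \<beta> \<alpha>) x m"
  proof (cases "m \<in> el M x")
    case True
    from hm_smult[OF \<beta> a hm_closed[OF \<alpha> True refl]] show ?thesis using True by (simp add: add_ac)
  qed (simp add: hom_comp_def compose_def)
qed

text \<open>The transition map of the hom object without the coding: a transformation of degree
  \<open>s\<close> is regarded as one of degree \<open>t\<close>, for
  \<open>s \<le> t\<close>.\<close>

definition hom_up :: "('p, 'a, 'u) pmod \<Rightarrow> ('p, 'a, 'u) pmod \<Rightarrow> 'p \<Rightarrow> 'p \<Rightarrow> ('p \<Rightarrow> 'u \<Rightarrow> 'u) \<Rightarrow> 'p \<Rightarrow> 'u \<Rightarrow> 'u" where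
  "hom_up M N s t \<alpha> = (\<lambda>x. compose (el M x) (tmap N (x + s) (x + t)) (\<alpha> x))"

lemma hom_up_apply [simp]:
  "m \<in> el M x \<Longrightarrow> hom_up M N s t \<alpha> x m = tmap N (x + s) (x + t) (\<alpha> x m)"
  by (simp add: hom_up_def compose_def)

lemma hom_up_outside [simp]: "m \<notin> el M x \<Longrightarrow> hom_up M N s t \<alpha> x m = undefined"
  by (simp add: hom_up_def compose_def)

lemma hom_up_hm:
  assumes M: "M \<in> pmods R \<U>" and N: "N \<in> pmods R \<U>" and st: "s \<le> t" and \<alpha>: "\<alpha> \<in> hm M N s"
  shows "hom_up M N s t \<alpha> \<in> hm M N t"
proof (rule nat_transI)
  have le: "x + s \<le> x + t" for x by (rule preordered_add_mono[OF order_refl st])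
  fix x
  show "hom_up M N s t \<alpha> x \<in> lin_maps R (stalk M x) (stalk (shift t N) x)"
    unfolding hom_up_def
    by (rule lin_comp[OF nat_lin[OF \<alpha>] _ pmod_stalk[OF M]]) (simp add: pmod_tmap[OF N le])
  fix y m assume xy: "x \<le> y" and m: "m \<in> el M x"
  have "x + s \<le> y + s" "x + t \<le> y + t" using xy by (simp_all add: add_right_mono_preorder)
  then show "hom_up M N s t \<alpha> y (tmap M x y m) = tmap (shift t N) x y (hom_up M N s t \<alpha> x m)"
    using xy m le hm_closed[OF \<alpha> m refl]
    by (simp add: pmod_tmap_closed[OF M] hm_natural[OF \<alpha>] pmod_tmap_tmap[OF N])
qed

end

section \<open>The hom objects\<close>

locale enriched_persistence = persistence R \<V> P
  for R :: "('a, 'b) ring_scheme" (structure) and \<V> :: "'u set set"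
      and P :: "'p::preordered_ab_group_add set" +
  fixes \<U> :: "'u set set"
  assumes U': "universe P (carrier R) \<U>" and powers: "contains_powers \<V> \<U>"
begin

lemma U: "universe (UNIV :: 'p set) (carrier R) \<U>"
  using U' P by simp

abbreviation um :: "('p, 'a, 'u) pmod set" where "um \<equiv> pmods R \<U>"
abbreviation ih :: "('p, 'a, 'u) pmod \<Rightarrow> ('p, 'a, 'u) pmod \<Rightarrow> ('p, 'a, 'u) pmod" where
  "ih M N \<equiv> ihom R \<V> M N"
abbreviation \<epsilon> :: "('p, 'a, 'u) pmod \<Rightarrow> ('p, 'a, 'u) pmod \<Rightarrow> 'p \<Rightarrow> ('p \<Rightarrow> 'u \<Rightarrow> 'u) \<Rightarrow> 'u" where
  "\<epsilon> M N s \<equiv> ihom_elem R \<V> M N s"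

text \<open>A natural transformation is determined by its graph, a subset of \<open>P \<times> A \<times> B\<close>
  where \<open>A\<close> and \<open>B\<close> are the unions of the stalks.\<close>

lemma small_nat_trans:
  assumes M: "M \<in> um" and N: "N \<in> um"
  shows "small \<V> (nat_trans R M N)"
proof -
  define A where "A = (\<Union>x. el M x)"
  define B where "B = (\<Union>x. el N x)"
  define g where "g = (\<lambda>\<eta> :: 'p \<Rightarrow> 'u \<Rightarrow> 'u. {(x, m, \<eta> x m) | x m. m \<in> el M x})"
  have inj: "inj_on g (nat_trans R M N)"
  proof (rule inj_onI)
    fix \<eta> \<theta> assume \<eta>: "\<eta> \<in> nat_trans R M N" and \<theta>: "\<theta> \<in> nat_trans R M N" and eq: "g \<eta> = g \<theta>"
    show "\<eta> = \<theta>"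
    proof (rule nat_eqI[OF \<eta> \<theta>])
      fix x m assume "m \<in> el M x"
      then have "(x, m, \<eta> x m) \<in> g \<theta>" unfolding eq[symmetric] by (auto simp: g_def)
      then show "\<eta> x m = \<theta> x m" by (auto simp: g_def)
    qed
  qed
  have "g ` nat_trans R M N \<subseteq> Pow ((UNIV :: 'p set) \<times> A \<times> B)"
    unfolding g_def A_def B_def using nat_closed by fast
  with inj have 1: "nat_trans R M N \<lesssim> Pow ((UNIV :: 'p set) \<times> A \<times> B)"
    unfolding lepoll_def by (intro exI[of _ g] conjI)
  have "small \<U> ((UNIV :: 'p set) \<times> A \<times> B)" unfolding A_def B_def
    by (intro small_Times[OF U] small_index[OF U] small_UN[OF U] pmod_carrier[OF M] pmod_carrier[OF N])
  then obtain C where C: "C \<in> \<U>" "(UNIV :: 'p set) \<times> A \<times> B \<lesssim> C" by (auto simp: small_def)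
  obtain D where D: "D \<in> \<V>" "Pow C \<lesssim> D" using powers C(1) by (auto simp: contains_powers_def)
  show ?thesis
    by (rule smallI[OF D(1) lepoll_trans[OF 1 lepoll_trans[OF Pow_lepoll_mono[OF C(2)] D(2)]]])
qed

lemma ihom_stalk: "stalk (ih M N) s = copy_module \<V> (hom_module R M (shift s N))"
  by (simp add: ihom_def)

context
  fixes M N :: "('p, 'a, 'u) pmod"
  assumes M: "M \<in> um" and N: "N \<in> um"
begin

private lemma code_inj: "inj_on (\<epsilon> M N s) (hm M N s)"
  unfolding ihom_elem_def
  by (rule code_inj_image(1)[OF V small_nat_trans[OF M shift_pmod[OF N]]])

lemma ihom_onto: "lin_onto R (\<epsilon> M N s) (hom_module R M (shift s N)) (stalk (ih M N) s)"
  using copy_module_onto[of \<V> "hom_module R M (shift s N)", OF _ hom_module_is_module[OF M shift_pmod[OF N]]]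
    code_inj unfolding ihom_stalk ihom_elem_def by simp

lemma ihom_carrier: "el (ih M N) s = \<epsilon> M N s ` hm M N s"
  using lin_onto_image[OF ihom_onto] by simp

lemma ihom_elem_eq_iff: "\<alpha> \<in> hm M N s \<Longrightarrow> \<beta> \<in> hm M N s \<Longrightarrow> \<epsilon> M N s \<alpha> = \<epsilon> M N s \<beta> \<longleftrightarrow> \<alpha> = \<beta>"
  using inj_onD[OF code_inj] by blast

lemma ihom_elem_closed: "\<alpha> \<in> hm M N s \<Longrightarrow> \<epsilon> M N s \<alpha> \<in> el (ih M N) s"
  by (simp add: ihom_carrier)

lemma ihom_decode: "\<alpha> \<in> hm M N s \<Longrightarrow> decode \<V> (hm M N s) (\<epsilon> M N s \<alpha>) = \<alpha>"
  using decode_code[of \<V> "hm M N s"] code_inj[of s] unfolding ihom_elem_def by blast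

lemma ihom_elem_add:
  "\<alpha> \<in> hm M N s \<Longrightarrow> \<beta> \<in> hm M N s \<Longrightarrow>
    \<epsilon> M N s \<alpha> \<oplus>\<^bsub>stalk (ih M N) s\<^esub> \<epsilon> M N s \<beta> = \<epsilon> M N s (\<alpha> \<oplus>\<^bsub>hom_module R M (shift s N)\<^esub> \<beta>)"
  by (rule lin_onto_add[OF ihom_onto, symmetric]) (simp_all del: hom_module_simps(2-))

lemma ihom_elem_smult:
  "a \<in> carrier R \<Longrightarrow> \<alpha> \<in> hm M N s \<Longrightarrow>
    a \<odot>\<^bsub>stalk (ih M N) s\<^esub> \<epsilon> M N s \<alpha> = \<epsilon> M N s (a \<odot>\<^bsub>hom_module R M (shift s N)\<^esub> \<alpha>)"
  by (rule lin_onto_smult[OF ihom_onto, symmetric]) (simp_all del: hom_module_simps(2-))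

lemma ihom_cases:
  assumes "z \<in> el (ih M N) s"
  obtains \<alpha> where "\<alpha> \<in> hm M N s" "z = \<epsilon> M N s \<alpha>"
  using assms by (auto simp: ihom_carrier)

lemma hom_add_closed: "\<alpha> \<in> hm M N s \<Longrightarrow> \<beta> \<in> hm M N s \<Longrightarrow> \<alpha> \<oplus>\<^bsub>hom_module R M (shift s N)\<^esub> \<beta> \<in> hm M N s"
  using mod_add[OF hom_module_is_module[OF M shift_pmod[OF N]], of \<alpha> s \<beta>] by simp

lemma hom_smult_closed: "a \<in> carrier R \<Longrightarrow> \<alpha> \<in> hm M N s \<Longrightarrow> a \<odot>\<^bsub>hom_module R M (shift s N)\<^esub> \<alpha> \<in> hm M N s"
  using mod_smult[OF hom_module_is_module[OF M shift_pmod[OF N]], of a \<alpha> s] by simp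

text \<open>Separates the coding from the mathematics: from here on transitions of hom objects are
  computed with honest transformations by \<open>hom_up\<close>.\<close>

lemma ihom_tmap:
  assumes "\<alpha> \<in> hm M N s"
  shows "tmap (ih M N) s t (\<epsilon> M N s \<alpha>) = \<epsilon> M N t (hom_up M N s t \<alpha>)"
proof -
  have "\<epsilon> M N s \<alpha> \<in> carrier (copy_module \<V> (hom_module R M (shift s N)))"
    using ihom_elem_closed[OF assms] unfolding ihom_stalk .
  then show ?thesis
    by (simp add: ihom_def ihom_decode[OF assms] hom_up_def)
      (simp add: ihom_elem_def)
qed

lemma ihom_pmod: "ih M N \<in> pm"
proof -
  have mod: "module R (stalk (ih M N) s)" for s
    by (rule lin_onto_module[OF hom_module_is_module[OF M shift_pmod[OF N]] ihom_onto])
  have lin: "tmap (ih M N) s t \<in> lin_maps R (stalk (ih M N) s) (stalk (ih M N) t)" if st: "s \<le> t" for s t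
  proof (rule lin_mapsI)
    show "tmap (ih M N) s t \<in> extensional (el (ih M N) s)"
      by (simp add: ihom_def)
    have le: "x + s \<le> x + t" for x by (rule preordered_add_mono[OF order_refl st])
    fix x assume "x \<in> el (ih M N) s"
    then obtain \<alpha> where \<alpha>: "\<alpha> \<in> hm M N s" "x = \<epsilon> M N s \<alpha>" by (rule ihom_cases)
    then show "tmap (ih M N) s t x \<in> el (ih M N) t"
      by (simp add: ihom_tmap ihom_elem_closed hom_up_hm[OF M N st])
    show "tmap (ih M N) s t (a \<odot>\<^bsub>stalk (ih M N) s\<^esub> x) = a \<odot>\<^bsub>stalk (ih M N) t\<^esub> tmap (ih M N) s t x"
      if a: "a \<in> carrier R" for a
    proof -
      have "hom_up M N s t (a \<odot>\<^bsub>hom_module R M (shift s N)\<^esub> \<alpha>) = a \<odot>\<^bsub>hom_module R M (shift t N)\<^esub> hom_up M N s t \<alpha>"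
        using a \<alpha>(1)
        by (intro nat_eqI[OF hom_up_hm[OF M N st hom_smult_closed] hom_smult_closed[OF _ hom_up_hm[OF M N
            st]]])
          (simp_all add: tmap_smult[OF N le] hm_closed)
      then show ?thesis
        using a \<alpha> by (simp add: ihom_elem_smult ihom_tmap hom_smult_closed hom_up_hm[OF M N st]
            del: hom_module_simps)
    qed
    fix y assume "y \<in> el (ih M N) s"
    then obtain \<beta> where \<beta>: "\<beta> \<in> hm M N s" "y = \<epsilon> M N s \<beta>" by (rule ihom_cases)
    have "hom_up M N s t (\<alpha> \<oplus>\<^bsub>hom_module R M (shift s N)\<^esub> \<beta>) =
        hom_up M N s t \<alpha> \<oplus>\<^bsub>hom_module R M (shift t N)\<^esub> hom_up M N s t \<beta>"
      using \<alpha>(1) \<beta>(1)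
      by (intro nat_eqI[OF hom_up_hm[OF M N st hom_add_closed] hom_add_closed[OF hom_up_hm[OF M N st]
          hom_up_hm[OF M N st]]])
        (simp_all add: tmap_add[OF N le] hm_closed)
    then show "tmap (ih M N) s t (x \<oplus>\<^bsub>stalk (ih M N) s\<^esub> y) =
        tmap (ih M N) s t x \<oplus>\<^bsub>stalk (ih M N) t\<^esub> tmap (ih M N) s t y"
      using \<alpha> \<beta> by (simp add: ihom_elem_add ihom_tmap hom_add_closed hom_up_hm[OF M N st]
          del: hom_module_simps)
  qed
  have refl: "tmap (ih M N) s s z = z" if z: "z \<in> el (ih M N) s" for s z
  proof -
    obtain \<alpha> where \<alpha>: "\<alpha> \<in> hm M N s" "z = \<epsilon> M N s \<alpha>" using z by (rule ihom_cases)
    have "hom_up M N s s \<alpha> = \<alpha>"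
      by (rule nat_eqI[OF hom_up_hm[OF M N order_refl \<alpha>(1)] \<alpha>(1)])
        (simp add: pmod_tmap_refl[OF N] hm_closed[OF \<alpha>(1)])
    with \<alpha> show ?thesis by (simp add: ihom_tmap)
  qed
  have trans: "tmap (ih M N) t r (tmap (ih M N) s t z) = tmap (ih M N) s r z"
    if st: "s \<le> t" "t \<le> r" and z: "z \<in> el (ih M N) s" for s t r z
  proof -
    obtain \<alpha> where \<alpha>: "\<alpha> \<in> hm M N s" "z = \<epsilon> M N s \<alpha>" using z by (rule ihom_cases)
    have sr: "s \<le> r" using st by (rule order_trans)
    have le: "x + s \<le> x + t" "x + t \<le> x + r" for x
      using st by (simp_all add: preordered_add_mono)
    have "hom_up M N t r (hom_up M N s t \<alpha>) = hom_up M N s r \<alpha>"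
      by (rule nat_eqI[OF hom_up_hm[OF M N st(2) hom_up_hm[OF M N st(1) \<alpha>(1)]] hom_up_hm[OF M N sr \<alpha>(1)]])
        (simp add: pmod_tmap_tmap[OF N] le hm_closed[OF \<alpha>(1)])
    with \<alpha> show ?thesis by (simp add: ihom_tmap hom_up_hm[OF M N st(1)])
  qed
  have carr: "el (ih M N) s \<in> \<V>" for s
    unfolding ihom_carrier unfolding ihom_elem_def
    by (rule code_inj_image(2)[OF V small_nat_trans[OF M shift_pmod[OF N]]])
  show ?thesis
    unfolding pmods_def persistence_module_def
    by (intro CollectI conjI allI impI ballI mod lin refl trans carr)
qed

end

lemma hom_comp_up_left:
  assumes M: "M \<in> um" and N: "N \<in> um" and L: "L \<in> um" and \<beta>: "\<beta> \<in> hm N L t" and \<alpha>: "\<alpha> \<in> hm M N s"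
    and t: "t \<le> t'"
  shows "hom_comp M s (hom_up N L t t' \<beta>) \<alpha> = hom_up M L (s + t) (s + t') (hom_comp M s \<beta> \<alpha>)"
proof -
  have st: "s + t \<le> s + t'" by (rule preordered_add_mono[OF order_refl t])
  show ?thesis
  proof (rule nat_eqI[OF hom_comp_hm[OF M \<alpha> hom_up_hm[OF N L t \<beta>]] hom_up_hm[OF M L st hom_comp_hm[OF M \<alpha>
      \<beta>]]])
    fix x m assume m: "m \<in> el M x"
    have "\<alpha> x m \<in> el N (s + x)" by (rule hm_closed[OF \<alpha> m]) (simp add: add.commute)
    then show "hom_comp M s (hom_up N L t t' \<beta>) \<alpha> x m = hom_up M L (s + t) (s + t') (hom_comp M s \<beta> \<alpha>) x m"
      using m by (simp add: add_ac)
  qed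
qed

text \<open>Raising the degree of \<open>\<alpha>\<close> inserts a transition map of
  \<open>N\<close> before \<open>\<beta>\<close>, and naturality of \<open>\<beta>\<close> moves it
  behind.\<close>

lemma hom_comp_up_right:
  assumes M: "M \<in> um" and N: "N \<in> um" and L: "L \<in> um" and \<beta>: "\<beta> \<in> hm N L t" and \<alpha>: "\<alpha> \<in> hm M N s"
    and s: "s \<le> s'"
  shows "hom_comp M s' \<beta> (hom_up M N s s' \<alpha>) = hom_up M L (s + t) (s' + t) (hom_comp M s \<beta> \<alpha>)"
proof -
  have st: "s + t \<le> s' + t" by (rule add_right_mono_preorder[OF s])
  show ?thesis
  proof (rule nat_eqI[OF hom_comp_hm[OF M hom_up_hm[OF M N s \<alpha>] \<beta>] hom_up_hm[OF M L st hom_comp_hm[OF M \<alpha>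
      \<beta>]]])
    fix x m assume m: "m \<in> el M x"
    have le: "x + s \<le> x + s'" by (rule preordered_add_mono[OF order_refl s])
    show "hom_comp M s' \<beta> (hom_up M N s s' \<alpha>) x m = hom_up M L (s + t) (s' + t) (hom_comp M s \<beta> \<alpha>) x m"
      using m hm_natural[OF \<beta> le hm_closed[OF \<alpha> m refl]] by (simp add: add_ac)
  qed
qed

text \<open>Coded transformations are decoded, composed and coded again. The factors come in the
  order \<open>\<beta>\<close>, \<open>\<alpha>\<close>, hence with degrees \<open>t\<close>,
  \<open>s\<close>, while the composite has degree \<open>s + t\<close>; commutativity of
  \<open>P\<close> reconciles the two. Bilinearity is that of \<open>hom_comp\<close>, and
  naturality is its compatibility with \<open>hom_up\<close> on either side.\<close>

lemma ihom_comp_bimap: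
  assumes M: "M \<in> um" and N: "N \<in> um" and L: "L \<in> um"
  shows "bimap (ih N L) (ih M N) (ih M L)
    (\<lambda>t s y x. \<epsilon> M L (s + t) (hom_comp M s (decode \<V> (hm N L t) y) (decode \<V> (hm M N s) x)))"
proof -
  note [simp] = ihom_decode[OF M N] ihom_decode[OF N L] ihom_tmap[OF M N] ihom_tmap[OF N L] ihom_tmap[OF M L]
    ihom_elem_add[OF M N] ihom_elem_add[OF N L] ihom_elem_add[OF M L]
    ihom_elem_smult[OF M N] ihom_elem_smult[OF N L] ihom_elem_smult[OF M L]
    hom_add_closed[OF M N] hom_add_closed[OF N L] hom_smult_closed[OF M N] hom_smult_closed[OF N L]
    ihom_elem_closed[OF M L] hom_comp_hm[OF M] hom_comp_add_left hom_comp_add_right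
    hom_comp_smult_left hom_comp_smult_right hom_up_hm[OF M N] hom_up_hm[OF N L]
    hom_comp_up_left[OF M N L] hom_comp_up_right[OF M N L] add.commute
  note [simp del] = hom_module_simps
  show ?thesis
  proof (rule bimapI)
    fix t s
    show "bilin R (stalk (ih N L) t) (stalk (ih M N) s) (stalk (ih M L) (t + s))
      (\<lambda>y x. \<epsilon> M L (s + t) (hom_comp M s (decode \<V> (hm N L t) y) (decode \<V> (hm M N s) x)))"
    proof (rule bilinI, unfold add.commute[of t s])
      fix y x assume "y \<in> el (ih N L) t" "x \<in> el (ih M N) s"
      then obtain \<alpha> \<beta> where \<alpha>: "\<alpha> \<in> hm M N s" "x = \<epsilon> M N s \<alpha>" and \<beta>: "\<beta> \<in> hm N L t" "y = \<epsilon> N L t \<beta>"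
        by (auto elim!: ihom_cases[OF M N] ihom_cases[OF N L])
      note c = hom_comp_hm[OF M \<alpha>(1) \<beta>(1)]
      show "\<epsilon> M L (s + t) (hom_comp M s (decode \<V> (hm N L t) y) (decode \<V> (hm M N s) x)) \<in> el (ih M L)
          (s + t)"
        using \<alpha> \<beta> c by simp
      show "\<epsilon> M L (s + t) (hom_comp M s (decode \<V> (hm N L t) (a \<odot>\<^bsub>stalk (ih N L) t\<^esub> y)) (decode \<V> (hm M N s) x))
          =
        a \<odot>\<^bsub>stalk (ih M L) (s + t)\<^esub> \<epsilon> M L (s + t) (hom_comp M s (decode \<V> (hm N L t) y) (decode \<V> (hm M N s)
            x))"
        "\<epsilon> M L (s + t) (hom_comp M s (decode \<V> (hm N L t) y) (decode \<V> (hm M N s) (a \<odot>\<^bsub>stalk (ih M N) s\<^esub> x))) =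
        a \<odot>\<^bsub>stalk (ih M L) (s + t)\<^esub> \<epsilon> M L (s + t) (hom_comp M s (decode \<V> (hm N L t) y) (decode \<V> (hm M N s)
            x))"
        if "a \<in> carrier R" for a
        using \<alpha> \<beta> c that by simp_all
      show "\<epsilon> M L (s + t) (hom_comp M s (decode \<V> (hm N L t) (y \<oplus>\<^bsub>stalk (ih N L) t\<^esub> y')) (decode \<V> (hm M N s)
          x)) =
        \<epsilon> M L (s + t) (hom_comp M s (decode \<V> (hm N L t) y) (decode \<V> (hm M N s) x)) \<oplus>\<^bsub>stalk (ih M L) (s + t)\<^esub>
        \<epsilon> M L (s + t) (hom_comp M s (decode \<V> (hm N L t) y') (decode \<V> (hm M N s) x))"
        if y': "y' \<in> el (ih N L) t" for y'
      proof -
        obtain \<beta>' where "\<beta>' \<in> hm N L t" "y' = \<epsilon> N L t \<beta>'" using y' by (rule ihom_cases[OF N L])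
        then show ?thesis using \<alpha> \<beta> c hom_comp_hm[OF M \<alpha>(1), of \<beta>'] by simp
      qed
      show "\<epsilon> M L (s + t) (hom_comp M s (decode \<V> (hm N L t) y) (decode \<V> (hm M N s) (x \<oplus>\<^bsub>stalk (ih M N)
          s\<^esub> x'))) =
        \<epsilon> M L (s + t) (hom_comp M s (decode \<V> (hm N L t) y) (decode \<V> (hm M N s) x)) \<oplus>\<^bsub>stalk (ih M L) (s + t)\<^esub>
        \<epsilon> M L (s + t) (hom_comp M s (decode \<V> (hm N L t) y) (decode \<V> (hm M N s) x'))"
        if x': "x' \<in> el (ih M N) s" for x'
      proof -
        obtain \<alpha>' where "\<alpha>' \<in> hm M N s" "x' = \<epsilon> M N s \<alpha>'" using x' by (rule ihom_cases[OF M N])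
        then show ?thesis using \<alpha> \<beta> c hom_comp_hm[OF M _ \<beta>(1), of \<alpha>'] by simp
      qed
    qed
  next
    fix t t' s y x assume tt: "t \<le> t'" and "y \<in> el (ih N L) t" "x \<in> el (ih M N) s"
    then obtain \<alpha> \<beta> where \<alpha>: "\<alpha> \<in> hm M N s" "x = \<epsilon> M N s \<alpha>" and \<beta>: "\<beta> \<in> hm N L t" "y = \<epsilon> N L t \<beta>"
      by (auto elim!: ihom_cases[OF M N] ihom_cases[OF N L])
    then show "\<epsilon> M L (s + t') (hom_comp M s (decode \<V> (hm N L t') (tmap (ih N L) t t' y)) (decode \<V> (hm M N s)
        x)) =
      tmap (ih M L) (t + s) (t' + s) (\<epsilon> M L (s + t) (hom_comp M s (decode \<V> (hm N L t) y) (decode \<V> (hm M N s)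
          x)))"
      using tt hom_comp_hm[OF M \<alpha>(1) \<beta>(1)] unfolding add.commute[of t s] add.commute[of t' s]
      by simp
  next
    fix s s' t y x assume ss: "s \<le> s'" and "y \<in> el (ih N L) t" "x \<in> el (ih M N) s"
    then obtain \<alpha> \<beta> where \<alpha>: "\<alpha> \<in> hm M N s" "x = \<epsilon> M N s \<alpha>" and \<beta>: "\<beta> \<in> hm N L t" "y = \<epsilon> N L t \<beta>"
      by (auto elim!: ihom_cases[OF M N] ihom_cases[OF N L])
    then show "\<epsilon> M L (s' + t) (hom_comp M s' (decode \<V> (hm N L t) y) (decode \<V> (hm M N s') (tmap (ih M N)
        s s' x))) =
      tmap (ih M L) (t + s) (t + s') (\<epsilon> M L (s + t) (hom_comp M s (decode \<V> (hm N L t) y) (decode \<V> (hm M N s)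
          x)))"
      using ss hom_comp_hm[OF M \<alpha>(1) \<beta>(1)] unfolding add.commute[of t s] add.commute[of t s']
      by simp
  qed
qed

lemma ihom_ext:
  assumes M: "M \<in> um" and N: "N \<in> um" and L: "L \<in> um"
    and h: "h \<in> nat_trans R (ih N L \<boxtimes> ih M N) K" and h': "h' \<in> nat_trans R (ih N L \<boxtimes> ih M N) K"
    and eq: "\<And>t s \<beta> \<alpha>. \<beta> \<in> hm N L t \<Longrightarrow> \<alpha> \<in> hm M N s \<Longrightarrow>
      h (t + s) (gp (ih N L) (ih M N) t s (t + s) (\<epsilon> N L t \<beta>) (\<epsilon> M N s \<alpha>)) =
      h' (t + s) (gp (ih N L) (ih M N) t s (t + s) (\<epsilon> N L t \<beta>) (\<epsilon> M N s \<alpha>))"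
  shows "h = h'"
  by (rule gr_ext[OF ihom_pmod[OF N L] ihom_pmod[OF M N] h h'])
    (auto elim!: ihom_cases[OF M N] ihom_cases[OF N L] simp: eq)

lemma ihom_comp:
  assumes M: "M \<in> um" and N: "N \<in> um" and L: "L \<in> um"
  shows ihom_comp_nat: "ihom_comp R \<V> M N L \<in> nat_trans R (ih N L \<boxtimes> ih M N) (ih M L)"
    and ihom_comp_pure: "\<And>t s r \<beta> \<alpha>. r = t + s \<Longrightarrow> \<beta> \<in> hm N L t \<Longrightarrow> \<alpha> \<in> hm M N s \<Longrightarrow>
      ihom_comp R \<V> M N L r (gp (ih N L) (ih M N) t s r (\<epsilon> N L t \<beta>) (\<epsilon> M N s \<alpha>)) =
      \<epsilon> M L r (hom_comp M s \<beta> \<alpha>)"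
proof -
  let ?Q = "\<lambda>h. h \<in> nat_trans R (ih N L \<boxtimes> ih M N) (ih M L) \<and>
        (\<forall>s t r. t + s \<le> r \<longrightarrow> (\<forall>\<beta>\<in>hm N L t. \<forall>\<alpha>\<in>hm M N s.
             h r (gp (ih N L) (ih M N) t s r (\<epsilon> N L t \<beta>) (\<epsilon> M N s \<alpha>)) =
             tmap (ih M L) (s + t) r (\<epsilon> M L (s + t) (hom_comp M s \<beta> \<alpha>))))"
  obtain h where h: "h \<in> nat_trans R (ih N L \<boxtimes> ih M N) (ih M L)" and
    h': "\<And>t s r y x. t + s \<le> r \<Longrightarrow> y \<in> el (ih N L) t \<Longrightarrow> x \<in> el (ih M N) s \<Longrightarrow>
      h r (gp (ih N L) (ih M N) t s r y x) = tmap (ih M L) (t + s) r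
        (\<epsilon> M L (s + t) (hom_comp M s (decode \<V> (hm N L t) y) (decode \<V> (hm M N s) x)))"
    by (rule gr_lift[OF ihom_pmod[OF N L] ihom_pmod[OF M N] ihom_pmod[OF M L] ihom_comp_bimap[OF M N L]])
        blast
  have Q: "?Q h"
    using h by (auto simp: h' ihom_elem_closed M N L ihom_decode add.commute)
  have "h'' = h" if "?Q h''" for h''
    by (rule ihom_ext[OF M N L]) (use that Q in auto)
  with Q have ex: "\<exists>!h. ?Q h" by (intro ex1I[of ?Q]) auto
  have *: "?Q (ihom_comp R \<V> M N L)"
    unfolding ihom_comp_def by (rule theI'[OF ex])
  then show "ihom_comp R \<V> M N L \<in> nat_trans R (ih N L \<boxtimes> ih M N) (ih M L)" by blast
  show "ihom_comp R \<V> M N L r (gp (ih N L) (ih M N) t s r (\<epsilon> N L t \<beta>) (\<epsilon> M N s \<alpha>)) =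
      \<epsilon> M L r (hom_comp M s \<beta> \<alpha>)"
    if r: "r = t + s" and \<beta>: "\<beta> \<in> hm N L t" and \<alpha>: "\<alpha> \<in> hm M N s" for t s r \<beta> \<alpha>
  proof -
    have "\<epsilon> M L (s + t) (hom_comp M s \<beta> \<alpha>) \<in> el (ih M L) (s + t)"
      by (rule ihom_elem_closed[OF M L hom_comp_hm[OF M \<alpha> \<beta>]])
    then show ?thesis
      using * \<beta> \<alpha> by (simp add: r pmod_tmap_refl[OF ihom_pmod[OF M L]] add.commute[of t s])
  qed
qed

text \<open>The Yoneda map for the coded identity, an element of the hom object in degree 0.\<close>

lemma ihom_id:
  assumes M: "M \<in> um"
  shows ihom_id_nat: "ihom_id R \<V> M \<in> nat_trans R I (ih M M)"
    and ihom_id_one: "ihom_id R \<V> M 0 (\<upsilon> \<one>) = \<epsilon> M M 0 (id_trans M)"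
proof -
  let ?Q = "\<lambda>h. h \<in> nat_trans R I (ih M M) \<and> h 0 (\<upsilon> \<one>) = \<epsilon> M M 0 (id_trans M)"
  note MM = ihom_pmod[OF M M]
  have Q: "?Q (unit_map (ih M M) (\<epsilon> M M 0 (id_trans M)))"
    by (intro conjI unit_map_nat[OF MM] ihom_elem_closed[OF M M] id_trans_hm[OF M])
  have "\<exists>!h. ?Q h"
    by (rule ex1I[of ?Q, OF Q]) (rule unit_ext[OF _ _ MM], use Q in auto)
  from theI'[OF this] show "ihom_id R \<V> M \<in> nat_trans R I (ih M M)"
    "ihom_id R \<V> M 0 (\<upsilon> \<one>) = \<epsilon> M M 0 (id_trans M)"
    unfolding ihom_id_def by blast+
qed

text \<open>Every element of a hom object is a coded transformation, so a triple pure tensor carries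
  three composable morphisms, and the diagram becomes associativity of
  \<open>hom_comp\<close>.\<close>

lemma ihom_comp_assoc:
  assumes A: "A \<in> um" and B: "B \<in> um" and C: "C \<in> um" and D: "D \<in> um"
  shows "hom_comp ((ih C D \<boxtimes> ih B C) \<boxtimes> ih A B) 0 (ihom_comp R \<V> A B D)
      (th (ih C D \<boxtimes> ih B C) (ih B D) (ih A B) (ih A B) 0 0 (ihom_comp R \<V> B C D) (id_trans (ih A B))) =
    hom_comp ((ih C D \<boxtimes> ih B C) \<boxtimes> ih A B) 0
      (hom_comp (ih C D \<boxtimes> (ih B C \<boxtimes> ih A B)) 0 (ihom_comp R \<V> A C D)
        (th (ih C D) (ih C D) (ih B C \<boxtimes> ih A B) (ih A C) 0 0 (id_trans (ih C D)) (ihom_comp R \<V> A B C)))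
      (gr_assoc R \<V> (ih C D) (ih B C) (ih A B))" (is "?lhs = ?rhs")
proof -
  note [simp] = A B C D ihom_pmod gr_tensor_pmod gr_assoc_nat id_trans_nat[where \<U> = \<V>]
      gr_tensor_hom_nat gr_pure_closed
    ihom_comp_nat ihom_elem_closed
  have hl: "?lhs \<in> nat_trans R ((ih C D \<boxtimes> ih B C) \<boxtimes> ih A B) (ih A D)"
    by (rule hom_comp_nat[where \<U> = \<V> and N = "ih B D \<boxtimes> ih A B"]) simp_all
  have hr: "?rhs \<in> nat_trans R ((ih C D \<boxtimes> ih B C) \<boxtimes> ih A B) (ih A D)"
    by (rule hom_comp_nat[where \<U> = \<V> and N = "ih C D \<boxtimes> (ih B C \<boxtimes> ih A B)"], simp_all,
        rule hom_comp_nat[where \<U> = \<V> and N = "ih C D \<boxtimes> ih A C"]) simp_all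
  show ?thesis
  proof (rule gr_ext_left[OF ihom_pmod[OF C D] ihom_pmod[OF B C] ihom_pmod[OF A B] hl hr])
    fix r t s z y x
    assume "z \<in> el (ih C D) r" "y \<in> el (ih B C) t" "x \<in> el (ih A B) s"
    then obtain \<gamma> \<beta> \<alpha> where \<gamma>: "\<gamma> \<in> hm C D r" "z = \<epsilon> C D r \<gamma>" and \<beta>: "\<beta> \<in> hm B C t" "y = \<epsilon> B C t \<beta>"
      and \<alpha>: "\<alpha> \<in> hm A B s" "x = \<epsilon> A B s \<alpha>"
      by (auto elim!: ihom_cases[OF C D] ihom_cases[OF B C] ihom_cases[OF A B])
    have 1: "hom_comp B t \<gamma> \<beta> \<in> hm B D (r + t)"
      using hom_comp_hm[OF B \<beta>(1) \<gamma>(1)] by (simp add: add.commute)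
    have 2: "hom_comp A s \<beta> \<alpha> \<in> hm A C (t + s)"
      using hom_comp_hm[OF A \<alpha>(1) \<beta>(1)] by (simp add: add.commute)
    show "?lhs (r + t + s) (gp (ih C D \<boxtimes> ih B C) (ih A B) (r + t) s (r + t + s)
        (gp (ih C D) (ih B C) r t (r + t) z y) x) =
      ?rhs (r + t + s) (gp (ih C D \<boxtimes> ih B C) (ih A B) (r + t) s (r + t + s)
        (gp (ih C D) (ih B C) r t (r + t) z y) x)"
      using \<gamma> \<beta> \<alpha> 1 2
      by (simp add: gr_assoc_value gr_tensor_hom_nat_value ihom_comp_pure add.assoc hom_comp_assoc[OF \<alpha>(1)])
        (simp add: add.commute)
  qed
qed

text \<open>By \<open>gr_ext_lunit\<close> only the generator of the unit counts. It goes to the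
  coded identity, which leaves the unit law of \<open>hom_comp\<close>.\<close>

lemma ihom_comp_id_left:
  assumes M: "M \<in> um" and N: "N \<in> um"
  shows "hom_comp (I \<boxtimes> ih M N) 0 (ihom_comp R \<V> M N N)
      (th I (ih N N) (ih M N) (ih M N) 0 0 (ihom_id R \<V> N) (id_trans (ih M N))) = gr_lunit R \<V> (ih M N)"
    (is "?lhs = ?rhs")
proof -
  note [simp] = M N unit_pmod ihom_pmod gr_tensor_pmod id_trans_nat[where \<U> = \<V>]
      gr_tensor_hom_nat gr_pure_closed
    ihom_comp_nat ihom_elem_closed ihom_id_nat ihom_id_one
  have hl: "?lhs \<in> nat_trans R (I \<boxtimes> ih M N) (ih M N)"
    by (rule hom_comp_nat[where \<U> = \<V> and N = "ih N N \<boxtimes> ih M N"]) simp_all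
  show ?thesis
  proof (rule gr_ext_lunit[OF ihom_pmod[OF M N] ihom_pmod[OF M N] hl gr_lunit_nat[OF ihom_pmod[OF M N]]])
    fix s x assume "x \<in> el (ih M N) s"
    then obtain \<alpha> where \<alpha>: "\<alpha> \<in> hm M N s" "x = \<epsilon> M N s \<alpha>" by (rule ihom_cases[OF M N])
    then show "?lhs s (gp I (ih M N) 0 s s (\<upsilon> \<one>) x) = ?rhs s (gp I (ih M N) 0 s s (\<upsilon> \<one>) x)"
      by (simp add: gr_tensor_hom_nat_value ihom_comp_pure gr_lunit_pure id_trans_hm[OF N, simplified]
          hom_comp_id_left[OF M N \<alpha>(1)])
  qed
qed

lemma ihom_comp_id_right:
  assumes M: "M \<in> um" and N: "N \<in> um"
  shows "hom_comp (ih M N \<boxtimes> I) 0 (ihom_comp R \<V> M M N)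
      (th (ih M N) (ih M N) I (ih M M) 0 0 (id_trans (ih M N)) (ihom_id R \<V> M)) = gr_runit R \<V> (ih M N)"
    (is "?lhs = ?rhs")
proof -
  note [simp] = M N unit_pmod ihom_pmod gr_tensor_pmod id_trans_nat[where \<U> = \<V>]
      gr_tensor_hom_nat gr_pure_closed
    ihom_comp_nat ihom_elem_closed ihom_id_nat ihom_id_one
  have hl: "?lhs \<in> nat_trans R (ih M N \<boxtimes> I) (ih M N)"
    by (rule hom_comp_nat[where \<U> = \<V> and N = "ih M N \<boxtimes> ih M M"]) simp_all
  show ?thesis
  proof (rule gr_ext_runit[OF ihom_pmod[OF M N] ihom_pmod[OF M N] hl gr_runit_nat[OF ihom_pmod[OF M N]]])
    fix s x assume "x \<in> el (ih M N) s"
    then obtain \<alpha> where \<alpha>: "\<alpha> \<in> hm M N s" "x = \<epsilon> M N s \<alpha>" by (rule ihom_cases[OF M N])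
    then show "?lhs s (gp (ih M N) I s 0 s x (\<upsilon> \<one>)) = ?rhs s (gp (ih M N) I s 0 s x (\<upsilon> \<one>))"
      by (simp add: gr_tensor_hom_nat_value ihom_comp_pure gr_runit_pure id_trans_hm[OF M, simplified]
          hom_comp_id_right[OF M \<alpha>(1)])
  qed
qed

end

section \<open>Biadditive extension from homogeneous elements\<close>

text \<open>The common shape of composition and tensor product of homogeneous morphisms. The
  function \<open>d\<close> gives the degree of the result, so that composition, whose arguments
  come in reversed order, fits as well.\<close>

definition biadditive :: "('i \<Rightarrow> ('r, 'a) module) \<Rightarrow> ('j \<Rightarrow> ('r, 'b) module) \<Rightarrow> ('k \<Rightarrow> ('r, 'c) module) \<Rightarrow>
    ('i \<Rightarrow> 'j \<Rightarrow> 'k) \<Rightarrow> ('i \<Rightarrow> 'j \<Rightarrow> 'a \<Rightarrow> 'b \<Rightarrow> 'c) \<Rightarrow> bool" where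
  "biadditive A B C d b \<longleftrightarrow>
    (\<forall>i j. \<forall>x\<in>carrier (A i). \<forall>y\<in>carrier (B j). b i j x y \<in> carrier (C (d i j))) \<and>
    (\<forall>i j. \<forall>x\<in>carrier (A i). \<forall>x'\<in>carrier (A i). \<forall>y\<in>carrier (B j).
      b i j (x \<oplus>\<^bsub>A i\<^esub> x') y = b i j x y \<oplus>\<^bsub>C (d i j)\<^esub> b i j x' y) \<and>
    (\<forall>i j. \<forall>x\<in>carrier (A i). \<forall>y\<in>carrier (B j). \<forall>y'\<in>carrier (B j).
      b i j x (y \<oplus>\<^bsub>B j\<^esub> y') = b i j x y \<oplus>\<^bsub>C (d i j)\<^esub> b i j x y')"

text \<open>The body is modelled on \<open>gcomp\<close> and \<open>gtensor_hom\<close>, so that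
  both are instances merely by unfolding.\<close>

definition dsum_extend :: "('i \<Rightarrow> ('r, 'a) module) \<Rightarrow> ('j \<Rightarrow> ('r, 'b) module) \<Rightarrow> ('k \<Rightarrow> ('r, 'c) module) \<Rightarrow>
    ('i \<Rightarrow> 'j \<Rightarrow> 'k) \<Rightarrow> ('i \<Rightarrow> 'j \<Rightarrow> 'a \<Rightarrow> 'b \<Rightarrow> 'c) \<Rightarrow> ('i \<Rightarrow> 'a) \<Rightarrow> ('j \<Rightarrow> 'b) \<Rightarrow> 'k \<Rightarrow> 'c" where
  "dsum_extend A B C d b \<psi> \<phi> = finsum (dsum_module UNIV C)
     (\<lambda>(i, j). dsum_single UNIV C (d i j) (b i j (\<psi> i) (\<phi> j)))
     ({i. \<psi> i \<noteq> \<zero>\<^bsub>A i\<^esub>} \<times> {j. \<phi> j \<noteq> \<zero>\<^bsub>B j\<^esub>})"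

lemma (in cring) mod_add_self:
  assumes "module R A" "x \<in> carrier A" "x \<oplus>\<^bsub>A\<^esub> x = x"
  shows "x = \<zero>\<^bsub>A\<^esub>"
proof -
  interpret A: module R A by fact
  show ?thesis using assms(2,3) by (metis A.add.r_cancel_one')
qed

context cring
begin

context
  fixes A :: "'i \<Rightarrow> ('a, 'c) module" and B :: "'j \<Rightarrow> ('a, 'd) module" and C :: "'k \<Rightarrow> ('a, 'e) module"
    and d :: "'i \<Rightarrow> 'j \<Rightarrow> 'k" and b :: "'i \<Rightarrow> 'j \<Rightarrow> 'c \<Rightarrow> 'd \<Rightarrow> 'e"
  assumes A: "\<And>i. module R (A i)" and B: "\<And>j. module R (B j)" and C: "\<And>k. module R (C k)"
    and b: "biadditive A B C d b"
begin

private abbreviation "DA \<equiv> dsum_module UNIV A"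
private abbreviation "DB \<equiv> dsum_module UNIV B"
private abbreviation "DC \<equiv> dsum_module UNIV C"
private abbreviation "g \<psi> \<phi> \<equiv> \<lambda>(i, j). dsum_single UNIV C (d i j) (b i j (\<psi> i) (\<phi> j))"

private lemma DC: "module R DC"
  by (rule dsum_module_is_module[OF C])

private lemma bc: "x \<in> carrier (A i) \<Longrightarrow> y \<in> carrier (B j) \<Longrightarrow> b i j x y \<in> carrier (C (d i j))"
  and bl: "x \<in> carrier (A i) \<Longrightarrow> x' \<in> carrier (A i) \<Longrightarrow> y \<in> carrier (B j) \<Longrightarrow>
      b i j (x \<oplus>\<^bsub>A i\<^esub> x') y = b i j x y \<oplus>\<^bsub>C (d i j)\<^esub> b i j x' y"
  and br: "x \<in> carrier (A i) \<Longrightarrow> y \<in> carrier (B j) \<Longrightarrow> y' \<in> carrier (B j) \<Longrightarrow>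
      b i j x (y \<oplus>\<^bsub>B j\<^esub> y') = b i j x y \<oplus>\<^bsub>C (d i j)\<^esub> b i j x y'"
  using b by (simp_all add: biadditive_def)

text \<open>From additivity alone: the value at zero equals its own double.\<close>

private lemma bz: "y \<in> carrier (B j) \<Longrightarrow> b i j \<zero>\<^bsub>A i\<^esub> y = \<zero>\<^bsub>C (d i j)\<^esub>"
  using bl[of "\<zero>\<^bsub>A i\<^esub>" i "\<zero>\<^bsub>A i\<^esub>" y j] A
  by (intro mod_add_self[OF C bc]) simp_all

private lemma zb: "x \<in> carrier (A i) \<Longrightarrow> b i j x \<zero>\<^bsub>B j\<^esub> = \<zero>\<^bsub>C (d i j)\<^esub>"
  using br[of x i "\<zero>\<^bsub>B j\<^esub>" j "\<zero>\<^bsub>B j\<^esub>"] B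
  by (intro mod_add_self[OF C bc]) simp_all

private lemma g_closed:
  assumes "\<psi> \<in> carrier DA" "\<phi> \<in> carrier DB"
  shows "g \<psi> \<phi> \<in> X \<rightarrow> carrier DC"
proof
  fix x assume "x \<in> X"
  obtain i j where x: "x = (i, j)" by (cases x)
  have "\<psi> i \<in> carrier (A i)" "\<phi> j \<in> carrier (B j)"
    using dsum_carrierD(2)[OF assms(1)] dsum_carrierD(2)[OF assms(2)] by simp_all
  then show "g \<psi> \<phi> x \<in> carrier DC"
    unfolding x using dsum_single_closed[of UNIV C, OF C UNIV_I bc] by simp
qed

text \<open>Terms outside the supports vanish, so the sum may be taken over larger finite sets. This
  is what allows sums with different supports to be compared.\<close>

private lemma extend_eq:
  assumes \<psi>: "\<psi> \<in> carrier DA" and \<phi>: "\<phi> \<in> carrier DB"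
    and S: "finite S" "{i. \<psi> i \<noteq> \<zero>\<^bsub>A i\<^esub>} \<subseteq> S" and T: "finite T" "{j. \<phi> j \<noteq> \<zero>\<^bsub>B j\<^esub>} \<subseteq> T"
  shows "dsum_extend A B C d b \<psi> \<phi> = finsum DC (g \<psi> \<phi>) (S \<times> T)"
proof -
  interpret DC: module R DC by (rule DC)
  note \<psi>c = dsum_carrierD(2)[OF \<psi> UNIV_I] and \<phi>c = dsum_carrierD(2)[OF \<phi> UNIV_I]
  show ?thesis
    unfolding dsum_extend_def
  proof (rule DC.add.finprod_mono_neutral_cong_left)
    show "finite (S \<times> T)" using S T by simp
    show "{i. \<psi> i \<noteq> \<zero>\<^bsub>A i\<^esub>} \<times> {j. \<phi> j \<noteq> \<zero>\<^bsub>B j\<^esub>} \<subseteq> S \<times> T" using S T by blast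
    show "g \<psi> \<phi> \<in> S \<times> T \<rightarrow> carrier DC" by (rule g_closed[OF \<psi> \<phi>])
    fix x assume x: "x \<in> S \<times> T - {i. \<psi> i \<noteq> \<zero>\<^bsub>A i\<^esub>} \<times> {j. \<phi> j \<noteq> \<zero>\<^bsub>B j\<^esub>}"
    obtain i j where ij: "x = (i, j)" by (cases x)
    from x have "\<psi> i = \<zero>\<^bsub>A i\<^esub> \<or> \<phi> j = \<zero>\<^bsub>B j\<^esub>" unfolding ij by blast
    then have "b i j (\<psi> i) (\<phi> j) = \<zero>\<^bsub>C (d i j)\<^esub>"
      using bz[OF \<phi>c] zb[OF \<psi>c] by metis
    then show "g \<psi> \<phi> x = \<zero>\<^bsub>DC\<^esub>"
      by (simp add: ij dsum_single_zero del: dsum_simps)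
  qed simp
qed

private lemma supp:
  assumes "\<psi> \<in> carrier (dsum_module UNIV D)"
  shows "finite {i. \<psi> i \<noteq> \<zero>\<^bsub>D i\<^esub>}"
  using dsum_carrierD(3)[OF assms] by simp

lemma dsum_extend_closed:
  assumes \<psi>: "\<psi> \<in> carrier (dsum_module UNIV A)" and \<phi>: "\<phi> \<in> carrier (dsum_module UNIV B)"
  shows "dsum_extend A B C d b \<psi> \<phi> \<in> carrier (dsum_module UNIV C)"
proof -
  interpret DC: module R DC by (rule DC)
  show ?thesis unfolding dsum_extend_def by (rule DC.finsum_closed[OF g_closed[OF \<psi> \<phi>]])
qed

lemma dsum_extend_add_left:
  assumes \<psi>: "\<psi> \<in> carrier (dsum_module UNIV A)" and \<psi>': "\<psi>' \<in> carrier (dsum_module UNIV A)"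
    and \<phi>: "\<phi> \<in> carrier (dsum_module UNIV B)"
  shows "dsum_extend A B C d b (\<psi> \<oplus>\<^bsub>dsum_module UNIV A\<^esub> \<psi>') \<phi> =
    dsum_extend A B C d b \<psi> \<phi> \<oplus>\<^bsub>dsum_module UNIV C\<^esub> dsum_extend A B C d b \<psi>' \<phi>"
proof -
  interpret DC: module R DC by (rule DC)
  \<comment> \<open>A union of supports that is large enough for both summands and for their
    sum.\<close>
  let ?S = "{i. \<psi> i \<noteq> \<zero>\<^bsub>A i\<^esub>} \<union> {i. \<psi>' i \<noteq> \<zero>\<^bsub>A i\<^esub>}" and ?T = "{j. \<phi> j \<noteq> \<zero>\<^bsub>B j\<^esub>}"
  let ?s = "\<psi> \<oplus>\<^bsub>DA\<^esub> \<psi>'"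
  have S: "finite ?S" and T: "finite ?T" using supp[OF \<psi>] supp[OF \<psi>'] supp[OF \<phi>] by simp_all
  have s: "?s \<in> carrier DA" by (rule mod_add[OF dsum_module_is_module[OF A] \<psi> \<psi>'])
  note \<psi>c = dsum_carrierD(2)[OF \<psi> UNIV_I] and \<psi>c' = dsum_carrierD(2)[OF \<psi>' UNIV_I]
    and \<phi>c = dsum_carrierD(2)[OF \<phi> UNIV_I]
  have "{i. ?s i \<noteq> \<zero>\<^bsub>A i\<^esub>} \<subseteq> ?S" using A by auto
  from extend_eq[OF s \<phi> S this T subset_refl]
  have "dsum_extend A B C d b ?s \<phi> = finsum DC (g ?s \<phi>) (?S \<times> ?T)" .
  also have "\<dots> = finsum DC (\<lambda>x. g \<psi> \<phi> x \<oplus>\<^bsub>DC\<^esub> g \<psi>' \<phi> x) (?S \<times> ?T)"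
  proof (rule DC.finsum_cong'[OF refl])
    show "(\<lambda>x. g \<psi> \<phi> x \<oplus>\<^bsub>DC\<^esub> g \<psi>' \<phi> x) \<in> ?S \<times> ?T \<rightarrow> carrier DC"
      using g_closed[OF \<psi> \<phi>, of UNIV] g_closed[OF \<psi>' \<phi>, of UNIV]
      by (intro Pi_I DC.a_closed) (blast dest: funcset_mem)+
    fix x assume "x \<in> ?S \<times> ?T"
    obtain i j where x: "x = (i, j)" by (cases x)
    have "dsum_single UNIV C (d i j) (b i j (\<psi> i) (\<phi> j) \<oplus>\<^bsub>C (d i j)\<^esub> b i j (\<psi>' i) (\<phi> j)) =
      dsum_single UNIV C (d i j) (b i j (\<psi> i) (\<phi> j)) \<oplus>\<^bsub>DC\<^esub> dsum_single UNIV C (d i j) (b i j (\<psi>' i) (\<phi> j))"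
      by (rule dsum_single_add[of UNIV C, OF C])
    then show "g ?s \<phi> x = g \<psi> \<phi> x \<oplus>\<^bsub>DC\<^esub> g \<psi>' \<phi> x"
      unfolding x using bl[OF \<psi>c \<psi>c' \<phi>c] by simp
  qed
  also have "\<dots> = finsum DC (g \<psi> \<phi>) (?S \<times> ?T) \<oplus>\<^bsub>DC\<^esub> finsum DC (g \<psi>' \<phi>) (?S \<times> ?T)"
    by (rule DC.finsum_addf[OF g_closed[OF \<psi> \<phi>] g_closed[OF \<psi>' \<phi>]])
  also have "\<dots> = dsum_extend A B C d b \<psi> \<phi> \<oplus>\<^bsub>DC\<^esub> dsum_extend A B C d b \<psi>' \<phi>"
    using extend_eq[OF \<psi> \<phi> S Un_upper1 T subset_refl] extend_eq[OF \<psi>' \<phi> S Un_upper2 T subset_refl]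
    by (simp only:)
  finally show ?thesis .
qed

lemma dsum_extend_add_right:
  assumes \<psi>: "\<psi> \<in> carrier (dsum_module UNIV A)" and \<phi>: "\<phi> \<in> carrier (dsum_module UNIV B)"
    and \<phi>': "\<phi>' \<in> carrier (dsum_module UNIV B)"
  shows "dsum_extend A B C d b \<psi> (\<phi> \<oplus>\<^bsub>dsum_module UNIV B\<^esub> \<phi>') =
    dsum_extend A B C d b \<psi> \<phi> \<oplus>\<^bsub>dsum_module UNIV C\<^esub> dsum_extend A B C d b \<psi> \<phi>'"
proof -
  interpret DC: module R DC by (rule DC)
  let ?T = "{i. \<phi> i \<noteq> \<zero>\<^bsub>B i\<^esub>} \<union> {i. \<phi>' i \<noteq> \<zero>\<^bsub>B i\<^esub>}" and ?S = "{j. \<psi> j \<noteq> \<zero>\<^bsub>A j\<^esub>}"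
  let ?s = "\<phi> \<oplus>\<^bsub>DB\<^esub> \<phi>'"
  have T: "finite ?T" and S: "finite ?S" using supp[OF \<phi>] supp[OF \<phi>'] supp[OF \<psi>] by simp_all
  have s: "?s \<in> carrier DB" by (rule mod_add[OF dsum_module_is_module[OF B] \<phi> \<phi>'])
  note \<phi>c = dsum_carrierD(2)[OF \<phi> UNIV_I] and \<phi>c' = dsum_carrierD(2)[OF \<phi>' UNIV_I]
    and \<psi>c = dsum_carrierD(2)[OF \<psi> UNIV_I]
  have "{i. ?s i \<noteq> \<zero>\<^bsub>B i\<^esub>} \<subseteq> ?T" using B by auto
  from extend_eq[OF \<psi> s S subset_refl T this]
  have "dsum_extend A B C d b \<psi> ?s = finsum DC (g \<psi> ?s) (?S \<times> ?T)" .
  also have "\<dots> = finsum DC (\<lambda>x. g \<psi> \<phi> x \<oplus>\<^bsub>DC\<^esub> g \<psi> \<phi>' x) (?S \<times> ?T)"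
  proof (rule DC.finsum_cong'[OF refl])
    show "(\<lambda>x. g \<psi> \<phi> x \<oplus>\<^bsub>DC\<^esub> g \<psi> \<phi>' x) \<in> ?S \<times> ?T \<rightarrow> carrier DC"
      using g_closed[OF \<psi> \<phi>, of UNIV] g_closed[OF \<psi> \<phi>', of UNIV]
      by (intro Pi_I DC.a_closed) (blast dest: funcset_mem)+
    fix x assume "x \<in> ?S \<times> ?T"
    obtain i j where x: "x = (i, j)" by (cases x)
    have "dsum_single UNIV C (d i j) (b i j (\<psi> i) (\<phi> j) \<oplus>\<^bsub>C (d i j)\<^esub> b i j (\<psi> i) (\<phi>' j)) =
      dsum_single UNIV C (d i j) (b i j (\<psi> i) (\<phi> j)) \<oplus>\<^bsub>DC\<^esub> dsum_single UNIV C (d i j) (b i j (\<psi> i) (\<phi>' j))"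
      by (rule dsum_single_add[of UNIV C, OF C])
    then show "g \<psi> ?s x = g \<psi> \<phi> x \<oplus>\<^bsub>DC\<^esub> g \<psi> \<phi>' x"
      unfolding x using br[OF \<psi>c \<phi>c \<phi>c'] by simp
  qed
  also have "\<dots> = finsum DC (g \<psi> \<phi>) (?S \<times> ?T) \<oplus>\<^bsub>DC\<^esub> finsum DC (g \<psi> \<phi>') (?S \<times> ?T)"
    by (rule DC.finsum_addf[OF g_closed[OF \<psi> \<phi>] g_closed[OF \<psi> \<phi>']])
  also have "\<dots> = dsum_extend A B C d b \<psi> \<phi> \<oplus>\<^bsub>DC\<^esub> dsum_extend A B C d b \<psi> \<phi>'"
    using extend_eq[OF \<psi> \<phi> S subset_refl T Un_upper1] extend_eq[OF \<psi> \<phi>' S subset_refl T Un_upper2]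
    by (simp only:)
  finally show ?thesis .
qed

text \<open>If \<open>x\<close> or \<open>y\<close> is zero, the corresponding support is empty; by
  \<open>extend_eq\<close> the sum can be taken over the one pair \<open>(i, j)\<close> in all
  cases.\<close>

lemma dsum_extend_single:
  assumes x: "x \<in> carrier (A i)" and y: "y \<in> carrier (B j)"
  shows "dsum_extend A B C d b (dsum_single UNIV A i x) (dsum_single UNIV B j y) =
    dsum_single UNIV C (d i j) (b i j x y)"
proof -
  interpret DC: module R DC by (rule DC)
  have X: "dsum_single UNIV A i x \<in> carrier DA" by (rule dsum_single_closed[of UNIV A, OF A UNIV_I x])
  have Y: "dsum_single UNIV B j y \<in> carrier DB" by (rule dsum_single_closed[of UNIV B, OF B UNIV_I y])
  have Z: "dsum_single UNIV C (d i j) (b i j x y) \<in> carrier DC"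
    by (rule dsum_single_closed[of UNIV C, OF C UNIV_I bc[OF x y]])
  define G where "G = g (dsum_single UNIV A i x) (dsum_single UNIV B j y)"
  have G: "G (i, j) = dsum_single UNIV C (d i j) (b i j x y)"
    by (simp add: G_def) (simp add: dsum_single_def)
  have "dsum_extend A B C d b (dsum_single UNIV A i x) (dsum_single UNIV B j y) = finsum DC G ({i} \<times> {j})"
    unfolding G_def by (rule extend_eq[OF X Y]) (auto simp: dsum_single_def)
  also have "{i} \<times> {j} = insert (i, j) {}" by auto
  also have "finsum DC G (insert (i, j) {}) = G (i, j) \<oplus>\<^bsub>DC\<^esub> finsum DC G {}"
    by (rule DC.finsum_insert) (use Z in \<open>simp_all add: G del: dsum_simps\<close>)
  also have "\<dots> = dsum_single UNIV C (d i j) (b i j x y)"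
    unfolding DC.finsum_empty G by (rule DC.r_zero[OF Z])
  finally show ?thesis .
qed

end

end

section \<open>Graded morphisms\<close>

context persistence
begin

abbreviation gh :: "('p, 'a, 'u) pmod \<Rightarrow> ('p, 'a, 'u) pmod \<Rightarrow> ('a, 'p \<Rightarrow> 'p \<Rightarrow> 'u \<Rightarrow> 'u) module" where
  "gh M N \<equiv> ghom_module R M N"

lemma hom_modules:
  fixes M N :: "('p, 'a, 'u) pmod"
  assumes "M \<in> pmods R \<W>" "N \<in> pmods R \<W>'"
  shows "module R (hom_module R M (shift s N))"
  by (rule hom_module_is_module[OF assms(1) shift_pmod[OF assms(2)]])

lemma homog_closed:
  fixes M N :: "('p, 'a, 'u) pmod"
  assumes "M \<in> pmods R \<W>" "N \<in> pmods R \<W>'" "\<alpha> \<in> hm M N s"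
  shows "homog R M N s \<alpha> \<in> carrier (gh M N)"
  unfolding ghom_module_def homog_def
  by (rule dsum_single_closed[of UNIV "\<lambda>s. hom_module R M (shift s N)", OF hom_modules[OF assms(1,2)] UNIV_I])
    (simp add: assms(3))

text \<open>The zero morphism counts as homogeneous of degree 0, so the case of zero in
  \<open>dsum_induct\<close> disappears.\<close>

lemma ghom_induct [consumes 3, case_names homog add]:
  fixes M N :: "('p, 'a, 'u) pmod"
  assumes M: "M \<in> pmods R \<W>" and N: "N \<in> pmods R \<W>'" and \<phi>: "\<phi> \<in> carrier (gh M N)"
    and homog: "\<And>s \<alpha>. \<alpha> \<in> hm M N s \<Longrightarrow> Q (homog R M N s \<alpha>)"
    and add: "\<And>\<phi> \<psi>. \<phi> \<in> carrier (gh M N) \<Longrightarrow> \<psi> \<in> carrier (gh M N) \<Longrightarrow> Q \<phi> \<Longrightarrow> Q \<psi> \<Longrightarrow> Q (\<phi> \<oplus>\<^bsub>gh M N\<^esub> \<psi>)"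
  shows "Q \<phi>"
  using \<phi> unfolding ghom_module_def
proof (induction \<phi> rule: dsum_induct)
  case (module i)
  show ?case by (rule hom_modules[OF M N])
next
  case zero
  have "\<zero>\<^bsub>hom_module R M (shift 0 N)\<^esub> \<in> hm M N 0"
    using mod_zero[OF hom_modules[OF M N], of 0] by (simp only: hom_module_simps(1))
  from homog[OF this] show ?case
    unfolding homog_def dsum_single_zero[of UNIV "\<lambda>s. hom_module R M (shift s N)"] .
next
  case (single s \<alpha>)
  then show ?case using homog by (simp add: homog_def)
next
  case (add \<phi> \<psi>)
  from assms(5)[unfolded ghom_module_def, OF add] show ?case .
qed

lemma ghom_component:
  assumes "\<phi> \<in> carrier (gh M N)"
  shows "\<phi> s \<in> hm M N s"
  using dsum_carrierD(2)[OF assms[unfolded ghom_module_def] UNIV_I] by simp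

lemma gcomp_eq:
  "gcomp R M N L \<psi> \<phi> = dsum_extend (\<lambda>t. hom_module R N (shift t L)) (\<lambda>s. hom_module R M (shift s N))
    (\<lambda>s. hom_module R M (shift s L)) (\<lambda>t s. s + t) (\<lambda>t s \<beta> \<alpha>. hom_comp M s \<beta> \<alpha>) \<psi> \<phi>"
  by (simp add: gcomp_def dsum_extend_def ghom_module_def homog_def gsupp_def)

context
  fixes M N L :: "('p, 'a, 'u) pmod" and \<W> :: "'u set set"
  assumes M: "M \<in> pmods R \<W>" and N: "N \<in> pmods R \<W>" and L: "L \<in> pmods R \<W>"
begin

private lemma comp_biadditive:
  "biadditive (\<lambda>t. hom_module R N (shift t L)) (\<lambda>s. hom_module R M (shift s N))
    (\<lambda>s. hom_module R M (shift s L)) (\<lambda>t s. s + t) (\<lambda>t s \<beta> \<alpha>. hom_comp M s \<beta> \<alpha>)"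
  by (simp add: biadditive_def hom_comp_hm[OF M] hom_comp_add_left hom_comp_add_right del:
      hom_module_simps(2-))

private lemmas comp_data = hom_modules[OF N L] hom_modules[OF M N] hom_modules[OF M L] comp_biadditive

lemma gcomp_closed: "\<psi> \<in> carrier (gh N L) \<Longrightarrow> \<phi> \<in> carrier (gh M N) \<Longrightarrow> gcomp R M N L \<psi> \<phi> \<in> carrier (gh M L)"
  unfolding gcomp_eq ghom_module_def by (rule dsum_extend_closed[OF comp_data])

lemma gcomp_add_left: "\<psi> \<in> carrier (gh N L) \<Longrightarrow> \<psi>' \<in> carrier (gh N L) \<Longrightarrow> \<phi> \<in> carrier (gh M N) \<Longrightarrow>
    gcomp R M N L (\<psi> \<oplus>\<^bsub>gh N L\<^esub> \<psi>') \<phi> = gcomp R M N L \<psi> \<phi> \<oplus>\<^bsub>gh M L\<^esub> gcomp R M N L \<psi>' \<phi>"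
  unfolding gcomp_eq ghom_module_def by (rule dsum_extend_add_left[OF comp_data])

lemma gcomp_add_right: "\<psi> \<in> carrier (gh N L) \<Longrightarrow> \<phi> \<in> carrier (gh M N) \<Longrightarrow> \<phi>' \<in> carrier (gh M N) \<Longrightarrow>
    gcomp R M N L \<psi> (\<phi> \<oplus>\<^bsub>gh M N\<^esub> \<phi>') = gcomp R M N L \<psi> \<phi> \<oplus>\<^bsub>gh M L\<^esub> gcomp R M N L \<psi> \<phi>'"
  unfolding gcomp_eq ghom_module_def by (rule dsum_extend_add_right[OF comp_data])

lemma gcomp_homog: "\<beta> \<in> hm N L t \<Longrightarrow> \<alpha> \<in> hm M N s \<Longrightarrow>
    gcomp R M N L (homog R N L t \<beta>) (homog R M N s \<alpha>) = homog R M L (s + t) (hom_comp M s \<beta> \<alpha>)"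
  unfolding gcomp_eq homog_def
  by (rule dsum_extend_single[OF comp_data]) simp_all

lemma gcomp_homog_zero: "\<beta> \<in> nat_trans R N L \<Longrightarrow> \<alpha> \<in> nat_trans R M N \<Longrightarrow>
    gcomp R M N L (homog R N L 0 \<beta>) (homog R M N 0 \<alpha>) = homog R M L 0 (hom_comp M 0 \<beta> \<alpha>)"
  using gcomp_homog[of \<beta> 0 \<alpha> 0] by simp

end

text \<open>On pure tensors this is additivity of \<open>gp\<close> in its left argument.\<close>

lemma gr_tensor_hom_add_left:
  assumes pm: "M \<in> pm" "M' \<in> pm" "N \<in> pm" "N' \<in> pm" and f: "f \<in> hm M M' u" "f' \<in> hm M M' u"
      and g: "g \<in> hm N N' v"
  shows "th M M' N N' u v (f \<oplus>\<^bsub>hom_module R M (shift u M')\<^esub> f') g =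
    th M M' N N' u v f g \<oplus>\<^bsub>hom_module R (M \<boxtimes> N) (shift (u + v) (M' \<boxtimes> N'))\<^esub> th M M' N N' u v f' g"
proof -
  note MN = gr_tensor_pmod[OF pm(1,3)] gr_tensor_pmod[OF pm(2,4)]
  have ff: "f \<oplus>\<^bsub>hom_module R M (shift u M')\<^esub> f' \<in> hm M M' u"
    using mod_add[OF hom_modules[OF pm(1,2)], of f u f'] f by (simp del: hom_module_simps(2-))
  note T = gr_tensor_hom_hm[OF pm f(1) g] gr_tensor_hom_hm[OF pm f(2) g]
  have TT: "th M M' N N' u v f g \<oplus>\<^bsub>hom_module R (M \<boxtimes> N) (shift (u + v) (M' \<boxtimes> N'))\<^esub> th M M' N N' u v f' g \<in> hm (M
      \<boxtimes> N) (M' \<boxtimes> N') (u + v)"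
    using mod_add[OF hom_modules[OF MN], of _ "u + v"] T by (simp del: hom_module_simps(2-))
  show ?thesis
  proof (rule gr_ext[OF pm(1,3) gr_tensor_hom_hm[OF pm ff g] TT])
    fix s t m n assume m: "m \<in> el M s" and n: "n \<in> el N t"
    have e: "s + u + (t + v) \<le> s + t + (u + v)" by (simp add: add_ac)
    have gn: "g t n \<in> el N' (t + v)" and fm: "f s m \<in> el M' (s + u)" "f' s m \<in> el M' (s + u)"
      using hm_closed[OF g n refl] hm_closed[OF f(1) m refl] hm_closed[OF f(2) m refl] .
    show "th M M' N N' u v (f \<oplus>\<^bsub>hom_module R M (shift u M')\<^esub> f') g (s + t) (gp M N s t (s + t) m n) =
      (th M M' N N' u v f g \<oplus>\<^bsub>hom_module R (M \<boxtimes> N) (shift (u + v) (M' \<boxtimes> N'))\<^esub> th M M' N N' u v f' g) (s + t)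
        (gp M N s t (s + t) m n)"
      unfolding gr_tensor_hom_pure[OF pm ff g order_refl m n]
      using m n bilin_add_left[OF gr_pure_bilin[OF pm(2,4) e] fm gn]
      by (simp add: gr_pure_closed pm gr_tensor_hom_pure[OF pm f(1) g] gr_tensor_hom_pure[OF pm f(2) g])
  qed
qed

lemma gr_tensor_hom_add_right:
  assumes pm: "M \<in> pm" "M' \<in> pm" "N \<in> pm" "N' \<in> pm" and f: "f \<in> hm M M' u"
      and g: "g \<in> hm N N' v" "g' \<in> hm N N' v"
  shows "th M M' N N' u v f (g \<oplus>\<^bsub>hom_module R N (shift v N')\<^esub> g') =
    th M M' N N' u v f g \<oplus>\<^bsub>hom_module R (M \<boxtimes> N) (shift (u + v) (M' \<boxtimes> N'))\<^esub> th M M' N N' u v f g'"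
proof -
  note MN = gr_tensor_pmod[OF pm(1,3)] gr_tensor_pmod[OF pm(2,4)]
  have gg: "g \<oplus>\<^bsub>hom_module R N (shift v N')\<^esub> g' \<in> hm N N' v"
    using mod_add[OF hom_modules[OF pm(3,4)], of g v g'] g by (simp del: hom_module_simps(2-))
  note T = gr_tensor_hom_hm[OF pm f g(1)] gr_tensor_hom_hm[OF pm f g(2)]
  have TT: "th M M' N N' u v f g \<oplus>\<^bsub>hom_module R (M \<boxtimes> N) (shift (u + v) (M' \<boxtimes> N'))\<^esub> th M M' N N' u v f g' \<in> hm (M
      \<boxtimes> N) (M' \<boxtimes> N') (u + v)"
    using mod_add[OF hom_modules[OF MN], of _ "u + v"] T by (simp del: hom_module_simps(2-))
  show ?thesis
  proof (rule gr_ext[OF pm(1,3) gr_tensor_hom_hm[OF pm f gg] TT])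
    fix s t m n assume m: "m \<in> el M s" and n: "n \<in> el N t"
    have e: "s + u + (t + v) \<le> s + t + (u + v)" by (simp add: add_ac)
    have fm: "f s m \<in> el M' (s + u)" and gn: "g t n \<in> el N' (t + v)" "g' t n \<in> el N' (t + v)"
      using hm_closed[OF f m refl] hm_closed[OF g(1) n refl] hm_closed[OF g(2) n refl] .
    show "th M M' N N' u v f (g \<oplus>\<^bsub>hom_module R N (shift v N')\<^esub> g') (s + t) (gp M N s t (s + t) m n) =
      (th M M' N N' u v f g \<oplus>\<^bsub>hom_module R (M \<boxtimes> N) (shift (u + v) (M' \<boxtimes> N'))\<^esub> th M M' N N' u v f g') (s + t)
        (gp M N s t (s + t) m n)"
      unfolding gr_tensor_hom_pure[OF pm f gg order_refl m n]
      using m n bilin_add_right[OF gr_pure_bilin[OF pm(2,4) e] fm gn]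
      by (simp add: gr_pure_closed pm gr_tensor_hom_pure[OF pm f g(1)] gr_tensor_hom_pure[OF pm f g(2)])
  qed
qed

lemma gtensor_hom_eq:
  "gtensor_hom R \<V> M M' N N' \<phi> \<psi> = dsum_extend (\<lambda>u. hom_module R M (shift u M')) (\<lambda>v. hom_module R N (shift v
      N'))
    (\<lambda>w. hom_module R (M \<boxtimes> N) (shift w (M' \<boxtimes> N'))) (+) (th M M' N N') \<phi> \<psi>"
  by (simp add: gtensor_hom_def dsum_extend_def ghom_module_def homog_def gsupp_def)

context
  fixes M M' N N' :: "('p, 'a, 'u) pmod"
  assumes pm: "M \<in> pm" "M' \<in> pm" "N \<in> pm" "N' \<in> pm"
begin

private lemma tensor_biadditive:
  "biadditive (\<lambda>u. hom_module R M (shift u M')) (\<lambda>v. hom_module R N (shift v N'))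
    (\<lambda>w. hom_module R (M \<boxtimes> N) (shift w (M' \<boxtimes> N'))) (+) (th M M' N N')"
  by (simp add: biadditive_def gr_tensor_hom_hm[OF pm] gr_tensor_hom_add_left[OF pm]
      gr_tensor_hom_add_right[OF pm]
      del: hom_module_simps(2-))

private lemmas tensor_data = hom_modules[OF pm(1,2)] hom_modules[OF pm(3,4)]
  hom_modules[OF gr_tensor_pmod[OF pm(1,3)] gr_tensor_pmod[OF pm(2,4)]] tensor_biadditive

lemma gtensor_hom_closed: "\<phi> \<in> carrier (gh M M') \<Longrightarrow> \<psi> \<in> carrier (gh N N') \<Longrightarrow>
    gtensor_hom R \<V> M M' N N' \<phi> \<psi> \<in> carrier (gh (M \<boxtimes> N) (M' \<boxtimes> N'))"
  unfolding gtensor_hom_eq ghom_module_def by (rule dsum_extend_closed[OF tensor_data])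

lemma gtensor_hom_add_left: "\<phi> \<in> carrier (gh M M') \<Longrightarrow> \<phi>' \<in> carrier (gh M M') \<Longrightarrow> \<psi> \<in> carrier (gh N N') \<Longrightarrow>
    gtensor_hom R \<V> M M' N N' (\<phi> \<oplus>\<^bsub>gh M M'\<^esub> \<phi>') \<psi> =
    gtensor_hom R \<V> M M' N N' \<phi> \<psi> \<oplus>\<^bsub>gh (M \<boxtimes> N) (M' \<boxtimes> N')\<^esub> gtensor_hom R \<V> M M' N N' \<phi>' \<psi>"
  unfolding gtensor_hom_eq ghom_module_def by (rule dsum_extend_add_left[OF tensor_data])

lemma gtensor_hom_add_right: "\<phi> \<in> carrier (gh M M') \<Longrightarrow> \<psi> \<in> carrier (gh N N') \<Longrightarrow> \<psi>' \<in> carrier (gh N N') \<Longrightarrow>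
    gtensor_hom R \<V> M M' N N' \<phi> (\<psi> \<oplus>\<^bsub>gh N N'\<^esub> \<psi>') =
    gtensor_hom R \<V> M M' N N' \<phi> \<psi> \<oplus>\<^bsub>gh (M \<boxtimes> N) (M' \<boxtimes> N')\<^esub> gtensor_hom R \<V> M M' N N' \<phi> \<psi>'"
  unfolding gtensor_hom_eq ghom_module_def by (rule dsum_extend_add_right[OF tensor_data])

lemma gtensor_hom_homog: "f \<in> hm M M' u \<Longrightarrow> g \<in> hm N N' v \<Longrightarrow>
    gtensor_hom R \<V> M M' N N' (homog R M M' u f) (homog R N N' v g) =
    homog R (M \<boxtimes> N) (M' \<boxtimes> N') (u + v) (th M M' N N' u v f g)"
  unfolding gtensor_hom_eq homog_def
  by (rule dsum_extend_single[OF tensor_data]) simp_all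

lemma gtensor_hom_homog_zero: "f \<in> nat_trans R M M' \<Longrightarrow> g \<in> nat_trans R N N' \<Longrightarrow>
    gtensor_hom R \<V> M M' N N' (homog R M M' 0 f) (homog R N N' 0 g) =
    homog R (M \<boxtimes> N) (M' \<boxtimes> N') 0 (th M M' N N' 0 0 f g)"
  using gtensor_hom_homog[of f 0 g 0] by simp

end

end

text \<open>The usual uniqueness of inverses: a further inverse \<open>h\<close> equals
  \<open>g f h\<close>, which equals \<open>g\<close>. It makes the definite description
  computable.\<close>

lemma (in category) inv_mor_eq:
  assumes "a \<in> Ob C" "b \<in> Ob C" "inverse_mors C a b f g"
  shows "inv_mor C a b f = g"
  unfolding inv_mor_def
proof (rule the_equality[of "inverse_mors C a b f", OF assms(3)])
  fix h assume h: "inverse_mors C a b f h"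
  have "h = Cmp C b a a (Cmp C a b a g f) h"
    using h assms by (simp add: inverse_mors_def Cmp_Idm_left)
  also have "\<dots> = Cmp C b b a g (Cmp C b a b f h)"
    using h assms by (intro Cmp_assoc[symmetric]) (auto simp: inverse_mors_def)
  also have "\<dots> = g"
    using h assms by (simp add: inverse_mors_def Cmp_Idm_right)
  finally show "h = g" .
qed

section \<open>The two monoidal categories\<close>

context persistence
begin

text \<open>Composition of \<open>PMod\<close> is recognised as \<open>hom_comp\<close> in degree 0,
  since \<open>\<beta> (0 + x)\<close> is \<open>\<beta> x\<close>. The graded lemmas thus serve
  both categories.\<close>

lemma PMod_simps:
  "Ob (PMod R \<W>) = pmods R \<W>" "Hom (PMod R \<W>) = nat_trans R" "Idm (PMod R \<W>) = id_trans"
  "Cmp (PMod R \<W>) M N L \<beta> \<alpha> = hom_comp (M :: ('p, 'a, 'u) pmod) 0 \<beta> \<alpha>"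
  by (simp_all add: PMod_def hom_comp_def)

lemma PMod_gr_simps:
  "Ob (PMod_gr R \<V>) = (pm :: ('p, 'a, 'u) pmod set)" "Hom (PMod_gr R \<V>) = nat_trans R" "Idm (PMod_gr R \<V>) =
      id_trans"
  "Cmp (PMod_gr R \<V>) M N L \<beta> \<alpha> = hom_comp (M :: ('p, 'a, 'u) pmod) 0 \<beta> \<alpha>"
  "TenO (PMod_gr R \<V>) M N = M \<boxtimes> N" "TenM (PMod_gr R \<V>) M M' N N' f g = th M M' N N' 0 0 f g"
  "UnitO (PMod_gr R \<V>) = I" "AssocM (PMod_gr R \<V>) M N L = gr_assoc R \<V> M N L"
  "LUnitM (PMod_gr R \<V>) M = gr_lunit R \<V> M" "RUnitM (PMod_gr R \<V>) M = gr_runit R \<V> M"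
  by (simp_all add: PMod_gr_def cat.extend_def PMod_def hom_comp_def)

lemma GMod_simps:
  "Ob (GMod R \<W>) = pmods R \<W>" "Hom (GMod R \<W>) M N = carrier (gh M N)" "Idm (GMod R \<W>) M =
      homog R M M 0 (id_trans M)"
  "Cmp (GMod R \<W>) M N L \<beta> \<alpha> = gcomp R (M :: ('p, 'a, 'u) pmod) N L \<beta> \<alpha>"
  by (simp_all add: GMod_def)

lemma GMod_gr_simps:
  "Ob (GMod_gr R \<V>) = (pm :: ('p, 'a, 'u) pmod set)" "Hom (GMod_gr R \<V>) M N = carrier (gh M N)"
  "Idm (GMod_gr R \<V>) M = homog R M M 0 (id_trans M)"
  "Cmp (GMod_gr R \<V>) M N L \<beta> \<alpha> = gcomp R M N L \<beta> \<alpha>"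
  "TenO (GMod_gr R \<V>) M N = M \<boxtimes> N" "TenM (GMod_gr R \<V>) M M' N N' f g = gtensor_hom R \<V> M M' N N' f g"
  "UnitO (GMod_gr R \<V>) = I"
  "AssocM (GMod_gr R \<V>) M N L = homog R ((M \<boxtimes> N) \<boxtimes> L) (M \<boxtimes> (N \<boxtimes> L)) 0 (gr_assoc R \<V> M N L)"
  "LUnitM (GMod_gr R \<V>) M = homog R (I \<boxtimes> M) M 0 (gr_lunit R \<V> M)"
  "RUnitM (GMod_gr R \<V>) M = homog R (M \<boxtimes> I) M 0 (gr_runit R \<V> M)"
  by (simp_all add: GMod_gr_def cat.extend_def GMod_def)

lemma hom_comp_id_left_nat:
  fixes M N :: "('p, 'a, 'u) pmod"
  shows "M \<in> pmods R \<W> \<Longrightarrow> N \<in> pmods R \<W> \<Longrightarrow> \<alpha> \<in> nat_trans R M N \<Longrightarrow> hom_comp M 0 (id_trans N) \<alpha> = \<alpha>"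
  using hom_comp_id_left[of M \<W> N \<alpha> 0] by simp

lemma hom_comp_id_right_nat:
  fixes M N :: "('p, 'a, 'u) pmod"
  shows "M \<in> pmods R \<W> \<Longrightarrow> \<alpha> \<in> nat_trans R M N \<Longrightarrow> hom_comp M 0 \<alpha> (id_trans M) = \<alpha>"
  using hom_comp_id_right[of M \<W> \<alpha> 0 N] by simp

lemma hom_comp_assoc_nat:
  fixes M N :: "('p, 'a, 'u) pmod"
  shows "\<alpha> \<in> nat_trans R M N \<Longrightarrow> hom_comp M 0 (hom_comp N 0 \<gamma> \<beta>) \<alpha> = hom_comp M 0 \<gamma> (hom_comp M 0 \<beta> \<alpha>)"
  using hom_comp_assoc[of \<alpha> M 0 N 0 \<gamma> \<beta>] by simp

lemma category_PMod: "category (PMod R \<W> :: (('p, 'a, 'u) pmod, _) cat)"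
  by unfold_locales
    (simp_all add: PMod_simps id_trans_nat hom_comp_nat hom_comp_id_left_nat hom_comp_id_right_nat
        hom_comp_assoc_nat)

lemma monoidal_PMod: "monoidal_category (PMod_gr R \<V> :: (('p, 'a, 'u) pmod, _) moncat)"
proof -
  note [simp] = id_trans_nat[of _ \<V>] gr_tensor_pmod unit_pmod gr_assoc_nat gr_lunit_nat gr_runit_nat
      gr_tensor_hom_nat
  interpret category "PMod_gr R \<V> :: (('p, 'a, 'u) pmod, _) moncat"
    by unfold_locales
      (simp_all add: PMod_gr_simps hom_comp_nat[of _ \<V>] hom_comp_id_left_nat[of _ \<V>]
          hom_comp_id_right_nat[of _ \<V>] hom_comp_assoc_nat)
  show ?thesis
  proof (unfold_locales, unfold PMod_gr_simps)
    show "I \<in> pm" by (rule unit_pmod)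
  next
    fix a b :: "('p, 'a, 'u) pmod"
    assume pm: "a \<in> pm" "b \<in> pm"
    show "a \<boxtimes> b \<in> pm" "th a a b b 0 0 (id_trans a) (id_trans b) = id_trans (a \<boxtimes> b)"
      using pm by (simp_all add: gr_tensor_hom_id)
    show "hom_comp ((a \<boxtimes> I) \<boxtimes> b) 0 (th a a (I \<boxtimes> b) b 0 0 (id_trans a) (gr_lunit R \<V> b)) (gr_assoc R \<V> a I b) =
        th (a \<boxtimes> I) a b b 0 0 (gr_runit R \<V> a) (id_trans b)"
      by (rule gr_triangle[OF pm])
  next
    fix a :: "('p, 'a, 'u) pmod" assume a: "a \<in> pm"
    show "iso_mor (PMod_gr R \<V>) (I \<boxtimes> a) a (gr_lunit R \<V> a)"
      unfolding iso_mor_def inverse_mors_def PMod_gr_simps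
      using gr_lunit_nat[OF a] gr_lunit_inv[OF a] by blast
    show "iso_mor (PMod_gr R \<V>) (a \<boxtimes> I) a (gr_runit R \<V> a)"
      unfolding iso_mor_def inverse_mors_def PMod_gr_simps
      using gr_runit_nat[OF a] gr_runit_inv[OF a] by blast
  next
    fix a b c :: "('p, 'a, 'u) pmod" assume abc: "a \<in> pm" "b \<in> pm" "c \<in> pm"
    show "iso_mor (PMod_gr R \<V>) ((a \<boxtimes> b) \<boxtimes> c) (a \<boxtimes> (b \<boxtimes> c)) (gr_assoc R \<V> a b c)"
      unfolding iso_mor_def inverse_mors_def PMod_gr_simps
      using gr_assoc_nat[OF abc] gr_assoc_inverse[OF abc] by metis
  \<comment> \<open>Functoriality and naturality are instances of the graded statements with all
    degrees 0; \<open>simplified\<close> removes \<open>0 + 0\<close> and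
    \<open>shift 0\<close>.\<close>
  qed (simp_all add: gr_pentagon
      gr_tensor_hom_comp[where u=0 and u'=0 and v=0 and v'=0 and w=0 and z=0, simplified]
      gr_assoc_natural[where u=0 and v=0 and w=0 and p=0 and q=0, simplified]
      gr_lunit_natural[where s=0, simplified] gr_runit_natural[where s=0, simplified])
qed

lemma homog_closed_zero:
  fixes M N :: "('p, 'a, 'u) pmod"
  assumes "M \<in> pmods R \<W>" "N \<in> pmods R \<W>" "\<alpha> \<in> nat_trans R M N"
  shows "homog R M N 0 \<alpha> \<in> carrier (gh M N)"
  using homog_closed[of M \<W> N \<W> \<alpha> 0] assms by simp

lemma gcomp_id_left:
  fixes M N :: "('p, 'a, 'u) pmod"
  assumes M: "M \<in> pmods R \<W>" and N: "N \<in> pmods R \<W>" and \<phi>: "\<phi> \<in> carrier (gh M N)"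
  shows "gcomp R M N N (homog R N N 0 (id_trans N)) \<phi> = \<phi>"
  using M N \<phi>
proof (induction \<phi> rule: ghom_induct)
  case (homog s \<alpha>)
  then show ?case
    using gcomp_homog[OF M N N id_trans_hm[OF N] homog] by (simp add: hom_comp_id_left[OF M N])
next
  case (add \<phi> \<psi>)
  then show ?case
    by (simp add: gcomp_add_right[OF M N N] homog_closed_zero[OF N N] id_trans_nat[OF N])
qed

lemma gcomp_id_right:
  fixes M N :: "('p, 'a, 'u) pmod"
  assumes M: "M \<in> pmods R \<W>" and N: "N \<in> pmods R \<W>" and \<phi>: "\<phi> \<in> carrier (gh M N)"
  shows "gcomp R M M N \<phi> (homog R M M 0 (id_trans M)) = \<phi>"
  using M N \<phi>
proof (induction \<phi> rule: ghom_induct)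
  case (homog s \<alpha>)
  then show ?case
    using gcomp_homog[OF M M N homog id_trans_hm[OF M]] by (simp add: hom_comp_id_right[OF M])
next
  case (add \<phi> \<psi>)
  then show ?case
    by (simp add: gcomp_add_left[OF M M N] homog_closed_zero[OF M M] id_trans_nat[OF M])
qed

text \<open>Both sides are additive in each argument, so the arguments are freed one at a time:
  \<open>1\<close> has three homogeneous ones, \<open>2\<close> frees \<open>f\<close>,
  \<open>3\<close> frees \<open>g\<close>, and the last induction frees \<open>h\<close>.\<close>

lemma gcomp_assoc:
  fixes A B C D :: "('p, 'a, 'u) pmod"
  assumes A: "A \<in> pmods R \<W>" and B: "B \<in> pmods R \<W>" and C: "C \<in> pmods R \<W>" and D: "D \<in> pmods R \<W>"
    and f: "f \<in> carrier (gh A B)" and g: "g \<in> carrier (gh B C)" and h: "h \<in> carrier (gh C D)"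
  shows "gcomp R A C D h (gcomp R A B C g f) = gcomp R A B D (gcomp R B C D h g) f"
proof -
  note cl = gcomp_closed[OF A B C] gcomp_closed[OF A B D] gcomp_closed[OF A C D] gcomp_closed[OF B C D]
    homog_closed[OF A B] homog_closed[OF B C] homog_closed[OF C D]
  note ad = gcomp_add_left[OF A B C] gcomp_add_left[OF A B D] gcomp_add_left[OF A C D]
      gcomp_add_left[OF B C D]
    gcomp_add_right[OF A B C] gcomp_add_right[OF A B D] gcomp_add_right[OF A C D] gcomp_add_right[OF B C D]
  have 1: "gcomp R A C D (homog R C D r \<gamma>) (gcomp R A B C (homog R B C t \<beta>) (homog R A B s \<alpha>)) =
      gcomp R A B D (gcomp R B C D (homog R C D r \<gamma>) (homog R B C t \<beta>)) (homog R A B s \<alpha>)"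
    if \<alpha>: "\<alpha> \<in> hm A B s" and \<beta>: "\<beta> \<in> hm B C t" and \<gamma>: "\<gamma> \<in> hm C D r" for r s t \<alpha> \<beta> \<gamma>
    using gcomp_homog[OF A B C \<beta> \<alpha>] gcomp_homog[OF B C D \<gamma> \<beta>]
      gcomp_homog[OF A C D \<gamma> hom_comp_hm[OF A \<alpha> \<beta>]] gcomp_homog[OF A B D hom_comp_hm[OF B \<beta> \<gamma>] \<alpha>]
    by (simp add: hom_comp_assoc[OF \<alpha>] add.assoc)
  have 2: "gcomp R A C D (homog R C D r \<gamma>) (gcomp R A B C (homog R B C t \<beta>) f) =
      gcomp R A B D (gcomp R B C D (homog R C D r \<gamma>) (homog R B C t \<beta>)) f"
    if \<beta>: "\<beta> \<in> hm B C t" and \<gamma>: "\<gamma> \<in> hm C D r" for r t \<beta> \<gamma>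
    using A B f by (induction rule: ghom_induct) (simp_all add: 1 \<beta> \<gamma> cl ad)
  have 3: "gcomp R A C D (homog R C D r \<gamma>) (gcomp R A B C g f) =
      gcomp R A B D (gcomp R B C D (homog R C D r \<gamma>) g) f"
    if \<gamma>: "\<gamma> \<in> hm C D r" for r \<gamma>
    using B C g by (induction rule: ghom_induct) (simp_all add: 2 \<gamma> f cl ad)
  show ?thesis
    using C D h by (induction rule: ghom_induct) (simp_all add: 3 g f cl ad)
qed

lemma category_GMod: "category (GMod R \<W> :: (('p, 'a, 'u) pmod, _) cat)"
  by unfold_locales
    (simp_all add: GMod_simps homog_closed_zero[of _ \<W>] id_trans_nat[of _ \<W>] gcomp_closed[of _ \<W>]
      gcomp_id_left[of _ \<W>] gcomp_id_right[of _ \<W>] gcomp_assoc[of _ \<W>])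

text \<open>On homogeneous arguments this is \<open>gr_tensor_hom_comp\<close>; four nested
  inductions then extend it by biadditivity, one argument at a time.\<close>

lemma gtensor_hom_gcomp:
  assumes M: "M \<in> pm" "M' \<in> pm" "M'' \<in> pm" and N: "N \<in> pm" "N' \<in> pm" "N'' \<in> pm"
    and f: "f \<in> carrier (gh M M')" and f': "f' \<in> carrier (gh M' M'')"
    and g: "g \<in> carrier (gh N N')" and g': "g' \<in> carrier (gh N' N'')"
  shows "gtensor_hom R \<V> M M'' N N'' (gcomp R M M' M'' f' f) (gcomp R N N' N'' g' g) =
    gcomp R (M \<boxtimes> N) (M' \<boxtimes> N') (M'' \<boxtimes> N'') (gtensor_hom R \<V> M' M'' N' N'' f' g') (gtensor_hom R \<V> M M' N N' f
        g)"
    (is "?Q f f' g g'")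
proof -
  note MN = gr_tensor_pmod[OF M(1) N(1)] gr_tensor_pmod[OF M(2) N(2)] gr_tensor_pmod[OF M(3) N(3)]
  note cl = gcomp_closed[OF M] gcomp_closed[OF N] gcomp_closed[OF MN] gtensor_hom_closed[OF M(1,2) N(1,2)]
    gtensor_hom_closed[OF M(2,3) N(2,3)] gtensor_hom_closed[OF M(1,3) N(1,3)]
    homog_closed[OF M(1,2)] homog_closed[OF M(2,3)] homog_closed[OF N(1,2)] homog_closed[OF N(2,3)]
  note ad = gcomp_add_left[OF M] gcomp_add_left[OF N] gcomp_add_left[OF MN]
    gcomp_add_right[OF M] gcomp_add_right[OF N] gcomp_add_right[OF MN]
    gtensor_hom_add_left[OF M(1,2) N(1,2)] gtensor_hom_add_left[OF M(2,3) N(2,3)]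
        gtensor_hom_add_left[OF M(1,3) N(1,3)]
    gtensor_hom_add_right[OF M(1,2) N(1,2)] gtensor_hom_add_right[OF M(2,3) N(2,3)]
        gtensor_hom_add_right[OF M(1,3) N(1,3)]
  have 1: "?Q (homog R M M' s \<alpha>) (homog R M' M'' s' \<alpha>') (homog R N N' t \<beta>) (homog R N' N'' t' \<beta>')"
    if \<alpha>: "\<alpha> \<in> hm M M' s" and \<alpha>': "\<alpha>' \<in> hm M' M'' s'" and \<beta>: "\<beta> \<in> hm N N' t" and \<beta>': "\<beta>' \<in> hm N' N'' t'"
    for s s' t t' \<alpha> \<alpha>' \<beta> \<beta>'
  proof -
    \<comment> \<open>The two sides accumulate the four degrees in different orders, and
      \<open>homog\<close> places the component in the degree named.\<close>
    have e: "s + s' + (t + t') = s + t + (s' + t')" by (simp add: add_ac)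
    show ?thesis
      unfolding gcomp_homog[OF M \<alpha>' \<alpha>] gcomp_homog[OF N \<beta>' \<beta>] gtensor_hom_homog[OF M(1,2) N(1,2) \<alpha> \<beta>]
        gtensor_hom_homog[OF M(2,3) N(2,3) \<alpha>' \<beta>']
        gtensor_hom_homog[OF M(1,3) N(1,3) hom_comp_hm[OF M(1) \<alpha> \<alpha>'] hom_comp_hm[OF N(1) \<beta> \<beta>']]
        gcomp_homog[OF MN gr_tensor_hom_hm[OF M(2,3) N(2,3) \<alpha>' \<beta>'] gr_tensor_hom_hm[OF M(1,2) N(1,2) \<alpha> \<beta>]]
        gr_tensor_hom_comp[OF M N \<alpha> \<alpha>' \<beta> \<beta>' refl refl] e ..
  qed
  have 2: "?Q f (homog R M' M'' s' \<alpha>') (homog R N N' t \<beta>) (homog R N' N'' t' \<beta>')"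
    if "\<alpha>' \<in> hm M' M'' s'" and "\<beta> \<in> hm N N' t" and "\<beta>' \<in> hm N' N'' t'" for s' t t' \<alpha>' \<beta> \<beta>'
    using M(1,2) f by (induction rule: ghom_induct) (simp_all add: 1 that cl ad)
  have 3: "?Q f f' (homog R N N' t \<beta>) (homog R N' N'' t' \<beta>')"
    if "\<beta> \<in> hm N N' t" and "\<beta>' \<in> hm N' N'' t'" for t t' \<beta> \<beta>'
    using M(2,3) f' by (induction rule: ghom_induct) (simp_all add: 2 f that cl ad)
  have 4: "?Q f f' g (homog R N' N'' t' \<beta>')" if "\<beta>' \<in> hm N' N'' t'" for t' \<beta>'
    using N(1,2) g by (induction rule: ghom_induct) (simp_all add: 3 f f' that cl ad)
  show ?thesis
    using N(2,3) g' by (induction rule: ghom_induct) (simp_all add: 4 f f' g cl ad)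
qed

lemma gassoc_natural:
  assumes M: "M \<in> pm" "M' \<in> pm" and N: "N \<in> pm" "N' \<in> pm" and L: "L \<in> pm" "L' \<in> pm"
    and f: "f \<in> carrier (gh M M')" and g: "g \<in> carrier (gh N N')" and h: "h \<in> carrier (gh L L')"
  shows "gcomp R ((M \<boxtimes> N) \<boxtimes> L) ((M' \<boxtimes> N') \<boxtimes> L') (M' \<boxtimes> (N' \<boxtimes> L'))
      (homog R ((M' \<boxtimes> N') \<boxtimes> L') (M' \<boxtimes> (N' \<boxtimes> L')) 0 (gr_assoc R \<V> M' N' L'))
      (gtensor_hom R \<V> (M \<boxtimes> N) (M' \<boxtimes> N') L L' (gtensor_hom R \<V> M M' N N' f g) h) =
    gcomp R ((M \<boxtimes> N) \<boxtimes> L) (M \<boxtimes> (N \<boxtimes> L)) (M' \<boxtimes> (N' \<boxtimes> L'))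
      (gtensor_hom R \<V> M M' (N \<boxtimes> L) (N' \<boxtimes> L') f (gtensor_hom R \<V> N N' L L' g h))
      (homog R ((M \<boxtimes> N) \<boxtimes> L) (M \<boxtimes> (N \<boxtimes> L)) 0 (gr_assoc R \<V> M N L))"
    (is "?Q f g h")
proof -
  note MN = gr_tensor_pmod[OF M(1) N(1)] gr_tensor_pmod[OF M(2) N(2)]
  note NL = gr_tensor_pmod[OF N(1) L(1)] gr_tensor_pmod[OF N(2) L(2)]
  note X = gr_tensor_pmod[OF MN(1) L(1)] gr_tensor_pmod[OF MN(2) L(2)]
  note Y = gr_tensor_pmod[OF M(1) NL(1)] gr_tensor_pmod[OF M(2) NL(2)]
  have \<alpha>: "gr_assoc R \<V> M N L \<in> hm ((M \<boxtimes> N) \<boxtimes> L) (M \<boxtimes> (N \<boxtimes> L)) 0"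
    "gr_assoc R \<V> M' N' L' \<in> hm ((M' \<boxtimes> N') \<boxtimes> L') (M' \<boxtimes> (N' \<boxtimes> L')) 0"
    using gr_assoc_nat M N L by simp_all
  note c1 = gcomp_closed[OF X(1) X(2) Y(2)] gcomp_add_right[OF X(1) X(2) Y(2)]
    and c2 = gcomp_closed[OF X(1) Y(1) Y(2)] gcomp_add_left[OF X(1) Y(1) Y(2)]
  note cl = gtensor_hom_closed[OF M N] gtensor_hom_closed[OF N L] gtensor_hom_closed[OF MN L]
      gtensor_hom_closed[OF M NL]
    homog_closed[OF M] homog_closed[OF N] homog_closed[OF L] homog_closed[OF X(1) Y(1) \<alpha>(1)]
        homog_closed[OF X(2) Y(2) \<alpha>(2)]
  note ad = gtensor_hom_add_left[OF M N] gtensor_hom_add_left[OF N L] gtensor_hom_add_left[OF MN L]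
      gtensor_hom_add_left[OF M NL]
    gtensor_hom_add_right[OF M N] gtensor_hom_add_right[OF N L] gtensor_hom_add_right[OF MN L]
        gtensor_hom_add_right[OF M NL]
  have 1: "?Q (homog R M M' s \<phi>) (homog R N N' t \<psi>) (homog R L L' r \<chi>)"
    if \<phi>: "\<phi> \<in> hm M M' s" and \<psi>: "\<psi> \<in> hm N N' t" and \<chi>: "\<chi> \<in> hm L L' r" for r s t \<phi> \<psi> \<chi>
  proof -
    note T = gr_tensor_hom_hm[OF M N \<phi> \<psi>] gr_tensor_hom_hm[OF N L \<psi> \<chi>]
    have e: "0 + (s + (t + r)) = s + t + r + 0" by (simp add: add.assoc)
    show ?thesis
      unfolding gtensor_hom_homog[OF M N \<phi> \<psi>] gtensor_hom_homog[OF N L \<psi> \<chi>]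
        gtensor_hom_homog[OF MN L T(1) \<chi>] gtensor_hom_homog[OF M NL \<phi> T(2)]
        gcomp_homog[OF X(1) X(2) Y(2) \<alpha>(2) gr_tensor_hom_hm[OF MN L T(1) \<chi>]]
        gcomp_homog[OF X(1) Y(1) Y(2) gr_tensor_hom_hm[OF M NL \<phi> T(2)] \<alpha>(1)]
        gr_assoc_natural[OF M N L \<phi> \<psi> \<chi> refl refl] e ..
  qed
  have 2: "?Q f (homog R N N' t \<psi>) (homog R L L' r \<chi>)"
    if "\<psi> \<in> hm N N' t" and "\<chi> \<in> hm L L' r" for r t \<psi> \<chi>
    using M f by (induction rule: ghom_induct) (simp_all add: 1 that cl ad c1 c2)
  have 3: "?Q f g (homog R L L' r \<chi>)" if "\<chi> \<in> hm L L' r" for r \<chi>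
    using N g by (induction rule: ghom_induct) (simp_all add: 2 f that cl ad c1 c2)
  show ?thesis
    using L h by (induction rule: ghom_induct) (simp_all add: 3 f g cl ad c1 c2)
qed

lemma glunit_natural:
  assumes M: "M \<in> pm" and M': "M' \<in> pm" and f: "f \<in> carrier (gh M M')"
  shows "gcomp R (I \<boxtimes> M) (I \<boxtimes> M') M' (homog R (I \<boxtimes> M') M' 0 (gr_lunit R \<V> M'))
      (gtensor_hom R \<V> I I M M' (homog R I I 0 (id_trans I)) f) =
    gcomp R (I \<boxtimes> M) M M' f (homog R (I \<boxtimes> M) M 0 (gr_lunit R \<V> M))"
  using M M' f
proof (induction rule: ghom_induct)
  note X = gr_tensor_pmod[OF unit_pmod M] and X' = gr_tensor_pmod[OF unit_pmod M']
      and i = id_trans_hm[OF unit_pmod]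
  have l: "gr_lunit R \<V> M \<in> hm (I \<boxtimes> M) M 0" "gr_lunit R \<V> M' \<in> hm (I \<boxtimes> M') M' 0"
    using gr_lunit_nat M M' by simp_all
  {
    case (homog s \<alpha>)
    show ?case
      using gtensor_hom_homog[OF unit_pmod unit_pmod M M' i homog] gcomp_homog[OF X M M' homog l(1)]
        gcomp_homog[OF X X' M' l(2) gr_tensor_hom_hm[OF unit_pmod unit_pmod M M' i homog]]
            gr_lunit_natural[OF M M' homog]
      by simp
  next
    case (add \<phi> \<psi>)
    then show ?case
      using homog_closed[OF unit_pmod unit_pmod i] homog_closed[OF X M l(1)] homog_closed[OF X' M' l(2)]
      by (simp add: gtensor_hom_add_right[OF unit_pmod unit_pmod M M'] gtensor_hom_closed[OF unit_pmod
          unit_pmod M M']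
          gcomp_add_left[OF X M M'] gcomp_add_right[OF X X' M'])
  }
qed

lemma grunit_natural:
  assumes M: "M \<in> pm" and M': "M' \<in> pm" and f: "f \<in> carrier (gh M M')"
  shows "gcomp R (M \<boxtimes> I) (M' \<boxtimes> I) M' (homog R (M' \<boxtimes> I) M' 0 (gr_runit R \<V> M'))
      (gtensor_hom R \<V> M M' I I f (homog R I I 0 (id_trans I))) =
    gcomp R (M \<boxtimes> I) M M' f (homog R (M \<boxtimes> I) M 0 (gr_runit R \<V> M))"
  using M M' f
proof (induction rule: ghom_induct)
  note X = gr_tensor_pmod[OF M unit_pmod] and X' = gr_tensor_pmod[OF M' unit_pmod]
      and i = id_trans_hm[OF unit_pmod]
  have l: "gr_runit R \<V> M \<in> hm (M \<boxtimes> I) M 0" "gr_runit R \<V> M' \<in> hm (M' \<boxtimes> I) M' 0"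
    using gr_runit_nat M M' by simp_all
  {
    case (homog s \<alpha>)
    show ?case
      using gtensor_hom_homog[OF M M' unit_pmod unit_pmod homog i] gcomp_homog[OF X M M' homog l(1)]
        gcomp_homog[OF X X' M' l(2) gr_tensor_hom_hm[OF M M' unit_pmod unit_pmod homog i]]
            gr_runit_natural[OF M M' homog]
      by simp
  next
    case (add \<phi> \<psi>)
    then show ?case
      using homog_closed[OF unit_pmod unit_pmod i] homog_closed[OF X M l(1)] homog_closed[OF X' M' l(2)]
      by (simp add: gtensor_hom_add_left[OF M M' unit_pmod unit_pmod] gtensor_hom_closed[OF M M' unit_pmod
          unit_pmod]
          gcomp_add_left[OF X M M'] gcomp_add_right[OF X X' M'])
  }
qed

text \<open>Composition of degree 0 components stays in degree 0, so the inverses of the structure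
  maps carry over from the ungraded category.\<close>

lemma inverse_mors_GMod_gr:
  assumes "A \<in> pm" "B \<in> pm" "f \<in> nat_trans R A B" "g \<in> nat_trans R B A"
    and "hom_comp A 0 g f = id_trans A" "hom_comp B 0 f g = id_trans B"
  shows "inverse_mors (GMod_gr R \<V>) A B (homog R A B 0 f) (homog R B A 0 g)"
  using assms unfolding inverse_mors_def GMod_gr_simps
  by (simp add: homog_closed_zero[of _ \<V>] gcomp_homog_zero[of _ \<V>])

text \<open>Identities, pentagon and triangle involve degree 0 morphisms only and reduce to the
  corresponding identities of natural transformations. Functoriality and naturality range over all
  graded morphisms and need the lemmas obtained by extension from homogeneous ones.\<close>

lemma monoidal_GMod: "monoidal_category (GMod_gr R \<V> :: (('p, 'a, 'u) pmod, _) moncat)"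
proof -
  note [simp] = id_trans_nat[of _ \<V>] gr_tensor_pmod unit_pmod gr_assoc_nat gr_lunit_nat gr_runit_nat
      gr_tensor_hom_nat
    homog_closed_zero[of _ \<V>] gcomp_homog_zero[of _ \<V>] gtensor_hom_homog_zero
  interpret category "GMod_gr R \<V> :: (('p, 'a, 'u) pmod, _) moncat"
    by unfold_locales
      (simp_all add: GMod_gr_simps gcomp_closed[of _ \<V>] gcomp_id_left[of _ \<V>] gcomp_id_right[of _ \<V>]
          gcomp_assoc[of _ \<V>])
  show ?thesis
  proof (unfold_locales, unfold GMod_gr_simps)
    show "I \<in> pm" by (rule unit_pmod)
  next
    fix a b :: "('p, 'a, 'u) pmod"
    assume ab: "a \<in> pm" "b \<in> pm"
    show "a \<boxtimes> b \<in> pm"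
      "gtensor_hom R \<V> a a b b (homog R a a 0 (id_trans a)) (homog R b b 0 (id_trans b)) =
        homog R (a \<boxtimes> b) (a \<boxtimes> b) 0 (id_trans (a \<boxtimes> b))"
      "gcomp R ((a \<boxtimes> I) \<boxtimes> b) (a \<boxtimes> (I \<boxtimes> b)) (a \<boxtimes> b)
        (gtensor_hom R \<V> a a (I \<boxtimes> b) b (homog R a a 0 (id_trans a)) (homog R (I \<boxtimes> b) b 0 (gr_lunit R \<V> b)))
        (homog R ((a \<boxtimes> I) \<boxtimes> b) (a \<boxtimes> (I \<boxtimes> b)) 0 (gr_assoc R \<V> a I b)) =
      gtensor_hom R \<V> (a \<boxtimes> I) a b b (homog R (a \<boxtimes> I) a 0 (gr_runit R \<V> a)) (homog R b b 0 (id_trans b))"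
      using ab by (simp_all add: gr_tensor_hom_id gr_triangle)
  next
    fix a :: "('p, 'a, 'u) pmod" assume a: "a \<in> pm"
    show "iso_mor (GMod_gr R \<V>) (I \<boxtimes> a) a (homog R (I \<boxtimes> a) a 0 (gr_lunit R \<V> a))"
      using inverse_mors_GMod_gr[OF gr_tensor_pmod[OF unit_pmod a] a gr_lunit_nat[OF a] gr_lunit_inv[OF a]]
      unfolding iso_mor_def by blast
    show "iso_mor (GMod_gr R \<V>) (a \<boxtimes> I) a (homog R (a \<boxtimes> I) a 0 (gr_runit R \<V> a))"
      using inverse_mors_GMod_gr[OF gr_tensor_pmod[OF a unit_pmod] a gr_runit_nat[OF a] gr_runit_inv[OF a]]
      unfolding iso_mor_def by blast
  next
    fix a b c :: "('p, 'a, 'u) pmod" assume abc: "a \<in> pm" "b \<in> pm" "c \<in> pm"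
    obtain k where k: "k \<in> nat_trans R (a \<boxtimes> (b \<boxtimes> c)) ((a \<boxtimes> b) \<boxtimes> c)"
      "hom_comp ((a \<boxtimes> b) \<boxtimes> c) 0 k (gr_assoc R \<V> a b c) = id_trans ((a \<boxtimes> b) \<boxtimes> c)"
      "hom_comp (a \<boxtimes> (b \<boxtimes> c)) 0 (gr_assoc R \<V> a b c) k = id_trans (a \<boxtimes> (b \<boxtimes> c))"
      by (rule gr_assoc_inverse[OF abc])
    have "(a \<boxtimes> b) \<boxtimes> c \<in> pm" "a \<boxtimes> (b \<boxtimes> c) \<in> pm" using abc by simp_all
    from inverse_mors_GMod_gr[OF this gr_assoc_nat[OF abc] k]
    show "iso_mor (GMod_gr R \<V>) ((a \<boxtimes> b) \<boxtimes> c) (a \<boxtimes> (b \<boxtimes> c)) (homog R ((a \<boxtimes> b) \<boxtimes> c) (a \<boxtimes> (b \<boxtimes> c))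
        0 (gr_assoc R \<V> a b c))"
      unfolding iso_mor_def by blast
  next
    fix a b c d :: "('p, 'a, 'u) pmod" assume abcd: "a \<in> pm" "b \<in> pm" "c \<in> pm" "d \<in> pm"
    \<comment> \<open>\<open>gcomp_homog_zero\<close> asks for transformations on both sides. Of the
      nested composite the simplifier cannot find this by itself, because the intermediate object
      has to be named.\<close>
    have "hom_comp ((a \<boxtimes> (b \<boxtimes> c)) \<boxtimes> d) 0 (th a a ((b \<boxtimes> c) \<boxtimes> d) (b \<boxtimes> (c \<boxtimes> d)) 0 0 (id_trans a)
        (gr_assoc R \<V> b c d))
      (gr_assoc R \<V> a (b \<boxtimes> c) d) \<in> nat_trans R ((a \<boxtimes> (b \<boxtimes> c)) \<boxtimes> d) (a \<boxtimes> (b \<boxtimes> (c \<boxtimes> d)))"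
      using abcd by (intro hom_comp_nat[where \<U> = \<V> and N = "a \<boxtimes> ((b \<boxtimes> c) \<boxtimes> d)"]) simp_all
    then show "gcomp R (((a \<boxtimes> b) \<boxtimes> c) \<boxtimes> d) ((a \<boxtimes> b) \<boxtimes> (c \<boxtimes> d)) (a \<boxtimes> (b \<boxtimes> (c \<boxtimes> d)))
        (homog R ((a \<boxtimes> b) \<boxtimes> (c \<boxtimes> d)) (a \<boxtimes> (b \<boxtimes> (c \<boxtimes> d))) 0 (gr_assoc R \<V> a b (c \<boxtimes> d)))
        (homog R (((a \<boxtimes> b) \<boxtimes> c) \<boxtimes> d) ((a \<boxtimes> b) \<boxtimes> (c \<boxtimes> d)) 0 (gr_assoc R \<V> (a \<boxtimes> b) c d)) =
      gcomp R (((a \<boxtimes> b) \<boxtimes> c) \<boxtimes> d) ((a \<boxtimes> (b \<boxtimes> c)) \<boxtimes> d) (a \<boxtimes> (b \<boxtimes> (c \<boxtimes> d)))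
        (gcomp R ((a \<boxtimes> (b \<boxtimes> c)) \<boxtimes> d) (a \<boxtimes> ((b \<boxtimes> c) \<boxtimes> d)) (a \<boxtimes> (b \<boxtimes> (c \<boxtimes> d)))
          (gtensor_hom R \<V> a a ((b \<boxtimes> c) \<boxtimes> d) (b \<boxtimes> (c \<boxtimes> d)) (homog R a a 0 (id_trans a))
            (homog R ((b \<boxtimes> c) \<boxtimes> d) (b \<boxtimes> (c \<boxtimes> d)) 0 (gr_assoc R \<V> b c d)))
          (homog R ((a \<boxtimes> (b \<boxtimes> c)) \<boxtimes> d) (a \<boxtimes> ((b \<boxtimes> c) \<boxtimes> d)) 0 (gr_assoc R \<V> a (b \<boxtimes> c) d)))
        (gtensor_hom R \<V> ((a \<boxtimes> b) \<boxtimes> c) (a \<boxtimes> (b \<boxtimes> c)) d d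
          (homog R ((a \<boxtimes> b) \<boxtimes> c) (a \<boxtimes> (b \<boxtimes> c)) 0 (gr_assoc R \<V> a b c)) (homog R d d 0 (id_trans d)))"
      using abcd by (simp add: gr_pentagon)
  qed (simp_all add: gtensor_hom_closed gtensor_hom_gcomp gassoc_natural glunit_natural grunit_natural)
qed

end

section \<open>The enrichments\<close>

context enriched_persistence
begin

lemma enr_simps:
  "EOb (PMod_enr R \<U> \<V>) = um" "EHom (PMod_enr R \<U> \<V>) M N = ih M N"
  "ECmp (PMod_enr R \<U> \<V>) M N L = ihom_comp R \<V> M N L" "EId (PMod_enr R \<U> \<V>) M = ihom_id R \<V> M"
  "EOb (GMod_enr R \<U> \<V>) = um" "EHom (GMod_enr R \<U> \<V>) M N = ih M N"
  "ECmp (GMod_enr R \<U> \<V>) M N L = homog R (ih N L \<boxtimes> ih M N) (ih M L) 0 (ihom_comp R \<V> M N L)"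
  "EId (GMod_enr R \<U> \<V>) M = homog R I (ih M M) 0 (ihom_id R \<V> M)"
  by (simp_all add: PMod_enr_def GMod_enr_def)

lemma enriched_PMod:
  "enriched_category (PMod_gr R \<V>) (PMod_enr R \<U> \<V> :: (('p, 'a, 'u) pmod, _, _) ecat)"
proof -
  interpret monoidal_category "PMod_gr R \<V> :: (('p, 'a, 'u) pmod, _) moncat" by (rule monoidal_PMod)
  show ?thesis
    by (unfold_locales, unfold PMod_gr_simps enr_simps)
      (simp_all add: ihom_pmod ihom_comp_nat ihom_id_nat ihom_comp_assoc ihom_comp_id_left ihom_comp_id_right)
qed

lemma enriched_GMod:
  "enriched_category (GMod_gr R \<V>) (GMod_enr R \<U> \<V> :: (('p, 'a, 'u) pmod, _, _) ecat)"
proof -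
  interpret monoidal_category "GMod_gr R \<V> :: (('p, 'a, 'u) pmod, _) moncat" by (rule monoidal_GMod)
  note [simp] = id_trans_nat[of _ \<V>] gr_tensor_pmod unit_pmod gr_assoc_nat gr_tensor_hom_nat
    homog_closed_zero[of _ \<V>] gcomp_homog_zero[of _ \<V>] gtensor_hom_homog_zero ihom_pmod ihom_comp_nat
        ihom_id_nat
  show ?thesis
  proof (unfold_locales, unfold GMod_gr_simps enr_simps)
    fix a b c d :: "('p, 'a, 'u) pmod" assume abcd: "a \<in> um" "b \<in> um" "c \<in> um" "d \<in> um"
    \<comment> \<open>As in the pentagon, the inner composite must be known to be a transformation
      before the outer graded composition reduces to degree 0.\<close>
    have "hom_comp (ih c d \<boxtimes> (ih b c \<boxtimes> ih a b)) 0 (ihom_comp R \<V> a c d)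
        (th (ih c d) (ih c d) (ih b c \<boxtimes> ih a b) (ih a c) 0 0 (id_trans (ih c d)) (ihom_comp R \<V> a b c))
      \<in> nat_trans R (ih c d \<boxtimes> (ih b c \<boxtimes> ih a b)) (ih a d)"
      using abcd by (intro hom_comp_nat[where \<U> = \<V> and N = "ih c d \<boxtimes> ih a c"]) simp_all
    then show "gcomp R ((ih c d \<boxtimes> ih b c) \<boxtimes> ih a b) (ih b d \<boxtimes> ih a b) (ih a d)
        (homog R (ih b d \<boxtimes> ih a b) (ih a d) 0 (ihom_comp R \<V> a b d))
        (gtensor_hom R \<V> (ih c d \<boxtimes> ih b c) (ih b d) (ih a b) (ih a b)
          (homog R (ih c d \<boxtimes> ih b c) (ih b d) 0 (ihom_comp R \<V> b c d)) (homog R (ih a b) (ih a b)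
              0 (id_trans (ih a b)))) =
      gcomp R ((ih c d \<boxtimes> ih b c) \<boxtimes> ih a b) (ih c d \<boxtimes> (ih b c \<boxtimes> ih a b)) (ih a d)
        (gcomp R (ih c d \<boxtimes> (ih b c \<boxtimes> ih a b)) (ih c d \<boxtimes> ih a c) (ih a d)
          (homog R (ih c d \<boxtimes> ih a c) (ih a d) 0 (ihom_comp R \<V> a c d))
          (gtensor_hom R \<V> (ih c d) (ih c d) (ih b c \<boxtimes> ih a b) (ih a c)
            (homog R (ih c d) (ih c d) 0 (id_trans (ih c d))) (homog R (ih b c \<boxtimes> ih a b) (ih a c)
                0 (ihom_comp R \<V> a b c))))
        (homog R ((ih c d \<boxtimes> ih b c) \<boxtimes> ih a b) (ih c d \<boxtimes> (ih b c \<boxtimes> ih a b)) 0 (gr_assoc R \<V> (ih c d) (ih b c)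
            (ih a b)))"
      using abcd by (simp add: ihom_comp_assoc)
  qed (simp_all add: ihom_comp_id_left ihom_comp_id_right)
qed

text \<open>The unit represents evaluation at \<open>0\<close>, so \<open>hom_name\<close> identifies \<open>Hom(M, N(s))\<close> with the
  morphisms of degree \<open>s\<close> from the unit to the hom object.\<close>

definition hom_name :: "('p, 'a, 'u) pmod \<Rightarrow> ('p, 'a, 'u) pmod \<Rightarrow> 'p \<Rightarrow> ('p \<Rightarrow> 'u \<Rightarrow> 'u) \<Rightarrow> 'p \<Rightarrow> 'u \<Rightarrow> 'u" where
  "hom_name M N s \<alpha> = unit_map (shift s (ih M N)) (\<epsilon> M N s \<alpha>)"

context
  fixes M N :: "('p, 'a, 'u) pmod"
  assumes M: "M \<in> um" and N: "N \<in> um"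
begin

lemma hom_name_hm: "\<alpha> \<in> hm M N s \<Longrightarrow> hom_name M N s \<alpha> \<in> hm I (ih M N) s"
  and hom_name_one: "\<alpha> \<in> hm M N s \<Longrightarrow> hom_name M N s \<alpha> 0 (\<upsilon> \<one>) = \<epsilon> M N s \<alpha>"
  unfolding hom_name_def
  using unit_map_nat[OF shift_pmod[OF ihom_pmod[OF M N]], of "\<epsilon> M N s \<alpha>" s] ihom_elem_closed[OF M N]
  by simp_all

lemma hom_name_unique:
  assumes "h \<in> hm I (ih M N) s" "\<alpha> \<in> hm M N s" "h 0 (\<upsilon> \<one>) = \<epsilon> M N s \<alpha>"
  shows "hom_name M N s \<alpha> = h"
  by (rule unit_ext[OF hom_name_hm[OF assms(2)] assms(1) shift_pmod[OF ihom_pmod[OF M N]]])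
    (simp add: hom_name_one assms)

text \<open>Evaluation at the generator is the inverse: it recovers the code of
  \<open>\<alpha>\<close>, and every value there is the code of some transformation.\<close>

lemma hom_name_bij: "bij_betw (hom_name M N s) (hm M N s) (hm I (ih M N) s)"
proof (rule bij_betwI')
  fix \<alpha> \<beta> assume ab: "\<alpha> \<in> hm M N s" "\<beta> \<in> hm M N s"
  show "hom_name M N s \<alpha> = hom_name M N s \<beta> \<longleftrightarrow> \<alpha> = \<beta>"
    using hom_name_one[OF ab(1)] hom_name_one[OF ab(2)] ihom_elem_eq_iff[OF M N ab] by auto
  show "hom_name M N s \<alpha> \<in> hm I (ih M N) s" by (rule hom_name_hm[OF ab(1)])
next
  fix h assume h: "h \<in> hm I (ih M N) s"
  have "h 0 (\<upsilon> \<one>) \<in> el (ih M N) s" by (rule hm_closed[OF h unit_one_closed]) simp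
  then obtain \<alpha> where \<alpha>: "\<alpha> \<in> hm M N s" "h 0 (\<upsilon> \<one>) = \<epsilon> M N s \<alpha>" by (rule ihom_cases[OF M N])
  show "\<exists>\<alpha>\<in>hm M N s. h = hom_name M N s \<alpha>"
    using hom_name_unique[OF h \<alpha>] \<alpha>(1) by blast
qed

lemma hom_name_add:
  assumes "\<alpha> \<in> hm M N s" "\<beta> \<in> hm M N s"
  shows "hom_name M N s (\<alpha> \<oplus>\<^bsub>hom_module R M (shift s N)\<^esub> \<beta>) =
    hom_name M N s \<alpha> \<oplus>\<^bsub>hom_module R I (shift s (ih M N))\<^esub> hom_name M N s \<beta>"
proof (rule hom_name_unique[OF _ hom_add_closed[OF M N assms]])
  show "hom_name M N s \<alpha> \<oplus>\<^bsub>hom_module R I (shift s (ih M N))\<^esub> hom_name M N s \<beta> \<in> hm I (ih M N) s"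
    using mod_add[OF hom_modules[OF unit_pmod ihom_pmod[OF M N]], of "hom_name M N s \<alpha>" s "hom_name M N s \<beta>"]
      hom_name_hm assms by (simp del: hom_module_simps(2-))
  show "(hom_name M N s \<alpha> \<oplus>\<^bsub>hom_module R I (shift s (ih M N))\<^esub> hom_name M N s \<beta>) 0 (\<upsilon> \<one>) =
    \<epsilon> M N s (\<alpha> \<oplus>\<^bsub>hom_module R M (shift s N)\<^esub> \<beta>)"
    unfolding ihom_elem_add[OF M N assms, symmetric] using assms by (simp add: hom_name_one)
qed

text \<open>Applied in every degree, this shows that naming preserves the support of a graded
  morphism, so finiteness of supports transfers in both directions.\<close>

lemma hom_name_eq_zero_iff:
  assumes \<alpha>: "\<alpha> \<in> hm M N s"
  shows "hom_name M N s \<alpha> = \<zero>\<^bsub>hom_module R I (shift s (ih M N))\<^esub> \<longleftrightarrow> \<alpha> = \<zero>\<^bsub>hom_module R M (shift s N)\<^esub>"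
proof -
  note m = hom_modules[OF M N, of s] and m' = hom_modules[OF unit_pmod ihom_pmod[OF M N], of s]
  let ?z = "\<zero>\<^bsub>hom_module R M (shift s N)\<^esub>"
  have z: "?z \<in> hm M N s" using mod_zero[OF m] by (simp only: hom_module_simps(1))
  have "?z \<oplus>\<^bsub>hom_module R M (shift s N)\<^esub> ?z = ?z" by (rule mod_l_zero[OF m mod_zero[OF m]])
  then have "hom_name M N s ?z \<oplus>\<^bsub>hom_module R I (shift s (ih M N))\<^esub> hom_name M N s ?z = hom_name M N s ?z"
    using hom_name_add[OF z z] by (simp only:)
  then have "hom_name M N s ?z = \<zero>\<^bsub>hom_module R I (shift s (ih M N))\<^esub>"
    by (rule mod_add_self[OF m', rotated]) (simp add: hom_name_hm[OF z] del: hom_module_simps(2-))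
  with bij_betw_imp_inj_on[OF hom_name_bij, of s] \<alpha> z show ?thesis
    by (metis inj_on_def)
qed

end

lemma hom_name_id: "M \<in> um \<Longrightarrow> hom_name M M 0 (id_trans M) = ihom_id R \<V> M"
  by (rule hom_name_unique) (simp_all add: ihom_id_nat id_trans_nat ihom_id_one)

text \<open>Both sides are maps out of the unit and are compared at its generator. The inverse
  unitor doubles the generator, the tensor product turns the two copies into the codes of
  \<open>\<beta>\<close> and \<open>\<alpha>\<close>, and \<open>ihom_comp\<close> composes
  these.\<close>

lemma hom_name_comp:
  assumes M: "M \<in> um" and N: "N \<in> um" and L: "L \<in> um" and \<alpha>: "\<alpha> \<in> hm M N s" and \<beta>: "\<beta> \<in> hm N L t"
  shows "hom_name M L (s + t) (hom_comp M s \<beta> \<alpha>) =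
    hom_comp I (t + s) (ihom_comp R \<V> M N L)
      (hom_comp I 0 (th I (ih N L) I (ih M N) t s (hom_name N L t \<beta>) (hom_name M N s \<alpha>)) (gr_lunit_inv I))"
proof -
  note pm = unit_pmod ihom_pmod[OF N L] unit_pmod ihom_pmod[OF M N]
  note b = hom_name_hm[OF N L \<beta>] and a = hom_name_hm[OF M N \<alpha>]
  note T = gr_tensor_hom_hm[OF pm b a]
  have l: "gr_lunit_inv I \<in> hm I (I \<boxtimes> I) 0" using gr_lunit_inv_nat[OF unit_pmod] by simp
  have c: "ihom_comp R \<V> M N L \<in> hm (ih N L \<boxtimes> ih M N) (ih M L) 0" using ihom_comp_nat[OF M N L] by simp
  have Tl: "hom_comp I 0 (th I (ih N L) I (ih M N) t s (hom_name N L t \<beta>) (hom_name M N s \<alpha>)) (gr_lunit_inv I)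
    \<in> hm I (ih N L \<boxtimes> ih M N) (t + s)"
    using hom_comp_hm[OF unit_pmod l T] by simp
  note C = hom_comp_hm[OF unit_pmod Tl c]
  have e: "t + s + 0 = s + t" by (simp add: add.commute)
  have "hom_comp I (t + s) (ihom_comp R \<V> M N L)
      (hom_comp I 0 (th I (ih N L) I (ih M N) t s (hom_name N L t \<beta>) (hom_name M N s \<alpha>)) (gr_lunit_inv I))
          0 (\<upsilon> \<one>) =
    ihom_comp R \<V> M N L (t + s) (gp (ih N L) (ih M N) t s (t + s) (\<epsilon> N L t \<beta>) (\<epsilon> M N s \<alpha>))"
    by (simp add: gr_lunit_inv_def gr_tensor_hom_pure[OF pm b a] hom_name_one[OF N L \<beta>]
        hom_name_one[OF M N \<alpha>])
  also have "\<dots> = \<epsilon> M L (s + t) (hom_comp M s \<beta> \<alpha>)"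
    using ihom_comp_pure[OF M N L refl \<beta> \<alpha>] by (simp add: add.commute)
  finally show ?thesis
    by (rule hom_name_unique[OF M L C[unfolded e] hom_comp_hm[OF M \<alpha> \<beta>]])
qed

lemma enriched_over_PMod:
  "enriched_over (PMod R \<U> :: (('p, 'a, 'u) pmod, _) cat) (PMod_gr R \<V>) (PMod_enr R \<U> \<V>)"
proof -
  interpret E: enriched_category "PMod_gr R \<V>" "PMod_enr R \<U> \<V> :: (('p, 'a, 'u) pmod, _, _) ecat"
    by (rule enriched_PMod)
  \<comment> \<open>Composition in the underlying category is expressed by \<open>inv_mor\<close>;
    here it is replaced by the explicit inverse, to which \<open>hom_name_comp\<close>
    refers.\<close>
  have inv: "inv_mor (PMod_gr R \<V>) (I \<boxtimes> I) I (gr_lunit R \<V> I) = gr_lunit_inv I"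
    by (rule E.inv_mor_eq)
      (simp_all add: PMod_gr_simps inverse_mors_def unit_pmod gr_tensor_pmod gr_lunit_nat gr_lunit_inv)
  have "iso_over_objects (PMod R \<U> :: (('p, 'a, 'u) pmod, _) cat) (underlying_cat (PMod_gr R \<V>)
      (PMod_enr R \<U> \<V>))"
    unfolding iso_over_objects_def underlying_cat_def cat.simps PMod_simps PMod_gr_simps enr_simps inv
  proof (intro conjI exI[of _ "\<lambda>M N. hom_name M N 0"] ballI)
    fix M N assume M: "M \<in> um" and N: "N \<in> um"
    show "bij_betw (hom_name M N 0) (nat_trans R M N) (nat_trans R I (ih M N))"
      using hom_name_bij[OF M N, of 0] by simp
    fix L \<alpha> \<beta> assume L: "L \<in> um" and "\<alpha> \<in> nat_trans R M N" "\<beta> \<in> nat_trans R N L"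
    then show "hom_name M L 0 (hom_comp M 0 \<beta> \<alpha>) = hom_comp I 0 (ihom_comp R \<V> M N L)
      (hom_comp I 0 (th I (ih N L) I (ih M N) 0 0 (hom_name N L 0 \<beta>) (hom_name M N 0 \<alpha>)) (gr_lunit_inv I))"
      using hom_name_comp[OF M N L, of \<alpha> 0 \<beta> 0] by simp
  qed (simp_all add: hom_name_id)
  with category_PMod enriched_PMod show ?thesis
    unfolding enriched_over_def by blast
qed

text \<open>Graded morphisms on both sides are families indexed by the degree, and naming acts
  degree by degree.\<close>

definition ghom_name :: "('p, 'a, 'u) pmod \<Rightarrow> ('p, 'a, 'u) pmod \<Rightarrow> ('p \<Rightarrow> 'p \<Rightarrow> 'u \<Rightarrow> 'u) \<Rightarrow> 'p \<Rightarrow> 'p \<Rightarrow> 'u \<Rightarrow> 'u"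
    where
  "ghom_name M N \<phi> = (\<lambda>s. hom_name M N s (\<phi> s))"

lemma ghom_carrierI:
  fixes M N :: "('p, 'a, 'u) pmod"
  assumes "\<And>s. \<phi> s \<in> hm M N s" "finite {s. \<phi> s \<noteq> \<zero>\<^bsub>hom_module R M (shift s N)\<^esub>}"
  shows "\<phi> \<in> carrier (gh M N)"
  unfolding ghom_module_def
  by (rule dsum_carrierI[OF _ _ assms(2)]) (use assms(1) in simp_all)

lemma ghom_finite_support:
  "\<phi> \<in> carrier (gh M N) \<Longrightarrow> finite {s. \<phi> s \<noteq> \<zero>\<^bsub>hom_module R M (shift s N)\<^esub>}"
  using dsum_carrierD(3)[of \<phi> UNIV "\<lambda>s. hom_module R M (shift s N)"]
  unfolding ghom_module_def by (simp del: hom_module_simps)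

context
  fixes M N :: "('p, 'a, 'u) pmod"
  assumes M: "M \<in> um" and N: "N \<in> um"
begin

lemma ghom_name_closed:
  assumes "\<phi> \<in> carrier (gh M N)"
  shows "ghom_name M N \<phi> \<in> carrier (gh I (ih M N))"
proof (rule ghom_carrierI)
  note c = ghom_component[OF assms]
  show "ghom_name M N \<phi> s \<in> hm I (ih M N) s" for s
    unfolding ghom_name_def by (rule hom_name_hm[OF M N c])
  show "finite {s. ghom_name M N \<phi> s \<noteq> \<zero>\<^bsub>hom_module R I (shift s (ih M N))\<^esub>}"
    unfolding ghom_name_def hom_name_eq_zero_iff[OF M N c] by (rule ghom_finite_support[OF assms])
qed

lemma ghom_name_bij: "bij_betw (ghom_name M N) (carrier (gh M N)) (carrier (gh I (ih M N)))"
proof (rule bij_betwI')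
  fix \<phi> \<psi> assume \<phi>: "\<phi> \<in> carrier (gh M N)" and \<psi>: "\<psi> \<in> carrier (gh M N)"
  show "ghom_name M N \<phi> \<in> carrier (gh I (ih M N))" by (rule ghom_name_closed[OF \<phi>])
  show "ghom_name M N \<phi> = ghom_name M N \<psi> \<longleftrightarrow> \<phi> = \<psi>"
  proof
    assume eq: "ghom_name M N \<phi> = ghom_name M N \<psi>"
    show "\<phi> = \<psi>"
    proof
      fix s
      from fun_cong[OF eq, of s] have "hom_name M N s (\<phi> s) = hom_name M N s (\<psi> s)"
          by (simp add: ghom_name_def)
      then show "\<phi> s = \<psi> s"
        by (rule inj_onD[OF bij_betw_imp_inj_on[OF hom_name_bij[OF M N]] _ ghom_component[OF \<phi>]
            ghom_component[OF \<psi>]])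
    qed
  qed simp
next
  fix \<psi> assume \<psi>: "\<psi> \<in> carrier (gh I (ih M N))"
  \<comment> \<open>A preimage is chosen in each degree; its support is that of
    \<open>\<psi>\<close>, because naming detects zero.\<close>
  define \<phi> where "\<phi> = (\<lambda>s. inv_into (hm M N s) (hom_name M N s) (\<psi> s))"
  have im: "\<psi> s \<in> hom_name M N s ` hm M N s" for s
    unfolding bij_betw_imp_surj_on[OF hom_name_bij[OF M N]] by (rule ghom_component[OF \<psi>])
  have c: "\<phi> s \<in> hm M N s" and e: "hom_name M N s (\<phi> s) = \<psi> s" for s
    unfolding \<phi>_def using inv_into_into[OF im] f_inv_into_f[OF im] by simp_all
  have "\<phi> \<in> carrier (gh M N)"
    by (rule ghom_carrierI[OF c])
      (use ghom_finite_support[OF \<psi>] in \<open>simp only: hom_name_eq_zero_iff[OF M N c, symmetric] e\<close>)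
  moreover have "\<psi> = ghom_name M N \<phi>" by (simp add: ghom_name_def e)
  ultimately show "\<exists>\<phi>\<in>carrier (gh M N). \<psi> = ghom_name M N \<phi>" by blast
qed

lemma ghom_name_add:
  assumes "\<phi> \<in> carrier (gh M N)" "\<psi> \<in> carrier (gh M N)"
  shows "ghom_name M N (\<phi> \<oplus>\<^bsub>gh M N\<^esub> \<psi>) = ghom_name M N \<phi> \<oplus>\<^bsub>gh I (ih M N)\<^esub> ghom_name M N \<psi>"
  using hom_name_add[OF M N ghom_component[OF assms(1)] ghom_component[OF assms(2)]]
  by (intro ext) (simp add: ghom_name_def ghom_module_def del: hom_module_simps)

lemma ghom_name_homog:
  assumes \<alpha>: "\<alpha> \<in> hm M N s"
  shows "ghom_name M N (homog R M N s \<alpha>) = homog R I (ih M N) s (hom_name M N s \<alpha>)"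
proof
  fix t
  have z: "\<zero>\<^bsub>hom_module R M (shift t N)\<^esub> \<in> hm M N t"
    using mod_zero[OF hom_modules[OF M N, of t]] by (simp only: hom_module_simps(1))
  have "hom_name M N t \<zero>\<^bsub>hom_module R M (shift t N)\<^esub> = \<zero>\<^bsub>hom_module R I (shift t (ih M N))\<^esub>"
    unfolding hom_name_eq_zero_iff[OF M N z] ..
  then show "ghom_name M N (homog R M N s \<alpha>) t = homog R I (ih M N) s (hom_name M N s \<alpha>) t"
    by (simp add: ghom_name_def homog_def dsum_single_def del: hom_module_simps)
qed

end

text \<open>Both sides are additive in \<open>\<psi>\<close> and in \<open>\<phi>\<close>, so the
  statement for homogeneous morphisms, which is \<open>hom_name_comp\<close>, is enough.\<close>

lemma ghom_name_comp:
  assumes M: "M \<in> um" and N: "N \<in> um" and L: "L \<in> um"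
    and \<phi>: "\<phi> \<in> carrier (gh M N)" and \<psi>: "\<psi> \<in> carrier (gh N L)"
  shows "ghom_name M L (gcomp R M N L \<psi> \<phi>) =
    gcomp R I (ih N L \<boxtimes> ih M N) (ih M L) (homog R (ih N L \<boxtimes> ih M N) (ih M L) 0 (ihom_comp R \<V> M N L))
      (gcomp R I (I \<boxtimes> I) (ih N L \<boxtimes> ih M N)
        (gtensor_hom R \<V> I (ih N L) I (ih M N) (ghom_name N L \<psi>) (ghom_name M N \<phi>))
        (homog R I (I \<boxtimes> I) 0 (gr_lunit_inv I)))" (is "?Q \<psi> \<phi>")
proof -
  note pm = unit_pmod ihom_pmod[OF N L] unit_pmod ihom_pmod[OF M N]
  note X = gr_tensor_pmod[OF unit_pmod unit_pmod] and Y = gr_tensor_pmod[OF pm(2,4)] and K = ihom_pmod[OF M L]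
  have l: "gr_lunit_inv I \<in> hm I (I \<boxtimes> I) 0" using gr_lunit_inv_nat[OF unit_pmod] by simp
  have c: "ihom_comp R \<V> M N L \<in> hm (ih N L \<boxtimes> ih M N) (ih M L) 0" using ihom_comp_nat[OF M N L] by simp
  note cl = homog_closed[OF unit_pmod X l] homog_closed[OF Y K c] gtensor_hom_closed[OF pm]
    gcomp_closed[OF unit_pmod X Y] gcomp_closed[OF M N L] ghom_name_closed[OF N L] ghom_name_closed[OF M N]
    homog_closed[OF M N] homog_closed[OF N L]
  note ad = gtensor_hom_add_left[OF pm] gtensor_hom_add_right[OF pm] gcomp_add_left[OF unit_pmod X Y]
    gcomp_add_right[OF unit_pmod Y K] gcomp_add_left[OF M N L] gcomp_add_right[OF M N L]
    ghom_name_add[OF N L] ghom_name_add[OF M N] ghom_name_add[OF M L]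
  have 1: "?Q (homog R N L t \<beta>) (homog R M N s \<alpha>)" if \<alpha>: "\<alpha> \<in> hm M N s" and \<beta>: "\<beta> \<in> hm N L t" for s t \<alpha> \<beta>
  proof -
    note T = gr_tensor_hom_hm[OF pm hom_name_hm[OF N L \<beta>] hom_name_hm[OF M N \<alpha>]]
    show ?thesis
      unfolding gcomp_homog[OF M N L \<beta> \<alpha>] ghom_name_homog[OF M N \<alpha>] ghom_name_homog[OF N L \<beta>]
        ghom_name_homog[OF M L hom_comp_hm[OF M \<alpha> \<beta>]]
        gtensor_hom_homog[OF pm hom_name_hm[OF N L \<beta>] hom_name_hm[OF M N \<alpha>]]
        gcomp_homog[OF unit_pmod X Y T l] gcomp_homog[OF unit_pmod Y K c hom_comp_hm[OF unit_pmod l T]]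
      unfolding add_0_left add_0_right hom_name_comp[OF M N L \<alpha> \<beta>]
      unfolding add.commute[of s t] ..
  qed
  have 2: "?Q (homog R N L t \<beta>) \<phi>" if "\<beta> \<in> hm N L t" for t \<beta>
    using M N \<phi> by (induction rule: ghom_induct) (simp_all add: 1 that cl ad)
  show ?thesis
    using N L \<psi> by (induction rule: ghom_induct) (simp_all add: 2 \<phi> cl ad)
qed

lemma enriched_over_GMod:
  "enriched_over (GMod R \<U> :: (('p, 'a, 'u) pmod, _) cat) (GMod_gr R \<V>) (GMod_enr R \<U> \<V>)"
proof -
  interpret E: enriched_category "GMod_gr R \<V>" "GMod_enr R \<U> \<V> :: (('p, 'a, 'u) pmod, _, _) ecat"
    by (rule enriched_GMod)
  note X = gr_tensor_pmod[OF unit_pmod unit_pmod]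
  have inv: "inv_mor (GMod_gr R \<V>) (I \<boxtimes> I) I (homog R (I \<boxtimes> I) I 0 (gr_lunit R \<V> I)) =
      homog R I (I \<boxtimes> I) 0 (gr_lunit_inv I)"
    by (rule E.inv_mor_eq[OF _ _ inverse_mors_GMod_gr[OF X unit_pmod gr_lunit_nat[OF unit_pmod]
        gr_lunit_inv[OF unit_pmod]]])
      (simp_all add: GMod_gr_simps unit_pmod X)
  have "iso_over_objects (GMod R \<U> :: (('p, 'a, 'u) pmod, _) cat) (underlying_cat (GMod_gr R \<V>)
      (GMod_enr R \<U> \<V>))"
    unfolding iso_over_objects_def underlying_cat_def cat.simps GMod_simps GMod_gr_simps enr_simps inv
  proof (intro conjI exI[of _ ghom_name] ballI)
    fix M assume M: "M \<in> um"
    show "ghom_name M M (homog R M M 0 (id_trans M)) = homog R I (ih M M) 0 (ihom_id R \<V> M)"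
      using ghom_name_homog[OF M M id_trans_hm[OF M]] hom_name_id[OF M] by simp
  qed (simp_all add: ghom_name_bij ghom_name_comp)
  with category_GMod enriched_GMod show ?thesis
    unfolding enriched_over_def by blast
qed

end

theorem corollary10p8:
  fixes R :: "('r, 'x) ring_scheme" and \<U> \<V> :: "'u set set"
  assumes "cring R"
    and "universe (UNIV :: 'p::preordered_ab_group_add set) (carrier R) \<U>"
    and "universe (UNIV :: 'p set) (carrier R) \<V>"
    and "contains_powers \<V> \<U>"
  shows "enriched_over (PMod R \<U> :: (('p, 'r, 'u) pmod, _) cat) (PMod_gr R \<V>) (PMod_enr R \<U> \<V>) \<and>
         enriched_over (GMod R \<U> :: (('p, 'r, 'u) pmod, _) cat) (GMod_gr R \<V>) (GMod_enr R \<U> \<V>)"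
proof -
  interpret cring R by fact
  interpret enriched_persistence R \<V> "UNIV :: 'p set" \<U>
    by unfold_locales (use assms in simp_all)
  show ?thesis
    using enriched_over_PMod enriched_over_GMod by blast
qed

end
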